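(* Let $G$ be a first-order (classical) structure expanding a group which is elementarily equivalent to an ultraproduct of structures expanding amenable torsion groups, and let $\tau\colon G\to K$ be a definable compactification of $G$. Then the connected component of the identity of $K$ is abelian.
   Context: A compactification of $G$ is a group homomorphism $\tau\colon G\to K$ with dense image, where $K$ is a compact Hausdorff group. It is definable if for all closed $D\subseteq K$ and open $V\subseteq K$ with $D\subseteq V$ there is a definable (with parameters) set $X\subseteq G$ with $\tau^{-1}(D)\subseteq X\subseteq\tau^{-1}(V)$. A group is amenable if it admits a left-invariant finitely additive probability measure on all subsets. *)

theory Defs
  imports "HOL-Analysis.Analysis" "HOL-Algebra.Coset"
begin

section \<open>First-order logic\<close>

text \<open>A language is given by its sets of function and relation symbols, each paired with its arity;
  constants are function symbols of arity 0. Equality is a logical symbol.\<close>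

record ('f, 'r) language =
  funs :: "('f \<times> nat) set"
  rels :: "('r \<times> nat) set"

datatype 'f fo_term = Var nat | App 'f "'f fo_term list"

datatype ('f, 'r) fo_formula =
    Eq "'f fo_term" "'f fo_term"
  | Rel 'r "'f fo_term list"
  | Neg "('f, 'r) fo_formula"
  | Conj "('f, 'r) fo_formula" "('f, 'r) fo_formula"
  | Ex nat "('f, 'r) fo_formula"

primrec wf_term :: "('f, 'r) language \<Rightarrow> 'f fo_term \<Rightarrow> bool" where
  "wf_term L (Var n) \<longleftrightarrow> True"
| "wf_term L (App f ts) \<longleftrightarrow> (f, length ts) \<in> funs L \<and> list_all (wf_term L) ts"

primrec wf_formula :: "('f, 'r) language \<Rightarrow> ('f, 'r) fo_formula \<Rightarrow> bool" where
  "wf_formula L (Eq s t) \<longleftrightarrow> wf_term L s \<and> wf_term L t"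
| "wf_formula L (Rel r ts) \<longleftrightarrow> (r, length ts) \<in> rels L \<and> list_all (wf_term L) ts"
| "wf_formula L (Neg \<phi>) \<longleftrightarrow> wf_formula L \<phi>"
| "wf_formula L (Conj \<phi> \<psi>) \<longleftrightarrow> wf_formula L \<phi> \<and> wf_formula L \<psi>"
| "wf_formula L (Ex n \<phi>) \<longleftrightarrow> wf_formula L \<phi>"

primrec fv_term :: "'f fo_term \<Rightarrow> nat set" where
  "fv_term (Var n) = {n}"
| "fv_term (App f ts) = \<Union> (set (map fv_term ts))"

primrec fv :: "('f, 'r) fo_formula \<Rightarrow> nat set" where
  "fv (Eq s t) = fv_term s \<union> fv_term t"
| "fv (Rel r ts) = \<Union> (set (map fv_term ts))"
| "fv (Neg \<phi>) = fv \<phi>"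
| "fv (Conj \<phi> \<psi>) = fv \<phi> \<union> fv \<psi>"
| "fv (Ex n \<phi>) = fv \<phi> - {n}"

text \<open>Interpretations are total on argument lists; only arguments from the universe, in number equal
  to a declared arity, are meaningful.\<close>

record ('f, 'r, 'a) fo_structure =
  univ :: "'a set"
  fun_int :: "'f \<Rightarrow> 'a list \<Rightarrow> 'a"
  rel_int :: "'r \<Rightarrow> 'a list \<Rightarrow> bool"

definition is_structure :: "('f, 'r) language \<Rightarrow> ('f, 'r, 'a) fo_structure \<Rightarrow> bool" where
  "is_structure L M \<longleftrightarrow> univ M \<noteq> {} \<and>
     (\<forall>(f, n) \<in> funs L. \<forall>xs. length xs = n \<and> set xs \<subseteq> univ M \<longrightarrow> fun_int M f xs \<in> univ M)"

primrec eval_term :: "('f, 'r, 'a) fo_structure \<Rightarrow> (nat \<Rightarrow> 'a) \<Rightarrow> 'f fo_term \<Rightarrow> 'a" where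
  "eval_term M e (Var n) = e n"
| "eval_term M e (App f ts) = fun_int M f (map (eval_term M e) ts)"

primrec sat :: "('f, 'r, 'a) fo_structure \<Rightarrow> (nat \<Rightarrow> 'a) \<Rightarrow> ('f, 'r) fo_formula \<Rightarrow> bool" where
  "sat M e (Eq s t) \<longleftrightarrow> eval_term M e s = eval_term M e t"
| "sat M e (Rel r ts) \<longleftrightarrow> rel_int M r (map (eval_term M e) ts)"
| "sat M e (Neg \<phi>) \<longleftrightarrow> \<not> sat M e \<phi>"
| "sat M e (Conj \<phi> \<psi>) \<longleftrightarrow> sat M e \<phi> \<and> sat M e \<psi>"
| "sat M e (Ex n \<phi>) \<longleftrightarrow> (\<exists>a \<in> univ M. sat M (e(n := a)) \<phi>)"

definition models :: "('f, 'r, 'a) fo_structure \<Rightarrow> ('f, 'r) fo_formula \<Rightarrow> bool" where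
  "models M \<phi> \<longleftrightarrow> (\<forall>e. range e \<subseteq> univ M \<longrightarrow> sat M e \<phi>)"

definition elementarily_equivalent ::
    "('f, 'r) language \<Rightarrow> ('f, 'r, 'a) fo_structure \<Rightarrow> ('f, 'r, 'b) fo_structure \<Rightarrow> bool" where
  "elementarily_equivalent L M N \<longleftrightarrow>
     (\<forall>\<phi>. wf_formula L \<phi> \<and> fv \<phi> = {} \<longrightarrow> (models M \<phi> \<longleftrightarrow> models N \<phi>))"

text \<open>The variable 0 ranges over the defined set; the valuation \<open>e\<close> supplies parameters for all
  other free variables.\<close>

definition definable :: "('f, 'r) language \<Rightarrow> ('f, 'r, 'a) fo_structure \<Rightarrow> 'a set \<Rightarrow> bool" where
  "definable L M X \<longleftrightarrow> (\<exists>\<phi> e. wf_formula L \<phi> \<and> range e \<subseteq> univ M \<and>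
     X = {a \<in> univ M. sat M (e(0 := a)) \<phi>})"


section \<open>Ultraproducts\<close>

definition is_ultrafilter :: "'i filter \<Rightarrow> bool" where
  "is_ultrafilter U \<longleftrightarrow> U \<noteq> bot \<and> (\<forall>P. eventually P U \<or> eventually (\<lambda>i. \<not> P i) U)"

definition ultra_rel ::
    "'i filter \<Rightarrow> ('i \<Rightarrow> ('f, 'r, 'b) fo_structure) \<Rightarrow> (('i \<Rightarrow> 'b) \<times> ('i \<Rightarrow> 'b)) set" where
  "ultra_rel U N = {(s, t). (\<forall>i. s i \<in> univ (N i)) \<and> (\<forall>i. t i \<in> univ (N i)) \<and>
     eventually (\<lambda>i. s i = t i) U}"

definition rep :: "('i \<Rightarrow> 'b) set \<Rightarrow> 'i \<Rightarrow> 'b" where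
  "rep c = (SOME s. s \<in> c)"

definition ultraproduct ::
    "'i filter \<Rightarrow> ('i \<Rightarrow> ('f, 'r, 'b) fo_structure) \<Rightarrow> ('f, 'r, ('i \<Rightarrow> 'b) set) fo_structure" where
  "ultraproduct U N = \<lparr>
     univ = {s. \<forall>i. s i \<in> univ (N i)} // ultra_rel U N,
     fun_int = (\<lambda>f cs. ultra_rel U N `` {\<lambda>i. fun_int (N i) f (map (\<lambda>c. rep c i) cs)}),
     rel_int = (\<lambda>r cs. eventually (\<lambda>i. rel_int (N i) r (map (\<lambda>c. rep c i) cs)) U)\<rparr>"


section \<open>Groups and compactifications\<close>

text \<open>\<open>M\<close> is an \<open>L\<close>-structure expanding the group \<open>G\<close>, the binary function symbol \<open>m\<close> of \<open>L\<close>
  denoting the multiplication of \<open>G\<close>. Identity and inverse are definable without parameters from the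
  multiplication; \<open>L\<close> may or may not also have symbols for them.\<close>

definition expands_group ::
    "('f, 'r) language \<Rightarrow> 'f \<Rightarrow> ('f, 'r, 'a) fo_structure \<Rightarrow> 'a monoid \<Rightarrow> bool" where
  "expands_group L m M G \<longleftrightarrow> is_structure L M \<and> group G \<and> (m, 2) \<in> funs L \<and>
     univ M = carrier G \<and>
     (\<forall>x \<in> carrier G. \<forall>y \<in> carrier G. fun_int M m [x, y] = x \<otimes>\<^bsub>G\<^esub> y)"

definition amenable :: "'a monoid \<Rightarrow> bool" where
  "amenable G \<longleftrightarrow> (\<exists>\<mu> :: 'a set \<Rightarrow> real.
     (\<forall>A \<subseteq> carrier G. 0 \<le> \<mu> A) \<and>
     \<mu> (carrier G) = 1 \<and>
     (\<forall>A \<subseteq> carrier G. \<forall>B \<subseteq> carrier G. A \<inter> B = {} \<longrightarrow> \<mu> (A \<union> B) = \<mu> A + \<mu> B) \<and>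
     (\<forall>g \<in> carrier G. \<forall>A \<subseteq> carrier G. \<mu> (g <#\<^bsub>G\<^esub> A) = \<mu> A))"

definition torsion_group :: "'a monoid \<Rightarrow> bool" where
  "torsion_group G \<longleftrightarrow> (\<forall>x \<in> carrier G. \<exists>n::nat. n > 0 \<and> x [^]\<^bsub>G\<^esub> n = \<one>\<^bsub>G\<^esub>)"

text \<open>The class \<^class>\<open>topological_group_add\<close> consists of all topological groups, written additively
  but not assumed commutative. A compact Hausdorff group is a type in this class and in
  \<^class>\<open>t2_space\<close> such that \<^term>\<open>UNIV\<close> is compact.\<close>

definition compactification ::
    "'a monoid \<Rightarrow> ('a \<Rightarrow> 'k::{topological_group_add, t2_space}) \<Rightarrow> bool" where
  "compactification G \<tau> \<longleftrightarrow> compact (UNIV :: 'k set) \<and>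
     (\<forall>x \<in> carrier G. \<forall>y \<in> carrier G. \<tau> (x \<otimes>\<^bsub>G\<^esub> y) = \<tau> x + \<tau> y) \<and>
     closure (\<tau> ` carrier G) = UNIV"

definition definable_compactification ::
    "('f, 'r) language \<Rightarrow> ('f, 'r, 'a) fo_structure \<Rightarrow> 'a monoid \<Rightarrow>
     ('a \<Rightarrow> 'k::{topological_group_add, t2_space}) \<Rightarrow> bool" where
  "definable_compactification L M G \<tau> \<longleftrightarrow> compactification G \<tau> \<and>
     (\<forall>D V. closed D \<and> open V \<and> D \<subseteq> V \<longrightarrow>
       (\<exists>X. definable L M X \<and> {x \<in> carrier G. \<tau> x \<in> D} \<subseteq> X \<and> X \<subseteq> {x \<in> carrier G. \<tau> x \<in> V}))"

end

theory Submission
  imports Defs "HOL-Computational_Algebra.Primes"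
begin

text \<open>For a neighbourhood \<open>W\<close> of the identity, a finite definable cover of \<open>G\<close> that refines \<open>W\<close>
  transfers to some \<open>H i\<close> and gives a map from \<open>H i\<close> to \<open>K\<close> with finite image that is dense and
  multiplicative up to \<open>W\<close>. Means on the groups \<open>H i\<close> converge to a Haar functional on \<open>K\<close>, so the
  orthogonal representations of \<open>K\<close> separate its points (Peter--Weyl). Composing a representation
  with such a map gives an almost multiplicative map into an orthogonal group, and averaging over
  the amenable group \<open>H i\<close> corrects it to a nearby genuine homomorphism. The finitely generated
  subgroups of its image are torsion, hence finite by Schur, so by Frobenius' argument for Jordan's theorem
  elements near the identity commute. Hence every representation of \<open>K\<close> is abelian near the
  identity, therefore abelian on the identity component, and the commutators of that component are
  killed by all representations.\<close>

section \<open>Transfer to a factor of the ultraproduct\<close>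

text \<open>Torsion and amenability are not first-order properties, so neither passes to
  \<open>G\<close>. What crosses the elementary equivalence is a finite incidence pattern of cells
  and products, realised in one single factor, and this factor changes with \<open>W\<close>. Every
  estimate must therefore be uniform over all amenable torsion groups: the stability constant
  depends only on the size \<open>n\<close> and the tolerance, and the radii 1/4 and 1 in the
  commutation theorem do not depend on the order of the finite group. A finite image turns the
  integral against a finitely additive mean into a finite sum. To separate points, the spectral
  argument is run inside the orthogonal complement of the functions invariant under commutators, so
  that any eigenspace found there is moved by some commutator. Real matrices stand in for complex
  ones; conjugate pairs of eigenvalues on the unit circle enter through cosines.\<close>

lemma ultra_rel_equiv: "equiv {s. \<forall>i. s i \<in> univ (N i)} (ultra_rel U N)"
proof (rule equivI)
  show "ultra_rel U N \<subseteq> {s. \<forall>i. s i \<in> univ (N i)} \<times> {s. \<forall>i. s i \<in> univ (N i)}"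
    by (auto simp: ultra_rel_def)
  show "refl_on {s. \<forall>i. s i \<in> univ (N i)} (ultra_rel U N)"
    by (auto simp: refl_on_def ultra_rel_def)
  show "sym (ultra_rel U N)"
    by (auto simp: sym_def ultra_rel_def eq_commute)
  show "trans (ultra_rel U N)"
    by (auto simp: trans_def ultra_rel_def elim: eventually_elim2)
qed

lemma rep_in_class:
  assumes "c \<in> univ (ultraproduct U N)"
  shows "rep c \<in> c" and "rep c i \<in> univ (N i)"
proof -
  have c: "c \<in> {s. \<forall>i. s i \<in> univ (N i)} // ultra_rel U N"
    using assms by (simp add: ultraproduct_def)
  then have "c \<noteq> {}"
    by (rule in_quotient_imp_non_empty[OF ultra_rel_equiv])
  then show r: "rep c \<in> c" unfolding rep_def by (simp add: some_in_eq)
  have "c \<subseteq> {s. \<forall>i. s i \<in> univ (N i)}"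
    by (rule in_quotient_imp_subset[OF ultra_rel_equiv c])
  with r show "rep c i \<in> univ (N i)" by auto
qed

lemma ultra_class:
  assumes "\<And>i. s i \<in> univ (N i)"
  shows "ultra_rel U N `` {s} \<in> univ (ultraproduct U N)"
    and "\<forall>\<^sub>F i in U. rep (ultra_rel U N `` {s}) i = s i"
proof -
  show *: "ultra_rel U N `` {s} \<in> univ (ultraproduct U N)"
    using assms by (auto simp: ultraproduct_def quotient_def)
  have "rep (ultra_rel U N `` {s}) \<in> ultra_rel U N `` {s}"
    by (rule rep_in_class(1)[OF *])
  then show "\<forall>\<^sub>F i in U. rep (ultra_rel U N `` {s}) i = s i"
    by (auto simp: ultra_rel_def eq_commute)
qed

text \<open>Arguments are evaluated through chosen representatives, which agree with the factorwise
  values only on a set in \<open>U\<close>; an argument list is finite, so these sets can be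
  intersected. Membership in the universe is carried along because \<open>rep\<close> is meaningful
  only on classes.\<close>

lemma Los_term:
  assumes str: "\<And>i. is_structure L (N i)"
    and e: "\<And>n. e n \<in> univ (ultraproduct U N)" and "wf_term L t"
  shows "eval_term (ultraproduct U N) e t \<in> univ (ultraproduct U N) \<and>
    (\<forall>\<^sub>F i in U. rep (eval_term (ultraproduct U N) e t) i = eval_term (N i) (\<lambda>n. rep (e n) i) t)"
  using assms(3)
proof (induction t)
  case (Var n)
  then show ?case by (simp add: e)
next
  case (App f ts)
  let ?P = "ultraproduct U N"
  define s where "s i = fun_int (N i) f (map (\<lambda>c. rep c i) (map (eval_term ?P e) ts))" for i
  have wf: "(f, length ts) \<in> funs L" "\<And>t. t \<in> set ts \<Longrightarrow> wf_term L t"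
    using App.prems by (auto simp: list_all_iff)
  note IH = App.IH[OF _ wf(2)]
  have s: "s i \<in> univ (N i)" for i
  proof -
    have "set (map (\<lambda>c. rep c i) (map (eval_term ?P e) ts)) \<subseteq> univ (N i)"
      using IH rep_in_class(2)[of _ U N i] by auto
    moreover have "\<forall>xs. length xs = length ts \<and> set xs \<subseteq> univ (N i) \<longrightarrow> fun_int (N i) f xs \<in> univ (N i)"
      using str[of i] wf(1) unfolding is_structure_def by fastforce
    ultimately show ?thesis unfolding s_def by (metis length_map)
  qed
  have eq: "eval_term ?P e (App f ts) = ultra_rel U N `` {s}"
    by (simp add: ultraproduct_def s_def[abs_def])
  have "\<forall>\<^sub>F i in U. \<forall>t\<in>set ts. rep (eval_term ?P e t) i = eval_term (N i) (\<lambda>n. rep (e n) i) t"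
    by (rule eventually_ball_finite) (use IH in auto)
  then have "\<forall>\<^sub>F i in U. s i = eval_term (N i) (\<lambda>n. rep (e n) i) (App f ts)"
    by eventually_elim (simp add: s_def comp_def cong: map_cong)
  with ultra_class(2)[of s N U] s
  have "\<forall>\<^sub>F i in U. rep (ultra_rel U N `` {s}) i = eval_term (N i) (\<lambda>n. rep (e n) i) (App f ts)"
    by (auto elim: eventually_elim2)
  then show ?case using eq ultra_class(1)[of s N U] s by metis
qed

lemma ultrafilter_not:
  assumes "is_ultrafilter U"
  shows "eventually (\<lambda>i. \<not> P i) U \<longleftrightarrow> \<not> eventually P U"
proof -
  have "\<not> (eventually P U \<and> eventually (\<lambda>i. \<not> P i) U)"
    using assms eventually_conj[of P U "\<lambda>i. \<not> P i"] by (auto simp: is_ultrafilter_def eventually_False)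
  then show ?thesis using assms by (auto simp: is_ultrafilter_def)
qed

lemma Los:
  assumes U: "is_ultrafilter U" and str: "\<And>i. is_structure L (N i)"
    and "\<And>n. e n \<in> univ (ultraproduct U N)" and "wf_formula L \<phi>"
  shows "sat (ultraproduct U N) e \<phi> \<longleftrightarrow> (\<forall>\<^sub>F i in U. sat (N i) (\<lambda>n. rep (e n) i) \<phi>)"
  using assms(3,4)
proof (induction \<phi> arbitrary: e)
  case (Eq s t)
  let ?P = "ultraproduct U N"
  have wf: "wf_term L s" "wf_term L t" using Eq.prems by auto
  note S = Los_term[where U=U and N=N and e=e, OF str Eq.prems(1) wf(1)]
    and T = Los_term[where U=U and N=N and e=e, OF str Eq.prems(1) wf(2)]
  have "eval_term ?P e s = eval_term ?P e t \<longleftrightarrow>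
    (\<forall>\<^sub>F i in U. rep (eval_term ?P e s) i = rep (eval_term ?P e t) i)" (is "?a = ?b \<longleftrightarrow> ?R")
  proof
    assume R: ?R
    have "rep ?a \<in> ?a" "rep ?b \<in> ?b" using S T wf by (auto intro: rep_in_class)
    moreover have "(rep ?a, rep ?b) \<in> ultra_rel U N"
      using R S T wf by (auto simp: ultra_rel_def intro: rep_in_class)
    moreover have "?a \<in> {s. \<forall>i. s i \<in> univ (N i)} // ultra_rel U N" "?b \<in> {s. \<forall>i. s i \<in> univ (N i)} // ultra_rel U N"
      using S T wf by (auto simp: ultraproduct_def)
    ultimately show "?a = ?b"
      using quotient_eqI[OF ultra_rel_equiv, of ?a N U ?b] by blast
  qed simp
  also have "\<dots> \<longleftrightarrow> (\<forall>\<^sub>F i in U. eval_term (N i) (\<lambda>n. rep (e n) i) s = eval_term (N i) (\<lambda>n. rep (e n) i) t)"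
    (is "_ \<longleftrightarrow> ?Q")
  proof -
    have ev: "\<forall>\<^sub>F i in U. rep ?a i = eval_term (N i) (\<lambda>n. rep (e n) i) s \<and> rep ?b i = eval_term (N i) (\<lambda>n. rep (e n) i) t"
      using S T wf by (simp add: eventually_conj)
    show ?thesis
    proof
      assume ?R with ev show ?Q by eventually_elim metis
    next
      assume ?Q with ev show ?R by eventually_elim metis
    qed
  qed
  finally show ?case by simp
next
  case (Rel r ts)
  let ?P = "ultraproduct U N"
  have wf: "\<And>t. t \<in> set ts \<Longrightarrow> wf_term L t"
    using Rel.prems by (auto simp: list_all_iff)
  have "\<forall>\<^sub>F i in U. \<forall>t\<in>set ts. rep (eval_term ?P e t) i = eval_term (N i) (\<lambda>n. rep (e n) i) t"
    by (rule eventually_ball_finite) (use Los_term[where U=U, OF str Rel.prems(1)] wf in auto)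
  then have ev: "\<forall>\<^sub>F i in U. rel_int (N i) r (map (\<lambda>c. rep c i) (map (eval_term ?P e) ts))
      = sat (N i) (\<lambda>n. rep (e n) i) (Rel r ts)"
    by eventually_elim (simp add: comp_def cong: map_cong)
  have "sat ?P e (Rel r ts) \<longleftrightarrow> (\<forall>\<^sub>F i in U. rel_int (N i) r (map (\<lambda>c. rep c i) (map (eval_term ?P e) ts)))"
    by (simp add: ultraproduct_def)
  also have "\<dots> \<longleftrightarrow> (\<forall>\<^sub>F i in U. sat (N i) (\<lambda>n. rep (e n) i) (Rel r ts))"
    by (rule eventually_cong[OF ev]) auto
  finally show ?case .
next
  case (Neg \<phi>)
  then show ?case by (simp add: ultrafilter_not[OF U])
next
  case (Conj \<phi> \<psi>)
  then show ?case by (simp add: eventually_conj_iff)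
next
  case (Ex n \<phi>)
  let ?P = "ultraproduct U N"
  let ?e = "\<lambda>i n. rep (e n) i"
  have upd: "(\<lambda>m. rep ((e(n := c)) m) i) = (?e i)(n := rep c i)" for c i by auto
  have IH: "sat ?P (e(n := c)) \<phi> \<longleftrightarrow> (\<forall>\<^sub>F i in U. sat (N i) ((?e i)(n := rep c i)) \<phi>)"
    if "c \<in> univ ?P" for c
  proof -
    have "(e(n := c)) m \<in> univ ?P" for m using Ex.prems(1) that by simp
    from Ex.IH[OF this] Ex.prems(2) show ?thesis by (simp add: upd del: fun_upd_apply)
  qed
  show ?case
  proof
    assume "sat ?P e (Ex n \<phi>)"
    then obtain c where c: "c \<in> univ ?P" "sat ?P (e(n := c)) \<phi>" by auto
    then have "\<forall>\<^sub>F i in U. sat (N i) ((?e i)(n := rep c i)) \<phi>" using IH by blast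
    then show "\<forall>\<^sub>F i in U. sat (N i) (?e i) (Ex n \<phi>)"
      by eventually_elim (use rep_in_class(2)[OF c(1)] in auto)
  next
    assume R: "\<forall>\<^sub>F i in U. sat (N i) (?e i) (Ex n \<phi>)"
    \<comment> \<open>\<open>Q i a\<close> selects a witness where factor \<open>i\<close> has one
      and any element elsewhere, so the section \<open>s\<close> is defined at every index and
      represents a class.\<close>
    define Q where "Q i a \<longleftrightarrow> a \<in> univ (N i) \<and> ((\<exists>b\<in>univ (N i). sat (N i) ((?e i)(n := b)) \<phi>) \<longrightarrow>
       sat (N i) ((?e i)(n := a)) \<phi>)" for i a
    have "\<exists>a. Q i a" for i
      using str[of i] unfolding Q_def is_structure_def by blast
    then obtain s where s: "\<And>i. Q i (s i)" by metis
    then have su: "\<And>i. s i \<in> univ (N i)" by (simp add: Q_def)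
    let ?c = "ultra_rel U N `` {s}"
    from R ultra_class(2)[of s N U, OF su]
    have "\<forall>\<^sub>F i in U. sat (N i) ((?e i)(n := rep ?c i)) \<phi>"
      by eventually_elim (use s in \<open>auto simp: Q_def\<close>)
    then show "sat ?P e (Ex n \<phi>)" using IH[of ?c] ultra_class(1)[of s N U] su by auto
  qed
qed

section \<open>Coincidence, renaming and existential closure of formulas\<close>

lemma eval_term_cong:
  assumes "\<And>n. n \<in> fv_term t \<Longrightarrow> e n = e' n"
  shows "eval_term M e t = eval_term M e' t"
  using assms
proof (induction t)
  case (App f ts)
  then have "map (eval_term M e) ts = map (eval_term M e') ts" by (auto intro!: map_cong)
  then show ?case by (simp del: map_eq_conv)
qed simp

lemma sat_cong:
  assumes "\<And>n. n \<in> fv \<phi> \<Longrightarrow> e n = e' n"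
  shows "sat M e \<phi> \<longleftrightarrow> sat M e' \<phi>"
  using assms
proof (induction \<phi> arbitrary: e e')
  case (Eq s t)
  then show ?case using eval_term_cong[of s e e' M] eval_term_cong[of t e e' M] by auto
next
  case (Rel r ts)
  have "map (eval_term M e) ts = map (eval_term M e') ts"
    using Rel by (auto intro!: eval_term_cong)
  then show ?case by (simp del: map_eq_conv)
next
  case (Neg \<phi>)
  show ?case using Neg.IH[of e e'] Neg.prems by simp
next
  case (Conj \<phi> \<psi>)
  show ?case using Conj.IH(1)[of e e'] Conj.IH(2)[of e e'] Conj.prems by simp
next
  case (Ex n \<phi>)
  then have "sat M (e(n := a)) \<phi> \<longleftrightarrow> sat M (e'(n := a)) \<phi>" for a
    by (intro Ex.IH) auto
  then show ?case by simp
qed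

primrec rename_term :: "(nat \<Rightarrow> nat) \<Rightarrow> 'f fo_term \<Rightarrow> 'f fo_term" where
  "rename_term \<sigma> (Var n) = Var (\<sigma> n)"
| "rename_term \<sigma> (App f ts) = App f (map (rename_term \<sigma>) ts)"

primrec rename :: "(nat \<Rightarrow> nat) \<Rightarrow> ('f, 'r) fo_formula \<Rightarrow> ('f, 'r) fo_formula" where
  "rename \<sigma> (Eq s t) = Eq (rename_term \<sigma> s) (rename_term \<sigma> t)"
| "rename \<sigma> (Rel r ts) = Rel r (map (rename_term \<sigma>) ts)"
| "rename \<sigma> (Neg \<phi>) = Neg (rename \<sigma> \<phi>)"
| "rename \<sigma> (Conj \<phi> \<psi>) = Conj (rename \<sigma> \<phi>) (rename \<sigma> \<psi>)"
| "rename \<sigma> (Ex n \<phi>) = Ex (\<sigma> n) (rename \<sigma> \<phi>)"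

lemma wf_rename_term: "wf_term L (rename_term \<sigma> t) \<longleftrightarrow> wf_term L t"
  by (induction t) (auto simp: list_all_iff)

lemma wf_rename: "wf_formula L (rename \<sigma> \<phi>) \<longleftrightarrow> wf_formula L \<phi>"
  by (induction \<phi>) (auto simp: list_all_iff wf_rename_term)

lemma eval_rename_term: "eval_term M e (rename_term \<sigma> t) = eval_term M (\<lambda>n. e (\<sigma> n)) t"
proof (induction t)
  case (App f ts)
  then have "map (\<lambda>t. eval_term M e (rename_term \<sigma> t)) ts = map (eval_term M (\<lambda>n. e (\<sigma> n))) ts"
    by (intro map_cong) auto
  then show ?case by (simp del: map_eq_conv add: comp_def)
qed simp

text \<open>\<open>rename\<close> acts on bound variables too; injectivity excludes capture.\<close>

lemma sat_rename:
  assumes "inj \<sigma>"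
  shows "sat M e (rename \<sigma> \<phi>) \<longleftrightarrow> sat M (\<lambda>n. e (\<sigma> n)) \<phi>"
proof (induction \<phi> arbitrary: e)
  case (Rel r ts)
  then show ?case by (simp add: comp_def eval_rename_term)
next
  case (Ex n \<phi>)
  have "(\<lambda>k. (e(\<sigma> n := a)) (\<sigma> k)) = (\<lambda>k. e (\<sigma> k))(n := a)" for a
    using assms by (auto simp: fun_eq_iff inj_eq)
  then show ?case unfolding rename.simps sat.simps Ex by simp
qed (auto simp: eval_rename_term)

lemma finite_fv_term: "finite (fv_term t)"
  by (induction t) auto

lemma finite_fv: "finite (fv \<phi>)"
  by (induction \<phi>) (auto simp: finite_fv_term)

lemma sat_foldr_Ex:
  "sat M e (foldr Ex ns \<phi>) \<longleftrightarrow>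
    (\<exists>e'. (\<forall>n. n \<notin> set ns \<longrightarrow> e' n = e n) \<and> (\<forall>n\<in>set ns. e' n \<in> univ M) \<and> sat M e' \<phi>)"
proof (induction ns arbitrary: e)
  case Nil
  have "(\<forall>n. e' n = e n) \<longleftrightarrow> e' = e" for e' by auto
  then show ?case by simp
next
  case (Cons k ns)
  show ?case
  proof
    assume "sat M e (foldr Ex (k # ns) \<phi>)"
    then obtain a e' where *: "a \<in> univ M" "\<forall>n. n \<notin> set ns \<longrightarrow> e' n = (e(k := a)) n"
      "\<forall>n\<in>set ns. e' n \<in> univ M" "sat M e' \<phi>"
      by (auto simp: Cons)
    then have "e' k \<in> univ M" by (cases "k \<in> set ns") auto
    then show "\<exists>e'. (\<forall>n. n \<notin> set (k # ns) \<longrightarrow> e' n = e n) \<and> (\<forall>n\<in>set (k # ns). e' n \<in> univ M) \<and> sat M e' \<phi>"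
      using * by (intro exI[of _ e']) auto
  next
    assume "\<exists>e'. (\<forall>n. n \<notin> set (k # ns) \<longrightarrow> e' n = e n) \<and> (\<forall>n\<in>set (k # ns). e' n \<in> univ M) \<and> sat M e' \<phi>"
    then obtain e' where *: "\<forall>n. n \<notin> set (k # ns) \<longrightarrow> e' n = e n" "\<forall>n\<in>set (k # ns). e' n \<in> univ M"
      "sat M e' \<phi>" by blast
    then show "sat M e (foldr Ex (k # ns) \<phi>)"
      by (auto simp: Cons intro!: bexI[of _ "e' k"] exI[of _ e'])
  qed
qed

lemma wf_foldr_Ex: "wf_formula L (foldr Ex ns \<phi>) \<longleftrightarrow> wf_formula L \<phi>"
  by (induction ns) auto

lemma fv_foldr_Ex: "fv (foldr Ex ns \<phi>) = fv \<phi> - set ns"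
  by (induction ns) auto

text \<open>Elementary equivalence concerns sentences only, so the parameters are quantified away:
  the existential closure of \<open>\<theta>\<close> goes to the ultraproduct, and the witnesses
  found there are evaluated in a factor where \<open>\<theta>\<close> holds.\<close>

lemma sat_transfer:
  assumes U: "is_ultrafilter U" and str: "\<And>i. is_structure L (N i)"
    and el: "elementarily_equivalent L M (ultraproduct U N)"
    and wf: "wf_formula L \<theta>" and e: "range e \<subseteq> univ M" and sat: "sat M e \<theta>"
  shows "\<exists>i e'. range e' \<subseteq> univ (N i) \<and> sat (N i) e' \<theta>"
proof -
  let ?P = "ultraproduct U N"
  obtain ns where ns: "set ns = fv \<theta>" using finite_list[OF finite_fv] by blast
  let ?c = "foldr Ex ns \<theta>"
  have wfc: "wf_formula L ?c" "fv ?c = {}" using wf ns by (auto simp: wf_foldr_Ex fv_foldr_Ex)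
  have "sat M e' ?c" for e'
    unfolding sat_foldr_Ex
    by (rule exI[of _ "\<lambda>n. if n \<in> set ns then e n else e' n"])
       (use e sat ns sat_cong[of \<theta> "\<lambda>n. if n \<in> set ns then e n else e' n" e M] in auto)
  then have "models M ?c" by (auto simp: models_def)
  then have P: "models ?P ?c" using el wfc by (auto simp: elementarily_equivalent_def)
  have "\<exists>a. a \<in> univ (N i)" for i
    using str[of i] unfolding is_structure_def by blast
  then obtain s where s: "\<And>i. s i \<in> univ (N i)" by metis
  let ?e = "\<lambda>_::nat. ultra_rel U N `` {s}"
  have "range ?e \<subseteq> univ ?P" using ultra_class(1)[of s N U] s by auto
  then have "sat ?P ?e ?c" using P by (auto simp: models_def)
  then obtain e' where e': "\<forall>n. n \<notin> set ns \<longrightarrow> e' n = ?e n" "\<forall>n\<in>set ns. e' n \<in> univ ?P" "sat ?P e' \<theta>"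
    unfolding sat_foldr_Ex by blast
  have e'u: "e' n \<in> univ ?P" for n
    using e' ultra_class(1)[of s N U] s by (cases "n \<in> set ns") auto
  have "\<forall>\<^sub>F i in U. sat (N i) (\<lambda>n. rep (e' n) i) \<theta>"
    using Los[where e=e' and N=N, OF U str e'u wf] e'(3) by blast
  moreover have "U \<noteq> bot" using U by (simp add: is_ultrafilter_def)
  ultimately obtain i where "sat (N i) (\<lambda>n. rep (e' n) i) \<theta>"
    using eventually_happens' by blast
  then show ?thesis
    using rep_in_class(2)[OF e'u] by (intro exI[of _ i] exI[of _ "\<lambda>n. rep (e' n) i"]) auto
qed


section \<open>Encoding a finite definable cover in one formula\<close>

definition conjs :: "('f, 'r) fo_formula list \<Rightarrow> ('f, 'r) fo_formula" where
  "conjs \<phi>s = foldr Conj \<phi>s (Eq (Var 0) (Var 0))"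

lemma sat_conjs: "sat M e (conjs \<phi>s) \<longleftrightarrow> (\<forall>\<phi>\<in>set \<phi>s. sat M e \<phi>)"
  unfolding conjs_def by (induction \<phi>s) auto

lemma wf_conjs: "wf_formula L (conjs \<phi>s) \<longleftrightarrow> (\<forall>\<phi>\<in>set \<phi>s. wf_formula L \<phi>)"
  unfolding conjs_def by (induction \<phi>s) auto

text \<open>Variables 0, 1, 2 are reserved for group elements; the parameters of the \<open>j\<close>-th of
  \<open>n\<close> formulas are moved to the variables congruent to \<open>3 + j\<close> modulo \<open>n\<close>.\<close>

definition shift_var :: "nat \<Rightarrow> nat \<Rightarrow> nat \<Rightarrow> nat \<Rightarrow> nat" where
  "shift_var n j t k = (if k = 0 then t else 3 + k * n + j)"

text \<open>One valuation \<open>g\<close> stores the parameters of all formulas, so the same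
  \<open>\<Phi>\<close> with a transferred valuation defines the corresponding cells in a
  factor.\<close>

definition defined_set :: "('f, 'r, 'a) fo_structure \<Rightarrow> (nat \<Rightarrow> 'a) \<Rightarrow> nat \<Rightarrow> (nat \<Rightarrow> ('f, 'r) fo_formula) \<Rightarrow> nat \<Rightarrow> 'a set" where
  "defined_set P g n \<Phi> j = {h \<in> univ P. sat P (\<lambda>k. if k = 0 then h else g (3 + k * n + j)) (\<Phi> j)}"

lemma sat_rename_shift_var:
  assumes "j < n" "t < 3" "e t \<in> univ P" "\<And>k. k \<ge> 3 \<Longrightarrow> e k = g k"
  shows "sat P e (rename (shift_var n j t) (\<Phi> j)) \<longleftrightarrow> e t \<in> defined_set P g n \<Phi> j"
proof -
  have "inj (shift_var n j t)"
    using assms(1,2) by (auto simp: inj_def shift_var_def split: if_splits)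
  moreover have "(\<lambda>k. e (shift_var n j t k)) = (\<lambda>k. if k = 0 then e t else g (3 + k * n + j))"
    using assms(4) by (auto simp: shift_var_def)
  ultimately show ?thesis using assms(3) by (simp add: sat_rename defined_set_def)
qed

text \<open>Besides covering and nonemptiness, non-incidences are recorded: \<open>B2\<close> lists
  disjoint pairs of cells, \<open>B3\<close> triples with no product of the first two in the third.
  Read contrapositively, every overlap or product in the factor is witnessed in \<open>G\<close>.
  Variable 2 holds the product because a cell formula is tested at a variable.\<close>

definition covering_formula :: "'f \<Rightarrow> nat \<Rightarrow> (nat \<Rightarrow> ('f, 'r) fo_formula) \<Rightarrow> (nat \<times> nat) list \<Rightarrow>
    (nat \<times> nat \<times> nat) list \<Rightarrow> ('f, 'r) fo_formula" where
  "covering_formula m n \<Phi> B2 B3 = (let \<psi> = (\<lambda>j t. rename (shift_var n j t) (\<Phi> j)) in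
     conjs (Neg (Ex 0 (conjs (map (\<lambda>j. Neg (\<psi> j 0)) [0..<n])))
       # map (\<lambda>j. Ex 0 (\<psi> j 0)) [0..<n]
       @ map (\<lambda>(a, b). Neg (Ex 0 (Conj (\<psi> a 0) (\<psi> b 0)))) B2
       @ map (\<lambda>(a, b, c). Neg (Ex 0 (Ex 1 (Conj (Conj (\<psi> a 0) (\<psi> b 1))
            (Ex 2 (Conj (Eq (Var 2) (App m [Var 0, Var 1])) (\<psi> c 2))))))) B3))"

lemma wf_covering_formula:
  assumes "(m, 2) \<in> funs L" "\<And>j. j < n \<Longrightarrow> wf_formula L (\<Phi> j)" "set B2 \<subseteq> {..<n} \<times> {..<n}"
    "set B3 \<subseteq> {..<n} \<times> {..<n} \<times> {..<n}"
  shows "wf_formula L (covering_formula m n \<Phi> B2 B3)"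
  using assms unfolding covering_formula_def Let_def wf_conjs
  by (auto simp: wf_conjs wf_rename numeral_2_eq_2)

lemma sat_covering_formula:
  fixes L :: "('f, 'r) language" and P :: "('f, 'r, 'a) fo_structure" and \<Phi> :: "nat \<Rightarrow> ('f, 'r) fo_formula"
  assumes grp: "expands_group L m P H" and g: "range g \<subseteq> univ P"
    and B: "set B2 \<subseteq> {..<n} \<times> {..<n}" "set B3 \<subseteq> {..<n} \<times> {..<n} \<times> {..<n}"
  defines "Y \<equiv> defined_set P g n \<Phi>"
  shows "sat P g (covering_formula m n \<Phi> B2 B3) \<longleftrightarrow>
    (\<Union>j<n. Y j) = carrier H \<and> (\<forall>j\<in>{..<n}. Y j \<noteq> {}) \<and> (\<forall>(a, b)\<in>set B2. Y a \<inter> Y b = {}) \<and>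
    (\<forall>(a, b, c)\<in>set B3. \<forall>x\<in>Y a. \<forall>y\<in>Y b. x \<otimes>\<^bsub>H\<^esub> y \<notin> Y c)"
proof -
  have car: "univ P = carrier H" and grpH: "group H"
    and mult: "\<And>x y. x \<in> carrier H \<Longrightarrow> y \<in> carrier H \<Longrightarrow> fun_int P m [x, y] = x \<otimes>\<^bsub>H\<^esub> y"
    using grp by (auto simp: expands_group_def)
  interpret group H by fact
  have Ysub: "Y j \<subseteq> carrier H" for j by (auto simp: Y_def defined_set_def car)
  let ?\<psi> = "\<lambda>j t. rename (shift_var n j t) (\<Phi> j)"
  have \<psi>: "sat P e (?\<psi> j t) \<longleftrightarrow> e t \<in> Y j"
    if "j < n" "t < 3" "e t \<in> carrier H" "\<And>k. k \<ge> 3 \<Longrightarrow> e k = g k" for e j t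
    unfolding Y_def by (rule sat_rename_shift_var) (use that car in auto)
  have 1: "sat P g (Neg (Ex 0 (conjs (map (\<lambda>j. Neg (?\<psi> j 0)) [0..<n])))) \<longleftrightarrow> (\<Union>j<n. Y j) = carrier H"
  proof -
    have "sat P g (Neg (Ex 0 (conjs (map (\<lambda>j. Neg (?\<psi> j 0)) [0..<n])))) \<longleftrightarrow> (\<forall>x\<in>carrier H. \<exists>j<n. x \<in> Y j)"
      by (auto simp: sat_conjs car \<psi> Bex_def)
    also have "\<dots> \<longleftrightarrow> (\<Union>j<n. Y j) = carrier H" using Ysub by auto
    finally show ?thesis .
  qed
  have 2: "sat P g (Ex 0 (?\<psi> j 0)) \<longleftrightarrow> Y j \<noteq> {}" if "j < n" for j
  proof -
    have "sat P g (Ex 0 (?\<psi> j 0)) \<longleftrightarrow> (\<exists>x\<in>carrier H. x \<in> Y j)"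
      using that by (auto simp: car \<psi>)
    then show ?thesis using Ysub by auto
  qed
  have 3: "sat P g (Neg (Ex 0 (Conj (?\<psi> a 0) (?\<psi> b 0)))) \<longleftrightarrow> Y a \<inter> Y b = {}" if "a < n" "b < n" for a b
  proof -
    have "sat P g (Neg (Ex 0 (Conj (?\<psi> a 0) (?\<psi> b 0)))) \<longleftrightarrow> (\<forall>x\<in>carrier H. \<not> (x \<in> Y a \<and> x \<in> Y b))"
      using that by (auto simp: car \<psi>)
    then show ?thesis using Ysub by auto
  qed
  have 4: "sat P g (Neg (Ex 0 (Ex 1 (Conj (Conj (?\<psi> a 0) (?\<psi> b 1))
            (Ex 2 (Conj (Eq (Var 2) (App m [Var 0, Var 1])) (?\<psi> c 2))))))) \<longleftrightarrow>
        (\<forall>x\<in>Y a. \<forall>y\<in>Y b. x \<otimes>\<^bsub>H\<^esub> y \<notin> Y c)" if "a < n" "b < n" "c < n" for a b c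
  proof -
    have "sat P (g(0 := x, Suc 0 := y)) (Conj (Conj (?\<psi> a 0) (?\<psi> b 1))
            (Ex 2 (Conj (Eq (Var 2) (App m [Var 0, Var 1])) (?\<psi> c 2))))
        \<longleftrightarrow> x \<in> Y a \<and> y \<in> Y b \<and> x \<otimes>\<^bsub>H\<^esub> y \<in> Y c" if xy: "x \<in> carrier H" "y \<in> carrier H" for x y
    proof -
      have "sat P ((g(0 := x, Suc 0 := y))(2 := x \<otimes>\<^bsub>H\<^esub> y)) (?\<psi> c 2) \<longleftrightarrow> x \<otimes>\<^bsub>H\<^esub> y \<in> Y c"
        using \<psi>[of c 2 "(g(0 := x, Suc 0 := y))(2 := x \<otimes>\<^bsub>H\<^esub> y)"] \<open>c < n\<close> xy by simp
      moreover have "sat P (g(0 := x, Suc 0 := y)) (?\<psi> a 0) \<longleftrightarrow> x \<in> Y a"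
        using \<psi>[of a 0 "g(0 := x, Suc 0 := y)"] \<open>a < n\<close> xy by simp
      moreover have "sat P (g(0 := x, Suc 0 := y)) (?\<psi> b 1) \<longleftrightarrow> y \<in> Y b"
        using \<psi>[of b 1 "g(0 := x, Suc 0 := y)"] \<open>b < n\<close> xy by simp
      ultimately show ?thesis using xy by (simp add: car mult)
    qed
    note F1 = this
    have F2: "sat P g (Neg (Ex 0 (Ex 1 \<kappa>))) \<longleftrightarrow>
        (\<forall>x\<in>carrier H. \<forall>y\<in>carrier H. \<not> sat P (g(0 := x, Suc 0 := y)) \<kappa>)" for \<kappa> :: "('f, 'r) fo_formula"
      by (simp add: car)
    have "sat P g (Neg (Ex 0 (Ex 1 (Conj (Conj (?\<psi> a 0) (?\<psi> b 1))
            (Ex 2 (Conj (Eq (Var 2) (App m [Var 0, Var 1])) (?\<psi> c 2))))))) \<longleftrightarrow>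
        (\<forall>x\<in>carrier H. \<forall>y\<in>carrier H. \<not> (x \<in> Y a \<and> y \<in> Y b \<and> x \<otimes>\<^bsub>H\<^esub> y \<in> Y c))"
      unfolding F2 by (intro ball_cong refl) (simp only: F1)
    also have "\<dots> \<longleftrightarrow> (\<forall>x\<in>Y a. \<forall>y\<in>Y b. x \<otimes>\<^bsub>H\<^esub> y \<notin> Y c)"
      using Ysub[of a] Ysub[of b] by blast
    finally show ?thesis .
  qed
  have "sat P g (covering_formula m n \<Phi> B2 B3) \<longleftrightarrow>
    sat P g (Neg (Ex 0 (conjs (map (\<lambda>j. Neg (?\<psi> j 0)) [0..<n])))) \<and>
    (\<forall>j\<in>{..<n}. sat P g (Ex 0 (?\<psi> j 0))) \<and>
    (\<forall>(a, b)\<in>set B2. sat P g (Neg (Ex 0 (Conj (?\<psi> a 0) (?\<psi> b 0))))) \<and>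
    (\<forall>(a, b, c)\<in>set B3. sat P g (Neg (Ex 0 (Ex 1 (Conj (Conj (?\<psi> a 0) (?\<psi> b 1))
            (Ex 2 (Conj (Eq (Var 2) (App m [Var 0, Var 1])) (?\<psi> c 2))))))))"
    unfolding covering_formula_def Let_def sat_conjs
    by (simp add: ball_Un case_prod_unfold atLeast0LessThan del: sat.simps)
  also have "\<dots> \<longleftrightarrow> (\<Union>j<n. Y j) = carrier H \<and> (\<forall>j\<in>{..<n}. Y j \<noteq> {}) \<and> (\<forall>(a, b)\<in>set B2. Y a \<inter> Y b = {}) \<and>
    (\<forall>(a, b, c)\<in>set B3. \<forall>x\<in>Y a. \<forall>y\<in>Y b. x \<otimes>\<^bsub>H\<^esub> y \<notin> Y c)"
  proof -
    have b2: "fst x < n" "snd x < n" if "x \<in> set B2" for x using that B(1) by auto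
    have b3: "fst x < n" "fst (snd x) < n" "snd (snd x) < n" if "x \<in> set B3" for x
      using that B(2) by auto
    show ?thesis unfolding 1 case_prod_unfold
      by (intro conj_cong refl ball_cong) (simp_all only: 2 3 4 b2 b3 lessThan_iff)
  qed
  finally show ?thesis .
qed

lemma definable_cover_transfer:
  fixes X :: "nat \<Rightarrow> 'a set"
  assumes U: "is_ultrafilter U" and M: "expands_group L m M G"
    and N: "\<And>i. expands_group L m (N i) (H i)"
    and el: "elementarily_equivalent L M (ultraproduct U N)"
    and X: "\<And>j. j < n \<Longrightarrow> definable L M (X j)" "(\<Union>j<n. X j) = carrier G" "\<And>j. j < n \<Longrightarrow> X j \<noteq> {}"
  obtains i Y where "(\<Union>j<n. Y j) = carrier (H i)" "\<And>j. j < n \<Longrightarrow> Y j \<noteq> {}"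
    "\<And>a b. a < n \<Longrightarrow> b < n \<Longrightarrow> Y a \<inter> Y b \<noteq> {} \<Longrightarrow> X a \<inter> X b \<noteq> {}"
    "\<And>a b c x y. a < n \<Longrightarrow> b < n \<Longrightarrow> c < n \<Longrightarrow> x \<in> Y a \<Longrightarrow> y \<in> Y b \<Longrightarrow> x \<otimes>\<^bsub>H i\<^esub> y \<in> Y c \<Longrightarrow>
       \<exists>x'\<in>X a. \<exists>y'\<in>X b. x' \<otimes>\<^bsub>G\<^esub> y' \<in> X c"
proof -
  have "\<forall>j. \<exists>\<phi> e. j < n \<longrightarrow> wf_formula L \<phi> \<and> range e \<subseteq> univ M \<and> X j = {a \<in> univ M. sat M (e(0 := a)) \<phi>}"
    using X(1) unfolding definable_def by metis
  then obtain \<Phi> E where \<Phi>: "\<And>j. j < n \<Longrightarrow> wf_formula L (\<Phi> j)"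
    and E: "\<And>j. j < n \<Longrightarrow> range (E j) \<subseteq> univ M"
    and XE: "\<And>j. j < n \<Longrightarrow> X j = {a \<in> univ M. sat M ((E j)(0 := a)) (\<Phi> j)}"
    by metis
  have grpG: "group G" and carG: "univ M = carrier G" using M by (auto simp: expands_group_def)
  interpret group G by fact
  have "n > 0" using X(2) one_closed by (cases n) auto
  \<comment> \<open>Inverts the interleaving of \<open>shift_var\<close>: variable
    \<open>3 + k * n + j\<close> holds parameter \<open>k\<close> of formula
    \<open>j\<close>.\<close>
  define g where "g k = E ((k - 3) mod n) ((k - 3) div n)" for k
  have "E j k \<in> univ M" if "j < n" for j k using E[OF that] by auto
  then have g: "range g \<subseteq> univ M" using \<open>n > 0\<close> by (auto simp: g_def)
  have XM: "defined_set M g n \<Phi> j = X j" if "j < n" for j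
  proof -
    have "(\<lambda>k. if k = 0 then h else g (3 + k * n + j)) = (E j)(0 := h)" for h
      using that by (auto simp: g_def)
    then show ?thesis using that by (simp add: defined_set_def XE)
  qed
  obtain B2 where B2: "set B2 = {(a, b). a < n \<and> b < n \<and> X a \<inter> X b = {}}"
    using finite_list[of "{(a, b). a < n \<and> b < n \<and> X a \<inter> X b = {}}"]
      finite_subset[of "{(a, b). a < n \<and> b < n \<and> X a \<inter> X b = {}}" "{..<n} \<times> {..<n}"] by auto
  let ?B3 = "{(a, b, c). a < n \<and> b < n \<and> c < n \<and> (\<forall>x\<in>X a. \<forall>y\<in>X b. x \<otimes>\<^bsub>G\<^esub> y \<notin> X c)}"
  obtain B3 where B3: "set B3 = ?B3"
    using finite_list[of ?B3] finite_subset[of ?B3 "{..<n} \<times> {..<n} \<times> {..<n}"] by auto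
  have Bs: "set B2 \<subseteq> {..<n} \<times> {..<n}" "set B3 \<subseteq> {..<n} \<times> {..<n} \<times> {..<n}" using B2 B3 by auto
  let ?\<theta> = "covering_formula m n \<Phi> B2 B3"
  have L: "(m, 2) \<in> funs L" and strN: "\<And>i. is_structure L (N i)"
    using M N by (auto simp: expands_group_def)
  have "sat M g ?\<theta>"
    unfolding sat_covering_formula[OF M g Bs] using XM X(2,3) B2 B3 by auto
  from sat_transfer[OF U strN el wf_covering_formula[OF L \<Phi> Bs] g this]
  obtain i e' where e': "range e' \<subseteq> univ (N i)" "sat (N i) e' ?\<theta>" by blast
  let ?Y = "defined_set (N i) e' n \<Phi>"
  have "(\<Union>j<n. ?Y j) = carrier (H i) \<and> (\<forall>j\<in>{..<n}. ?Y j \<noteq> {}) \<and> (\<forall>(a, b)\<in>set B2. ?Y a \<inter> ?Y b = {}) \<and>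
    (\<forall>(a, b, c)\<in>set B3. \<forall>x\<in>?Y a. \<forall>y\<in>?Y b. x \<otimes>\<^bsub>H i\<^esub> y \<notin> ?Y c)"
    by (rule sat_covering_formula[OF N e'(1) Bs, THEN iffD1, OF e'(2)])
  then have Y: "(\<Union>j<n. ?Y j) = carrier (H i)" "\<And>j. j < n \<Longrightarrow> ?Y j \<noteq> {}"
    "\<And>a b. (a, b) \<in> set B2 \<Longrightarrow> ?Y a \<inter> ?Y b = {}"
    "\<And>a b c x y. (a, b, c) \<in> set B3 \<Longrightarrow> x \<in> ?Y a \<Longrightarrow> y \<in> ?Y b \<Longrightarrow> x \<otimes>\<^bsub>H i\<^esub> y \<notin> ?Y c"
    by auto
  show ?thesis
  proof (rule that[of ?Y i])
    show "X a \<inter> X b \<noteq> {}" if "a < n" "b < n" "?Y a \<inter> ?Y b \<noteq> {}" for a b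
      using Y(3)[of a b] that B2 by auto
    show "\<exists>x'\<in>X a. \<exists>y'\<in>X b. x' \<otimes>\<^bsub>G\<^esub> y' \<in> X c"
      if "a < n" "b < n" "c < n" "x \<in> ?Y a" "y \<in> ?Y b" "x \<otimes>\<^bsub>H i\<^esub> y \<in> ?Y c" for a b c x y
      using Y(4)[of a b c x y] that B3 by auto
    show "(\<Union>j<n. ?Y j) = carrier (H i)" by (fact Y(1))
    show "?Y j \<noteq> {}" if "j < n" for j using that by (fact Y(2))
  qed
qed

section \<open>Orthogonal matrices of finite size\<close>

text \<open>One type for all sizes, so that the size of a representation can be quantified over: the
  \<open>n\<close> by \<open>n\<close> matrices are \<open>mats n\<close>, with unit \<open>un n\<close>.\<close>

typedef fmat = "{f :: nat \<Rightarrow> nat \<Rightarrow> real. \<exists>n. \<forall>i j. n \<le> i \<or> n \<le> j \<longrightarrow> f i j = 0}"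
  morphisms ent Abs_fmat
  by auto

setup_lifting type_definition_fmat

definition mats :: "nat \<Rightarrow> fmat set" where
  "mats n = {A. \<forall>i j. n \<le> i \<or> n \<le> j \<longrightarrow> ent A i j = 0}"

lemma matsD: "A \<in> mats n \<Longrightarrow> n \<le> i \<or> n \<le> j \<Longrightarrow> ent A i j = 0"
  by (auto simp: mats_def)

lemma mats_mono: "n \<le> m \<Longrightarrow> A \<in> mats n \<Longrightarrow> A \<in> mats m"
  by (auto simp: mats_def)

lemma fmat_in_mats: "\<exists>n. A \<in> mats n"
  using ent[of A] by (auto simp: mats_def)

lemma obtain_mats2: obtains n where "A \<in> mats n" "B \<in> mats n"
proof -
  obtain a b where "A \<in> mats a" "B \<in> mats b" using fmat_in_mats by metis
  then show ?thesis using that[of "max a b"] by (meson mats_mono max.cobounded1 max.cobounded2)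
qed

lemma obtain_mats3: obtains n where "A \<in> mats n" "B \<in> mats n" "C \<in> mats n"
proof -
  obtain a where "A \<in> mats a" "B \<in> mats a" by (rule obtain_mats2)
  moreover obtain b where "C \<in> mats b" using fmat_in_mats by metis
  ultimately show ?thesis using that[of "max a b"] by (meson mats_mono max.cobounded1 max.cobounded2)
qed

lemma fmat_eqI: "(\<And>i j. ent A i j = ent B i j) \<Longrightarrow> A = B"
  by (simp add: ent_inject[symmetric] fun_eq_iff)

instantiation fmat :: "{zero, plus, minus, uminus, times, scaleR}"
begin

lift_definition zero_fmat :: fmat is "\<lambda>i j. 0" by simp

lift_definition plus_fmat :: "fmat \<Rightarrow> fmat \<Rightarrow> fmat" is "\<lambda>A B i j. A i j + B i j"
proof -
  fix f g :: "nat \<Rightarrow> nat \<Rightarrow> real"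
  assume "\<exists>n. \<forall>i j. n \<le> i \<or> n \<le> j \<longrightarrow> f i j = 0" "\<exists>n. \<forall>i j. n \<le> i \<or> n \<le> j \<longrightarrow> g i j = 0"
  then obtain a b where "\<forall>i j. a \<le> i \<or> a \<le> j \<longrightarrow> f i j = 0" "\<forall>i j. b \<le> i \<or> b \<le> j \<longrightarrow> g i j = 0" by blast
  then show "\<exists>n. \<forall>i j. n \<le> i \<or> n \<le> j \<longrightarrow> f i j + g i j = 0" by (intro exI[of _ "max a b"]) auto
qed

lift_definition minus_fmat :: "fmat \<Rightarrow> fmat \<Rightarrow> fmat" is "\<lambda>A B i j. A i j - B i j"
proof -
  fix f g :: "nat \<Rightarrow> nat \<Rightarrow> real"
  assume "\<exists>n. \<forall>i j. n \<le> i \<or> n \<le> j \<longrightarrow> f i j = 0" "\<exists>n. \<forall>i j. n \<le> i \<or> n \<le> j \<longrightarrow> g i j = 0"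
  then obtain a b where "\<forall>i j. a \<le> i \<or> a \<le> j \<longrightarrow> f i j = 0" "\<forall>i j. b \<le> i \<or> b \<le> j \<longrightarrow> g i j = 0" by blast
  then show "\<exists>n. \<forall>i j. n \<le> i \<or> n \<le> j \<longrightarrow> f i j - g i j = 0" by (intro exI[of _ "max a b"]) auto
qed

lift_definition uminus_fmat :: "fmat \<Rightarrow> fmat" is "\<lambda>A i j. - A i j" by simp

lift_definition scaleR_fmat :: "real \<Rightarrow> fmat \<Rightarrow> fmat" is "\<lambda>c A i j. c * A i j" by auto

text \<open>The support of row \<open>i\<close> is finite for every matrix, so the product needs no
  size parameter; \<open>ent_times\<close> replaces the support by any sufficient range.\<close>

lift_definition times_fmat :: "fmat \<Rightarrow> fmat \<Rightarrow> fmat" is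
  "\<lambda>A B i j. \<Sum>k | A i k \<noteq> 0. A i k * B k j"
proof -
  fix f g :: "nat \<Rightarrow> nat \<Rightarrow> real"
  assume "\<exists>n. \<forall>i j. n \<le> i \<or> n \<le> j \<longrightarrow> f i j = 0" "\<exists>n. \<forall>i j. n \<le> i \<or> n \<le> j \<longrightarrow> g i j = 0"
  then obtain a b where "\<forall>i j. a \<le> i \<or> a \<le> j \<longrightarrow> f i j = 0" "\<forall>i j. b \<le> i \<or> b \<le> j \<longrightarrow> g i j = 0" by blast
  then show "\<exists>n. \<forall>i j. n \<le> i \<or> n \<le> j \<longrightarrow> (\<Sum>k | f i k \<noteq> 0. f i k * g k j) = 0"
    by (intro exI[of _ "max a b"]) (auto intro!: sum.neutral)
qed

instance ..

end

lemmas ent_simps [simp] = zero_fmat.rep_eq plus_fmat.rep_eq minus_fmat.rep_eq uminus_fmat.rep_eq scaleR_fmat.rep_eq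

lemma ent_times:
  assumes "A \<in> mats n"
  shows "ent (A * B) i j = (\<Sum>k<n. ent A i k * ent B k j)"
  unfolding times_fmat.rep_eq
  by (rule sum.mono_neutral_left) (use matsD[OF assms] in \<open>auto simp: not_less[symmetric]\<close>)

lemma mats_times: "A \<in> mats n \<Longrightarrow> B \<in> mats n \<Longrightarrow> A * B \<in> mats n"
  unfolding mats_def[of n] mem_Collect_eq
  by (intro allI impI, subst ent_times[where n=n]) (auto simp: mats_def intro!: sum.neutral)

lemma mats_add: "A \<in> mats n \<Longrightarrow> B \<in> mats n \<Longrightarrow> A + B \<in> mats n"
  and mats_diff: "A \<in> mats n \<Longrightarrow> B \<in> mats n \<Longrightarrow> A - B \<in> mats n"
  and mats_uminus: "A \<in> mats n \<Longrightarrow> - A \<in> mats n"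
  and mats_scaleR: "A \<in> mats n \<Longrightarrow> c *\<^sub>R A \<in> mats n"
  and mats_zero: "0 \<in> mats n"
  by (auto simp: mats_def)

lemmas mats_intros = mats_times mats_add mats_diff mats_uminus mats_scaleR mats_zero

instance fmat :: real_algebra
proof
  fix A B C :: fmat and a b :: real
  show "A + B + C = A + (B + C)" "A + B = B + A" "0 + A = A" "- A + A = 0" "A - B = A + - B"
    "a *\<^sub>R (A + B) = a *\<^sub>R A + a *\<^sub>R B" "(a + b) *\<^sub>R A = a *\<^sub>R A + b *\<^sub>R A"
    "a *\<^sub>R b *\<^sub>R A = (a * b) *\<^sub>R A" "1 *\<^sub>R A = A"
    by (auto intro!: fmat_eqI simp: algebra_simps)
  obtain n where n: "A \<in> mats n" "B \<in> mats n" "C \<in> mats n" by (rule obtain_mats3)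
  note t = ent_times[where n=n]
  show "(A + B) * C = A * C + B * C" "A * (B + C) = A * B + A * C"
    "a *\<^sub>R A * B = a *\<^sub>R (A * B)" "A * a *\<^sub>R B = a *\<^sub>R (A * B)"
    by (auto intro!: fmat_eqI simp: n t mats_intros algebra_simps sum.distrib sum_distrib_left)
  show "A * B * C = A * (B * C)"
  proof (rule fmat_eqI)
    fix i j
    have "ent (A * B * C) i j = (\<Sum>k<n. \<Sum>l<n. ent A i l * ent B l k * ent C k j)"
      by (simp add: n t mats_intros sum_distrib_right)
    also have "\<dots> = (\<Sum>l<n. \<Sum>k<n. ent A i l * ent B l k * ent C k j)" by (rule sum.swap)
    also have "\<dots> = ent (A * (B * C)) i j"
      by (simp add: n t mats_intros sum_distrib_left algebra_simps)
    finally show "ent (A * B * C) i j = ent (A * (B * C)) i j" .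
  qed
qed

instantiation fmat :: real_inner
begin

text \<open>The Frobenius inner product. The trace of an \<open>n\<close> by \<open>n\<close> matrix
  \<open>X\<close> is written \<open>X \<bullet> un n\<close> throughout.\<close>

definition inner_fmat :: "fmat \<Rightarrow> fmat \<Rightarrow> real" where
  "inner_fmat A B = (\<Sum>(i, j) | ent A i j \<noteq> 0. ent A i j * ent B i j)"

definition norm_fmat :: "fmat \<Rightarrow> real" where "norm_fmat A = sqrt (A \<bullet> A)"

definition sgn_fmat :: "fmat \<Rightarrow> fmat" where "sgn_fmat A = inverse (norm A) *\<^sub>R A"

definition dist_fmat :: "fmat \<Rightarrow> fmat \<Rightarrow> real" where "dist_fmat A B = norm (A - B)"

definition uniformity_fmat :: "(fmat \<times> fmat) filter" where
  "uniformity_fmat = (INF e\<in>{0 <..}. principal {(x, y). dist x y < e})"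

definition open_fmat :: "fmat set \<Rightarrow> bool" where
  "open_fmat U = (\<forall>x\<in>U. eventually (\<lambda>(x', y). x' = x \<longrightarrow> y \<in> U) uniformity)"

lemma inner_fmat:
  assumes "A \<in> mats n"
  shows "A \<bullet> B = (\<Sum>i<n. \<Sum>j<n. ent A i j * ent B i j)"
proof -
  have "A \<bullet> B = (\<Sum>(i, j)\<in>{..<n} \<times> {..<n}. ent A i j * ent B i j)"
    unfolding inner_fmat_def
    by (rule sum.mono_neutral_left) (use matsD[OF assms] in \<open>auto simp: not_less[symmetric]\<close>)
  then show ?thesis by (simp add: sum.cartesian_product)
qed

instance
proof
  fix A B C :: fmat and r :: real
  obtain n where n: "A \<in> mats n" "B \<in> mats n" "C \<in> mats n" by (rule obtain_mats3)
  note t = inner_fmat[where n=n]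
  show "A \<bullet> B = B \<bullet> A" "(A + B) \<bullet> C = A \<bullet> C + B \<bullet> C" "r *\<^sub>R A \<bullet> B = r * (A \<bullet> B)"
    by (auto simp: n t mats_intros algebra_simps sum.distrib sum_distrib_left)
  show "0 \<le> A \<bullet> A" by (auto simp: n t intro!: sum_nonneg)
  show "A \<bullet> A = 0 \<longleftrightarrow> A = 0"
  proof
    assume "A \<bullet> A = 0"
    then have "\<forall>i<n. \<forall>j<n. ent A i j = 0"
      by (simp add: n t sum_nonneg_eq_0_iff sum_nonneg)
    then show "A = 0" using matsD[OF n(1)] by (intro fmat_eqI) (metis not_less zero_fmat.rep_eq)
  qed (simp add: t mats_zero)
qed (auto simp: norm_fmat_def sgn_fmat_def dist_fmat_def uniformity_fmat_def open_fmat_def)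

end

instance fmat :: real_normed_algebra
proof
  fix A B :: fmat
  obtain n where n: "A \<in> mats n" "B \<in> mats n" by (rule obtain_mats2)
  have "(norm (A * B))\<^sup>2 = (\<Sum>i<n. \<Sum>j<n. (\<Sum>k<n. ent A i k * ent B k j)\<^sup>2)"
    unfolding power2_norm_eq_inner inner_fmat[OF mats_times[OF n]]
    by (simp add: ent_times[OF n(1)] power2_eq_square)
  also have "\<dots> \<le> (\<Sum>i<n. \<Sum>j<n. (\<Sum>k<n. (ent A i k)\<^sup>2) * (\<Sum>k<n. (ent B k j)\<^sup>2))"
    by (intro sum_mono Cauchy_Schwarz_ineq_sum)
  also have "\<dots> = (\<Sum>i<n. \<Sum>k<n. (ent A i k)\<^sup>2) * (\<Sum>j<n. \<Sum>k<n. (ent B k j)\<^sup>2)"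
    by (simp add: sum_product)
  also have "(\<Sum>j<n. \<Sum>k<n. (ent B k j)\<^sup>2) = (\<Sum>k<n. \<Sum>j<n. (ent B k j)\<^sup>2)" by (rule sum.swap)
  also have "(\<Sum>i<n. \<Sum>k<n. (ent A i k)\<^sup>2) * \<dots> = (norm A * norm B)\<^sup>2"
    unfolding power_mult_distrib power2_norm_eq_inner inner_fmat[OF n(1)] inner_fmat[OF n(2)]
    by (simp add: power2_eq_square)
  finally show "norm (A * B) \<le> norm A * norm B" by (rule power2_le_imp_le) simp
qed

lift_definition tr :: "fmat \<Rightarrow> fmat" is "\<lambda>A i j. A j i" by auto

lift_definition un :: "nat \<Rightarrow> fmat" is "\<lambda>n i j. if i = j \<and> i < n then 1 else 0" 
  subgoal for n by (intro exI[of _ n]) auto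
  done

lift_definition eu :: "nat \<Rightarrow> nat \<Rightarrow> fmat" is "\<lambda>a b i j. if i = a \<and> j = b then 1 else 0"
  subgoal for a b by (intro exI[of _ "Suc (max a b)"]) auto
  done

text \<open>Entries are rounded down to multiples of 1/\<open>m\<close>. This commutes with
  \<open>tr\<close>, fixes \<open>un n\<close> for positive \<open>m\<close>, and has finite range
  on bounded sets of a fixed size, so the normalisation of an approximate homomorphism survives
  it.\<close>

lift_definition rnd :: "nat \<Rightarrow> fmat \<Rightarrow> fmat" is "\<lambda>m A i j. of_int \<lfloor>real m * A i j\<rfloor> / real m"
proof -
  fix m :: nat and A :: "nat \<Rightarrow> nat \<Rightarrow> real"
  assume "\<exists>n. \<forall>i j. n \<le> i \<or> n \<le> j \<longrightarrow> A i j = 0"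
  then obtain n where "\<forall>i j. n \<le> i \<or> n \<le> j \<longrightarrow> A i j = 0" ..
  then show "\<exists>n. \<forall>i j. n \<le> i \<or> n \<le> j \<longrightarrow> of_int \<lfloor>real m * A i j\<rfloor> / real m = 0"
    by (intro exI[of _ n]) auto
qed

lemmas ent_simps2 [simp] = tr.rep_eq un.rep_eq eu.rep_eq rnd.rep_eq

lemma mats_tr [simp]: "tr A \<in> mats n \<longleftrightarrow> A \<in> mats n"
  and mats_un [simp]: "un n \<in> mats n"
  and mats_eu: "a < n \<Longrightarrow> b < n \<Longrightarrow> eu a b \<in> mats n"
  and mats_rnd: "A \<in> mats n \<Longrightarrow> rnd m A \<in> mats n"
  by (auto simp: mats_def)

lemma tr_simps [simp]: "tr (A + B) = tr A + tr B" "tr (A - B) = tr A - tr B" "tr (- A) = - tr A"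
   "tr (c *\<^sub>R A) = c *\<^sub>R tr A" "tr 0 = 0" "tr (tr A) = A" "tr (un n) = un n"
  by (auto intro!: fmat_eqI)

lemma tr_times [simp]: "tr (A * B) = tr B * tr A"
proof -
  obtain n where n: "A \<in> mats n" "B \<in> mats n" by (rule obtain_mats2)
  then show ?thesis by (intro fmat_eqI) (simp add: ent_times[where n=n] mult.commute)
qed

lemma inner_tr: "tr A \<bullet> tr B = A \<bullet> B"
proof -
  obtain n where n: "A \<in> mats n" "B \<in> mats n" by (rule obtain_mats2)
  then show ?thesis by (simp add: inner_fmat[where n=n], subst sum.swap) simp
qed

lemma norm_tr [simp]: "norm (tr A) = norm A"
  by (simp add: norm_eq_sqrt_inner inner_tr)

lemma inner_times_left: "(A * B) \<bullet> C = B \<bullet> (tr A * C)"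
proof -
  obtain n where n: "A \<in> mats n" "B \<in> mats n" "C \<in> mats n" by (rule obtain_mats3)
  have "(A * B) \<bullet> C = (\<Sum>i<n. \<Sum>j<n. \<Sum>k<n. ent A i k * ent B k j * ent C i j)"
    by (simp add: n inner_fmat[where n=n] ent_times[where n=n] mats_intros sum_distrib_right)
  also have "\<dots> = (\<Sum>i<n. \<Sum>k<n. \<Sum>j<n. ent A i k * ent B k j * ent C i j)"
    by (intro sum.cong refl sum.swap)
  also have "\<dots> = (\<Sum>k<n. \<Sum>i<n. \<Sum>j<n. ent A i k * ent B k j * ent C i j)"
    by (rule sum.swap)
  also have "\<dots> = (\<Sum>k<n. \<Sum>j<n. \<Sum>i<n. ent A i k * ent B k j * ent C i j)"
    by (intro sum.cong refl sum.swap)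
  also have "\<dots> = B \<bullet> (tr A * C)"
    by (simp add: n inner_fmat[where n=n] ent_times[where n=n] mats_intros sum_distrib_left algebra_simps)
  finally show ?thesis .
qed

lemma inner_times_right: "(A * B) \<bullet> C = A \<bullet> (C * tr B)"
proof -
  have "(A * B) \<bullet> C = tr (A * B) \<bullet> tr C" by (simp only: inner_tr)
  also have "\<dots> = tr A \<bullet> (B * tr C)" by (simp add: inner_times_left)
  also have "\<dots> = tr A \<bullet> tr (C * tr B)" by simp
  finally show ?thesis by (simp only: inner_tr)
qed

lemma un_times [simp]: "A \<in> mats n \<Longrightarrow> un n * A = A"
proof (rule fmat_eqI)
  fix i j assume A: "A \<in> mats n"
  have "ent (un n * A) i j = (\<Sum>k<n. if i = k then ent A k j else 0)"
    unfolding ent_times[OF mats_un] by (intro sum.cong refl) auto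
  then show "ent (un n * A) i j = ent A i j" using matsD[OF A, of i j] by (auto simp: not_less)
qed

lemma times_un [simp]: "A \<in> mats n \<Longrightarrow> A * un n = A"
  using tr_times[of A "un n"] un_times[of "tr A" n] by (metis mats_tr tr_simps(6,7))

lemma inner_un: "un n \<bullet> un n = n"
  by (simp add: inner_fmat[where n=n] if_distrib[of "\<lambda>x. x * _"] cong: if_cong)

lemma fmat_expand:
  assumes "A \<in> mats n"
  shows "A = (\<Sum>i<n. \<Sum>j<n. ent A i j *\<^sub>R eu i j)"
proof (rule fmat_eqI)
  fix a b
  have ent_sum: "ent (sum f S) i j = (\<Sum>x\<in>S. ent (f x) i j)" for f :: "nat \<Rightarrow> fmat" and S i j
    by (induction S rule: infinite_finite_induct) auto
  have "ent (\<Sum>i<n. \<Sum>j<n. ent A i j *\<^sub>R eu i j) a b =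
      (\<Sum>i<n. \<Sum>j<n. if b = j then (if a = i then ent A i j else 0) else 0)"
    unfolding ent_sum by (intro sum.cong refl) simp
  also have "\<dots> = (\<Sum>i<n. if a = i then (if b < n then ent A i b else 0) else 0)"
    by (intro sum.cong refl) simp
  also have "\<dots> = (if a < n \<and> b < n then ent A a b else 0)" by simp
  also have "\<dots> = ent A a b" using matsD[OF assms, of a b] by auto
  finally show "ent A a b = ent (\<Sum>i<n. \<Sum>j<n. ent A i j *\<^sub>R eu i j) a b" by simp
qed

lemma mats_subset_span: "mats n \<subseteq> span ((\<lambda>(i, j). eu i j) ` ({..<n} \<times> {..<n}))"
proof
  fix A assume "A \<in> mats n"
  then have "A = (\<Sum>i<n. \<Sum>j<n. ent A i j *\<^sub>R eu i j)" by (rule fmat_expand)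
  also have "\<dots> \<in> span ((\<lambda>(i, j). eu i j) ` ({..<n} \<times> {..<n}))"
    by (intro span_sum span_scale span_base) auto
  finally show "A \<in> span ((\<lambda>(i, j). eu i j) ` ({..<n} \<times> {..<n}))" .
qed

lemma norm_le_ent: 
  assumes "A \<in> mats n"
  shows "norm A \<le> (\<Sum>i<n. \<Sum>j<n. \<bar>ent A i j\<bar>)"
proof -
  have 1: "norm (eu i j) = 1" for i j
  proof -
    have "eu i j \<in> mats (Suc (max i j))" by (intro mats_eu) auto
    then have "eu i j \<bullet> eu i j = (\<Sum>a<Suc (max i j). \<Sum>b<Suc (max i j). if a = i then (if b = j then 1 else 0) else 0)"
      unfolding inner_fmat[OF \<open>eu i j \<in> _\<close>] by (intro sum.cong refl) auto
    also have "\<dots> = (\<Sum>a<Suc (max i j). if a = i then 1 else 0)"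
      by (intro sum.cong refl) (auto simp del: sum.lessThan_Suc)
    also have "\<dots> = 1" by (subst sum.delta) auto
    finally show ?thesis by (simp add: norm_eq_sqrt_inner)
  qed
  have "norm A = norm (\<Sum>i<n. \<Sum>j<n. ent A i j *\<^sub>R eu i j)" using fmat_expand[OF assms] by simp
  also have "\<dots> \<le> (\<Sum>i<n. \<Sum>j<n. norm (ent A i j *\<^sub>R eu i j))"
    by (intro order_trans[OF norm_sum] sum_mono norm_sum)
  finally show ?thesis by (simp add: 1)
qed

lemma ent_le_norm: "\<bar>ent A i j\<bar> \<le> norm A"
proof -
  obtain n0 where n0: "A \<in> mats n0" using fmat_in_mats by blast
  define n where "n = Suc (max n0 (max i j))"
  have n: "A \<in> mats n" "i < n" "j < n" using mats_mono[OF _ n0, of n] by (auto simp: n_def)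
  have "(ent A i j)\<^sup>2 \<le> (\<Sum>j<n. (ent A i j)\<^sup>2)"
    by (rule member_le_sum) (use n in auto)
  also have "\<dots> \<le> (\<Sum>i<n. \<Sum>j<n. (ent A i j)\<^sup>2)"
    by (rule member_le_sum[where f="\<lambda>i. \<Sum>j<n. (ent A i j)\<^sup>2"]) (use n in \<open>auto intro: sum_nonneg\<close>)
  also have "\<dots> = (norm A)\<^sup>2"
    unfolding power2_norm_eq_inner inner_fmat[OF n(1)] by (simp add: power2_eq_square)
  finally show ?thesis by (simp add: abs_le_square_iff[symmetric])
qed

lemma tendsto_fmat:
  assumes "\<And>k. A k \<in> mats n" "L \<in> mats n" "\<And>i j. i < n \<Longrightarrow> j < n \<Longrightarrow> (\<lambda>k. ent (A k) i j) \<longlonglongrightarrow> ent L i j"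
  shows "A \<longlonglongrightarrow> L"
proof -
  have "(\<lambda>k. \<Sum>i<n. \<Sum>j<n. \<bar>ent (A k - L) i j\<bar>) \<longlonglongrightarrow> (\<Sum>i<n. \<Sum>j<n. \<bar>ent L i j - ent L i j\<bar>)"
    unfolding minus_fmat.rep_eq by (intro tendsto_sum tendsto_rabs tendsto_diff tendsto_const assms(3)) auto
  then have "(\<lambda>k. \<Sum>i<n. \<Sum>j<n. \<bar>ent (A k - L) i j\<bar>) \<longlonglongrightarrow> 0" by simp
  moreover have "norm (A k - L) \<le> (\<Sum>i<n. \<Sum>j<n. \<bar>ent (A k - L) i j\<bar>)" for k
    using assms by (intro norm_le_ent mats_intros)
  ultimately have "(\<lambda>k. A k - L) \<longlonglongrightarrow> 0"
    by (intro Lim_null_comparison[of "\<lambda>k. A k - L"]) auto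
  then show ?thesis by (simp add: LIM_zero_iff)
qed

text \<open>The type itself is not complete, since a limit may have infinitely many nonzero entries;
  a fixed size restores finite dimension.\<close>

lemma mats_Cauchy_convergent:
  assumes A: "\<And>k. A k \<in> mats n" and C: "Cauchy A"
  obtains L where "L \<in> mats n" "A \<longlonglongrightarrow> L"
proof -
  have "Cauchy (\<lambda>k. ent (A k) i j)" for i j
  proof (rule metric_CauchyI)
    fix e :: real assume "e > 0"
    then obtain M where M: "\<And>m n. m \<ge> M \<Longrightarrow> n \<ge> M \<Longrightarrow> dist (A m) (A n) < e"
      using metric_CauchyD[OF C] by metis
    have "dist (ent (A m) i j) (ent (A n) i j) \<le> dist (A m) (A n)" for m n
      using ent_le_norm[of "A m - A n" i j] by (simp add: dist_norm)
    then show "\<exists>M. \<forall>m\<ge>M. \<forall>n\<ge>M. dist (ent (A m) i j) (ent (A n) i j) < e"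
      using M by (meson le_less_trans)
  qed
  then have "\<exists>l. (\<lambda>k. ent (A k) i j) \<longlonglongrightarrow> l" for i j
    by (simp add: Cauchy_convergent_iff convergent_def)
  then obtain l where l: "\<And>i j. (\<lambda>k. ent (A k) i j) \<longlonglongrightarrow> l i j" by metis
  define L where "L = (\<Sum>i<n. \<Sum>j<n. l i j *\<^sub>R eu i j)"
  have l0: "l i j = 0" if "n \<le> i \<or> n \<le> j" for i j
  proof -
    have "(\<lambda>k. ent (A k) i j) = (\<lambda>_. 0)" using matsD[OF A that] by auto
    then show ?thesis using l[of i j] by (simp add: LIMSEQ_const_iff)
  qed
  then have "l \<in> {f. \<exists>n. \<forall>i j. n \<le> i \<or> n \<le> j \<longrightarrow> f i j = 0}" by auto
  then have entL: "ent (Abs_fmat l) = l" by (rule Abs_fmat_inverse)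
  have "Abs_fmat l \<in> mats n" using l0 by (simp add: mats_def entL)
  moreover from this have "A \<longlonglongrightarrow> Abs_fmat l"
    by (rule tendsto_fmat[OF A]) (simp add: entL l)
  ultimately show ?thesis by (rule that)
qed

lemma norm_rnd:
  assumes "A \<in> mats n" "m > 0"
  shows "norm (rnd m A - A) \<le> real n * real n / real m"
proof -
  have "\<bar>ent (rnd m A - A) i j\<bar> \<le> 1 / real m" for i j
  proof -
    have "ent (rnd m A - A) i j = (of_int \<lfloor>real m * ent A i j\<rfloor> - real m * ent A i j) / real m"
      using assms(2) by (simp add: field_simps)
    moreover have "\<bar>of_int \<lfloor>real m * ent A i j\<rfloor> - real m * ent A i j\<bar> \<le> 1" by linarith
    ultimately show ?thesis using assms(2) by (simp add: divide_right_mono)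
  qed
  then have "(\<Sum>i<n. \<Sum>j<n. \<bar>ent (rnd m A - A) i j\<bar>) \<le> (\<Sum>i<n. \<Sum>j<n. 1 / real m)"
    by (intro sum_mono)
  moreover have "norm (rnd m A - A) \<le> (\<Sum>i<n. \<Sum>j<n. \<bar>ent (rnd m A - A) i j\<bar>)"
    using assms by (intro norm_le_ent mats_intros mats_rnd)
  ultimately show ?thesis by simp
qed

lemma tr_rnd: "tr (rnd m A) = rnd m (tr A)"
  by (auto intro!: fmat_eqI)

lemma rnd_un: "m > 0 \<Longrightarrow> rnd m (un n) = un n"
  by (auto intro!: fmat_eqI)

lemma finite_rnd: "finite (rnd m ` {A \<in> mats n. norm A \<le> B})"
proof (cases "m = 0")
  case True
  have "rnd m A = 0" for A using True by (auto intro!: fmat_eqI)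
  then have "rnd m ` {A \<in> mats n. norm A \<le> B} \<subseteq> {0}" by auto
  then show ?thesis by (rule finite_subset) auto
next
  case False
  define K where "K = \<lceil>real m * \<bar>B\<bar>\<rceil> + 1"
  let ?F = "({..<n} \<times> {..<n}) \<rightarrow>\<^sub>E {-K..K}"
  let ?g = "\<lambda>f. \<Sum>i<n. \<Sum>j<n. (of_int (f (i, j)) / real m) *\<^sub>R eu i j"
  have "rnd m ` {A \<in> mats n. norm A \<le> B} \<subseteq> ?g ` ?F"
  proof safe
    fix A assume A: "A \<in> mats n" "norm A \<le> B"
    let ?f = "restrict (\<lambda>(i, j). \<lfloor>real m * ent A i j\<rfloor>) ({..<n} \<times> {..<n})"
    have "\<lfloor>real m * ent A i j\<rfloor> \<in> {-K..K}" for i j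
    proof -
      have "\<bar>ent A i j\<bar> \<le> \<bar>B\<bar>" using ent_le_norm[of A i j] A(2) by linarith
      then have "\<bar>real m * ent A i j\<bar> \<le> real m * \<bar>B\<bar>" by (simp add: abs_mult mult_left_mono)
      then show ?thesis unfolding K_def by (simp, linarith)
    qed
    then have "?f \<in> ?F" by auto
    moreover have "rnd m A = ?g ?f"
      using fmat_expand[OF mats_rnd[OF A(1)], of m] by simp
    ultimately show "rnd m A \<in> ?g ` ?F" by blast
  qed
  moreover have "finite ?F" by (intro finite_PiE) auto
  ultimately show ?thesis by (meson finite_imageI finite_subset)
qed

definition orth :: "nat \<Rightarrow> fmat set" where
  "orth n = {A \<in> mats n. A * tr A = un n \<and> tr A * A = un n}"

lemma orthD: "A \<in> orth n \<Longrightarrow> A \<in> mats n" "A \<in> orth n \<Longrightarrow> A * tr A = un n" "A \<in> orth n \<Longrightarrow> tr A * A = un n"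
  by (auto simp: orth_def)

lemma orth_un [simp]: "un n \<in> orth n" by (simp add: orth_def)

lemma orth_tr: "A \<in> orth n \<Longrightarrow> tr A \<in> orth n" by (simp add: orth_def)

lemma orth_times: 
  assumes "A \<in> orth n" "B \<in> orth n" shows "A * B \<in> orth n"
proof -
  have "A * B * tr (A * B) = A * (B * tr B) * tr A" "tr (A * B) * (A * B) = tr B * (tr A * A) * B"
    by (simp_all add: mult.assoc)
  then show ?thesis using assms by (auto simp: orth_def mats_intros)
qed

lemma norm_orth_times:
  assumes "A \<in> orth n" "B \<in> mats n" shows "norm (A * B) = norm B" "norm (B * A) = norm B"
proof -
  have "(A * B) \<bullet> (A * B) = B \<bullet> (tr A * A * B)" by (simp add: inner_times_left mult.assoc)
  then show "norm (A * B) = norm B" using assms by (simp add: norm_eq_sqrt_inner orth_def)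
  have "(B * A) \<bullet> (B * A) = B \<bullet> (B * (A * tr A))" by (simp add: inner_times_right mult.assoc)
  then show "norm (B * A) = norm B" using assms by (simp add: norm_eq_sqrt_inner orth_def)
qed

lemma norm_orth: "A \<in> orth n \<Longrightarrow> norm A = sqrt n"
  using norm_orth_times(1)[of A n "un n"] by (simp add: norm_eq_sqrt_inner inner_un orthD)

section \<open>Frobenius' commutator argument\<close>

text \<open>The type has no unit element, so the zeroth power must name the size.\<close>

primrec mpow :: "nat \<Rightarrow> fmat \<Rightarrow> nat \<Rightarrow> fmat" where
  "mpow n A 0 = un n"
| "mpow n A (Suc k) = A * mpow n A k"

lemma mpow_mats [simp]: "A \<in> mats n \<Longrightarrow> mpow n A k \<in> mats n"
  by (induction k) (auto intro: mats_intros)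

lemma mpow_orth [simp]: "A \<in> orth n \<Longrightarrow> mpow n A k \<in> orth n"
  by (induction k) (auto intro: orth_times)

lemma mpow_add: "A \<in> mats n \<Longrightarrow> mpow n A (j + k) = mpow n A j * mpow n A k"
  by (induction j) (auto simp: mult.assoc)

lemma mpow_commute: "A \<in> mats n \<Longrightarrow> B \<in> mats n \<Longrightarrow> A * B = B * A \<Longrightarrow> mpow n A k * B = B * mpow n A k"
proof (induction k)
  case (Suc k)
  then have IH: "mpow n A k * B = B * mpow n A k" by blast
  have "mpow n A (Suc k) * B = A * B * mpow n A k" by (simp add: mult.assoc IH)
  also have "\<dots> = B * A * mpow n A k" by (simp only: Suc.prems(3))
  also have "\<dots> = B * mpow n A (Suc k)" by (simp add: mult.assoc)
  finally show ?case .
qed simp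

lemma mpow_mult: "A \<in> mats n \<Longrightarrow> mpow n (mpow n A j) k = mpow n A (j * k)"
  by (induction k) (auto simp: mpow_add)

text \<open>Conjugation by \<open>A\<close> sends C^j B to C^(j+1) B, so all these have the trace of
  \<open>B\<close>, and so does \<open>E * B\<close> for the average \<open>E\<close> of the powers
  of \<open>C\<close>, the projection onto the fixed vectors of \<open>C\<close>. For
  \<open>x = un n - E\<close>, vanishing of the trace of \<open>x * B\<close> says that |x|^2 equals
  minus the inner product of \<open>x * (B - un n)\<close> with \<open>x\<close>, which is at most
  |x|^2 |B - un n|. Hence \<open>x = 0\<close> and \<open>C = un n\<close>.\<close>

lemma commute_if_commutes_with_commutator:
  assumes A: "A \<in> orth n" and B: "B \<in> orth n"
    and C: "C = A * B * tr A * tr B" and AC: "A * C = C * A"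
    and m: "m > 0" "mpow n C m = un n" and small: "norm (B - un n) < 1"
  shows "A * B = B * A"
proof -
  have Co: "C \<in> orth n" unfolding C by (intro orth_times orth_tr A B)
  note M [simp] = orthD(1)[OF A] orthD(1)[OF B] orthD(1)[OF Co]
  note [simp] = mats_intros
  have CB: "C * B = A * B * tr A"
  proof -
    have "C * B = A * B * tr A * (tr B * B)" unfolding C by (simp add: mult.assoc)
    then show ?thesis using orthD(3)[OF B] by simp
  qed
  have conj: "A * (mpow n C j * B) * tr A = mpow n C (Suc j) * B" for j
  proof -
    have "A * (mpow n C j * B) * tr A = mpow n C j * (A * B * tr A)"
      using mpow_commute[of C n A j] AC by (simp add: mult.assoc[symmetric])
    also have "\<dots> = mpow n C j * (C * B)" by (simp only: CB)
    also have "\<dots> = mpow n C (Suc j) * B"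
      using mpow_commute[of C n C j] by (simp add: mult.assoc[symmetric])
    finally show ?thesis .
  qed
  have trace_conj: "(A * X * tr A) \<bullet> un n = X \<bullet> un n" if "X \<in> mats n" for X
  proof -
    have "(A * X * tr A) \<bullet> un n = X \<bullet> (tr A * (un n * A))"
      using inner_times_right[of "A * X" "tr A" "un n"] inner_times_left[of A X "un n * A"] by simp
    then show ?thesis by (simp add: orthD(3)[OF A])
  qed
  have trj: "(mpow n C j * B) \<bullet> un n = B \<bullet> un n" for j
  proof (induction j)
    case (Suc j)
    have "(mpow n C (Suc j) * B) \<bullet> un n = (A * (mpow n C j * B) * tr A) \<bullet> un n"
      by (simp only: conj)
    also have "\<dots> = (mpow n C j * B) \<bullet> un n" by (rule trace_conj) simp
    finally show ?case using Suc by simp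
  qed simp
  define E where "E = (1 / real m) *\<^sub>R (\<Sum>j<m. mpow n C j)"
  have Em [simp]: "E \<in> mats n"
  proof -
    have "(\<Sum>j\<in>J. mpow n C j) \<in> mats n" for J
      by (induction J rule: infinite_finite_induct) auto
    then show ?thesis by (simp add: E_def)
  qed
  have "(E * B) \<bullet> un n = (1 / real m) * (\<Sum>j<m. (mpow n C j * B) \<bullet> un n)"
    by (simp add: E_def sum_distrib_right inner_sum_left)
  then have EB: "(E * B) \<bullet> un n = B \<bullet> un n" using m(1) by (simp add: trj)
  have CE: "C * E = E"
  proof -
    have "C * (\<Sum>j<m. mpow n C j) = (\<Sum>j<m. mpow n C (Suc j))" by (simp add: sum_distrib_left)
    also have "\<dots> = (\<Sum>j<m. mpow n C j) - mpow n C 0 + mpow n C m"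
      using sum.lessThan_Suc_shift[of "mpow n C" m] by (simp add: algebra_simps del: mpow.simps)
    finally show ?thesis using m(2) by (simp add: E_def)
  qed
  have CTE: "tr (mpow n C j) * E = E" for j
  proof (induction j)
    case (Suc j)
    have "tr C * E = tr C * (C * E)" by (simp only: CE)
    also have "\<dots> = E" using orthD(3)[OF Co] by (simp add: mult.assoc[symmetric])
    finally have "tr C * E = E" .
    then show ?case using Suc by (simp add: mult.assoc)
  qed simp
  have trE: "tr E = (1 / real m) *\<^sub>R (\<Sum>j<m. tr (mpow n C j))"
  proof -
    have "tr (\<Sum>j\<in>J. mpow n C j) = (\<Sum>j\<in>J. tr (mpow n C j))" for J
      by (induction J rule: infinite_finite_induct) auto
    then show ?thesis by (simp add: E_def)
  qed
  \<comment> \<open>The transposed powers of \<open>C\<close> fix \<open>E\<close> from the left,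
    and averaging them yields \<open>tr E * E = E\<close>; the left side is symmetric, so
    \<open>E\<close> is symmetric too.\<close>
  have EE: "tr E * E = E"
    using m(1) by (simp add: trE sum_distrib_right CTE scaleR_sum_left[symmetric] sum_constant_scaleR)
  then have Es: "tr E = E" by (metis tr_simps(6) tr_times)
  define x where "x = un n - E"
  have xm [simp]: "x \<in> mats n" and xs: "tr x = x" by (simp_all add: x_def Es)
  have xx: "x * x = x" using EE by (simp add: x_def algebra_simps Es)
  have "0 = (x * B) \<bullet> un n" by (simp add: x_def algebra_simps inner_diff_left EB)
  also have "\<dots> = B \<bullet> x" by (simp add: inner_times_left xs)
  also have "\<dots> = un n \<bullet> x + (B - un n) \<bullet> x" by (simp add: inner_diff_left)
  also have "un n \<bullet> x = x \<bullet> x"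
    using inner_times_left[of x "un n" x] by (simp add: xs xx)
  also have "(B - un n) \<bullet> x = (x * (B - un n)) \<bullet> x"
    using inner_times_left[of x "B - un n" x] by (simp add: xs xx)
  finally have 0: "x \<bullet> x = - ((x * (B - un n)) \<bullet> x)" by simp
  have "- ((x * (B - un n)) \<bullet> x) \<le> norm (x * (B - un n)) * norm x"
    using Cauchy_Schwarz_ineq2[of "x * (B - un n)" x] by linarith
  also have "\<dots> \<le> (norm x * norm (B - un n)) * norm x"
    by (intro mult_right_mono norm_mult_ineq) auto
  finally have "x \<bullet> x \<le> norm x * norm x * norm (B - un n)"
    using 0 by (simp add: mult_ac)
  moreover have "x \<bullet> x = norm x * norm x" by (simp add: power2_norm_eq_inner[symmetric] power2_eq_square)
  ultimately have "norm x * norm x \<le> norm x * norm x * norm (B - un n)" by linarith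
  then have "norm x * norm x * (1 - norm (B - un n)) \<le> 0" by (simp add: algebra_simps)
  then have "norm x * norm x \<le> 0" using small by (simp add: mult_le_0_iff)
  then have "x = 0" by (simp add: mult_le_0_iff)
  then have "E = un n" by (simp add: x_def)
  then have "C = un n" using CE by simp
  then have "A * B * tr A = B" using CB by simp
  then have "A * B * (tr A * A) = B * A" by (simp add: mult.assoc[symmetric])
  then show ?thesis using orthD(3)[OF A] by simp
qed

text \<open>The iterated commutators \<open>b k\<close> of \<open>A\<close> with \<open>B\<close>
  approach the unit by a factor 1/2 = 2 * 1/4 at each step, so in a finite group they reach it; the
  previous lemma then undoes the steps one at a time. The bound 1 on \<open>B\<close> is the one
  that lemma asks for, and it persists along the iteration.\<close>

lemma finite_orth_near_identity_commute:
  assumes fin: "finite \<Gamma>" and \<Gamma>: "\<Gamma> \<subseteq> orth n" "un n \<in> \<Gamma>"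
    "\<And>X Y. X \<in> \<Gamma> \<Longrightarrow> Y \<in> \<Gamma> \<Longrightarrow> X * Y \<in> \<Gamma>" "\<And>X. X \<in> \<Gamma> \<Longrightarrow> tr X \<in> \<Gamma>"
    and tors: "\<And>X. X \<in> \<Gamma> \<Longrightarrow> \<exists>m>0. mpow n X m = un n"
    and A: "A \<in> \<Gamma>" "norm (A - un n) \<le> 1/4" and B: "B \<in> \<Gamma>" "norm (B - un n) < 1"
  shows "A * B = B * A"
proof -
  define c where "c X = A * X * tr A * tr X" for X
  define b where "b k = (c ^^ k) B" for k
  have b_Suc: "b (Suc k) = A * b k * tr A * tr (b k)" for k by (simp add: b_def c_def)
  have b\<Gamma>: "b k \<in> \<Gamma>" for k
  proof (induction k)
    case 0
    then show ?case by (simp add: b_def B)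
  next
    case (Suc k)
    then show ?case unfolding b_Suc by (intro \<Gamma>(3,4) A)
  qed
  have o: "b k \<in> orth n" "A \<in> orth n" for k using b\<Gamma> A \<Gamma>(1) by auto
  note [simp] = mats_intros orthD(1)[OF o(1)] orthD(1)[OF o(2)]
  have contract: "norm (b (Suc k) - un n) \<le> 1/2 * norm (b k - un n)" for k
  proof -
    let ?X = "b k"
    have "b (Suc k) - un n = (A * ?X - ?X * A) * (tr A * tr ?X)"
    proof -
      have "?X * A * (tr A * tr ?X) = ?X * (A * tr A) * tr ?X" by (simp add: mult.assoc)
      then show ?thesis using orthD(2)[OF o(2)] orthD(2)[OF o(1)]
        by (simp add: b_Suc algebra_simps)
    qed
    also have "norm \<dots> = norm (A * ?X - ?X * A)"
      by (rule norm_orth_times(2)[of _ n]) (auto intro!: orth_times orth_tr o)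
    \<comment> \<open>Replacing both factors by their differences from the unit leaves the additive
      commutator unchanged and exhibits it as bilinear in two small terms.\<close>
    also have "A * ?X - ?X * A = (A - un n) * (?X - un n) - (?X - un n) * (A - un n)"
      by (simp add: algebra_simps)
    also have "norm \<dots> \<le> norm (A - un n) * norm (?X - un n) + norm (?X - un n) * norm (A - un n)"
      by (intro order_trans[OF norm_triangle_ineq4] add_mono norm_mult_ineq)
    also have "\<dots> \<le> 1/4 * norm (?X - un n) + norm (?X - un n) * (1/4)"
      by (intro add_mono mult_right_mono mult_left_mono A(2)) auto
    finally show ?thesis by simp
  qed
  have bound: "norm (b k - un n) \<le> (1/2) ^ k * norm (B - un n)" for k
  proof (induction k)
    case (Suc k)
    then show ?case using contract[of k] by simp
  qed (simp add: b_def)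
  have lt1: "norm (b k - un n) < 1" for k
  proof -
    have "(1/2) ^ k * norm (B - un n) \<le> 1 * norm (B - un n)"
      by (intro mult_right_mono power_le_one) auto
    then show ?thesis using bound[of k] B(2) by linarith
  qed
  have "\<exists>k. b k = un n"
  proof (rule ccontr)
    assume "\<nexists>k. b k = un n"
    then have ne: "\<And>k. b k \<noteq> un n" by blast
    \<comment> \<open>\<open>\<delta>\<close> is the distance from the unit to the nearest other
      element of the finite set \<open>\<Gamma>\<close>.\<close>
    define \<delta> where "\<delta> = Min ((\<lambda>X. norm (X - un n)) ` (\<Gamma> - {un n}))"
    have N: "finite ((\<lambda>X. norm (X - un n)) ` (\<Gamma> - {un n}))" "(\<lambda>X. norm (X - un n)) ` (\<Gamma> - {un n}) \<noteq> {}"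
      using fin b\<Gamma>[of 0] ne[of 0] by auto
    have "\<delta> \<in> (\<lambda>X. norm (X - un n)) ` (\<Gamma> - {un n})" unfolding \<delta>_def by (rule Min_in[OF N])
    then have "\<delta> > 0" by auto
    then obtain k where k: "(1/2 :: real) ^ k < \<delta>" using real_arch_pow_inv[of \<delta> "1/2"] by auto
    have "\<delta> \<le> norm (b k - un n)" unfolding \<delta>_def using N(1) b\<Gamma>[of k] ne[of k] by (intro Min_le) auto
    also have "\<dots> \<le> (1/2) ^ k * 1" by (rule order_trans[OF bound mult_left_mono]) (use B(2) in auto)
    finally show False using k by simp
  qed
  then obtain k where "b k = un n" by blast
  then show ?thesis
  proof (induction k)
    case 0
    then show ?case by (simp add: b_def)
  next
    case (Suc k)
    have comm: "A * b k = b k * A"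
    proof -
      have "A * b k * tr A * tr (b k) * b k * A = A * b k * (tr A * A)"
        using orthD(3)[OF o(1)] by (simp add: mult.assoc)
      then show ?thesis using Suc.prems orthD(3)[OF o(2)] by (simp add: b_Suc)
    qed
    show ?case
    proof (cases k)
      case 0
      then show ?thesis using comm by (simp add: b_def)
    next
      case (Suc k')
      obtain m where m: "m > 0" "mpow n (b k) m = un n" using tors[OF b\<Gamma>] by blast
      \<comment> \<open>\<open>b k\<close> is itself the commutator of \<open>A\<close> and
        \<open>b k'\<close> and commutes with \<open>A\<close>, so the previous lemma applies;
        \<open>A\<close> then commutes with \<open>b k'\<close>, and \<open>b k\<close> collapses to
        the unit.\<close>
      have eq: "b k = A * b k' * tr A * tr (b k')" by (simp only: Suc b_Suc)
      have "A * b k' = b k' * A"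
        by (rule commute_if_commutes_with_commutator[OF o(2) o(1)[of k'] eq comm m lt1])
      then have "b k = b k' * (A * tr A) * tr (b k')" by (simp add: Suc b_Suc mult.assoc)
      then have "b k = un n" using orthD(2)[OF o(2)] orthD(2)[OF o(1)] by simp
      then show ?thesis by (rule Suc.IH)
    qed
  qed
qed

section \<open>Torsion groups of orthogonal matrices\<close>

lemma inner_eu: "i < n \<Longrightarrow> j < n \<Longrightarrow> eu i j \<bullet> A = ent A i j"
proof -
  assume ij: "i < n" "j < n"
  have "eu i j \<bullet> A = (\<Sum>a<n. \<Sum>b<n. if j = b then (if i = a then ent A a b else 0) else 0)"
    unfolding inner_fmat[OF mats_eu[OF ij]] by (intro sum.cong refl) auto
  also have "\<dots> = (\<Sum>a<n. if i = a then ent A a j else 0)"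
    by (intro sum.cong refl) (use ij in simp)
  finally show ?thesis using ij by simp
qed

lemma eu_sandwich:
  assumes "i < n" "P \<in> mats n" shows "eu i i * P * eu i i = ent P i i *\<^sub>R eu i i"
proof (rule fmat_eqI)
  fix a b
  note e = mats_eu[OF assms(1,1)]
  have 1: "ent (eu i i * P) a c = (if a = i then ent P i c else 0)" for c
  proof -
    have "ent (eu i i * P) a c = (\<Sum>k<n. if i = k then (if a = i then ent P k c else 0) else 0)"
      unfolding ent_times[OF e] by (intro sum.cong refl) auto
    then show ?thesis using assms(1) by simp
  qed
  have "ent (eu i i * P * eu i i) a b = (\<Sum>k<n. if i = k then (if b = i then ent (eu i i * P) a k else 0) else 0)"
    unfolding ent_times[OF mats_times[OF e assms(2)]] by (intro sum.cong refl) auto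
  then show "ent (eu i i * P * eu i i) a b = ent (ent P i i *\<^sub>R eu i i) a b"
    using assms(1) by (simp add: 1)
qed

text \<open>The trace of a projection is its rank. A nonzero diagonal entry \<open>c\<close> of
  \<open>P\<close> yields the rank one projection \<open>R\<close> below \<open>P\<close>, of trace
  1; removing it lowers the trace by 1, and the trace stays nonnegative. The floor is taken in the
  measure because integrality is known only at the end.\<close>

lemma trace_symmetric_idempotent:
  assumes "P \<in> mats n" "tr P = P" "P * P = P"
  shows "P \<bullet> un n \<in> \<nat>"
  using assms
proof (induction "nat \<lfloor>P \<bullet> un n\<rfloor>" arbitrary: P rule: less_induct)
  case (less P)
  note P = less.prems
  have nonneg: "X \<bullet> un n = X \<bullet> X" if "X \<in> mats n" "tr X = X" "X * X = X" for X
    using inner_times_right[of X X "un n"] that by simp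
  show ?case
  proof (cases "\<exists>i<n. ent P i i \<noteq> 0")
    case False
    have "P \<bullet> un n = (\<Sum>i<n. \<Sum>j<n. ent P i j * ent (un n) i j)" by (rule inner_fmat[OF P(1)])
    also have "\<dots> = 0" using False by (intro sum.neutral ballI) auto
    finally show ?thesis by simp
  next
    case True
    then obtain i where i: "i < n" "ent P i i \<noteq> 0" by blast
    note e = mats_eu[OF i(1,1)]
    have tre: "tr (eu i i) = eu i i" by (auto intro!: fmat_eqI)
    define c where "c = ent P i i"
    define R where "R = (1 / c) *\<^sub>R (P * eu i i * P)"
    have c: "c \<noteq> 0" using i by (simp add: c_def)
    have Rm: "R \<in> mats n" by (simp add: R_def mats_intros P e)
    have "P * eu i i * P * (P * eu i i * P) = P * (eu i i * (P * P) * eu i i) * P" by (simp add: mult.assoc)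
    also have "\<dots> = c *\<^sub>R (P * eu i i * P)" by (simp add: P eu_sandwich[OF i(1) P(1)] c_def)
    finally have RR: "R * R = R" using c by (simp add: R_def)
    have PR: "P * R = R" "R * P = R" using P(3) by (simp_all add: R_def mult.assoc) (simp_all add: mult.assoc[symmetric])
    have trR: "tr R = R" by (simp add: R_def tre P mult.assoc)
    have "R \<bullet> un n = (1 / c) * ((P * eu i i * P) \<bullet> un n)" by (simp add: R_def)
    also have "(P * eu i i * P) \<bullet> un n = (P * eu i i) \<bullet> (un n * P)"
      using inner_times_right[of "P * eu i i" P "un n"] P(2) by simp
    also have "\<dots> = eu i i \<bullet> (P * P)"
      using inner_times_left[of P "eu i i" P] P by simp
    also have "\<dots> = c" using inner_eu[OF i(1,1)] P by (simp add: c_def)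
    finally have R1: "R \<bullet> un n = 1" using c by simp
    have Q: "P - R \<in> mats n" "tr (P - R) = P - R" "(P - R) * (P - R) = P - R"
      by (simp_all add: mats_intros P Rm trR algebra_simps PR RR)
    have val: "(P - R) \<bullet> un n = P \<bullet> un n - 1" by (simp add: inner_diff_left R1)
    have "0 \<le> (P - R) \<bullet> un n" unfolding nonneg[OF Q] by simp
    then have "nat \<lfloor>(P - R) \<bullet> un n\<rfloor> < nat \<lfloor>P \<bullet> un n\<rfloor>" unfolding val by linarith
    from less.hyps[OF this Q] have "P \<bullet> un n - 1 \<in> \<nat>" unfolding val .
    then have "P \<bullet> un n - 1 + 1 \<in> \<nat>" by (intro Nats_add Nats_1)
    then show ?thesis by simp
  qed
qed

section \<open>Traces of torsion matrices lie in real cyclotomic fields\<close>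

definition rat_scale :: "rat \<Rightarrow> 'a::real_vector \<Rightarrow> 'a" where
  "rat_scale q x = of_rat q *\<^sub>R x"

interpretation rat_vs: vector_space rat_scale
  by standard (auto simp: rat_scale_def scaleR_add_right scaleR_add_left of_rat_add of_rat_mult)

interpretation rat_vsp: vector_space_pair rat_scale rat_scale ..

lemma rat_scale_real: "rat_scale q (x::real) = of_rat q * x"
  by (simp add: rat_scale_def)

lemma sum_periodic_shift:
  fixes f :: "int \<Rightarrow> 'a::comm_monoid_add"
  assumes per: "\<And>j. f (j mod int m) = f j" and m: "m > 0"
  shows "(\<Sum>j\<in>{0..<int m}. f (j + a)) = (\<Sum>j\<in>{0..<int m}. f j)"
proof (rule sum.reindex_bij_witness[where i="\<lambda>j. (j - a) mod int m" and j="\<lambda>j. (j + a) mod int m"])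
  fix b assume "b \<in> {0..<int m}"
  then show "((b + a) mod int m - a) mod int m = b" "((b - a) mod int m + a) mod int m = b"
    by (simp_all add: mod_diff_left_eq mod_add_left_eq)
qed (use m in \<open>auto simp: per\<close>)

lemma sum_periodic_neg:
  fixes f :: "int \<Rightarrow> 'a::comm_monoid_add"
  assumes per: "\<And>j. f (j mod int m) = f j" and m: "m > 0"
  shows "(\<Sum>j\<in>{0..<int m}. f (- j)) = (\<Sum>j\<in>{0..<int m}. f j)"
proof (rule sum.reindex_bij_witness[where i="\<lambda>j. (- j) mod int m" and j="\<lambda>j. (- j) mod int m"])
  fix b assume "b \<in> {0..<int m}"
  then show "(- ((- b) mod int m)) mod int m = b" "(- ((- b) mod int m)) mod int m = b"
    by (simp_all add: mod_minus_eq)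
qed (use m in \<open>auto simp: per\<close>)

lemma cos_2pi_periodic: "m > 0 \<Longrightarrow> cos (2 * pi * of_int (k * (j mod int m)) / real m) = cos (2 * pi * of_int (k * j) / real m)"
proof -
  assume m: "m > 0"
  have "2 * pi * of_int (k * (j mod int m)) / real m = 2 * pi * of_int (k * j) / real m + of_int (- (k * (j div int m))) * (2 * pi)"
  proof -
    have "real_of_int j = of_int (int m * (j div int m) + j mod int m)" by simp
    then have "real_of_int j = real m * of_int (j div int m) + of_int (j mod int m)"
      unfolding of_int_add of_int_mult of_int_of_nat_eq .
    then show ?thesis using m by (simp add: field_simps)
  qed
  then show ?thesis by (simp only: cos.plus_of_int[where 'a=real, unfolded of_real_eq_id id_apply])
qed

text \<open>Real part of the vanishing geometric sum of a root of unity different from 1.\<close>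

lemma sum_cos_2pi:
  assumes "m > 0" "0 < j" "j < int m"
  shows "(\<Sum>k\<in>{0..<int m}. cos (2 * pi * of_int (k * j) / real m)) = 0"
proof -
  define w where "w = cis (2 * pi * of_int j / real m)"
  have "w ^ m = cis (real m * (2 * pi * of_int j / real m))" unfolding w_def by (rule Complex.DeMoivre)
  also have "real m * (2 * pi * of_int j / real m) = 2 * pi * of_int j" using assms by simp
  also have "cis (2 * pi * of_int j) = 1" by (rule cis_multiple_2pi) simp
  finally have wm: "w ^ m = 1" .
  have w1: "w \<noteq> 1"
  proof
    assume "w = 1"
    then have "cos (2 * pi * of_int j / real m) = 1" by (simp add: w_def complex_eq_iff)
    then obtain x :: int where "2 * pi * of_int j / real m = of_int x * 2 * pi"
      using cos_one_2pi_int by auto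
    then have "real_of_int j = of_int x * real m" using assms(1) by (simp add: field_simps)
    then have "j = x * int m" by (metis of_int_eq_iff of_int_mult of_int_of_nat_eq)
    then have "int m dvd j" by simp
    then show False using assms(2,3) by (simp add: zdvd_not_zless)
  qed
  have "(\<Sum>k<m. w ^ k) = 0" using geometric_sum[OF w1, of m] wm by simp
  then have "Re (\<Sum>k<m. w ^ k) = 0" by simp
  moreover have "Re (w ^ k) = cos (2 * pi * of_int (int k * j) / real m)" for k
    unfolding w_def Complex.DeMoivre by (simp add: mult_ac)
  ultimately have "(\<Sum>k<m. cos (2 * pi * of_int (int k * j) / real m)) = 0" by simp
  moreover have "(\<Sum>k<m. cos (2 * pi * of_int (int k * j) / real m)) = (\<Sum>k\<in>{0..<int m}. cos (2 * pi * of_int (k * j) / real m))"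
    by (rule sum.reindex_bij_witness[where i=nat and j=int]) auto
  ultimately show ?thesis by simp
qed

text \<open>For positive \<open>m\<close> this is the maximal real subfield of the
  \<open>m\<close>-th cyclotomic field. Written as a rational span it is visibly finite-dimensional;
  that it is a field is the content of the lemmas on products and inverses.\<close>

definition cosfield :: "nat \<Rightarrow> real set" where
  "cosfield m = rat_vs.span (range (\<lambda>k::int. cos (2 * pi * of_int k / real m)))"

lemma cosfield_cos: "cos (2 * pi * of_int k / real m) \<in> cosfield m"
  unfolding cosfield_def by (rule rat_vs.span_base) auto

lemma cosfield_1: "1 \<in> cosfield m"
  using cosfield_cos[of 0 m] by simp

lemma cosfield_add: "x \<in> cosfield m \<Longrightarrow> y \<in> cosfield m \<Longrightarrow> x + y \<in> cosfield m"
  and cosfield_scale: "x \<in> cosfield m \<Longrightarrow> of_rat q * x \<in> cosfield m"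
  and cosfield_sum: "(\<And>i. i \<in> I \<Longrightarrow> f i \<in> cosfield m) \<Longrightarrow> sum f I \<in> cosfield m"
  using rat_vs.span_add[of x _ y] rat_vs.span_scale[of x _ q] rat_vs.span_sum[of I f]
  unfolding cosfield_def rat_scale_real by auto

lemma cosfield_induct [consumes 1, case_names 0 step]:
  assumes "x \<in> cosfield m" "P 0"
    "\<And>c (k::int) y. P y \<Longrightarrow> P (of_rat c * cos (2 * pi * of_int k / real m) + y)"
  shows "P x"
  using assms(1) unfolding cosfield_def
proof (induction rule: rat_vs.span_induct_alt)
  case base
  show ?case by (rule assms(2))
next
  case (step c x y)
  from step(1) obtain k :: int where x: "x = cos (2 * pi * of_int k / real m)" by (rule rangeE)
  show ?case unfolding x rat_scale_real by (rule assms(3)) (rule step(2))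
qed

lemma cosfield_0: "0 \<in> cosfield m"
  unfolding cosfield_def by (rule rat_vs.span_zero)

text \<open>The product-to-sum formula settles the generators; linearity in each factor does the
  rest.\<close>

lemma cosfield_mult:
  assumes "x \<in> cosfield m" "y \<in> cosfield m" shows "x * y \<in> cosfield m"
proof -
  have cc: "cos (2 * pi * of_int k / real m) * cos (2 * pi * of_int l / real m) \<in> cosfield m" for k l :: int
  proof -
    have 1: "2 * pi * of_int (k - l) / real m = 2 * pi * of_int k / real m - 2 * pi * of_int l / real m"
      and 2: "2 * pi * of_int (k + l) / real m = 2 * pi * of_int k / real m + 2 * pi * of_int l / real m"
      by (simp_all add: diff_divide_distrib add_divide_distrib right_diff_distrib distrib_left)
    have 3: "real_of_rat (1/2) = 1/2" by (simp add: of_rat_divide)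
    have "cos (2 * pi * of_int k / real m) * cos (2 * pi * of_int l / real m) =
      of_rat (1/2) * cos (2 * pi * of_int (k - l) / real m) + of_rat (1/2) * cos (2 * pi * of_int (k + l) / real m)"
      unfolding cos_times_cos 1 2 3 by (simp add: add_divide_distrib)
    then show ?thesis using cosfield_add[OF cosfield_scale cosfield_scale, OF cosfield_cos cosfield_cos] by metis
  qed
  have c: "cos (2 * pi * of_int k / real m) * y \<in> cosfield m" if "y \<in> cosfield m" for k y
    using that
  proof (induction rule: cosfield_induct)
    case (step c l y)
    have "cos (2 * pi * of_int k / real m) * (of_rat c * cos (2 * pi * of_int l / real m) + y) =
      of_rat c * (cos (2 * pi * of_int k / real m) * cos (2 * pi * of_int l / real m)) + cos (2 * pi * of_int k / real m) * y"
      by (simp only: distrib_left mult.left_commute)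
    then show ?case using cosfield_add[OF cosfield_scale[OF cc] step] by metis
  qed (simp add: cosfield_0)
  from assms(1) show ?thesis
  proof (induction rule: cosfield_induct)
    case (step q k z)
    have "(of_rat q * cos (2 * pi * of_int k / real m) + z) * y =
      of_rat q * (cos (2 * pi * of_int k / real m) * y) + z * y"
      by (simp only: distrib_right mult.assoc)
    then show ?case using cosfield_add[OF cosfield_scale[OF c[OF assms(2)]] step] by metis
  qed (simp add: cosfield_0)
qed

lemma cosfield_finite_span:
  assumes "m > 0"
  shows "\<exists>B. finite B \<and> cosfield m = rat_vs.span B"
proof -
  have "cos (2 * pi * of_int k / real m) = cos (2 * pi * of_int (k mod int m) / real m)" for k
    using cos_2pi_periodic[OF assms, of 1 k] by simp
  then have "range (\<lambda>k::int. cos (2 * pi * of_int k / real m)) = (\<lambda>k::int. cos (2 * pi * of_int k / real m)) ` {0..<int m}"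
    using assms by (auto simp: image_iff intro!: bexI[of _ "_ mod int m"])
  then show ?thesis unfolding cosfield_def
    by (intro exI[of _ "(\<lambda>k::int. cos (2 * pi * of_int k / real m)) ` {0..<int m}"]) auto
qed

lemma cosfield_mono:
  assumes "m dvd m'" "m' > 0" shows "cosfield m \<subseteq> cosfield m'"
proof -
  obtain d where d: "m' = m * d" using assms by auto
  have "cos (2 * pi * of_int k / real m) = cos (2 * pi * of_int (k * int d) / real m')" for k
    using assms d by (simp add: field_simps)
  then have "range (\<lambda>k::int. cos (2 * pi * of_int k / real m)) \<subseteq> range (\<lambda>k::int. cos (2 * pi * of_int k / real m'))"
    by blast
  then show ?thesis unfolding cosfield_def by (rule rat_vs.span_mono)
qed

text \<open>Multiplication by a nonzero \<open>x\<close> is injective on a finite-dimensional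
  rational space. It maps a basis to an independent set of full size; adjoining 1 to that set would
  exceed the dimension, so 1 lies in the image.\<close>

lemma cosfield_inverse:
  assumes x: "x \<in> cosfield m" and m: "m > 0"
  shows "inverse x \<in> cosfield m"
proof (cases "x = 0")
  case True
  then show ?thesis by (simp add: cosfield_0)
next
  case False
  obtain T where T: "finite T" "cosfield m = rat_vs.span T" using cosfield_finite_span[OF m] by blast
  obtain B where B: "B \<subseteq> T" "rat_vs.independent B" "T \<subseteq> rat_vs.span B"
    by (rule rat_vs.maximal_independent_subset)
  have spB: "cosfield m = rat_vs.span B"
    unfolding T using B by (meson rat_vs.span_mono rat_vs.span_minimal rat_vs.subspace_span subset_antisym)
  have finB: "finite B" using B T finite_subset by blast
  have lin: "Vector_Spaces.linear rat_scale rat_scale ((*) x)"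
    unfolding Vector_Spaces.linear_iff by (auto intro!: rat_vs.vector_space_axioms simp: algebra_simps rat_scale_real)
  have inj: "inj_on ((*) x) S" for S using False by (auto simp: inj_on_def)
  have ind: "rat_vs.independent ((*) x ` B)"
    by (rule rat_vsp.linear_independent_injective_image[OF lin B(2) inj])
  have sub: "(*) x ` B \<subseteq> rat_vs.span B"
    using cosfield_mult[OF x] rat_vs.span_base unfolding spB by blast
  have "1 \<in> rat_vs.span ((*) x ` B)"
  proof (rule ccontr)
    assume n: "1 \<notin> rat_vs.span ((*) x ` B)"
    then have "rat_vs.independent (insert 1 ((*) x ` B))"
      using rat_vs.independent_insertI[OF _ ind] by blast
    moreover have "insert 1 ((*) x ` B) \<subseteq> rat_vs.span B" using sub cosfield_1[of m] spB by auto
    ultimately have "card (insert 1 ((*) x ` B)) \<le> card B"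
      using rat_vs.independent_span_bound[OF finB] by blast
    moreover have "1 \<notin> (*) x ` B" using n rat_vs.span_base[of 1 "(*) x ` B"] by blast
    ultimately show False using finB by (simp add: card_image[OF inj])
  qed
  then have "1 \<in> (*) x ` rat_vs.span B"
    using rat_vsp.linear_span_image[OF lin, of B] by simp
  then obtain y where "y \<in> cosfield m" "1 = x * y" unfolding spB by auto
  then show ?thesis by (simp add: inverse_unique)
qed

lemma mats_sum: "(\<And>i. i \<in> I \<Longrightarrow> f i \<in> mats n) \<Longrightarrow> sum f I \<in> mats n"
  by (induction I rule: infinite_finite_induct) (auto intro: mats_intros)

lemma tr_sum: "tr (sum f I) = (\<Sum>i\<in>I. tr (f i))"
  by (induction I rule: infinite_finite_induct) auto

text \<open>Over the complex numbers the trace is a sum of \<open>m\<close>-th roots of unity. The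
  real substitute groups conjugate eigenvalues: \<open>x + tr x\<close> acts on the range of
  \<open>Q k\<close> as twice cos (2 pi k / m), the \<open>Q k\<close> add up to the unit, and their
  traces are natural multiples of \<open>c k\<close>.\<close>

lemma trace_torsion_in_cosfield:
  assumes x: "x \<in> orth n" and m: "m > 0" "mpow n x m = un n"
  shows "x \<bullet> un n \<in> cosfield m"
proof -
  define X where "X j = mpow n x (nat (j mod int m))" for j
  define cs where "cs k j = cos (2 * pi * of_int (k * j) / real m)" for k j
  \<comment> \<open>\<open>Q k\<close> is \<open>c k\<close> times the projection onto the
    eigenspaces of exp (2 pi i k / m) and its conjugate. The indices k and m - k give the same
    matrix, and the weight \<open>c k\<close>, which is 1/2 or 1, makes the sum over all k equal to
    the unit.\<close>
  define Q where "Q k = (1 / real m) *\<^sub>R (\<Sum>j\<in>{0..<int m}. cs k j *\<^sub>R X j)" for k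
  note xm = orthD(1)[OF x]
  have un_pow: "mpow n (un n) k = un n" for k by (induction k) auto
  have red: "mpow n x k = mpow n x (k mod m)" for k
  proof -
    have "mpow n x k = mpow n x (m * (k div m) + k mod m)" by simp
    also have "\<dots> = mpow n x (m * (k div m)) * mpow n x (k mod m)" by (rule mpow_add[OF xm])
    also have "mpow n x (m * (k div m)) = un n"
      using mpow_mult[OF xm, of m "k div m"] m(2) un_pow by simp
    finally show ?thesis using xm by simp
  qed
  have Xnat: "X (int k) = mpow n x k" for k
    unfolding X_def using red[of k] by (simp add: nat_mod_as_int)
  have Xo [simp]: "X j \<in> orth n" for j by (simp add: X_def x)
  have Xm [simp]: "X j \<in> mats n" for j using orthD(1)[OF Xo] .
  have X0: "X 0 = un n" using Xnat[of 0] by simp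
  have X1: "X 1 = x" using Xnat[of 1] xm by simp
  have Xper: "X (j mod int m) = X j" for j by (simp add: X_def)
  have Xadd: "X i * X j = X (i + j)" for i j
  proof -
    have "X i * X j = mpow n x (nat (i mod int m) + nat (j mod int m))"
      unfolding X_def by (simp add: mpow_add[OF xm])
    also have "\<dots> = X (int (nat (i mod int m) + nat (j mod int m)))" by (rule Xnat[symmetric])
    also have "int (nat (i mod int m) + nat (j mod int m)) = i mod int m + j mod int m"
      using m(1) by simp
    also have "X \<dots> = X (i + j)" using Xper[of "i mod int m + j mod int m"] Xper[of "i + j"]
      by (simp add: mod_add_eq)
    finally show ?thesis .
  qed
  have trX: "tr (X j) = X (- j)" for j
  proof -
    have "tr (X j) = tr (X j) * (X j * X (- j))" by (simp add: Xadd X0)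
    also have "\<dots> = X (- j)" using orthD(3)[OF Xo, of j] by (simp add: mult.assoc[symmetric])
    finally show ?thesis .
  qed
  have csper: "cs k (j mod int m) = cs k j" for k j
    unfolding cs_def by (rule cos_2pi_periodic[OF m(1)])
  have cs_neg: "cs k (- j) = cs k j" for k j by (simp add: cs_def)
  have Qm [simp]: "Q k \<in> mats n" for k unfolding Q_def by (intro mats_intros mats_sum Xm)
  have shift: "X a * (\<Sum>j\<in>{0..<int m}. cs k j *\<^sub>R X j) = (\<Sum>j\<in>{0..<int m}. cs k (j - a) *\<^sub>R X j)" for a k
  proof -
    have per: "cs k (j mod int m - a) *\<^sub>R X (j mod int m) = cs k (j - a) *\<^sub>R X j" for j
      using csper[of k "j mod int m - a"] csper[of k "j - a"] by (simp add: Xper mod_diff_left_eq)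
    have "X a * (\<Sum>j\<in>{0..<int m}. cs k j *\<^sub>R X j) = (\<Sum>j\<in>{0..<int m}. cs k (j + a - a) *\<^sub>R X (j + a))"
      by (simp add: sum_distrib_left Xadd add.commute)
    also have "\<dots> = (\<Sum>j\<in>{0..<int m}. cs k (j - a) *\<^sub>R X j)"
      by (rule sum_periodic_shift[of "\<lambda>j. cs k (j - a) *\<^sub>R X j"]) (use m(1) per in auto)
    finally show ?thesis .
  qed
  have XQ: "(X a + X (- a)) * Q k = (2 * cs k a) *\<^sub>R Q k" for a k
  proof -
    have "cs k (j - a) + cs k (j + a) = 2 * cs k a * cs k j" for j
    proof -
      have 1: "2 * pi * of_int (k * (j - a)) / real m = 2 * pi * of_int (k * j) / real m - 2 * pi * of_int (k * a) / real m"
        and 2: "2 * pi * of_int (k * (j + a)) / real m = 2 * pi * of_int (k * j) / real m + 2 * pi * of_int (k * a) / real m"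
        by (simp_all add: diff_divide_distrib add_divide_distrib right_diff_distrib distrib_left)
      show ?thesis unfolding cs_def 1 2 cos_add cos_diff by simp
    qed
    note c = this
    have "(X a + X (- a)) * (\<Sum>j\<in>{0..<int m}. cs k j *\<^sub>R X j) =
        (\<Sum>j\<in>{0..<int m}. (cs k (j - a) + cs k (j + a)) *\<^sub>R X j)"
      unfolding distrib_right shift by (simp add: scaleR_add_left sum.distrib)
    also have "\<dots> = (2 * cs k a) *\<^sub>R (\<Sum>j\<in>{0..<int m}. cs k j *\<^sub>R X j)"
      unfolding c by (simp add: scaleR_sum_right)
    finally show ?thesis by (simp add: Q_def)
  qed
  have neg: "(\<Sum>j\<in>{0..<int m}. cs k j *\<^sub>R X (- j)) = (\<Sum>j\<in>{0..<int m}. cs k j *\<^sub>R X j)" for k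
    using sum_periodic_neg[of "\<lambda>j. cs k j *\<^sub>R X j" m] m(1) by (simp add: csper Xper cs_neg)
  have trQ: "tr (Q k) = Q k" for k by (simp add: Q_def tr_sum trX neg)
  define c where "c k = (1 / real m) * (\<Sum>j\<in>{0..<int m}. cs k j * cs k j)" for k
  have QQ: "Q k * Q k = c k *\<^sub>R Q k" for k
  proof -
    have "2 *\<^sub>R Q k = (1 / real m) *\<^sub>R (\<Sum>j\<in>{0..<int m}. cs k j *\<^sub>R (X j + X (- j)))"
      unfolding scaleR_2 by (simp add: Q_def scaleR_add_right sum.distrib neg)
    then have "2 *\<^sub>R Q k * Q k = (1 / real m) *\<^sub>R (\<Sum>j\<in>{0..<int m}. cs k j *\<^sub>R ((X j + X (- j)) * Q k))"
      by (simp add: sum_distrib_right)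
    also have "\<dots> = (1 / real m) *\<^sub>R (\<Sum>j\<in>{0..<int m}. (2 * (cs k j * cs k j)) *\<^sub>R Q k)"
      unfolding XQ by (simp add: mult_ac)
    also have "\<dots> = (2 * c k) *\<^sub>R Q k"
      by (simp add: c_def scaleR_sum_left[symmetric] sum_distrib_left[symmetric])
    finally have "2 *\<^sub>R (Q k * Q k) = 2 *\<^sub>R (c k *\<^sub>R Q k)" by simp
    from scaleR_left_imp_eq[OF _ this] show ?thesis by simp
  qed
  have c0: "c k > 0" for k
  proof -
    have "cs k 0 * cs k 0 \<le> (\<Sum>j\<in>{0..<int m}. cs k j * cs k j)"
      by (rule member_le_sum) (use m(1) in auto)
    then show ?thesis using m(1) by (simp add: c_def cs_def)
  qed
  have csF: "cs k j \<in> cosfield m" for k j unfolding cs_def by (rule cosfield_cos)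
  have cF: "c k \<in> cosfield m" for k
    using cosfield_scale[OF cosfield_sum, of "{0..<int m}" "\<lambda>j. cs k j * cs k j" m "1 / of_nat m"]
    by (simp add: c_def of_rat_divide cosfield_mult csF)
  have QF: "Q k \<bullet> un n \<in> cosfield m" for k
  proof -
    have "(inverse (c k) *\<^sub>R Q k) \<bullet> un n \<in> \<nat>"
      by (rule trace_symmetric_idempotent) (use c0[of k] in \<open>simp_all add: mats_intros trQ QQ\<close>)
    then obtain N where "inverse (c k) * (Q k \<bullet> un n) = real N" by (auto elim: Nats_cases)
    then have "Q k \<bullet> un n = of_rat (of_nat N) * c k" using c0[of k] by (simp add: field_simps)
    then show ?thesis using cosfield_scale[OF cF[of k], of "of_nat N"] by simp
  qed
  have sumQ: "(\<Sum>k\<in>{0..<int m}. Q k) = un n"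
  proof -
    have "(\<Sum>k\<in>{0..<int m}. Q k) = (1 / real m) *\<^sub>R (\<Sum>k\<in>{0..<int m}. \<Sum>j\<in>{0..<int m}. cs k j *\<^sub>R X j)"
      by (simp add: Q_def scaleR_sum_right)
    also have "(\<Sum>k\<in>{0..<int m}. \<Sum>j\<in>{0..<int m}. cs k j *\<^sub>R X j) = (\<Sum>j\<in>{0..<int m}. (\<Sum>k\<in>{0..<int m}. cs k j) *\<^sub>R X j)"
      by (subst sum.swap) (simp add: scaleR_sum_left)
    also have "\<dots> = (\<Sum>j\<in>{0..<int m}. if j = 0 then real m *\<^sub>R X j else 0)"
      by (intro sum.cong refl) (use m(1) sum_cos_2pi in \<open>auto simp: cs_def\<close>)
    also have "\<dots> = real m *\<^sub>R un n" using m(1) by (simp add: X0)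
    finally show ?thesis using m(1) by simp
  qed
  \<comment> \<open>\<open>x\<close> and its transpose have equal trace, so doubling brings in the
    symmetric combination to which \<open>XQ\<close> applies.\<close>
  have "2 * (x \<bullet> un n) = ((X 1 + X (- 1)) * (\<Sum>k\<in>{0..<int m}. Q k)) \<bullet> un n"
    unfolding sumQ using inner_tr[of x "un n"] by (simp add: distrib_right xm inner_add_left X1 trX[of 1, symmetric])
  also have "\<dots> = (\<Sum>k\<in>{0..<int m}. 2 * cs k 1 * (Q k \<bullet> un n))"
    unfolding sum_distrib_left XQ by (simp add: inner_sum_left)
  also have "\<dots> = 2 * (\<Sum>k\<in>{0..<int m}. cs k 1 * (Q k \<bullet> un n))"
    by (simp add: sum_distrib_left mult_ac)
  finally have "x \<bullet> un n = (\<Sum>k\<in>{0..<int m}. cs k 1 * (Q k \<bullet> un n))" by simp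
  also have "\<dots> \<in> cosfield m" by (intro cosfield_sum cosfield_mult csF QF)
  finally show ?thesis .
qed

section \<open>Descent of a finitely generated torsion group to a finite-dimensional rational
  space\<close>

definition field_span :: "real set \<Rightarrow> 'a::real_vector set \<Rightarrow> 'a set" where
  "field_span F T = {x. \<exists>c. (\<forall>t\<in>T. c t \<in> F) \<and> x = (\<Sum>t\<in>T. c t *\<^sub>R t)}"

text \<open>Orthogonal projection onto a real span stays defined over the subfield generated by the
  Gram matrix. A vanishing pivot is harmless because division by zero yields zero.\<close>

lemma field_span_projection:
  fixes x :: "'a::real_inner"
  assumes T: "finite T" "\<And>s t. s \<in> T \<Longrightarrow> t \<in> T \<Longrightarrow> s \<bullet> t \<in> F" "\<And>t. t \<in> T \<Longrightarrow> x \<bullet> t \<in> F"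
    and F: "0 \<in> F" "\<And>a b. a \<in> F \<Longrightarrow> b \<in> F \<Longrightarrow> a + b \<in> F" "\<And>a b. a \<in> F \<Longrightarrow> b \<in> F \<Longrightarrow> a - b \<in> F"
      "\<And>a b. a \<in> F \<Longrightarrow> b \<in> F \<Longrightarrow> a * b \<in> F" "\<And>a. a \<in> F \<Longrightarrow> inverse a \<in> F"
  shows "\<exists>y\<in>field_span F T. \<forall>t\<in>T. (x - y) \<bullet> t = 0"
  using T
proof (induction T arbitrary: x rule: finite_induct)
  case empty
  show ?case by (intro bexI[of _ 0]) (auto simp: field_span_def)
next
  case (insert g T)
  have Fsum: "(\<And>i. i \<in> I \<Longrightarrow> f i \<in> F) \<Longrightarrow> sum f I \<in> F" for f :: "'a \<Rightarrow> real" and I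
    by (induction I rule: infinite_finite_induct) (auto intro: F)
  have span_inner: "y \<bullet> z \<in> F" if "y \<in> field_span F T" "\<And>t. t \<in> T \<Longrightarrow> t \<bullet> z \<in> F" for y z
    using that by (auto simp: field_span_def inner_sum_left intro!: Fsum F(4))
  have ortho: "v \<bullet> y = 0" if "y \<in> field_span F T" "\<forall>t\<in>T. v \<bullet> t = 0" for v y
    using that by (auto simp: field_span_def inner_sum_right)
  obtain yx where yx: "yx \<in> field_span F T" "\<forall>t\<in>T. (x - yx) \<bullet> t = 0"
    using insert.IH[of x] insert.prems by auto
  obtain yg where yg: "yg \<in> field_span F T" "\<forall>t\<in>T. (g - yg) \<bullet> t = 0"
    using insert.IH[of g] insert.prems by auto
  \<comment> \<open>Gram-Schmidt: \<open>g'\<close> is the part of \<open>g\<close> orthogonal to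
    \<open>T\<close>, and \<open>a\<close> is the coefficient of \<open>x\<close> along it.\<close>
  define g' where "g' = g - yg"
  define a where "a = ((x - yx) \<bullet> g') / (g' \<bullet> g')"
  have 1: "(x - yx) \<bullet> g' \<in> F"
  proof -
    have "(x - yx) \<bullet> g' = (x - yx) \<bullet> g - (x - yx) \<bullet> yg" by (simp add: g'_def inner_diff_right)
    also have "\<dots> = x \<bullet> g - yx \<bullet> g" using ortho[OF yg(1) yx(2)] by (simp add: inner_diff_left)
    finally show ?thesis using insert.prems span_inner[OF yx(1), of g] by (auto intro!: F(3))
  qed
  have 2: "g' \<bullet> g' \<in> F"
  proof -
    have "g' \<bullet> g' = g' \<bullet> g - g' \<bullet> yg" by (simp add: g'_def inner_diff_right)
    also have "\<dots> = g \<bullet> g - yg \<bullet> g" using ortho[OF yg] by (simp add: g'_def inner_diff_left)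
    finally show ?thesis using insert.prems span_inner[OF yg(1), of g] by (auto intro!: F(3))
  qed
  have aF: "a \<in> F" unfolding a_def divide_inverse by (intro F(4,5) 1 2)
  obtain cx cg where c: "\<forall>t\<in>T. cx t \<in> F" "yx = (\<Sum>t\<in>T. cx t *\<^sub>R t)" "\<forall>t\<in>T. cg t \<in> F" "yg = (\<Sum>t\<in>T. cg t *\<^sub>R t)"
    using yx(1) yg(1) by (auto simp: field_span_def)
  show ?case
  proof (intro bexI[of _ "yx + a *\<^sub>R g'"] ballI)
    have "yx + a *\<^sub>R g' = a *\<^sub>R g + (\<Sum>t\<in>T. (cx t - a * cg t) *\<^sub>R t)"
      by (simp add: g'_def c scaleR_diff_right scaleR_diff_left sum_subtractf scaleR_sum_right)
    also have "\<dots> = (\<Sum>t\<in>insert g T. (if t = g then a else cx t - a * cg t) *\<^sub>R t)"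
      using insert.hyps by (simp, intro sum.cong refl) auto
    finally show "yx + a *\<^sub>R g' \<in> field_span F (insert g T)"
      unfolding field_span_def using aF c
      by (auto intro!: exI[of _ "\<lambda>t. if t = g then a else cx t - a * cg t"] F(3,4))
  next
    fix t assume t: "t \<in> insert g T"
    have T0: "(x - (yx + a *\<^sub>R g')) \<bullet> t = 0" if "t \<in> T" for t
      using yx(2) yg(2) that by (simp add: g'_def algebra_simps inner_add_left inner_diff_left)
    show "(x - (yx + a *\<^sub>R g')) \<bullet> t = 0"
    proof (cases "t = g")
      case True
      have "(x - (yx + a *\<^sub>R g')) \<bullet> g = (x - (yx + a *\<^sub>R g')) \<bullet> g' + (x - (yx + a *\<^sub>R g')) \<bullet> yg"
        by (simp add: g'_def inner_diff_right)
      also have "(x - (yx + a *\<^sub>R g')) \<bullet> yg = 0" using T0 by (intro ortho[OF yg(1)]) auto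
      also have "(x - (yx + a *\<^sub>R g')) \<bullet> g' = (x - yx) \<bullet> g' - a * (g' \<bullet> g')"
        by (simp add: algebra_simps inner_add_left inner_diff_left)
      also have "\<dots> = 0" by (cases "g' = 0") (auto simp: a_def)
      finally show ?thesis using True by simp
    next
      case False
      then show ?thesis using T0 t by simp
    qed
  qed
qed

text \<open>Words in \<open>S\<close>. For orthogonal \<open>S\<close> closed under
  \<open>tr\<close> this is the generated subgroup, because \<open>tr\<close> is inversion
  there.\<close>

inductive_set gen :: "nat \<Rightarrow> fmat set \<Rightarrow> fmat set" for n S where
  gen_un: "un n \<in> gen n S"
| gen_step: "x \<in> gen n S \<Longrightarrow> s \<in> S \<Longrightarrow> x * s \<in> gen n S"

lemma gen_orth: "S \<subseteq> orth n \<Longrightarrow> gen n S \<subseteq> orth n"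
proof
  fix x assume S: "S \<subseteq> orth n" and "x \<in> gen n S"
  from this(2) show "x \<in> orth n" by induction (use S in \<open>auto intro: orth_times\<close>)
qed

lemma gen_base: "S \<subseteq> orth n \<Longrightarrow> s \<in> S \<Longrightarrow> s \<in> gen n S"
  using gen_step[OF gen_un, of s S n] orthD(1)[of s n] by auto

lemma gen_mult:
  assumes S: "S \<subseteq> orth n" and x: "x \<in> gen n S" and y: "y \<in> gen n S"
  shows "x * y \<in> gen n S"
  using y
proof induction
  case gen_un
  then show ?case using x gen_orth[OF S] orthD(1)[of x n] by auto
next
  case (gen_step y s)
  then show ?case using gen.gen_step[of "x * y" n S s] by (simp add: mult.assoc)
qed

lemma gen_tr:
  assumes S: "S \<subseteq> orth n" "tr ` S \<subseteq> S" and x: "x \<in> gen n S"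
  shows "tr x \<in> gen n S"
  using x
proof induction
  case gen_un
  then show ?case by (simp add: gen.gen_un)
next
  case (gen_step y s)
  then show ?case using gen_mult[OF S(1) gen_base[OF S(1)], of "tr s" "tr y"] S(2) by auto
qed

text \<open>The group contains a finite set \<open>T\<close> spanning it over the reals. Inner
  products of group elements are traces of group elements, hence cyclotomic, and an element whose
  inner products with \<open>T\<close> lie in \<open>F\<close> has coefficients in \<open>F\<close>.
  The group thus lies in the \<open>F\<close>-span of \<open>T\<close>, which is finite-dimensional
  over the rationals.\<close>

lemma torsion_gen_rational_span:
  assumes S: "finite S" "S \<subseteq> orth n" "tr ` S \<subseteq> S"
    and tors: "\<And>x. x \<in> gen n S \<Longrightarrow> \<exists>m>0. mpow n x m = un n"
  shows "\<exists>W. finite W \<and> gen n S \<subseteq> rat_vs.span W"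
proof -
  let ?G = "gen n S"
  note Go = gen_orth[OF S(2)]
  have Gm: "x \<in> mats n" if "x \<in> ?G" for x using Go that orthD(1) by blast
  obtain T0 where T0: "T0 \<subseteq> ?G" "independent T0" "?G \<subseteq> span T0"
    by (rule maximal_independent_subset)
  have "T0 \<subseteq> span ((\<lambda>(i, j). eu i j) ` ({..<n} \<times> {..<n}))"
    using T0(1) Gm mats_subset_span[of n] by blast
  from independent_span_bound[OF _ T0(2) this] have "finite T0" by simp
  \<comment> \<open>The unit is added as the starting word of the later induction. \<open>T\<close>
    may become dependent, which the projection lemma tolerates.\<close>
  define T where "T = insert (un n) T0"
  have T: "finite T" "T \<subseteq> ?G" "?G \<subseteq> span T" "un n \<in> T"
  proof -
    show "finite T" "T \<subseteq> ?G" "un n \<in> T" using T0(1) \<open>finite T0\<close> by (auto simp: T_def gen_un)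
    have "span T0 \<subseteq> span T" by (rule span_mono) (auto simp: T_def)
    then show "?G \<subseteq> span T" using T0(3) by (rule order_trans[rotated])
  qed
  obtain ord where ord: "\<And>x. x \<in> ?G \<Longrightarrow> ord x > 0 \<and> mpow n x (ord x) = un n"
    using tors by metis
  \<comment> \<open>No exponent common to the whole group is known, so \<open>F\<close> is fixed for
    finitely many traces only: those of the Gram products of \<open>T\<close> and of the one-letter
    extensions of its elements. Induction on words reaches the rest.\<close>
  define D where "D = (\<lambda>(s, t). s * tr t) ` (T \<times> T) \<union> (\<lambda>(s, g, t). s * g * tr t) ` (T \<times> S \<times> T)"
  have "s * tr t \<in> ?G" if "s \<in> ?G" "t \<in> T" for s t
    by (rule gen_mult[OF S(2) that(1)], rule gen_tr[OF S(2,3)]) (use that(2) T(2) in blast)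
  moreover have "s * g \<in> ?G" if "s \<in> T" "g \<in> S" for s g
    by (rule gen_step[OF _ that(2)]) (use that(1) T(2) in blast)
  ultimately have D: "finite D" "D \<subseteq> ?G"
    using T(1,2) S(1) by (auto simp: D_def)
  define M where "M = prod ord D"
  have M0: "M > 0" unfolding M_def using ord D(2) by (intro prod_pos) auto
  define F where "F = cosfield M"
  have trD: "d \<bullet> un n \<in> F" if "d \<in> D" for d
  proof -
    have "d \<in> ?G" using that D by blast
    then have "d \<bullet> un n \<in> cosfield (ord d)"
      using trace_torsion_in_cosfield[of d n "ord d"] Go ord by auto
    moreover have "ord d dvd M" unfolding M_def using that D(1) by (rule dvd_prodI[rotated])
    ultimately show ?thesis using cosfield_mono M0 by (auto simp: F_def)
  qed
  have inner_trace: "x \<bullet> t = (x * tr t) \<bullet> un n" if "t \<in> mats n" for x t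
    using inner_times_right[of x "tr t" "un n"] that by simp
  have neg: "- a \<in> F" if "a \<in> F" for a
    using cosfield_scale[OF that[unfolded F_def], of "-1"] by (simp add: F_def of_rat_minus)
  have F: "0 \<in> F" "\<And>a b. a \<in> F \<Longrightarrow> b \<in> F \<Longrightarrow> a + b \<in> F" "\<And>a b. a \<in> F \<Longrightarrow> b \<in> F \<Longrightarrow> a - b \<in> F"
    "\<And>a b. a \<in> F \<Longrightarrow> b \<in> F \<Longrightarrow> a * b \<in> F" "\<And>a. a \<in> F \<Longrightarrow> inverse a \<in> F" "1 \<in> F"
  proof -
    show "0 \<in> F" using cosfield_scale[OF cosfield_1, of 0] by (simp add: F_def)
    show "\<And>a b. a \<in> F \<Longrightarrow> b \<in> F \<Longrightarrow> a + b \<in> F" by (simp add: F_def cosfield_add)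
    then show "a - b \<in> F" if "a \<in> F" "b \<in> F" for a b using that neg[of b] by (metis diff_conv_add_uminus)
    show "\<And>a b. a \<in> F \<Longrightarrow> b \<in> F \<Longrightarrow> a * b \<in> F" by (simp add: F_def cosfield_mult)
    show "\<And>a. a \<in> F \<Longrightarrow> inverse a \<in> F" using M0 by (simp add: F_def cosfield_inverse)
    show "1 \<in> F" by (simp add: F_def cosfield_1)
  qed
  have Tinner: "s \<bullet> t \<in> F" if "s \<in> T" "t \<in> T" for s t
    using inner_trace[of t s] trD[of "s * tr t"] that T(2) Gm by (force simp: D_def)
  have key: "x \<in> field_span F T" if x: "x \<in> ?G" "\<And>t. t \<in> T \<Longrightarrow> x \<bullet> t \<in> F" for x
  proof -
    obtain y where y: "y \<in> field_span F T" "\<forall>t\<in>T. (x - y) \<bullet> t = 0"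
      using field_span_projection[OF T(1) Tinner x(2) F(1-5)] by blast
    have "y \<in> span T" using y(1) by (auto simp: field_span_def intro: span_sum span_scale span_base)
    then have xy: "x - y \<in> span T" using x(1) T(3) by (intro span_diff) auto
    \<comment> \<open>The residual lies in the real span of \<open>T\<close> and is orthogonal to
      it, so it vanishes.\<close>
    have "(x - y) \<bullet> z = 0" if "z \<in> span T" for z
      using that by (induction rule: span_induct_alt) (use y(2) in \<open>auto simp: inner_add_right\<close>)
    from this[OF xy] have "x = y" by simp
    then show ?thesis using y(1) by simp
  qed
  have step: "t * g \<in> field_span F T" if "t \<in> T" "g \<in> S" for t g
  proof (rule key)
    show "t * g \<in> ?G" using that T(2) by (auto intro: gen_step)
    show "(t * g) \<bullet> u \<in> F" if "u \<in> T" for u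
      using inner_trace[of u "t * g"] trD[of "t * g * tr u"] that \<open>t \<in> T\<close> \<open>g \<in> S\<close> T(2) Gm
      by (force simp: D_def)
  qed
  have fs_add: "x + y \<in> field_span F T" if xy: "x \<in> field_span F T" "y \<in> field_span F T" for x y
  proof -
    obtain a b where "\<forall>t\<in>T. a t \<in> F" "x = (\<Sum>t\<in>T. a t *\<^sub>R t)" "\<forall>t\<in>T. b t \<in> F" "y = (\<Sum>t\<in>T. b t *\<^sub>R t)"
      using xy by (auto simp: field_span_def)
    then show ?thesis unfolding field_span_def
      by (auto intro!: exI[of _ "\<lambda>t. a t + b t"] F(2) simp: scaleR_add_left sum.distrib)
  qed
  have fs_scale: "a *\<^sub>R x \<in> field_span F T" if xa: "x \<in> field_span F T" "a \<in> F" for x a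
  proof -
    obtain b where "\<forall>t\<in>T. b t \<in> F" "x = (\<Sum>t\<in>T. b t *\<^sub>R t)"
      using xa by (auto simp: field_span_def)
    then show ?thesis unfolding field_span_def using xa(2)
      by (auto intro!: exI[of _ "\<lambda>t. a * b t"] F(4) simp: scaleR_sum_right)
  qed
  have fs_0: "0 \<in> field_span F T" by (auto simp: field_span_def F(1) intro!: exI[of _ "\<lambda>_. 0"])
  have fs_sum: "(\<And>i. i \<in> I \<Longrightarrow> f i \<in> field_span F T) \<Longrightarrow> sum f I \<in> field_span F T" for f :: "fmat \<Rightarrow> fmat" and I
    by (induction I rule: infinite_finite_induct) (auto intro: fs_0 fs_add)
  have "x \<in> field_span F T" if "x \<in> ?G" for x
    using that
  proof induction
    case gen_un
    show ?case
    proof (rule key)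
      show "un n \<bullet> t \<in> F" if "t \<in> T" for t using Tinner[OF T(4) that] .
    qed (rule gen.gen_un)
  next
    case (gen_step x g)
    then obtain b where b: "\<forall>t\<in>T. b t \<in> F" "x = (\<Sum>t\<in>T. b t *\<^sub>R t)" by (auto simp: field_span_def)
    have "x * g = (\<Sum>t\<in>T. b t *\<^sub>R (t * g))" by (simp add: b(2) sum_distrib_right)
    also have "\<dots> \<in> field_span F T" using b(1) gen_step.hyps by (intro fs_sum fs_scale step) auto
    finally show ?case .
  qed
  moreover obtain B where B: "finite B" "F = rat_vs.span B"
    using cosfield_finite_span[OF M0] by (auto simp: F_def)
  have "field_span F T \<subseteq> rat_vs.span ((\<lambda>(b, t). b *\<^sub>R t) ` (B \<times> T))"
  proof -
    have "a *\<^sub>R t \<in> rat_vs.span ((\<lambda>(b, t). b *\<^sub>R t) ` (B \<times> T))" if "a \<in> rat_vs.span B" "t \<in> T" for a t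
      using that(1)
    proof (induction rule: rat_vs.span_induct_alt)
      case base
      show ?case by (simp add: rat_vs.span_zero)
    next
      case (step c x y)
      have "(rat_scale c x + y) *\<^sub>R t = rat_scale c (x *\<^sub>R t) + y *\<^sub>R t"
        by (simp add: rat_scale_def scaleR_add_left)
      also have "\<dots> \<in> rat_vs.span ((\<lambda>(b, t). b *\<^sub>R t) ` (B \<times> T))"
        using step that(2) by (intro rat_vs.span_add rat_vs.span_scale) (auto intro!: rat_vs.span_base)
      finally show ?case .
    qed
    then show ?thesis unfolding field_span_def B(2) by (auto intro!: rat_vs.span_sum)
  qed
  ultimately show ?thesis using B(1) T(1)
    by (intro exI[of _ "(\<lambda>(b, t). b *\<^sub>R t) ` (B \<times> T)"]) auto
qed

section \<open>The localization of the integers at a prime\<close>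

definition pint :: "nat \<Rightarrow> rat \<Rightarrow> bool" where
  "pint p q \<longleftrightarrow> (\<exists>a b::int. \<not> int p dvd b \<and> q = of_int a / of_int b)"

lemma pint_of_int: "p > 1 \<Longrightarrow> pint p (of_int a)"
  unfolding pint_def by (rule exI[of _ a], rule exI[of _ 1]) auto

lemma pint_add:
  assumes "prime p" "pint p x" "pint p y" shows "pint p (x + y)"
proof -
  obtain a b c d :: int where *: "\<not> int p dvd b" "x = of_int a / of_int b" "\<not> int p dvd d" "y = of_int c / of_int d"
    using assms(2,3) unfolding pint_def by blast
  then have "b \<noteq> 0" "d \<noteq> 0" by auto
  then have "x + y = of_int (a * d + c * b) / of_int (b * d)"
    using * by (simp add: field_simps)
  moreover have "\<not> int p dvd b * d" using * assms(1) by (simp add: prime_dvd_mult_iff)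
  ultimately show ?thesis unfolding pint_def by blast
qed

lemma pint_mult:
  assumes "prime p" "pint p x" "pint p y" shows "pint p (x * y)"
proof -
  obtain a b c d :: int where *: "\<not> int p dvd b" "x = of_int a / of_int b" "\<not> int p dvd d" "y = of_int c / of_int d"
    using assms(2,3) unfolding pint_def by blast
  then have "x * y = of_int (a * c) / of_int (b * d)" by simp
  moreover have "\<not> int p dvd b * d" using * assms(1) by (simp add: prime_dvd_mult_iff)
  ultimately show ?thesis unfolding pint_def by blast
qed

text \<open>Bezout inverts the denominator modulo \<open>p\<close>, so the residues are represented
  by the naturals below \<open>p\<close>.\<close>

lemma pint_residue:
  assumes "prime p" "pint p x"
  shows "\<exists>r<p. \<exists>y. pint p y \<and> x - of_nat r = of_nat p * y"
proof -
  obtain a b :: int where *: "\<not> int p dvd b" "x = of_int a / of_int b"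
    using assms(2) unfolding pint_def by blast
  have "coprime (int p) b" using * assms(1) by (simp add: prime_imp_coprime)
  then obtain u v where uv: "u * int p + v * b = 1"
    using bezout_int[of "int p" b] by auto
  define r where "r = (a * v) mod int p"
  have "int p dvd a - r * b"
  proof -
    have "int p dvd a * v - r" unfolding r_def by (rule dvd_minus_mod)
    then have "int p dvd (a * v - r) * b + a * u * int p" by simp
    also have "(a * v - r) * b + a * u * int p = a * (u * int p + v * b) - r * b" by (simp add: algebra_simps)
    finally show ?thesis using uv by simp
  qed
  then obtain t where t: "a - r * b = int p * t" by blast
  have "0 \<le> r" "r < int p" using assms(1) by (simp_all add: r_def prime_gt_0_nat)
  moreover have "x - of_int r = of_nat p * (of_int t / of_int b)"
  proof -
    have "b \<noteq> 0" using * by auto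
    have "of_int a - of_int r * of_int b = (of_nat p * of_int t :: rat)"
      using arg_cong[OF t, of "of_int :: int \<Rightarrow> rat"] by simp
    then show ?thesis using \<open>b \<noteq> 0\<close> * by (simp add: field_simps)
  qed
  moreover have "pint p (of_int t / of_int b)" unfolding pint_def using * by blast
  ultimately show ?thesis
    by (intro exI[of _ "nat r"] conjI exI[of _ "of_int t / of_int b"]) (auto simp: nat_less_iff)
qed

lemma pint_infinitely_divisible:
  assumes "prime p" "\<And>k. \<exists>y. pint p y \<and> x = of_nat (p ^ k) * y"
  shows "x = 0"
proof (rule ccontr)
  assume "x \<noteq> 0"
  obtain a b :: int where ab: "b > 0" "x = of_int a / of_int b"
    by (metis Fract_of_int_quotient Rat_cases)
  with \<open>x \<noteq> 0\<close> have "a \<noteq> 0" by auto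
  \<comment> \<open>p^k exceeds k, so with k the absolute value of \<open>a\<close> it cannot divide
    the nonzero integer \<open>a\<close>.\<close>
  define k where "k = nat \<bar>a\<bar>"
  obtain y where y: "pint p y" "x = of_nat (p ^ k) * y" using assms(2) by blast
  obtain c d :: int where cd: "\<not> int p dvd d" "y = of_int c / of_int d" using y(1) unfolding pint_def by blast
  have "d \<noteq> 0" using cd by auto
  have "of_int (a * d) = (of_int (int (p ^ k) * c * b) :: rat)"
    using y(2) ab cd \<open>d \<noteq> 0\<close> by (simp add: field_simps)
  then have "a * d = int (p ^ k) * (c * b)" by (simp only: of_int_eq_iff mult.assoc)
  then have "int p ^ k dvd a * d" by simp
  moreover have "coprime (int p ^ k) d"
    using cd(1) assms(1) by (simp add: prime_imp_coprime)
  ultimately have "int p ^ k dvd a" by (simp add: coprime_dvd_mult_left_iff)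
  then have "\<bar>int p ^ k\<bar> \<le> \<bar>a\<bar>" using \<open>a \<noteq> 0\<close> by (intro dvd_imp_le_int)
  then have "int (p ^ k) \<le> \<bar>a\<bar>" by simp
  moreover have "int k < int (p ^ k)"
    using power_gt_expt[of p k] prime_gt_1_nat[OF assms(1)] by simp
  ultimately show False unfolding k_def by simp
qed

lemma obtain_pint_prime:
  assumes "finite Q"
  obtains p :: nat where "prime p" "p > 2" "\<And>q. q \<in> Q \<Longrightarrow> pint p q"
proof -
  have "\<exists>b::int. b > 0 \<and> (\<exists>a::int. q = of_int a / of_int b)" for q :: rat
    by (metis Fract_of_int_quotient Rat_cases)
  then obtain d where d: "\<And>q::rat. d q > (0::int)" "\<And>q. \<exists>a::int. q = of_int a / of_int (d q)" by metis
  \<comment> \<open>A prime above all denominators divides none of them; the inserted 2 makes it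
    odd.\<close>
  obtain p where p: "prime p" "p > nat (Max (insert 2 (d ` Q)))" using bigger_prime by blast
  have gt: "x < int p" if "x \<in> insert 2 (d ` Q)" for x
  proof -
    have "x \<le> Max (insert 2 (d ` Q))" using that assms by (intro Max_ge) auto
    then show ?thesis using p(2) by linarith
  qed
  have "pint p q" if "q \<in> Q" for q
  proof -
    have "\<not> int p dvd d q" using d(1)[of q] gt[of "d q"] that zdvd_not_zless by auto
    then show ?thesis unfolding pint_def using d(2)[of q] by blast
  qed
  moreover have "p > 2" using gt[of 2] by simp
  ultimately show ?thesis using that p(1) by blast
qed

text \<open>A lattice \<open>R\<close> with coefficients integral at an odd prime \<open>p\<close>: nontrivial elements of the group
  congruent to the unit modulo \<open>p\<close> have infinite order (Minkowski).\<close>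

locale p_lattice =
  fixes n p :: nat and R \<Gamma> :: "fmat set"
  assumes p: "prime p" "p > 2"
    and Rmats: "R \<subseteq> mats n" and \<Gamma>R: "\<Gamma> \<subseteq> R"
    and un\<Gamma>: "un n \<in> \<Gamma>" and mult\<Gamma>: "\<And>x y. x \<in> \<Gamma> \<Longrightarrow> y \<in> \<Gamma> \<Longrightarrow> x * y \<in> \<Gamma>"
    and Radd: "\<And>x y. x \<in> R \<Longrightarrow> y \<in> R \<Longrightarrow> x + y \<in> R"
    and Rmult: "\<And>x y. x \<in> R \<Longrightarrow> y \<in> R \<Longrightarrow> x * y \<in> R"
    and Rint: "\<And>x (k::int). x \<in> R \<Longrightarrow> of_int k *\<^sub>R x \<in> R"
    and Rdiv: "\<And>x (k::nat) y. x \<in> R \<Longrightarrow> \<not> p dvd k \<Longrightarrow> real k *\<^sub>R y = real p *\<^sub>R x \<Longrightarrow> \<exists>u\<in>R. y = real p *\<^sub>R u"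
    and Rsep: "\<And>x. (\<And>k. \<exists>u\<in>R. x = real (p ^ k) *\<^sub>R u) \<Longrightarrow> x = 0"
begin

lemma Rnat: "x \<in> R \<Longrightarrow> real k *\<^sub>R x \<in> R"
  using Rint[of x "int k"] by simp

lemma Rminus: "x \<in> R \<Longrightarrow> - x \<in> R"
  using Rint[of x "-1"] by simp

lemma R0: "0 \<in> R"
  using Rint[of "un n" 0] un\<Gamma> \<Gamma>R by auto

text \<open>Let \<open>z - un n\<close> be \<open>P\<close> times \<open>w\<close>, with
  \<open>P\<close> the largest possible power of \<open>p\<close>. From z^l = 1 the sum
  \<open>s\<close> of the first \<open>l\<close> powers of \<open>z\<close> satisfies
  \<open>w * s = 0\<close>, and modulo P^2 this sum is l + (l (l - 1) / 2) P w. If \<open>l\<close>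
  differs from \<open>p\<close>, it follows that l w is divisible by \<open>p\<close>, hence so is
  \<open>w\<close>. If \<open>l = p\<close>, oddness of \<open>p\<close> makes the middle
  coefficient divisible by \<open>p\<close>, and dividing the relation by \<open>p\<close> again
  shows \<open>w\<close> divisible by \<open>p\<close>. Both contradict maximality.\<close>

lemma prime_order_trivial:
  assumes z: "z \<in> \<Gamma>" "z - un n = real p *\<^sub>R w0" "w0 \<in> R" and l: "prime l" "mpow n z l = un n"
  shows "z = un n"
proof (rule ccontr)
  assume "z \<noteq> un n"
  define v where "v = z - un n"
  have "v \<noteq> 0" using \<open>z \<noteq> un n\<close> by (simp add: v_def)
  then have ex: "\<exists>k. \<not> (\<exists>u\<in>R. v = real (p ^ k) *\<^sub>R u)" using Rsep[of v] by blast
  \<comment> \<open>\<open>K\<close> is the first exponent for which p^K does not divide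
    \<open>v\<close> in \<open>R\<close>. The congruence of \<open>z\<close> with the unit forces it
    to be at least 2, so the maximal exponent \<open>k\<close> is at least 1.\<close>
  define K where "K = (LEAST k. \<not> (\<exists>u\<in>R. v = real (p ^ k) *\<^sub>R u))"
  have K: "\<not> (\<exists>u\<in>R. v = real (p ^ K) *\<^sub>R u)" unfolding K_def by (rule LeastI_ex[OF ex])
  have below: "\<exists>u\<in>R. v = real (p ^ k) *\<^sub>R u" if "k < K" for k
    using not_less_Least[of k "\<lambda>k. \<not> (\<exists>u\<in>R. v = real (p ^ k) *\<^sub>R u)"] that K_def by blast
  have zR: "z \<in> R" "un n \<in> R" using z(1) un\<Gamma> \<Gamma>R by auto
  have vR: "v \<in> R" unfolding v_def using Radd[OF zR(1) Rminus[OF zR(2)]] by simp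
  have "K \<noteq> 0" using K vR by (metis One_nat_def of_nat_1 power_0 scaleR_one)
  moreover have "K \<noteq> 1" using K z(2,3) by (auto simp: v_def)
  ultimately obtain k where k: "K = Suc k" "k \<ge> 1" by (cases K) auto
  obtain w where w: "w \<in> R" "v = real (p ^ k) *\<^sub>R w" using below[of k] k by auto
  have nw: "\<not> (\<exists>u\<in>R. w = real p *\<^sub>R u)"
    using K w(2) k(1) by (auto simp: mult.commute)
  have [simp]: "z \<in> mats n" "w \<in> mats n" "v \<in> mats n" using zR w vR Rmats by auto
  note [simp] = mats_intros
  define P where "P = real (p ^ k)"
  have P0: "P \<noteq> 0" using p by (simp add: P_def prime_gt_0_nat)
  have z_eq: "z = un n + P *\<^sub>R w" using w(2) by (simp add: v_def P_def algebra_simps)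
  have Pint: "P = of_int (int (p ^ k))" by (simp add: P_def)
  have RP: "P *\<^sub>R x \<in> R" if "x \<in> R" for x unfolding Pint by (rule Rint[OF that])
  have zpow: "\<exists>r\<in>R. mpow n z j = un n + (real j * P) *\<^sub>R w + (P * P) *\<^sub>R r" for j
  proof (induction j)
    case 0
    show ?case by (rule bexI[of _ 0]) (auto simp: R0)
  next
    case (Suc j)
    then obtain r where r: "r \<in> R" "mpow n z j = un n + (real j * P) *\<^sub>R w + (P * P) *\<^sub>R r" by blast
    have [simp]: "r \<in> mats n" using r Rmats by auto
    have "mpow n z (Suc j) = (un n + P *\<^sub>R w) * (un n + (real j * P) *\<^sub>R w) + (P * P) *\<^sub>R (z * r)"
      unfolding mpow.simps r(2) using z_eq by (simp add: distrib_left)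
    also have "\<dots> = un n + (real (Suc j) * P) *\<^sub>R w + (P * P) *\<^sub>R (real j *\<^sub>R (w * w) + z * r)"
      by (simp add: algebra_simps)
    finally show ?case using Radd[OF Rnat[OF Rmult[OF w(1) w(1)]] Rmult[OF zR(1) r(1)]] by blast
  qed
  then obtain r where r: "\<And>j. r j \<in> R" "\<And>j. mpow n z j = un n + (real j * P) *\<^sub>R w + (P * P) *\<^sub>R r j" by metis
  define s where "s = (\<Sum>j<l. mpow n z j)"
  define g where "g = (\<Sum>j<l. j)"
  define q where "q = (\<Sum>j<l. r j)"
  have qR: "q \<in> R"
  proof -
    have "sum r J \<in> R" for J by (induction J rule: infinite_finite_induct) (auto intro: R0 Radd r)
    then show ?thesis by (simp add: q_def)
  qed
  have [simp]: "q \<in> mats n" using qR Rmats by auto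
  have s_eq: "s = real l *\<^sub>R un n + (real g * P) *\<^sub>R w + (P * P) *\<^sub>R q"
    unfolding s_def r(2) g_def q_def
    by (simp add: sum.distrib scaleR_sum_left[symmetric] scaleR_sum_right[symmetric] sum_distrib_right[symmetric]
        sum_constant_scaleR del: mpow.simps)
  have sm [simp]: "s \<in> mats n" unfolding s_eq by simp
  have "z * s = (\<Sum>j<l. mpow n z (Suc j))" by (simp add: s_def sum_distrib_left)
  also have "\<dots> = s" using sum.lessThan_Suc_shift[of "mpow n z" l] l(2)
    by (simp add: s_def algebra_simps del: mpow.simps(2))
  finally have "(P *\<^sub>R w) * s = 0" unfolding z_eq by (simp add: distrib_right)
  then have "w * s = 0" using P0 by simp
  then have eq0: "real l *\<^sub>R w + (real g * P) *\<^sub>R (w * w) + (P * P) *\<^sub>R (w * q) = 0"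
    unfolding s_eq by (simp add: distrib_left)
  define P' where "P' = real (p ^ (k - 1))"
  have PP': "P = real p * P'" using k(2) by (cases k) (auto simp: P_def P'_def)
  have RP': "P' *\<^sub>R x \<in> R" if "x \<in> R" for x unfolding P'_def by (rule Rnat[OF that])
  show False
  proof (cases "l = p")
    case False
    have "\<not> p dvd l" using False l(1) p(1) primes_dvd_imp_eq by blast
    moreover have "real l *\<^sub>R w = real p *\<^sub>R (- (P' *\<^sub>R (real g *\<^sub>R (w * w))) - P' *\<^sub>R (P *\<^sub>R (w * q)))"
      using eq0 by (simp add: PP' algebra_simps eq_neg_iff_add_eq_0)
    moreover have "- (P' *\<^sub>R (real g *\<^sub>R (w * w))) - P' *\<^sub>R (P *\<^sub>R (w * q)) \<in> R"
      unfolding diff_conv_add_uminus by (intro Radd Rminus RP' RP Rnat Rmult w qR)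
    ultimately show False using Rdiv nw by blast
  next
    case True
    have odd: "odd p" using p prime_odd_nat by auto
    then obtain h where h: "p = 2 * h + 1" by (elim oddE)
    have "g = p * h" unfolding g_def True using h by (simp add: Sum_Ico_nat lessThan_atLeast0)
    then have "real p *\<^sub>R (w + (real h * P) *\<^sub>R (w * w) + (P' * P) *\<^sub>R (w * q)) = 0"
      using eq0 unfolding True by (simp add: PP' algebra_simps)
    then have "w + (real h * P) *\<^sub>R (w * w) + (P' * P) *\<^sub>R (w * q) = 0"
      using p by simp
    then have "w = real p *\<^sub>R (- (P' *\<^sub>R (real h *\<^sub>R (w * w))) - P' *\<^sub>R (P' *\<^sub>R (w * q)))"
      by (simp add: PP' algebra_simps eq_neg_iff_add_eq_0)
    moreover have "- (P' *\<^sub>R (real h *\<^sub>R (w * w))) - P' *\<^sub>R (P' *\<^sub>R (w * q)) \<in> R"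
      unfolding diff_conv_add_uminus by (intro Radd Rminus RP' RP Rnat Rmult w qR)
    ultimately show False using nw by blast
  qed
qed

text \<open>Split a prime factor \<open>l\<close> off the exponent: the power of \<open>z\<close> to
  the cofactor is still congruent to the unit and is killed by \<open>l\<close>, so it is trivial,
  and the exponent has become smaller.\<close>

lemma torsion_trivial:
  assumes "m > 0" "z \<in> \<Gamma>" "z - un n = real p *\<^sub>R w" "w \<in> R" "mpow n z m = un n"
  shows "z = un n"
  using assms
proof (induction m arbitrary: z w rule: less_induct)
  case (less m)
  note zm = subsetD[OF Rmats subsetD[OF \<Gamma>R less.prems(2)]]
  show ?case
  proof (cases "m = 1")
    case True
    then show ?thesis using less.prems(5) zm by simp
  next
    case False
    then obtain l where l: "prime l" "l dvd m" using prime_factor_nat by blast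
    then obtain d where d: "m = d * l" by (metis dvd_def mult.commute)
    have "d > 0" using less.prems(1) d by (cases d) auto
    have "d < m" using d l(1) \<open>d > 0\<close> prime_gt_1_nat by simp
    have pw: "mpow n z j \<in> \<Gamma> \<and> (\<exists>u\<in>R. mpow n z j - un n = real p *\<^sub>R u)" for j
    proof (induction j)
      case 0
      show ?case using un\<Gamma> R0 by (auto intro!: bexI[of _ 0])
    next
      case (Suc j)
      then obtain u where u: "u \<in> R" "mpow n z j - un n = real p *\<^sub>R u" by blast
      have "mpow n z (Suc j) - un n = z * (mpow n z j - un n) + (z - un n)"
        using zm by (simp add: algebra_simps)
      also have "\<dots> = real p *\<^sub>R (z * u + w)" by (simp add: u(2) less.prems(3) scaleR_add_right)
      moreover have "z * u + w \<in> R"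
        using less.prems(2,4) u(1) \<Gamma>R by (intro Radd Rmult) auto
      moreover have "mpow n z (Suc j) \<in> \<Gamma>" using Suc less.prems(2) mult\<Gamma> by simp
      ultimately show ?case by metis
    qed
    obtain u where u: "u \<in> R" "mpow n z d - un n = real p *\<^sub>R u" using pw by blast
    have "mpow n (mpow n z d) l = un n" using less.prems(5) d mpow_mult[OF zm] by simp
    with pw[of d] u l(1) have "mpow n z d = un n" using prime_order_trivial by blast
    then show ?thesis using less.IH[OF \<open>d < m\<close> \<open>d > 0\<close> less.prems(2-4)] by blast
  qed
qed

end

text \<open>Schur's theorem. For a rational basis \<open>E\<close> taken from the group, finitely
  many denominators occur in the structure constants and in the coordinates of the generators; an
  odd prime \<open>p\<close> avoiding them makes the \<open>p\<close>-integral combinations of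
  \<open>E\<close> a ring containing the group. Reduction modulo \<open>p\<close> is then injective
  on the group by Minkowski's lemma, and its target is finite.\<close>

lemma finite_torsion_gen:
  assumes S: "finite S" "S \<subseteq> orth n" "tr ` S \<subseteq> S"
    and tors: "\<And>x. x \<in> gen n S \<Longrightarrow> \<exists>m>0. mpow n x m = un n"
  shows "finite (gen n S)"
proof -
  let ?G = "gen n S"
  obtain W where W: "finite W" "?G \<subseteq> rat_vs.span W"
    using torsion_gen_rational_span[OF S tors] by blast
  obtain E where E: "E \<subseteq> ?G" "rat_vs.independent E" "?G \<subseteq> rat_vs.span E"
    by (rule rat_vs.maximal_independent_subset)
  have finE: "finite E" using rat_vs.independent_span_bound[OF W(1) E(2)] E(1) W(2) by blast
  let ?r = "rat_vs.representation E"
  define Q where "Q = (\<Union>a\<in>E. \<Union>b\<in>E. ?r (a * b) ` E) \<union> (\<Union>s\<in>insert (un n) S. ?r s ` E)"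
  have finQ: "finite Q" using finE S(1) by (simp add: Q_def)
  obtain p where p: "prime p" "p > 2" "\<And>q. q \<in> Q \<Longrightarrow> pint p q"
    using obtain_pint_prime[OF finQ] by metis
  define R where "R = {v \<in> rat_vs.span E. \<forall>c\<in>E. pint p (?r v c)}"
  have RI: "v \<in> R" if "v \<in> rat_vs.span E" "\<And>c. c \<in> E \<Longrightarrow> pint p (?r v c)" for v
    using that by (simp add: R_def)
  have Rspan: "v \<in> rat_vs.span E" if "v \<in> R" for v using that by (simp add: R_def)
  have Rp: "pint p (?r v c)" if "v \<in> R" "c \<in> E" for v c using that by (simp add: R_def)
  have expand: "(\<Sum>c\<in>E. rat_scale (?r v c) c) = v" if "v \<in> rat_vs.span E" for v
    by (rule rat_vs.sum_representation_eq[OF E(2) that finE]) simp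
  have Radd: "x + y \<in> R" if "x \<in> R" "y \<in> R" for x y
    using that by (intro RI) (auto simp: R_def rat_vs.representation_add[OF E(2)] rat_vs.span_add intro: pint_add[OF p(1)])
  have Rscale: "rat_scale q x \<in> R" if "x \<in> R" "pint p q" for x q
    using that by (intro RI) (auto simp: R_def rat_vs.representation_scale[OF E(2)] rat_vs.span_scale intro: pint_mult[OF p(1)])
  have R0: "0 \<in> R"
    by (rule RI) (use pint_of_int[of p 0] p(2) in \<open>auto simp: rat_vs.representation_zero rat_vs.span_zero\<close>)
  have Rsum: "(\<And>i. i \<in> I \<Longrightarrow> f i \<in> R) \<Longrightarrow> sum f I \<in> R" for f :: "fmat \<Rightarrow> fmat" and I
    by (induction I rule: infinite_finite_induct) (auto intro: R0 Radd)
  have EE: "a * b \<in> R" if "a \<in> E" "b \<in> E" for a b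
  proof (rule RI)
    have "a * b \<in> ?G" using that E(1) gen_mult[OF S(2)] by blast
    then show "a * b \<in> rat_vs.span E" using E(3) by blast
    show "pint p (?r (a * b) c)" if "c \<in> E" for c
      using that \<open>a \<in> E\<close> \<open>b \<in> E\<close> by (intro p(3)) (auto simp: Q_def)
  qed
  have scale_mult: "rat_scale q x * y = rat_scale q (x * y)" "x * rat_scale q y = rat_scale q (x * y)" for q and x y :: fmat
    by (simp_all add: rat_scale_def)
  have Rmult: "x * y \<in> R" if "x \<in> R" "y \<in> R" for x y
  proof -
    have "x * y = (\<Sum>a\<in>E. rat_scale (?r x a) a) * (\<Sum>b\<in>E. rat_scale (?r y b) b)"
      using expand[OF Rspan] that by simp
    also have "\<dots> = (\<Sum>a\<in>E. \<Sum>b\<in>E. rat_scale (?r x a) (rat_scale (?r y b) (a * b)))"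
      by (simp add: sum_product scale_mult mult.commute)
    also have "\<dots> \<in> R" using that by (intro Rsum Rscale EE Rp)
    finally show ?thesis .
  qed
  have SR: "s \<in> R" if "s \<in> insert (un n) S" for s
  proof (rule RI)
    have "s \<in> ?G" using that gen_base[OF S(2)] gen_un by auto
    then show "s \<in> rat_vs.span E" using E(3) by blast
    show "pint p (?r s c)" if "c \<in> E" for c
      using that \<open>s \<in> insert (un n) S\<close> by (intro p(3)) (auto simp: Q_def)
  qed
  have GR: "?G \<subseteq> R"
  proof
    fix x assume "x \<in> ?G"
    then show "x \<in> R" by induction (auto intro: SR Rmult)
  qed
  have Gm: "?G \<subseteq> mats n" using gen_orth[OF S(2)] orthD(1) by blast
  have Rm: "R \<subseteq> mats n"
  proof
    fix v assume "v \<in> R"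
    then have "v = (\<Sum>c\<in>E. rat_scale (?r v c) c)" using expand[OF Rspan] by simp
    also have "\<dots> \<in> mats n" using E(1) Gm by (intro mats_sum) (auto simp: rat_scale_def intro: mats_scaleR)
    finally show "v \<in> mats n" .
  qed
  have p1: "p > 1" and p0: "rat_of_nat p \<noteq> 0" using p(2) by auto
  have rs_nat: "real k *\<^sub>R x = rat_scale (of_nat k) x" for k and x :: fmat
    by (simp add: rat_scale_def)
  interpret p_lattice n p R ?G
  proof
    show "of_int k *\<^sub>R x \<in> R" if "x \<in> R" for x and k :: int
      using Rscale[OF that pint_of_int[OF p1, of k]] by (simp add: rat_scale_def)
    show "\<exists>u\<in>R. y = real p *\<^sub>R u" if "x \<in> R" "\<not> p dvd k" "real k *\<^sub>R y = real p *\<^sub>R x" for x y and k :: nat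
    proof -
      have "k \<noteq> 0" using that(2) by (metis dvd_0_right)
      have "pint p (1 / of_nat k)" unfolding pint_def
        by (rule exI[of _ 1], rule exI[of _ "int k"]) (use that(2) in auto)
      then have "rat_scale (1 / of_nat k) x \<in> R" using Rscale that(1) by blast
      moreover have "y = real p *\<^sub>R rat_scale (1 / of_nat k) x"
      proof -
        have "y = (1 / real k) *\<^sub>R (real k *\<^sub>R y)" using \<open>k \<noteq> 0\<close> by simp
        also have "\<dots> = real p *\<^sub>R rat_scale (1 / of_nat k) x"
          unfolding that(3) by (simp add: rat_scale_def of_rat_divide)
        finally show ?thesis .
      qed
      ultimately show ?thesis by blast
    qed
    show "x = 0" if x: "\<And>k. \<exists>u\<in>R. x = real (p ^ k) *\<^sub>R u" for x
    proof -
      have xs: "x \<in> rat_vs.span E" using x[of 0] Rspan by auto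
      have "?r x c = 0" if c: "c \<in> E" for c
      proof (rule pint_infinitely_divisible[OF p(1)])
        fix k
        obtain u where u: "u \<in> R" "x = rat_scale (of_nat (p ^ k)) u" using x[of k] rs_nat by metis
        then have "?r x c = of_nat (p ^ k) * ?r u c"
          using rat_vs.representation_scale[OF E(2) Rspan[OF u(1)]] by simp
        then show "\<exists>y. pint p y \<and> ?r x c = of_nat (p ^ k) * y" using Rp[OF u(1) c] by blast
      qed
      then have "(\<Sum>c\<in>E. rat_scale (?r x c) c) = 0" by simp
      then show ?thesis using expand[OF xs] by simp
    qed
  qed (use p Rm GR gen_un gen_mult[OF S(2)] Radd Rmult in blast)+
  obtain res where res: "\<And>q. pint p q \<Longrightarrow> res q < p \<and> (\<exists>y. pint p y \<and> q - of_nat (res q) = of_nat p * y)"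
    using pint_residue[OF p(1)] by metis
  \<comment> \<open>Coordinates modulo \<open>p\<close>. Equal codes make \<open>x * tr y\<close>
    congruent to the unit, so it is trivial.\<close>
  define code where "code x = restrict (\<lambda>c. res (?r x c)) E" for x
  have "inj_on code ?G"
  proof (rule inj_onI)
    fix x y assume xy: "x \<in> ?G" "y \<in> ?G" "code x = code y"
    have xR: "x \<in> R" "y \<in> R" using xy GR by auto
    have "\<exists>q. pint p q \<and> ?r x c - ?r y c = of_nat p * q" if c: "c \<in> E" for c
    proof -
      obtain a where a: "pint p a" "?r x c - of_nat (res (?r x c)) = of_nat p * a" using res[OF Rp[OF xR(1) c]] by blast
      obtain b where b: "pint p b" "?r y c - of_nat (res (?r y c)) = of_nat p * b" using res[OF Rp[OF xR(2) c]] by blast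
      have "res (?r x c) = res (?r y c)" using fun_cong[OF xy(3), of c] c by (simp add: code_def)
      then have "?r x c - ?r y c = of_nat p * (a + (-1) * b)"
        using a(2) b(2) by (simp add: algebra_simps)
      moreover have "pint p (a + (-1) * b)"
        using a(1) b(1) pint_of_int[OF p1, of "-1"] by (intro pint_add[OF p(1)] pint_mult[OF p(1)]) auto
      ultimately show ?thesis by blast
    qed
    then obtain q where q: "\<And>c. c \<in> E \<Longrightarrow> pint p (q c) \<and> ?r x c - ?r y c = of_nat p * q c" by metis
    define u where "u = (\<Sum>c\<in>E. rat_scale (q c) c)"
    have ER: "c \<in> R" if "c \<in> E" for c using that E(1) GR by blast
    have uR: "u \<in> R" unfolding u_def using q by (intro Rsum Rscale ER) auto
    have "x - y = (\<Sum>c\<in>E. rat_scale (?r x c) c) - (\<Sum>c\<in>E. rat_scale (?r y c) c)"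
      using expand[OF Rspan] xR by simp
    also have "\<dots> = (\<Sum>c\<in>E. rat_scale (?r x c - ?r y c) c)"
      by (simp add: sum_subtractf rat_vs.scale_left_diff_distrib)
    also have "\<dots> = real p *\<^sub>R u"
      unfolding u_def rs_nat rat_vs.scale_sum_right by (intro sum.cong refl) (simp add: q)
    finally have xyu: "x - y = real p *\<^sub>R u" .
    have yo: "y \<in> orth n" and xm: "x \<in> mats n" using xy gen_orth[OF S(2)] Gm by auto
    have tG: "tr y \<in> ?G" using gen_tr[OF S(2,3) xy(2)] .
    have "x * tr y - un n = (x - y) * tr y" using orthD(2)[OF yo] by (simp add: algebra_simps)
    also have "\<dots> = real p *\<^sub>R (u * tr y)" by (simp add: xyu)
    finally have z: "x * tr y - un n = real p *\<^sub>R (u * tr y)" .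
    have zG: "x * tr y \<in> ?G" by (rule gen_mult[OF S(2) xy(1) tG])
    obtain m where m: "m > 0" "mpow n (x * tr y) m = un n" using tors[OF zG] by blast
    have "u * tr y \<in> R" using uR tG GR by (intro Rmult) auto
    from torsion_trivial[OF m(1) zG z this m(2)] have "x * tr y = un n" .
    then have "x * (tr y * y) = y" using orthD(1)[OF yo] by (simp add: mult.assoc[symmetric])
    then show "x = y" using orthD(3)[OF yo] xm by simp
  qed
  moreover have "code ` ?G \<subseteq> E \<rightarrow>\<^sub>E {..<p}"
    using res Rp GR by (auto simp: code_def)
  moreover have "finite (E \<rightarrow>\<^sub>E {..<p})" using finE by (intro finite_PiE) auto
  ultimately show ?thesis by (metis finite_imageD finite_subset)
qed

theorem torsion_orth_near_identity_commute:
  assumes A: "A \<in> orth n" "norm (A - un n) \<le> 1/4" and B: "B \<in> orth n" "norm (B - un n) < 1"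
    and tors: "\<And>x. x \<in> gen n {A, B, tr A, tr B} \<Longrightarrow> \<exists>m>0. mpow n x m = un n"
  shows "A * B = B * A"
proof -
  let ?S = "{A, B, tr A, tr B}"
  have S: "finite ?S" "?S \<subseteq> orth n" "tr ` ?S \<subseteq> ?S" using A(1) B(1) orth_tr by auto
  show ?thesis
  proof (rule finite_orth_near_identity_commute[OF finite_torsion_gen[OF S tors] gen_orth[OF S(2)] gen_un])
    show "A \<in> gen n ?S" "B \<in> gen n ?S" by (auto intro: gen_base[OF S(2)])
  qed (use A(2) B(2) tors gen_mult[OF S(2)] gen_tr[OF S(2,3)] in blast)+
qed

section \<open>Stability of approximate homomorphisms\<close>

locale finitely_additive =
  fixes C :: "'b set" and \<mu> :: "'b set \<Rightarrow> real"
  assumes nonneg: "A \<subseteq> C \<Longrightarrow> 0 \<le> \<mu> A" and total: "\<mu> C = 1"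
    and additive: "A \<subseteq> C \<Longrightarrow> B \<subseteq> C \<Longrightarrow> A \<inter> B = {} \<Longrightarrow> \<mu> (A \<union> B) = \<mu> A + \<mu> B"
begin

lemma empty: "\<mu> {} = 0"
  using additive[of "{}" "{}"] by simp

lemma finite_Union:
  assumes "finite I" "\<And>i. i \<in> I \<Longrightarrow> A i \<subseteq> C" "\<And>i j. i \<in> I \<Longrightarrow> j \<in> I \<Longrightarrow> i \<noteq> j \<Longrightarrow> A i \<inter> A j = {}"
  shows "\<mu> (\<Union>i\<in>I. A i) = (\<Sum>i\<in>I. \<mu> (A i))"
  using assms
proof (induction I)
  case (insert x I)
  have "A x \<inter> (\<Union>i\<in>I. A i) = {}" using insert by blast
  then have "\<mu> (A x \<union> (\<Union>i\<in>I. A i)) = \<mu> (A x) + \<mu> (\<Union>i\<in>I. A i)"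
    using insert.prems by (intro additive) auto
  then show ?case using insert by simp
qed (simp add: empty)

text \<open>Integral of a function of finite range with values in any real vector space. On infinite
  range the sum defaults to 0, hence the finiteness assumptions below.\<close>

definition mint :: "('b \<Rightarrow> 'v::real_vector) \<Rightarrow> 'v" where
  "mint f = (\<Sum>v\<in>f ` C. \<mu> {x \<in> C. f x = v} *\<^sub>R v)"

text \<open>The integral may be computed on any finite partition fine enough to determine the
  integrand. Additivity follows with the partition given by a pair of functions.\<close>

lemma mint_comp:
  assumes "finite (P ` C)"
  shows "mint (\<lambda>x. \<phi> (P x)) = (\<Sum>p\<in>P ` C. \<mu> {x \<in> C. P x = p} *\<^sub>R \<phi> p)"
proof -
  have "(\<Sum>p\<in>P ` C. \<mu> {x \<in> C. P x = p} *\<^sub>R \<phi> p) =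
      (\<Sum>v\<in>\<phi> ` P ` C. \<Sum>p\<in>{p \<in> P ` C. \<phi> p = v}. \<mu> {x \<in> C. P x = p} *\<^sub>R \<phi> p)"
    by (rule sum.image_gen[OF assms])
  also have "\<dots> = (\<Sum>v\<in>\<phi> ` P ` C. \<mu> {x \<in> C. \<phi> (P x) = v} *\<^sub>R v)"
  proof (intro sum.cong refl)
    fix v
    have "\<mu> (\<Union>p\<in>{p \<in> P ` C. \<phi> p = v}. {x \<in> C. P x = p}) = (\<Sum>p\<in>{p \<in> P ` C. \<phi> p = v}. \<mu> {x \<in> C. P x = p})"
      by (rule finite_Union) (use assms in auto)
    moreover have "(\<Union>p\<in>{p \<in> P ` C. \<phi> p = v}. {x \<in> C. P x = p}) = {x \<in> C. \<phi> (P x) = v}" by auto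
    ultimately show "(\<Sum>p\<in>{p \<in> P ` C. \<phi> p = v}. \<mu> {x \<in> C. P x = p} *\<^sub>R \<phi> p) = \<mu> {x \<in> C. \<phi> (P x) = v} *\<^sub>R v"
      by (simp add: scaleR_sum_left)
  qed
  finally show ?thesis by (simp add: mint_def image_image)
qed

lemma mint_cong: "(\<And>x. x \<in> C \<Longrightarrow> f x = g x) \<Longrightarrow> mint f = mint g"
  unfolding mint_def by (intro sum.cong) (auto intro!: arg_cong[of _ _ \<mu>])

lemma mint_linear:
  assumes "linear L" "finite (f ` C)"
  shows "mint (\<lambda>x. L (f x)) = L (mint f)"
  using mint_comp[OF assms(2), of L] by (simp add: mint_def linear_sum[OF assms(1)] linear_scale[OF assms(1)])

lemma finite_image_Pair:
  assumes "finite (f ` C)" "finite (g ` C)" shows "finite ((\<lambda>x. (f x, g x)) ` C)"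
  by (rule finite_subset[of _ "f ` C \<times> g ` C"]) (use assms in auto)

lemma finite_image_comp2:
  assumes "finite (f ` C)" "finite (g ` C)" shows "finite ((\<lambda>x. h (f x) (g x)) ` C)"
  using finite_imageI[OF finite_image_Pair[OF assms], of "\<lambda>(a, b). h a b"] by (simp add: image_image)

lemma mint_add:
  assumes "finite (f ` C)" "finite (g ` C)"
  shows "mint (\<lambda>x. f x + g x) = mint f + mint g"
proof -
  note fin = finite_image_Pair[OF assms]
  show ?thesis
    using mint_comp[OF fin, of "\<lambda>(a, b). a + b"] mint_comp[OF fin, of fst] mint_comp[OF fin, of snd]
    by (simp add: case_prod_unfold scaleR_add_right sum.distrib)
qed

lemma mint_diff:
  assumes "finite (f ` C)" "finite (g ` C)"
  shows "mint (\<lambda>x. f x - g x) = mint f - mint g"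
proof -
  note fin = finite_image_Pair[OF assms]
  show ?thesis
    using mint_comp[OF fin, of "\<lambda>(a, b). a - b"] mint_comp[OF fin, of fst] mint_comp[OF fin, of snd]
    by (simp add: case_prod_unfold scaleR_diff_right sum_subtractf)
qed

lemma sum_measure: "finite (f ` C) \<Longrightarrow> (\<Sum>v\<in>f ` C. \<mu> {x \<in> C. f x = v}) = 1"
proof -
  assume "finite (f ` C)"
  then have "\<mu> (\<Union>v\<in>f ` C. {x \<in> C. f x = v}) = (\<Sum>v\<in>f ` C. \<mu> {x \<in> C. f x = v})"
    by (intro finite_Union) auto
  moreover have "(\<Union>v\<in>f ` C. {x \<in> C. f x = v}) = C" by auto
  ultimately show ?thesis using total by simp
qed

lemma mint_const: "mint (\<lambda>x. c) = c"
proof -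
  have "C \<noteq> {}" using total empty by auto
  then have "(\<lambda>x. c) ` C = {c}" by auto
  then show ?thesis by (simp add: mint_def total)
qed

lemma norm_mint_le:
  fixes f :: "'b \<Rightarrow> 'v::real_normed_vector"
  assumes "finite (f ` C)" "\<And>x. x \<in> C \<Longrightarrow> norm (f x) \<le> K"
  shows "norm (mint f) \<le> K"
proof -
  have "norm (mint f) \<le> (\<Sum>v\<in>f ` C. \<mu> {x \<in> C. f x = v} * norm v)"
    unfolding mint_def by (rule order_trans[OF norm_sum]) (simp add: nonneg)
  also have "\<dots> \<le> (\<Sum>v\<in>f ` C. \<mu> {x \<in> C. f x = v} * K)"
    by (intro sum_mono mult_left_mono nonneg) (use assms(2) in auto)
  also have "\<dots> = K" using sum_measure[OF assms(1)] by (simp add: sum_distrib_right[symmetric])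
  finally show ?thesis .
qed

lemma mint_nonneg: "(\<And>x. x \<in> C \<Longrightarrow> 0 \<le> f x) \<Longrightarrow> 0 \<le> mint f" for f :: "'b \<Rightarrow> real"
  unfolding mint_def by (intro sum_nonneg) (auto intro!: mult_nonneg_nonneg nonneg)

end

locale mean_group = group H + finitely_additive "carrier H" \<mu> for H :: "'b monoid" and \<mu> +
  assumes left_invariant: "g \<in> carrier H \<Longrightarrow> A \<subseteq> carrier H \<Longrightarrow> \<mu> (g <#\<^bsub>H\<^esub> A) = \<mu> A"
begin

lemma mint_translate:
  assumes a: "a \<in> carrier H"
  shows "mint (\<lambda>x. f (a \<otimes>\<^bsub>H\<^esub> x)) = mint f"
proof -
  have "(\<lambda>x. f (a \<otimes>\<^bsub>H\<^esub> x)) ` carrier H = f ` carrier H"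
  proof safe
    fix x assume "x \<in> carrier H"
    then have "x = a \<otimes>\<^bsub>H\<^esub> (inv\<^bsub>H\<^esub> a \<otimes>\<^bsub>H\<^esub> x)" using a by (simp add: m_assoc[symmetric])
    then show "f x \<in> (\<lambda>x. f (a \<otimes>\<^bsub>H\<^esub> x)) ` carrier H"
      using a \<open>x \<in> carrier H\<close> by (intro image_eqI[of _ _ "inv\<^bsub>H\<^esub> a \<otimes>\<^bsub>H\<^esub> x"]) auto
  qed (use a in auto)
  moreover have "\<mu> {x \<in> carrier H. f (a \<otimes>\<^bsub>H\<^esub> x) = v} = \<mu> {x \<in> carrier H. f x = v}" for v
  proof -
    have "a <#\<^bsub>H\<^esub> {x \<in> carrier H. f (a \<otimes>\<^bsub>H\<^esub> x) = v} = {x \<in> carrier H. f x = v}"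
    proof safe
      fix x assume "x \<in> carrier H" "v = f x"
      then show "x \<in> a <#\<^bsub>H\<^esub> {y \<in> carrier H. f (a \<otimes>\<^bsub>H\<^esub> y) = f x}"
        using a by (auto simp: l_coset_def m_assoc[symmetric] intro!: exI[of _ "inv\<^bsub>H\<^esub> a \<otimes>\<^bsub>H\<^esub> x"])
    qed (use a in \<open>auto simp: l_coset_def\<close>)
    then show ?thesis using left_invariant[OF a, of "{x \<in> carrier H. f (a \<otimes>\<^bsub>H\<^esub> x) = v}"] by simp
  qed
  ultimately show ?thesis by (simp add: mint_def)
qed

end

lemma amenable_mean_group:
  assumes "group H" "amenable H"
  obtains \<mu> where "mean_group H \<mu>"
proof -
  from assms(2)[unfolded amenable_def]
  obtain \<mu> :: "'a set \<Rightarrow> real" where "(\<forall>A \<subseteq> carrier H. 0 \<le> \<mu> A) \<and> \<mu> (carrier H) = 1 \<and>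
     (\<forall>A \<subseteq> carrier H. \<forall>B \<subseteq> carrier H. A \<inter> B = {} \<longrightarrow> \<mu> (A \<union> B) = \<mu> A + \<mu> B) \<and>
     (\<forall>g \<in> carrier H. \<forall>A \<subseteq> carrier H. \<mu> (g <#\<^bsub>H\<^esub> A) = \<mu> A)" by (rule exE)
  then have "mean_group H \<mu>"
    unfolding mean_group_def mean_group_axioms_def finitely_additive_def using assms(1) by simp
  then show ?thesis by (rule that)
qed

lemma linear_times_left: "linear (\<lambda>x. a * x :: fmat)" and linear_times_right: "linear (\<lambda>x. x * a :: fmat)"
  by (rule linearI; simp add: algebra_simps)+

context mean_group
begin

text \<open>Values need not be orthogonal, since correction and rounding leave
  \<open>orth n\<close>. The conditions on the unit and on inverses are exact and kept by every
  step; the latter makes the multiplicative limit orthogonal.\<close>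

definition approx_hom :: "nat \<Rightarrow> ('b \<Rightarrow> fmat) \<Rightarrow> real \<Rightarrow> bool" where
  "approx_hom n f \<epsilon> \<longleftrightarrow> finite (f ` carrier H) \<and> f ` carrier H \<subseteq> mats n \<and> f \<one>\<^bsub>H\<^esub> = un n \<and>
    (\<forall>x\<in>carrier H. f (inv\<^bsub>H\<^esub> x) = tr (f x)) \<and>
    (\<forall>x\<in>carrier H. \<forall>y\<in>carrier H. norm (f (x \<otimes>\<^bsub>H\<^esub> y) - f x * f y) \<le> \<epsilon>)"

lemma mint_mats:
  assumes "f ` carrier H \<subseteq> mats n" shows "mint f \<in> mats n"
proof -
  have *: "sum g J \<in> mats n" if "\<And>v. v \<in> J \<Longrightarrow> g v \<in> mats n" for J :: "fmat set" and g
    using that by (induction J rule: infinite_finite_induct) (auto intro: mats_intros)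
  show ?thesis unfolding mint_def by (rule *) (use assms in \<open>auto intro!: mats_scaleR\<close>)
qed

text \<open>The defect \<open>e\<close> is an exact Hochschild 2-cocycle, and averaging it over the group exhibits it
  as a coboundary up to a quadratic error; subtracting the coboundary is one step of a Newton
  iteration. Rounding the entries restores a finite image.\<close>

lemma approx_hom_improve:
  assumes f: "approx_hom n f \<epsilon>" and \<epsilon>: "0 < \<epsilon>" "\<epsilon> \<le> 1"
    and bound: "\<And>x. x \<in> carrier H \<Longrightarrow> norm (f x) \<le> B" and B: "B \<ge> 1"
  obtains g where "approx_hom n g ((3 + B\<^sup>2) * \<epsilon>\<^sup>2)"
    "\<And>x. x \<in> carrier H \<Longrightarrow> norm (g x - f x) \<le> (B + 1) * \<epsilon>"
proof -
  let ?C = "carrier H"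
  have fin: "finite (f ` ?C)" and fm: "\<And>x. x \<in> ?C \<Longrightarrow> f x \<in> mats n" and f1: "f \<one>\<^bsub>H\<^esub> = un n"
    and finv: "\<And>x. x \<in> ?C \<Longrightarrow> f (inv\<^bsub>H\<^esub> x) = tr (f x)"
    and def: "\<And>x y. x \<in> ?C \<Longrightarrow> y \<in> ?C \<Longrightarrow> norm (f (x \<otimes>\<^bsub>H\<^esub> y) - f x * f y) \<le> \<epsilon>"
    using f by (auto simp: approx_hom_def)
  have fin': "finite ((\<lambda>z. f (\<phi> z)) ` ?C)" if "\<phi> ` ?C \<subseteq> ?C" for \<phi>
    by (rule finite_subset[OF _ fin]) (use that in auto)
  define e where "e x y = f (x \<otimes>\<^bsub>H\<^esub> y) - f x * f y" for x y
  \<comment> \<open>\<open>f (inv z)\<close> stands in for the inverse of \<open>f z\<close>; the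
    average over \<open>z\<close> would be an exact primitive of the cocycle if \<open>f\<close>
    were multiplicative.\<close>
  define b where "b x = mint (\<lambda>z. e x z * f (inv\<^bsub>H\<^esub> z))" for x
  have en: "norm (e x y) \<le> \<epsilon>" if "x \<in> ?C" "y \<in> ?C" for x y using def that by (simp add: e_def)
  have em: "e x y \<in> mats n" if "x \<in> ?C" "y \<in> ?C" for x y using that fm by (simp add: e_def mats_intros)
  have fine: "finite ((\<lambda>z. e (\<phi> z) (\<psi> z)) ` ?C)" if "\<phi> ` ?C \<subseteq> ?C" "\<psi> ` ?C \<subseteq> ?C" for \<phi> \<psi>
  proof -
    have "finite ((\<lambda>z. f (\<phi> z \<otimes>\<^bsub>H\<^esub> \<psi> z)) ` ?C)" by (rule fin') (use that in auto)
    then show ?thesis unfolding e_def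
      using finite_image_comp2[OF _ finite_image_comp2[OF fin'[OF that(1)] fin'[OF that(2)], of "(*)"], of _ "(-)"] by auto
  qed
  note fin_mult = finite_image_comp2[where h="(*)"]
  have inj_simps: "(\<lambda>z. x) ` ?C \<subseteq> ?C" "(\<lambda>z. z) ` ?C \<subseteq> ?C" "(\<lambda>z. inv\<^bsub>H\<^esub> z) ` ?C \<subseteq> ?C"
    "(\<lambda>z. x \<otimes>\<^bsub>H\<^esub> z) ` ?C \<subseteq> ?C" if "x \<in> ?C" for x using that by auto
  have bn: "norm (b x) \<le> \<epsilon> * B" if x: "x \<in> ?C" for x
    unfolding b_def
  proof (rule norm_mint_le)
    show "finite ((\<lambda>z. e x z * f (inv\<^bsub>H\<^esub> z)) ` ?C)"
      by (intro fin_mult fine fin' inj_simps x) (use x in auto)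
    show "norm (e x z * f (inv\<^bsub>H\<^esub> z)) \<le> \<epsilon> * B" if "z \<in> ?C" for z
      by (rule order_trans[OF norm_mult_ineq mult_mono]) (use en bound that x \<epsilon> B in auto)
  qed
  have bm: "b x \<in> mats n" if "x \<in> ?C" for x
    unfolding b_def using that em fm by (intro mint_mats) (auto intro: mats_times)
  \<comment> \<open>\<open>d x y\<close> is the defect of \<open>f + b\<close> with its quadratic
    term \<open>b x * b y\<close> left out. It turns out to be \<open>q + e x y * r\<close>, where
    both summands are quadratic in \<open>\<epsilon>\<close>.\<close>
  define d where "d x y = e x y + b (x \<otimes>\<^bsub>H\<^esub> y) - f x * b y - b x * f y" for x y
  have dn: "norm (d x y) \<le> 2 * \<epsilon>\<^sup>2" if x: "x \<in> ?C" and y: "y \<in> ?C" for x y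
  proof -
    note m = fm[OF x] fm[OF y] em[OF x y]
    define q where "q = mint (\<lambda>z. e x z * e (inv\<^bsub>H\<^esub> z) y)"
    define r where "r = mint (\<lambda>z. e z (inv\<^bsub>H\<^esub> z))"
    have xy: "x \<otimes>\<^bsub>H\<^esub> y \<in> ?C" using x y by simp
    have F1: "finite ((\<lambda>z. e x z * f (inv\<^bsub>H\<^esub> z)) ` ?C)" "finite ((\<lambda>z. e y z * f (inv\<^bsub>H\<^esub> z)) ` ?C)"
      "finite ((\<lambda>z. e (x \<otimes>\<^bsub>H\<^esub> y) z * f (inv\<^bsub>H\<^esub> z)) ` ?C)"
      by (intro fin_mult fine fin' inj_simps; use x y in auto)+
    have F2: "finite ((\<lambda>z. e x (y \<otimes>\<^bsub>H\<^esub> z) * f (inv\<^bsub>H\<^esub> z)) ` ?C)"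
      by (intro fin_mult fine fin') (use x y in auto)
    have F3: "finite ((\<lambda>z. e x z * e (inv\<^bsub>H\<^esub> z) y) ` ?C)" "finite ((\<lambda>z. e z (inv\<^bsub>H\<^esub> z)) ` ?C)"
      by (intro fin_mult fine; use x y in auto)+
    have F4: "finite ((\<lambda>z. f x * (e y z * f (inv\<^bsub>H\<^esub> z))) ` ?C)" "finite ((\<lambda>z. e x z * f (inv\<^bsub>H\<^esub> z) * f y) ` ?C)"
      "finite ((\<lambda>z. e x y * e z (inv\<^bsub>H\<^esub> z)) ` ?C)"
      using finite_imageI[OF F1(2), of "\<lambda>u. f x * u"] finite_imageI[OF F1(1), of "\<lambda>u. u * f y"]
        finite_imageI[OF F3(2), of "\<lambda>u. e x y * u"] by (simp_all add: image_image)
    have s1: "mint (\<lambda>z. f x * (e y z * f (inv\<^bsub>H\<^esub> z))) = f x * b y"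
      unfolding b_def by (rule mint_linear[OF linear_times_left F1(2)])
    have s2: "mint (\<lambda>z. e x z * f (inv\<^bsub>H\<^esub> z) * f y) = b x * f y"
      unfolding b_def by (rule mint_linear[OF linear_times_right F1(1)])
    have s3: "mint (\<lambda>z. e x y * e z (inv\<^bsub>H\<^esub> z)) = e x y * r"
      unfolding r_def by (rule mint_linear[OF linear_times_left F3(2)])
    have s4: "mint (\<lambda>z. e x (y \<otimes>\<^bsub>H\<^esub> z) * f (inv\<^bsub>H\<^esub> z)) = b x * f y + q"
    proof -
      \<comment> \<open>Left invariance enters here: the integrand is rewritten as a function of the
        product of \<open>y\<close> and \<open>z\<close>, which is then replaced by
        \<open>z\<close>.\<close>
      have "mint (\<lambda>z. e x (y \<otimes>\<^bsub>H\<^esub> z) * f (inv\<^bsub>H\<^esub> z)) =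
          mint (\<lambda>z. e x (y \<otimes>\<^bsub>H\<^esub> z) * f (inv\<^bsub>H\<^esub> (y \<otimes>\<^bsub>H\<^esub> z) \<otimes>\<^bsub>H\<^esub> y))"
        by (rule mint_cong) (use y in \<open>simp add: inv_mult_group m_assoc\<close>)
      also have "\<dots> = mint (\<lambda>z. e x z * f (inv\<^bsub>H\<^esub> z \<otimes>\<^bsub>H\<^esub> y))"
        by (rule mint_translate[OF y, of "\<lambda>z. e x z * f (inv\<^bsub>H\<^esub> z \<otimes>\<^bsub>H\<^esub> y)"])
      also have "\<dots> = mint (\<lambda>z. e x z * f (inv\<^bsub>H\<^esub> z) * f y + e x z * e (inv\<^bsub>H\<^esub> z) y)"
        by (rule mint_cong) (simp add: e_def algebra_simps)
      also have "\<dots> = b x * f y + q" using mint_add[OF F4(2) F3(1)] s2 by (simp add: q_def)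
      finally show ?thesis .
    qed
    have "b (x \<otimes>\<^bsub>H\<^esub> y) = mint (\<lambda>z. f x * (e y z * f (inv\<^bsub>H\<^esub> z)) + e x (y \<otimes>\<^bsub>H\<^esub> z) * f (inv\<^bsub>H\<^esub> z)
        - (e x y - e x y * e z (inv\<^bsub>H\<^esub> z)))"
      unfolding b_def
    proof (rule mint_cong)
      fix z assume z: "z \<in> ?C"
      have "f z * f (inv\<^bsub>H\<^esub> z) = un n - e z (inv\<^bsub>H\<^esub> z)" using z by (simp add: e_def f1)
      then have 1: "e x y * (f z * f (inv\<^bsub>H\<^esub> z)) = e x y - e x y * e z (inv\<^bsub>H\<^esub> z)"
        using m by (simp add: right_diff_distrib)
      have "e (x \<otimes>\<^bsub>H\<^esub> y) z = f x * e y z + e x (y \<otimes>\<^bsub>H\<^esub> z) - e x y * f z"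
        using x y z by (simp add: e_def m_assoc algebra_simps)
      note cocycle = this
      have "e (x \<otimes>\<^bsub>H\<^esub> y) z * f (inv\<^bsub>H\<^esub> z) =
          f x * (e y z * f (inv\<^bsub>H\<^esub> z)) + e x (y \<otimes>\<^bsub>H\<^esub> z) * f (inv\<^bsub>H\<^esub> z) - e x y * (f z * f (inv\<^bsub>H\<^esub> z))"
        unfolding cocycle by (simp only: left_diff_distrib distrib_right mult.assoc)
      then show "e (x \<otimes>\<^bsub>H\<^esub> y) z * f (inv\<^bsub>H\<^esub> z) = f x * (e y z * f (inv\<^bsub>H\<^esub> z)) + e x (y \<otimes>\<^bsub>H\<^esub> z) * f (inv\<^bsub>H\<^esub> z)
        - (e x y - e x y * e z (inv\<^bsub>H\<^esub> z))" unfolding 1 .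
    qed
    also have "\<dots> = f x * b y + (b x * f y + q) - (e x y - e x y * r)"
      using mint_diff[OF finite_image_comp2[OF F4(1) F2, of "(+)"]
          finite_image_comp2[OF _ F4(3), of "\<lambda>_. e x y" "(-)"]]
        mint_add[OF F4(1) F2] mint_diff[OF _ F4(3), of "\<lambda>_. e x y"] mint_const[of "e x y"]
      by (simp add: s1 s3 s4 image_constant_conv)
    finally have "d x y = q + e x y * r" by (simp add: d_def algebra_simps)
    moreover have "norm q \<le> \<epsilon> * \<epsilon>" unfolding q_def
    proof (rule norm_mint_le[OF F3(1)])
      show "norm (e x z * e (inv\<^bsub>H\<^esub> z) y) \<le> \<epsilon> * \<epsilon>" if "z \<in> ?C" for z
        by (rule order_trans[OF norm_mult_ineq mult_mono]) (use en that x y \<epsilon> in auto)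
    qed
    moreover have "norm r \<le> \<epsilon>" unfolding r_def by (rule norm_mint_le[OF F3(2)]) (simp add: en)
    then have "norm (e x y * r) \<le> \<epsilon> * \<epsilon>"
      by (intro order_trans[OF norm_mult_ineq mult_mono]) (use en x y \<epsilon> in auto)
    ultimately show ?thesis using norm_triangle_ineq[of q "e x y * r"] by (simp add: power2_eq_square)
  qed
  \<comment> \<open>Symmetrising \<open>b\<close> under inversion keeps the relation between
    inverses and transposes exact for \<open>h\<close>.\<close>
  define \<beta> where "\<beta> x = (1/2) *\<^sub>R (b x + tr (b (inv\<^bsub>H\<^esub> x)))" for x
  define h where "h x = f x + \<beta> x" for x
  have \<beta>n: "norm (\<beta> x) \<le> \<epsilon> * B" if "x \<in> ?C" for x
    using norm_triangle_ineq[of "b x" "tr (b (inv\<^bsub>H\<^esub> x))"] bn[of x] bn[of "inv\<^bsub>H\<^esub> x"] that by (simp add: \<beta>_def)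
  have hm: "h x \<in> mats n" if "x \<in> ?C" for x
    using that fm bm by (simp add: h_def \<beta>_def mats_intros)
  have b1: "b \<one>\<^bsub>H\<^esub> = 0"
  proof -
    have "b \<one>\<^bsub>H\<^esub> = mint (\<lambda>z. 0)" unfolding b_def by (rule mint_cong) (simp add: e_def f1 fm)
    then show ?thesis by (simp add: mint_const)
  qed
  have h1: "h \<one>\<^bsub>H\<^esub> = un n" by (simp add: h_def \<beta>_def b1 f1)
  have hinv: "h (inv\<^bsub>H\<^esub> x) = tr (h x)" if "x \<in> ?C" for x
    using that by (simp add: h_def \<beta>_def finv add.commute)
  have hdef: "norm (h (x \<otimes>\<^bsub>H\<^esub> y) - h x * h y) \<le> (2 + B\<^sup>2) * \<epsilon>\<^sup>2" if x: "x \<in> ?C" and y: "y \<in> ?C" for x y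
  proof -
    have "tr (d (inv\<^bsub>H\<^esub> y) (inv\<^bsub>H\<^esub> x)) = e x y + tr (b (inv\<^bsub>H\<^esub> (x \<otimes>\<^bsub>H\<^esub> y))) - tr (b (inv\<^bsub>H\<^esub> x)) * f y - f x * tr (b (inv\<^bsub>H\<^esub> y))"
      using x y finv[of x] finv[of y] finv[of "x \<otimes>\<^bsub>H\<^esub> y"]
      by (simp add: d_def e_def inv_mult_group)
    then have "h (x \<otimes>\<^bsub>H\<^esub> y) - h x * h y = (1/2) *\<^sub>R (d x y + tr (d (inv\<^bsub>H\<^esub> y) (inv\<^bsub>H\<^esub> x))) - \<beta> x * \<beta> y"
    proof -
      have h2: "(1/2) *\<^sub>R (u + u) = u" for u :: fmat by (simp add: scaleR_2[symmetric])
      have "(1/2) *\<^sub>R (d x y + tr (d (inv\<^bsub>H\<^esub> y) (inv\<^bsub>H\<^esub> x))) =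
        (1/2) *\<^sub>R (e x y + e x y) + \<beta> (x \<otimes>\<^bsub>H\<^esub> y) - f x * \<beta> y - \<beta> x * f y"
        unfolding \<open>tr (d _ _) = _\<close> by (simp add: d_def \<beta>_def algebra_simps)
      then show ?thesis unfolding h2 by (simp add: h_def e_def algebra_simps)
    qed
    also have "norm \<dots> \<le> norm ((1/2) *\<^sub>R (d x y + tr (d (inv\<^bsub>H\<^esub> y) (inv\<^bsub>H\<^esub> x)))) + norm (\<beta> x * \<beta> y)"
      by (rule norm_triangle_ineq4)
    also have "\<dots> \<le> 2 * \<epsilon>\<^sup>2 + (\<epsilon> * B) * (\<epsilon> * B)"
    proof (rule add_mono)
      show "norm ((1/2) *\<^sub>R (d x y + tr (d (inv\<^bsub>H\<^esub> y) (inv\<^bsub>H\<^esub> x)))) \<le> 2 * \<epsilon>\<^sup>2"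
        using norm_triangle_ineq[of "d x y" "tr (d (inv\<^bsub>H\<^esub> y) (inv\<^bsub>H\<^esub> x))"] dn[OF x y] dn[of "inv\<^bsub>H\<^esub> y" "inv\<^bsub>H\<^esub> x"] x y
        by simp
      show "norm (\<beta> x * \<beta> y) \<le> (\<epsilon> * B) * (\<epsilon> * B)"
        by (rule order_trans[OF norm_mult_ineq mult_mono]) (use \<beta>n x y \<epsilon> B in auto)
    qed
    also have "\<dots> = (2 + B\<^sup>2) * \<epsilon>\<^sup>2" by (simp add: power2_eq_square algebra_simps)
    finally show ?thesis .
  qed
  have hn: "norm (h x) \<le> 2 * B" if "x \<in> ?C" for x
  proof -
    have "norm (h x) \<le> B + \<epsilon> * B"
      unfolding h_def by (rule order_trans[OF norm_triangle_ineq add_mono]) (use bound \<beta>n that in auto)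
    also have "\<dots> \<le> 2 * B" using \<epsilon> B mult_right_mono[of \<epsilon> 1 B] by simp
    finally show ?thesis .
  qed
  \<comment> \<open>Rounding within \<open>\<eta>\<close> costs at most
    \<open>\<eta> * (4 * B + 2)\<close>, that is \<open>\<epsilon>\<^sup>2\<close>. In the constant
    \<open>3 + B\<^sup>2\<close> this accounts for 1, the bound on \<open>d\<close> for 2, and the
    product \<open>\<beta> x * \<beta> y\<close> for \<open>B\<^sup>2\<close>.\<close>
  define \<eta> where "\<eta> = \<epsilon>\<^sup>2 / (4 * B + 2)"
  have \<eta>: "0 < \<eta>" "\<eta> \<le> 1" "\<eta> * (4 * B + 2) = \<epsilon>\<^sup>2" "\<eta> \<le> \<epsilon>"
  proof -
    show "0 < \<eta>" "\<eta> * (4 * B + 2) = \<epsilon>\<^sup>2" using \<epsilon> B by (simp_all add: \<eta>_def)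
    have "\<epsilon>\<^sup>2 \<le> \<epsilon>" using \<epsilon> by (simp add: power2_eq_square mult_left_le)
    moreover have "\<eta> \<le> \<epsilon>\<^sup>2" unfolding \<eta>_def using B \<epsilon> by (simp add: divide_le_eq mult_le_cancel_left1)
    ultimately show "\<eta> \<le> \<epsilon>" "\<eta> \<le> 1" using \<epsilon> by linarith+
  qed
  obtain m0 where m0: "real n * real n / \<eta> < real m0" using reals_Archimedean2 by blast
  define m where "m = Suc m0"
  have m: "m > 0" "real n * real n / real m \<le> \<eta>"
  proof -
    show "m > 0" by (simp add: m_def)
    have "real n * real n \<le> \<eta> * real m" using m0 \<eta>(1) by (simp add: m_def field_simps)
    then show "real n * real n / real m \<le> \<eta>" by (simp add: m_def divide_le_eq)
  qed
  define g where "g x = rnd m (h x)" for x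
  have gh: "norm (g x - h x) \<le> \<eta>" if "x \<in> ?C" for x
    unfolding g_def using norm_rnd[OF hm[OF that] m(1)] m(2) by linarith
  have "approx_hom n g ((3 + B\<^sup>2) * \<epsilon>\<^sup>2)"
    unfolding approx_hom_def
  proof (intro conjI ballI)
    have "g ` ?C \<subseteq> rnd m ` {A \<in> mats n. norm A \<le> 2 * B}" using hm hn by (auto simp: g_def)
    then show "finite (g ` ?C)" by (rule finite_subset[OF _ finite_rnd])
    show "g ` ?C \<subseteq> mats n" using hm by (auto simp: g_def intro: mats_rnd)
    show "g \<one>\<^bsub>H\<^esub> = un n" using m(1) by (simp add: g_def h1 rnd_un)
    show "g (inv\<^bsub>H\<^esub> x) = tr (g x)" if "x \<in> ?C" for x using that by (simp add: g_def hinv tr_rnd)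
    fix x y assume x: "x \<in> ?C" and y: "y \<in> ?C"
    have gn: "norm (g y) \<le> 2 * B + 1"
      using norm_triangle_ineq[of "h y" "g y - h y"] hn[OF y] gh[OF y] \<eta>(2) by simp
    have "g (x \<otimes>\<^bsub>H\<^esub> y) - g x * g y = (g (x \<otimes>\<^bsub>H\<^esub> y) - h (x \<otimes>\<^bsub>H\<^esub> y)) + (h (x \<otimes>\<^bsub>H\<^esub> y) - h x * h y)
       - ((g x - h x) * g y + h x * (g y - h y))" by (simp add: algebra_simps)
    also have "norm \<dots> \<le> norm (g (x \<otimes>\<^bsub>H\<^esub> y) - h (x \<otimes>\<^bsub>H\<^esub> y)) + norm (h (x \<otimes>\<^bsub>H\<^esub> y) - h x * h y)
       + (norm (g x - h x) * norm (g y) + norm (h x) * norm (g y - h y))"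
      by (intro order_trans[OF norm_triangle_ineq4] add_mono norm_triangle_ineq order_trans[OF norm_triangle_ineq] norm_mult_ineq)
    also have "\<dots> \<le> \<eta> + (2 + B\<^sup>2) * \<epsilon>\<^sup>2 + (\<eta> * (2 * B + 1) + 2 * B * \<eta>)"
      by (intro add_mono mult_mono gh hdef gn hn x y m_closed) (use \<eta> B in auto)
    also have "\<dots> = (2 + B\<^sup>2) * \<epsilon>\<^sup>2 + \<eta> * (4 * B + 2)" by (simp add: algebra_simps)
    also have "\<dots> = (3 + B\<^sup>2) * \<epsilon>\<^sup>2" unfolding \<eta>(3) by (simp add: algebra_simps)
    finally show "norm (g (x \<otimes>\<^bsub>H\<^esub> y) - g x * g y) \<le> (3 + B\<^sup>2) * \<epsilon>\<^sup>2" .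
  qed
  moreover have "norm (g x - f x) \<le> (B + 1) * \<epsilon>" if "x \<in> ?C" for x
  proof -
    have "norm (g x - f x) \<le> norm (g x - h x) + norm (\<beta> x)"
      using norm_triangle_ineq[of "g x - h x" "\<beta> x"] by (simp add: h_def)
    then show ?thesis using gh[OF that] \<beta>n[OF that] \<eta>(4) by (simp add: algebra_simps)
  qed
  ultimately show ?thesis by (rule that)
qed

text \<open>Once \<open>(3 + B\<^sup>2) * \<epsilon>\<close> is at most 1/2, each correction at
  least halves the defect, and the displacements are bounded by a geometric series with sum
  \<open>2 * (B + 1) * \<epsilon>\<close>, at most 1. The iterates thus stay within norm
  \<open>B\<close>, which is why \<open>f\<close> starts within \<open>B - 1\<close>.\<close>

lemma approx_hom_limit:
  assumes f: "approx_hom n f \<epsilon>" and bound: "\<And>x. x \<in> carrier H \<Longrightarrow> norm (f x) \<le> B - 1" and B: "B \<ge> 1"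
    and \<epsilon>: "0 < \<epsilon>" "\<epsilon> \<le> 1" "2 * (3 + B\<^sup>2) * \<epsilon> \<le> 1" "2 * (B + 1) * \<epsilon> \<le> 1"
  obtains \<rho> where "\<And>x. x \<in> carrier H \<Longrightarrow> \<rho> x \<in> orth n"
    "\<And>x y. x \<in> carrier H \<Longrightarrow> y \<in> carrier H \<Longrightarrow> \<rho> (x \<otimes>\<^bsub>H\<^esub> y) = \<rho> x * \<rho> y"
    "\<And>x. x \<in> carrier H \<Longrightarrow> norm (\<rho> x - f x) \<le> 2 * (B + 1) * \<epsilon>" "\<rho> \<one>\<^bsub>H\<^esub> = un n"
proof -
  let ?C = "carrier H"
  define inva where "inva k g \<longleftrightarrow> approx_hom n g (\<epsilon> / 2 ^ k) \<and>
    (\<forall>x\<in>?C. norm (g x - f x) \<le> 2 * (B + 1) * \<epsilon> * (1 - 1 / 2 ^ k))" for k and g :: "'b \<Rightarrow> fmat"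
  have "\<exists>F. \<forall>k. inva k (F k) \<and> (\<forall>x\<in>?C. norm (F (Suc k) x - F k x) \<le> (B + 1) * (\<epsilon> / 2 ^ k))"
  proof (rule dependent_nat_choice)
    show "\<exists>g. inva 0 g" using f by (auto simp: inva_def)
    fix g k assume g: "inva k g"
    have e: "0 < \<epsilon> / 2 ^ k" "\<epsilon> / 2 ^ k \<le> 1" "\<epsilon> / 2 ^ k \<le> \<epsilon>"
      using \<epsilon> by (auto simp: divide_le_eq mult_le_cancel_left1 intro: order_trans[of \<epsilon> 1])
    have gb: "norm (g x) \<le> B" if "x \<in> ?C" for x
    proof -
      have "2 * (B + 1) * \<epsilon> * (1 - 1 / 2 ^ k) \<le> 2 * (B + 1) * \<epsilon> * 1"
        using B \<epsilon> by (intro mult_left_mono) auto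
      then have "norm (g x - f x) \<le> 1" using g that \<epsilon>(4) by (fastforce simp: inva_def)
      then show ?thesis using norm_triangle_ineq[of "g x - f x" "f x"] bound[OF that] by simp
    qed
    from g have "approx_hom n g (\<epsilon> / 2 ^ k)" by (simp add: inva_def)
    from approx_hom_improve[OF this e(1,2) gb B]
    obtain g' where g': "approx_hom n g' ((3 + B\<^sup>2) * (\<epsilon> / 2 ^ k)\<^sup>2)"
      "\<And>x. x \<in> ?C \<Longrightarrow> norm (g' x - g x) \<le> (B + 1) * (\<epsilon> / 2 ^ k)" by blast
    have "(3 + B\<^sup>2) * (\<epsilon> / 2 ^ k)\<^sup>2 \<le> (3 + B\<^sup>2) * \<epsilon> * (\<epsilon> / 2 ^ k)"
      unfolding power2_eq_square mult.assoc[symmetric] using e by (intro mult_right_mono mult_left_mono) auto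
    also have "\<dots> \<le> (1/2) * (\<epsilon> / 2 ^ k)"
    proof (rule mult_right_mono)
      show "(3 + B\<^sup>2) * \<epsilon> \<le> 1/2" using \<epsilon>(3) by argo
    qed (use e in simp)
    finally have "(3 + B\<^sup>2) * (\<epsilon> / 2 ^ k)\<^sup>2 \<le> \<epsilon> / 2 ^ Suc k" by simp
    then have "approx_hom n g' (\<epsilon> / 2 ^ Suc k)" using g'(1) by (force simp: approx_hom_def)
    moreover have "norm (g' x - f x) \<le> 2 * (B + 1) * \<epsilon> * (1 - 1 / 2 ^ Suc k)" if x: "x \<in> ?C" for x
    proof -
      have "norm (g' x - f x) \<le> norm (g' x - g x) + norm (g x - f x)"
        using norm_triangle_ineq[of "g' x - g x" "g x - f x"] by simp
      also have "\<dots> \<le> (B + 1) * (\<epsilon> / 2 ^ k) + 2 * (B + 1) * \<epsilon> * (1 - 1 / 2 ^ k)"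
        using g'(2)[OF x] g x by (intro add_mono) (auto simp: inva_def)
      also have "\<dots> = 2 * (B + 1) * \<epsilon> * (1 - 1 / 2 ^ Suc k)" by (simp add: field_simps)
      finally show ?thesis .
    qed
    ultimately show "\<exists>g'. inva (Suc k) g' \<and> (\<forall>x\<in>?C. norm (g' x - g x) \<le> (B + 1) * (\<epsilon> / 2 ^ k))"
      using g'(2) by (auto simp: inva_def)
  qed
  then obtain F where F: "\<And>k. inva k (F k)" "\<And>k x. x \<in> ?C \<Longrightarrow> norm (F (Suc k) x - F k x) \<le> (B + 1) * (\<epsilon> / 2 ^ k)"
    by blast
  have Fm: "F k x \<in> mats n" if "x \<in> ?C" for k x using F(1)[of k] that by (auto simp: inva_def approx_hom_def)
  have "\<exists>L. L \<in> mats n \<and> (\<lambda>k. F k x) \<longlonglongrightarrow> L" if x: "x \<in> ?C" for x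
  proof -
    have "summable (\<lambda>k. (B + 1) * \<epsilon> * (1 / 2) ^ k)" by (intro summable_mult summable_geometric) auto
    then have sm: "summable (\<lambda>k. (B + 1) * (\<epsilon> / 2 ^ k))" by (simp add: power_divide)
    have "Cauchy (\<lambda>k. F k x)"
    proof (rule metric_CauchyI)
      fix e :: real assume "e > 0"
      then obtain N where N: "\<And>m l. m \<ge> N \<Longrightarrow> norm (sum (\<lambda>k. (B + 1) * (\<epsilon> / 2 ^ k)) {m..<l}) < e"
        using sm[unfolded summable_Cauchy] by blast
      have "norm (F l x - F m x) < e" if "m \<ge> N" "l \<ge> m" for m l
      proof -
        have "norm (F l x - F m x) = norm (\<Sum>k=m..<l. F (Suc k) x - F k x)"
          using sum_Suc_diff'[OF \<open>l \<ge> m\<close>, of "\<lambda>k. F k x"] by simp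
        also have "\<dots> \<le> sum (\<lambda>k. (B + 1) * (\<epsilon> / 2 ^ k)) {m..<l}"
          by (rule order_trans[OF norm_sum sum_mono]) (rule F(2)[OF x])
        also have "\<dots> < e" using N[OF \<open>m \<ge> N\<close>, of l] by simp
        finally show ?thesis .
      qed
      note close = this
      show "\<exists>M. \<forall>m\<ge>M. \<forall>l\<ge>M. dist (F m x) (F l x) < e"
      proof (intro exI allI impI)
        fix m l assume "m \<ge> N" "l \<ge> N"
        then show "dist (F m x) (F l x) < e"
          using close[of m l] close[of l m] by (cases "m \<le> l") (auto simp: dist_norm norm_minus_commute)
      qed
    qed
    from mats_Cauchy_convergent[OF Fm[OF x] this] show ?thesis by blast
  qed
  then obtain \<rho> where \<rho>m: "\<And>x. x \<in> ?C \<Longrightarrow> \<rho> x \<in> mats n" and \<rho>: "\<And>x. x \<in> ?C \<Longrightarrow> (\<lambda>k. F k x) \<longlonglongrightarrow> \<rho> x" by metis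
  have hom: "\<rho> (x \<otimes>\<^bsub>H\<^esub> y) = \<rho> x * \<rho> y" if x: "x \<in> ?C" and y: "y \<in> ?C" for x y
  proof -
    have "(\<lambda>k. \<epsilon> * (1 / 2) ^ k) \<longlonglongrightarrow> \<epsilon> * 0" by (intro tendsto_mult tendsto_const LIMSEQ_realpow_zero) auto
    then have lim0: "(\<lambda>k. \<epsilon> / 2 ^ k) \<longlonglongrightarrow> 0" by (simp add: power_divide)
    have "norm (F k (x \<otimes>\<^bsub>H\<^esub> y) - F k x * F k y) \<le> \<epsilon> / 2 ^ k" for k
      using F(1)[of k] x y by (simp add: inva_def approx_hom_def)
    then have "(\<lambda>k. F k (x \<otimes>\<^bsub>H\<^esub> y) - F k x * F k y) \<longlonglongrightarrow> 0"
      by (intro Lim_null_comparison[OF _ lim0]) auto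
    moreover have "(\<lambda>k. F k (x \<otimes>\<^bsub>H\<^esub> y) - F k x * F k y) \<longlonglongrightarrow> \<rho> (x \<otimes>\<^bsub>H\<^esub> y) - \<rho> x * \<rho> y"
      by (intro tendsto_diff tendsto_mult \<rho>) (use x y in auto)
    ultimately have "\<rho> (x \<otimes>\<^bsub>H\<^esub> y) - \<rho> x * \<rho> y = 0" using LIMSEQ_unique by blast
    then show ?thesis by simp
  qed
  have one: "\<rho> \<one>\<^bsub>H\<^esub> = un n"
  proof -
    have "(\<lambda>k. F k \<one>\<^bsub>H\<^esub>) = (\<lambda>_. un n)" using F(1) by (auto simp: inva_def approx_hom_def)
    then show ?thesis using \<rho>[of "\<one>\<^bsub>H\<^esub>"] by (simp add: LIMSEQ_const_iff)
  qed
  have \<rho>inv: "\<rho> (inv\<^bsub>H\<^esub> x) = tr (\<rho> x)" if x: "x \<in> ?C" for x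
  proof -
    have "(\<lambda>k. norm (F k x - \<rho> x)) \<longlonglongrightarrow> 0" using \<rho>[OF x] by (simp add: LIM_zero tendsto_norm_zero)
    then have "(\<lambda>k. norm (tr (F k x) - tr (\<rho> x))) \<longlonglongrightarrow> 0"
      using norm_tr[of "F _ x - \<rho> x"] by simp
    then have "(\<lambda>k. tr (F k x)) \<longlonglongrightarrow> tr (\<rho> x)" by (simp add: tendsto_norm_zero_iff LIM_zero_iff)
    moreover have "(\<lambda>k. tr (F k x)) = (\<lambda>k. F k (inv\<^bsub>H\<^esub> x))" using F(1) x by (auto simp: inva_def approx_hom_def)
    ultimately show ?thesis using \<rho>[of "inv\<^bsub>H\<^esub> x"] x LIMSEQ_unique by auto
  qed
  show ?thesis
  proof (rule that[of \<rho>])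
    show "\<rho> x \<in> orth n" if x: "x \<in> ?C" for x
      using \<rho>m[OF x] hom[of x "inv\<^bsub>H\<^esub> x"] hom[of "inv\<^bsub>H\<^esub> x" x] x \<rho>inv[OF x] one by (simp add: orth_def)
    show "norm (\<rho> x - f x) \<le> 2 * (B + 1) * \<epsilon>" if x: "x \<in> ?C" for x
    proof (rule LIMSEQ_le_const2)
      show "(\<lambda>k. norm (F k x - f x)) \<longlonglongrightarrow> norm (\<rho> x - f x)" by (intro tendsto_intros \<rho> x)
      have "norm (F k x - f x) \<le> 2 * (B + 1) * \<epsilon>" for k
      proof -
        have "2 * (B + 1) * \<epsilon> * (1 - 1 / 2 ^ k) \<le> 2 * (B + 1) * \<epsilon> * 1"
          using B \<epsilon> by (intro mult_left_mono) auto
        then show ?thesis using F(1)[of k] x by (fastforce simp: inva_def)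
      qed
      then show "\<exists>N. \<forall>k\<ge>N. norm (F k x - f x) \<le> 2 * (B + 1) * \<epsilon>" by blast
    qed
  qed (use hom one in auto)
qed

end

text \<open>The tolerance depends on \<open>n\<close> and \<open>\<eta>\<close> alone and serves all
  groups at once. An orthogonal-valued map is first symmetrised into an \<open>approx_hom\<close>
  and then corrected.\<close>

theorem amenable_stability:
  fixes n :: nat and \<eta> :: real
  assumes "\<eta> > 0"
  obtains \<epsilon> where "\<epsilon> > 0"
    "\<And>(H :: 'b monoid) A. group H \<Longrightarrow> amenable H \<Longrightarrow> finite (A ` carrier H) \<Longrightarrow> A ` carrier H \<subseteq> orth n \<Longrightarrow>
      (\<And>x y. x \<in> carrier H \<Longrightarrow> y \<in> carrier H \<Longrightarrow> norm (A (x \<otimes>\<^bsub>H\<^esub> y) - A x * A y) \<le> \<epsilon>) \<Longrightarrow>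
      \<exists>\<rho>. (\<forall>x\<in>carrier H. \<rho> x \<in> orth n \<and> norm (\<rho> x - A x) \<le> \<eta>) \<and> \<rho> \<one>\<^bsub>H\<^esub> = un n \<and>
        (\<forall>x\<in>carrier H. \<forall>y\<in>carrier H. \<rho> (x \<otimes>\<^bsub>H\<^esub> y) = \<rho> x * \<rho> y)"
proof -
  \<comment> \<open>Symmetrised values have norm at most sqrt n + 1 = \<open>B - 1\<close>.
    \<open>K\<close> is the factor by which symmetrisation enlarges the defect, 2 + (B - 1) + sqrt
    n. \<open>D\<close> below dominates every constant to be absorbed under 1 or
    \<open>\<eta>\<close>.\<close>
  define B where "B = sqrt (real n) + 2"
  define K where "K = 3 + 2 * sqrt (real n)"
  have B: "B \<ge> 2" and K: "K \<ge> 3" by (simp_all add: B_def K_def)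
  define D where "D = 2 * (3 + B\<^sup>2) + 4 * (B + 1) + 2"
  define \<epsilon> where "\<epsilon> = min 1 \<eta> / (K * D)"
  have D: "D > 0" using B by (simp add: D_def add_pos_nonneg add_nonneg_pos)
  have KeD: "K * \<epsilon> * D = min 1 \<eta>" using D K by (simp add: \<epsilon>_def)
  have \<epsilon>0: "\<epsilon> > 0" using D K assms by (simp add: \<epsilon>_def)
  have Ke: "0 < K * \<epsilon>" using K \<epsilon>0 by simp
  have part: "K * \<epsilon> * c \<le> min 1 \<eta>" if "c \<le> D" for c
    using mult_left_mono[OF that, of "K * \<epsilon>"] Ke KeD by simp
  have eK: "\<epsilon> \<le> K * \<epsilon>" using K \<epsilon>0 by simp
  show ?thesis
  proof (rule that[OF \<epsilon>0])
    fix H :: "'b monoid" and A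
    assume H: "group H" "amenable H" and fin: "finite (A ` carrier H)" and Ao: "A ` carrier H \<subseteq> orth n"
      and def: "\<And>x y. x \<in> carrier H \<Longrightarrow> y \<in> carrier H \<Longrightarrow> norm (A (x \<otimes>\<^bsub>H\<^esub> y) - A x * A y) \<le> \<epsilon>"
    let ?C = "carrier H"
    obtain \<mu> where "mean_group H \<mu>" by (rule amenable_mean_group[OF H])
    then interpret mean_group H \<mu> .
    have Ax: "A x \<in> orth n" if "x \<in> ?C" for x using Ao that by auto
    note Am = orthD(1)[OF Ax]
    have A1: "norm (A \<one>\<^bsub>H\<^esub> - un n) \<le> \<epsilon>"
    proof -
      have "A \<one>\<^bsub>H\<^esub> - A \<one>\<^bsub>H\<^esub> * A \<one>\<^bsub>H\<^esub> = A \<one>\<^bsub>H\<^esub> * (un n - A \<one>\<^bsub>H\<^esub>)" using Am[of "\<one>\<^bsub>H\<^esub>"] by (simp add: algebra_simps)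
      then have "norm (un n - A \<one>\<^bsub>H\<^esub>) = norm (A (\<one>\<^bsub>H\<^esub> \<otimes>\<^bsub>H\<^esub> \<one>\<^bsub>H\<^esub>) - A \<one>\<^bsub>H\<^esub> * A \<one>\<^bsub>H\<^esub>)"
        using norm_orth_times(1)[OF Ax, of "\<one>\<^bsub>H\<^esub>" "un n - A \<one>\<^bsub>H\<^esub>"] Am[of "\<one>\<^bsub>H\<^esub>"] by (simp add: mats_intros)
      then show ?thesis using def[of "\<one>\<^bsub>H\<^esub>" "\<one>\<^bsub>H\<^esub>"] by (simp add: norm_minus_commute)
    qed
    have Ainv: "norm (tr (A (inv\<^bsub>H\<^esub> x)) - A x) \<le> 2 * \<epsilon>" if x: "x \<in> ?C" for x
    proof -
      let ?y = "inv\<^bsub>H\<^esub> x"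
      have y: "?y \<in> ?C" using x by simp
      have "A x * A ?y * tr (A ?y) = A x" using orthD(2)[OF Ax[OF y]] Am[OF x] by (simp add: mult.assoc)
      then have "A x - tr (A ?y) = (A x * A ?y - un n) * tr (A ?y)"
        using Am[OF y] by (simp add: left_diff_distrib)
      then have "norm (A x - tr (A ?y)) = norm (A x * A ?y - un n)"
        using norm_orth_times(2)[OF orth_tr[OF Ax[OF y]], of "A x * A ?y - un n"] Am[OF x] Am[OF y]
        by (simp add: mats_intros)
      also have "\<dots> \<le> norm (A (x \<otimes>\<^bsub>H\<^esub> ?y) - A x * A ?y) + norm (A \<one>\<^bsub>H\<^esub> - un n)"
        using norm_triangle_ineq4[of "A \<one>\<^bsub>H\<^esub> - un n" "A \<one>\<^bsub>H\<^esub> - A x * A ?y"] x by simp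
      also have "\<dots> \<le> 2 * \<epsilon>" using def[OF x y] A1 by simp
      finally show ?thesis by (simp add: norm_minus_commute)
    qed
    \<comment> \<open>The value at the unit is reset; elsewhere averaging with the transpose at the
      inverse gives the symmetry. Either change costs at most \<open>\<epsilon>\<close>.\<close>
    define f where "f x = (if x = \<one>\<^bsub>H\<^esub> then un n else (1/2) *\<^sub>R (A x + tr (A (inv\<^bsub>H\<^esub> x))))" for x
    have fA: "norm (f x - A x) \<le> \<epsilon>" if x: "x \<in> ?C" for x
    proof (cases "x = \<one>\<^bsub>H\<^esub>")
      case True
      then show ?thesis using A1 by (simp add: f_def norm_minus_commute)
    next
      case False
      have "A x = (1/2) *\<^sub>R (A x + A x)" by (simp add: scaleR_2[symmetric])
      then have "f x - A x = (1/2) *\<^sub>R (A x + tr (A (inv\<^bsub>H\<^esub> x))) - (1/2) *\<^sub>R (A x + A x)"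
        using False by (simp add: f_def)
      also have "\<dots> = (1/2) *\<^sub>R (tr (A (inv\<^bsub>H\<^esub> x)) - A x)"
        unfolding scaleR_diff_right[symmetric] by simp
      finally show ?thesis using Ainv[OF x] by simp
    qed
    have fm: "f x \<in> mats n" if "x \<in> ?C" for x using that Am by (simp add: f_def mats_intros)
    have nA: "norm (A x) = sqrt (real n)" if "x \<in> ?C" for x using norm_orth[OF Ax[OF that]] .
    have "1 \<le> D" using B by (simp add: D_def add_nonneg_nonneg)
    from part[OF this] have Ke1: "K * \<epsilon> \<le> 1" by simp
    have fb: "norm (f x) \<le> B - 1" if "x \<in> ?C" for x
      using norm_triangle_ineq[of "f x - A x" "A x"] fA[OF that] nA[OF that] eK Ke1 by (simp add: B_def)
    have "approx_hom n f (K * \<epsilon>)"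
      unfolding approx_hom_def
    proof (intro conjI ballI)
      have "finite ((\<lambda>x. A (inv\<^bsub>H\<^esub> x)) ` ?C)" by (rule finite_subset[OF _ fin]) auto
      from finite_image_comp2[OF fin this, of "\<lambda>a b. (1/2) *\<^sub>R (a + tr b)"]
      have "finite (insert (un n) ((\<lambda>x. (1/2) *\<^sub>R (A x + tr (A (inv\<^bsub>H\<^esub> x)))) ` ?C))" by simp
      then show "finite (f ` ?C)" by (rule finite_subset[rotated]) (auto simp: f_def)
      show "f ` ?C \<subseteq> mats n" using fm by auto
      show "f \<one>\<^bsub>H\<^esub> = un n" by (simp add: f_def)
      show "f (inv\<^bsub>H\<^esub> x) = tr (f x)" if "x \<in> ?C" for x
        using that by (auto simp: f_def add.commute inv_eq_1_iff)
      fix x y assume x: "x \<in> ?C" and y: "y \<in> ?C"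
      have "f (x \<otimes>\<^bsub>H\<^esub> y) - f x * f y = (f (x \<otimes>\<^bsub>H\<^esub> y) - A (x \<otimes>\<^bsub>H\<^esub> y)) + (A (x \<otimes>\<^bsub>H\<^esub> y) - A x * A y)
         - ((f x - A x) * f y + A x * (f y - A y))" by (simp add: algebra_simps)
      also have "norm \<dots> \<le> norm (f (x \<otimes>\<^bsub>H\<^esub> y) - A (x \<otimes>\<^bsub>H\<^esub> y)) + norm (A (x \<otimes>\<^bsub>H\<^esub> y) - A x * A y)
         + (norm (f x - A x) * norm (f y) + norm (A x) * norm (f y - A y))"
        by (intro order_trans[OF norm_triangle_ineq4] add_mono norm_triangle_ineq order_trans[OF norm_triangle_ineq] norm_mult_ineq)
      also have "\<dots> \<le> \<epsilon> + \<epsilon> + (\<epsilon> * (B - 1) + sqrt (real n) * \<epsilon>)"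
        by (intro add_mono mult_mono fA def fb x y m_closed) (use nA[OF x] \<epsilon>0 in auto)
      also have "\<dots> = K * \<epsilon>" by (simp add: K_def B_def algebra_simps)
      finally show "norm (f (x \<otimes>\<^bsub>H\<^esub> y) - f x * f y) \<le> K * \<epsilon>" .
    qed
    note hom = this
    have "2 * (3 + B\<^sup>2) * (K * \<epsilon>) \<le> 1" "2 * (B + 1) * (K * \<epsilon>) \<le> 1"
    proof -
      have "2 * (3 + B\<^sup>2) \<le> D" "2 * (B + 1) \<le> D" using B by (simp_all add: D_def add_nonneg_nonneg)
      from part[OF this(1)] part[OF this(2)]
      show "2 * (3 + B\<^sup>2) * (K * \<epsilon>) \<le> 1" "2 * (B + 1) * (K * \<epsilon>) \<le> 1" by (simp_all add: mult.commute)
    qed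
    note lims = this
    have B1: "B \<ge> 1" using B by simp
    obtain \<rho> where \<rho>: "\<And>x. x \<in> ?C \<Longrightarrow> \<rho> x \<in> orth n"
      "\<And>x y. x \<in> ?C \<Longrightarrow> y \<in> ?C \<Longrightarrow> \<rho> (x \<otimes>\<^bsub>H\<^esub> y) = \<rho> x * \<rho> y"
      "\<And>x. x \<in> ?C \<Longrightarrow> norm (\<rho> x - f x) \<le> 2 * (B + 1) * (K * \<epsilon>)" "\<rho> \<one>\<^bsub>H\<^esub> = un n"
      using approx_hom_limit[OF hom fb B1 Ke Ke1 lims] by blast
    have "norm (\<rho> x - A x) \<le> \<eta>" if x: "x \<in> ?C" for x
    proof -
      have "norm (\<rho> x - A x) \<le> norm (\<rho> x - f x) + norm (f x - A x)"
        using norm_triangle_ineq[of "\<rho> x - f x" "f x - A x"] by simp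
      also have "\<dots> \<le> K * \<epsilon> * (2 * (B + 1) + 1)" using \<rho>(3)[OF x] fA[OF x] eK by (simp add: algebra_simps)
      also have "\<dots> \<le> min 1 \<eta>" using B by (intro part) (simp add: D_def add_nonneg_nonneg)
      finally show ?thesis by simp
    qed
    then show "\<exists>\<rho>. (\<forall>x\<in>?C. \<rho> x \<in> orth n \<and> norm (\<rho> x - A x) \<le> \<eta>) \<and> \<rho> \<one>\<^bsub>H\<^esub> = un n \<and>
        (\<forall>x\<in>?C. \<forall>y\<in>?C. \<rho> (x \<otimes>\<^bsub>H\<^esub> y) = \<rho> x * \<rho> y)" using \<rho> by blast
  qed
qed

section \<open>Approximations of a compact group and the Haar functional\<close>

lemma open_left_translate: "open W \<Longrightarrow> open {k. a + k \<in> W}" for a :: "'k::topological_group_add"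
  using open_vimage[of W "\<lambda>k. a + k"] by (simp add: vimage_def continuous_on_add continuous_on_id)

lemma open_left_uminus: "open W \<Longrightarrow> open {k. - k + a \<in> W}" for a :: "'k::topological_group_add"
  using open_vimage[of W "\<lambda>k. - k + a"] by (simp add: vimage_def continuous_on_add continuous_on_minus continuous_on_id)

lemma nhds_sum:
  fixes W :: "'k::topological_group_add set"
  assumes "open W" "0 \<in> W"
  shows "\<exists>V. open V \<and> 0 \<in> V \<and> (\<forall>a\<in>V. \<forall>b\<in>V. a + b \<in> W) \<and> (\<forall>a\<in>V. - a \<in> V) \<and> V \<subseteq> W"
proof -
  have "open ((\<lambda>(a, b). a + b) -` W)"
    by (rule open_vimage[OF assms(1)]) (auto simp: case_prod_unfold intro!: continuous_intros)
  moreover have "(0, 0) \<in> (\<lambda>(a, b). a + b) -` W" using assms(2) by simp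
  ultimately obtain A B where AB: "open A" "open B" "(0, 0) \<in> A \<times> B" "A \<times> B \<subseteq> (\<lambda>(a, b). a + b) -` W"
    by (rule open_prod_elim)
  define V where "V = (A \<inter> B) \<inter> uminus -` (A \<inter> B)"
  have "open V" unfolding V_def using AB by (intro open_Int open_vimage continuous_intros) auto
  moreover have "0 \<in> V" using AB by (auto simp: V_def)
  moreover have V2: "a + b \<in> W" if "a \<in> V" "b \<in> V" for a b using that AB by (auto simp: V_def)
  moreover have "- a \<in> V" if "a \<in> V" for a using that by (auto simp: V_def)
  moreover have "V \<subseteq> W" using V2[OF _ \<open>0 \<in> V\<close>] by auto
  ultimately show ?thesis by blast
qed

text \<open>Over compact \<open>K\<close>, an open condition valid at \<open>w = 0\<close> for every
  \<open>k\<close> holds uniformly for \<open>w\<close> near 0. Control of conjugates and two-sided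
  uniform continuity are instances.\<close>

lemma nhds_tube:
  fixes f :: "'k::topological_group_add \<times> 'k \<Rightarrow> 'c::topological_space"
  assumes K: "compact (UNIV :: 'k set)" and f: "continuous_on UNIV f" and S: "open S" "\<And>k. f (0, k) \<in> S"
  shows "\<exists>V. open V \<and> 0 \<in> V \<and> (\<forall>w\<in>V. \<forall>k. f (w, k) \<in> S)"
proof -
  have "open (f -` S)" using f S(1) by (rule open_vimage[rotated])
  moreover have "{0} \<times> UNIV \<subseteq> f -` S" using S(2) by auto
  ultimately obtain X0 where "0 \<in> X0" "open X0" "X0 \<times> UNIV \<subseteq> f -` S"
    using Elementary_Topology.tube_lemma[OF K] by metis
  then show ?thesis by (intro exI[of _ X0]) auto
qed

lemma nhds_conj:
  fixes W :: "'k::topological_group_add set"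
  assumes K: "compact (UNIV :: 'k set)" and W: "open W" "0 \<in> W"
  shows "\<exists>V. open V \<and> 0 \<in> V \<and> (\<forall>w\<in>V. \<forall>k. - k + w + k \<in> W)"
proof -
  have "continuous_on UNIV (\<lambda>p::'k \<times> 'k. - snd p + fst p + snd p)" by (intro continuous_intros)
  from nhds_tube[OF K this W(1)] show ?thesis using W(2) by simp
qed

lemma uniformly_continuous_group:
  fixes \<phi> :: "'k::topological_group_add \<Rightarrow> real"
  assumes K: "compact (UNIV :: 'k set)" and \<phi>: "continuous_on UNIV \<phi>" and "\<epsilon> > 0"
  shows "\<exists>W. open W \<and> 0 \<in> W \<and> (\<forall>w\<in>W. \<forall>s. \<bar>\<phi> (s + w) - \<phi> s\<bar> < \<epsilon> \<and> \<bar>\<phi> (w + s) - \<phi> s\<bar> < \<epsilon>)"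
proof -
  have c: "continuous_on UNIV (\<lambda>p. \<phi> (g p))" if "continuous_on UNIV g" for g :: "'k \<times> 'k \<Rightarrow> 'k"
    by (rule continuous_on_compose2[OF \<phi> that]) auto
  have "continuous_on UNIV (\<lambda>p::'k \<times> 'k. \<bar>\<phi> (snd p + fst p) - \<phi> (snd p)\<bar>)"
    by (intro continuous_intros c)
  from nhds_tube[OF K this, of "{..<\<epsilon>}"] obtain V1 where V1: "open V1 \<and> 0 \<in> V1 \<and> (\<forall>w\<in>V1. \<forall>s. \<bar>\<phi> (s + w) - \<phi> s\<bar> < \<epsilon>)"
    using \<open>\<epsilon> > 0\<close> by (simp only: lessThan_iff fst_conv snd_conv) auto
  have "continuous_on UNIV (\<lambda>p::'k \<times> 'k. \<bar>\<phi> (fst p + snd p) - \<phi> (snd p)\<bar>)"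
    by (intro continuous_intros c)
  from nhds_tube[OF K this, of "{..<\<epsilon>}"] obtain V2 where V2: "open V2 \<and> 0 \<in> V2 \<and> (\<forall>w\<in>V2. \<forall>s. \<bar>\<phi> (w + s) - \<phi> s\<bar> < \<epsilon>)"
    using \<open>\<epsilon> > 0\<close> by (simp only: lessThan_iff fst_conv snd_conv) auto
  show ?thesis by (rule exI[of _ "V1 \<inter> V2"]) (use V1 V2 in auto)
qed

text \<open>The group is written additively without being commutative:
  \<open>- a + b \<in> W\<close> says that b lies in the left translate of \<open>W\<close> by
  a.\<close>

definition approximates :: "'b monoid \<Rightarrow> ('b \<Rightarrow> 'k::topological_group_add) \<Rightarrow> 'k set \<Rightarrow> bool" where
  "approximates H f W \<longleftrightarrow> finite (f ` carrier H) \<and>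
     (\<forall>x\<in>carrier H. \<forall>y\<in>carrier H. - (f x + f y) + f (x \<otimes>\<^bsub>H\<^esub> y) \<in> W) \<and>
     (\<forall>k. \<exists>h\<in>carrier H. - f h + k \<in> W)"

text \<open>Finitely many translates cover \<open>K\<close>; definability thickens their preimages
  to definable cells of \<open>G\<close>. After the transfer each \<open>h\<close> is sent to the
  centre of a cell containing it. Overlaps and products in the factor have witnesses in
  \<open>G\<close>, where \<open>\<tau>\<close> is an exact homomorphism, so the centres multiply
  correctly up to the size of the cells.\<close>

lemma definable_compactification_approximates:
  fixes L :: "('f, 'r) language" and \<tau> :: "'a \<Rightarrow> 'k::{topological_group_add, t2_space}"
    and N :: "'i \<Rightarrow> ('f, 'r, 'b) fo_structure" and H :: "'i \<Rightarrow> 'b monoid"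
  assumes M: "expands_group L m M G" and U: "is_ultrafilter U"
    and N: "\<And>i. expands_group L m (N i) (H i)"
    and el: "elementarily_equivalent L M (ultraproduct U N)"
    and \<tau>: "definable_compactification L M G \<tau>"
    and W: "open W" "0 \<in> (W :: 'k set)"
  shows "\<exists>i f. approximates (H i) f W"
proof -
  have K: "compact (UNIV :: 'k set)" and hom: "\<And>x y. x \<in> carrier G \<Longrightarrow> y \<in> carrier G \<Longrightarrow> \<tau> (x \<otimes>\<^bsub>G\<^esub> y) = \<tau> x + \<tau> y"
    and dense: "closure (\<tau> ` carrier G) = UNIV"
    and sep: "\<And>D V. closed D \<Longrightarrow> open V \<Longrightarrow> D \<subseteq> V \<Longrightarrow>
       \<exists>X. definable L M X \<and> {x \<in> carrier G. \<tau> x \<in> D} \<subseteq> X \<and> X \<subseteq> {x \<in> carrier G. \<tau> x \<in> V}"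
    using \<tau> unfolding definable_compactification_def compactification_def by auto
  \<comment> \<open>Sizes: \<open>Vd\<close> halves \<open>V\<close> so that closures of cells fit,
    \<open>V\<close> is halved inside \<open>Wb\<close> and \<open>Wc\<close>, \<open>Wc\<close>
    absorbs a conjugation into \<open>Wb\<close>, and \<open>Wb\<close> and \<open>Wa\<close> leave
    room for adding the errors up to \<open>W\<close>.\<close>
  from nhds_sum[OF W] obtain Wa where Wa': "open Wa \<and> 0 \<in> Wa \<and> (\<forall>a\<in>Wa. \<forall>b\<in>Wa. a + b \<in> W) \<and> (\<forall>a\<in>Wa. - a \<in> Wa) \<and> Wa \<subseteq> W" by (rule exE)
  then have Wa: "open Wa" "0 \<in> Wa" "\<And>a b. a \<in> Wa \<Longrightarrow> b \<in> Wa \<Longrightarrow> a + b \<in> W" "\<And>a. a \<in> Wa \<Longrightarrow> - a \<in> Wa" "Wa \<subseteq> W" by simp_all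
  from nhds_sum[OF Wa(1,2)] obtain Wb where Wb': "open Wb \<and> 0 \<in> Wb \<and> (\<forall>a\<in>Wb. \<forall>b\<in>Wb. a + b \<in> Wa) \<and> (\<forall>a\<in>Wb. - a \<in> Wb) \<and> Wb \<subseteq> Wa" by (rule exE)
  then have Wb: "open Wb" "0 \<in> Wb" "\<And>a b. a \<in> Wb \<Longrightarrow> b \<in> Wb \<Longrightarrow> a + b \<in> Wa" "\<And>a. a \<in> Wb \<Longrightarrow> - a \<in> Wb" "Wb \<subseteq> Wa" by simp_all
  from nhds_conj[OF K Wb(1,2)] obtain Wc where Wc': "open Wc \<and> 0 \<in> Wc \<and> (\<forall>w\<in>Wc. \<forall>k. - k + w + k \<in> Wb)" by (rule exE)
  then have Wc: "open Wc" "0 \<in> Wc" "\<And>w k. w \<in> Wc \<Longrightarrow> - k + w + k \<in> Wb" by simp_all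
  from nhds_sum[OF open_Int[OF Wb(1) Wc(1)] IntI[OF Wb(2) Wc(2)]] obtain V where V_props: "open V \<and> 0 \<in> V \<and> (\<forall>a\<in>V. \<forall>b\<in>V. a + b \<in> (Wb \<inter> Wc)) \<and> (\<forall>a\<in>V. - a \<in> V) \<and> V \<subseteq> (Wb \<inter> Wc)" by (rule exE)
  then have V: "open V" "0 \<in> V" "\<And>a b. a \<in> V \<Longrightarrow> b \<in> V \<Longrightarrow> a + b \<in> (Wb \<inter> Wc)" "\<And>a. a \<in> V \<Longrightarrow> - a \<in> V" "V \<subseteq> (Wb \<inter> Wc)" by simp_all
  from nhds_sum[OF V(1,2)] obtain Vd where Vd': "open Vd \<and> 0 \<in> Vd \<and> (\<forall>a\<in>Vd. \<forall>b\<in>Vd. a + b \<in> V) \<and> (\<forall>a\<in>Vd. - a \<in> Vd) \<and> Vd \<subseteq> V" by (rule exE)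
  then have Vd: "open Vd" "0 \<in> Vd" "\<And>a b. a \<in> Vd \<Longrightarrow> b \<in> Vd \<Longrightarrow> a + b \<in> V" "\<And>a. a \<in> Vd \<Longrightarrow> - a \<in> Vd" "Vd \<subseteq> V" by simp_all
  define P where "P v = {k. - v + k \<in> Vd}" for v :: 'k
  have Popen: "open (P v)" for v unfolding P_def by (rule open_left_translate[OF Vd(1)])
  have Pself: "v \<in> P v" for v using Vd(2) by (simp add: P_def)
  have clP: "closure (P v) \<subseteq> {k. - v + k \<in> V}" for v
  proof
    fix k assume k: "k \<in> closure (P v)"
    have "open {k'. - k' + k \<in> Vd}" "k \<in> {k'. - k' + k \<in> Vd}" using open_left_uminus[OF Vd(1)] Vd(2) by auto
    then obtain k' where "k' \<in> P v" "- k' + k \<in> Vd" using k unfolding closure_iff_nhds_not_empty by blast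
    then have "(- v + k') + (- k' + k) \<in> V" by (intro Vd(3)) (auto simp: P_def)
    then show "k \<in> {k. - v + k \<in> V}" by (simp add: add.assoc)
  qed
  have "UNIV \<subseteq> (\<Union>v\<in>UNIV. P v)" using Pself by auto
  then obtain C where C: "C \<subseteq> UNIV" "finite C" "UNIV \<subseteq> (\<Union>v\<in>C. P v)"
    by (rule compactE_image[OF K Popen])
  obtain vs where vs: "set vs = C" using finite_list[OF C(2)] by blast
  define n where "n = length vs"
  define v where "v j = vs ! j" for j
  have cover: "\<exists>j<n. k \<in> P (v j)" for k
  proof -
    have "k \<in> (\<Union>v\<in>C. P v)" using C(3) by auto
    then show ?thesis by (auto simp: v_def n_def vs[symmetric] in_set_conv_nth)
  qed
  have "\<forall>u. \<exists>X. definable L M X \<and> {x \<in> carrier G. \<tau> x \<in> closure (P u)} \<subseteq> X \<and> X \<subseteq> {x \<in> carrier G. \<tau> x \<in> {k. - u + k \<in> V}}"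
    by (intro allI sep closed_closure open_left_translate[OF V(1)] clP)
  from choice[OF this] obtain X0 where X0': "\<forall>u. definable L M (X0 u) \<and> {x \<in> carrier G. \<tau> x \<in> closure (P u)} \<subseteq> (X0 u) \<and> (X0 u) \<subseteq> {x \<in> carrier G. \<tau> x \<in> {k. - u + k \<in> V}}"
    by (rule exE)
  have X0: "definable L M (X0 u)" "{x \<in> carrier G. \<tau> x \<in> closure (P u)} \<subseteq> X0 u"
    "X0 u \<subseteq> {x \<in> carrier G. \<tau> x \<in> {k. - u + k \<in> V}}" for u
    using spec[OF X0', of u] by simp_all
  define X where "X j = X0 (v j)" for j
  have XV: "x \<in> carrier G" "- v j + \<tau> x \<in> V" if "x \<in> X j" for x j using X0(3) that by (auto simp: X_def)
  have PX: "x \<in> X j" if "x \<in> carrier G" "\<tau> x \<in> P (v j)" for x j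
  proof -
    have "\<tau> x \<in> closure (P (v j))" using that(2) closure_subset by blast
    then show ?thesis using X0(2) that(1) by (auto simp: X_def)
  qed
  have Xdef: "definable L M (X j)" for j by (simp add: X_def X0)
  have Xcover: "(\<Union>j<n. X j) = carrier G"
  proof
    show "carrier G \<subseteq> (\<Union>j<n. X j)"
    proof
      fix x assume x: "x \<in> carrier G"
      obtain j where "j < n" "\<tau> x \<in> P (v j)" using cover by blast
      then show "x \<in> (\<Union>j<n. X j)" using PX[OF x] by blast
    qed
  qed (use XV in blast)
  have Xne: "X j \<noteq> {}" for j
  proof -
    \<comment> \<open>Density makes every cell nonempty, hence after the transfer every centre close
      to a value of \<open>f\<close>.\<close>
    have "v j \<in> closure (\<tau> ` carrier G)" using dense by simp
    then obtain x where "x \<in> carrier G" "\<tau> x \<in> P (v j)"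
      using Popen Pself unfolding closure_iff_nhds_not_empty by blast
    then show ?thesis using PX by blast
  qed
  obtain i Y where Y: "(\<Union>j<n. Y j) = carrier (H i)" "\<And>j. j < n \<Longrightarrow> Y j \<noteq> {}"
    "\<And>a b. a < n \<Longrightarrow> b < n \<Longrightarrow> Y a \<inter> Y b \<noteq> {} \<Longrightarrow> X a \<inter> X b \<noteq> {}"
    "\<And>a b c x y. a < n \<Longrightarrow> b < n \<Longrightarrow> c < n \<Longrightarrow> x \<in> Y a \<Longrightarrow> y \<in> Y b \<Longrightarrow> x \<otimes>\<^bsub>H i\<^esub> y \<in> Y c \<Longrightarrow>
       \<exists>x'\<in>X a. \<exists>y'\<in>X b. x' \<otimes>\<^bsub>G\<^esub> y' \<in> X c"
    by (rule definable_cover_transfer[OF U M N el Xdef Xcover Xne]) blast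
  have "\<forall>h. \<exists>j. h \<in> carrier (H i) \<longrightarrow> j < n \<and> h \<in> Y j" using Y(1) by blast
  then obtain J where J: "\<And>h. h \<in> carrier (H i) \<Longrightarrow> J h < n \<and> h \<in> Y (J h)" by metis
  define f where "f h = v (J h)" for h
  have "group (H i)" using N by (auto simp: expands_group_def)
  then interpret Hi: group "H i" .
  have "approximates (H i) f W" unfolding approximates_def
  proof (intro conjI ballI allI)
    have "f ` carrier (H i) \<subseteq> v ` {..<n}" using J by (auto simp: f_def)
    then show "finite (f ` carrier (H i))" by (rule finite_subset) auto
  next
    fix x y assume x: "x \<in> carrier (H i)" and y: "y \<in> carrier (H i)"
    obtain x' y' where xy': "x' \<in> X (J x)" "y' \<in> X (J y)" "x' \<otimes>\<^bsub>G\<^esub> y' \<in> X (J (x \<otimes>\<^bsub>H i\<^esub> y))"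
      using Y(4) J x y Hi.m_closed[OF x y] by meson
    define w1 where "w1 = - f x + \<tau> x'"
    define w2 where "w2 = - f y + \<tau> y'"
    define w3 where "w3 = - f (x \<otimes>\<^bsub>H i\<^esub> y) + \<tau> (x' \<otimes>\<^bsub>G\<^esub> y')"
    have w: "w1 \<in> V" "w2 \<in> V" "w3 \<in> V" using XV(2) xy' by (auto simp: w1_def w2_def w3_def f_def)
    have t: "\<tau> x' = f x + w1" "\<tau> y' = f y + w2" by (simp_all add: w1_def w2_def add.assoc[symmetric])
    have "\<tau> (x' \<otimes>\<^bsub>G\<^esub> y') = f (x \<otimes>\<^bsub>H i\<^esub> y) + w3" by (simp add: w3_def add.assoc[symmetric])
    moreover have "\<tau> (x' \<otimes>\<^bsub>G\<^esub> y') = f x + w1 + (f y + w2)" using hom XV(1) xy' t by metis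
    ultimately have "f (x \<otimes>\<^bsub>H i\<^esub> y) = f x + w1 + (f y + w2) + - w3" by (simp add: add.assoc)
    \<comment> \<open>Moving \<open>w1\<close> past \<open>f y\<close> conjugates it, which is where
      \<open>Wc\<close> is needed.\<close>
    then have "- (f x + f y) + f (x \<otimes>\<^bsub>H i\<^esub> y) = (- f y + w1 + f y) + (w2 + - w3)"
      by (simp add: minus_add add.assoc diff_conv_add_uminus del: add_uminus_conv_diff)
    moreover have "- f y + w1 + f y \<in> Wb" using Wc(3) V(5) w(1) by blast
    moreover have "w2 + - w3 \<in> Wa" using Wb(3) V(4,5) w by blast
    ultimately show "- (f x + f y) + f (x \<otimes>\<^bsub>H i\<^esub> y) \<in> W" using Wa(3) Wb(5) by auto
  next
    fix k
    obtain j where j: "j < n" "k \<in> P (v j)" using cover by blast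
    obtain h where h: "h \<in> Y j" using Y(2)[OF j(1)] by blast
    then have hc: "h \<in> carrier (H i)" using Y(1) j(1) by blast
    obtain x where x: "x \<in> X j" "x \<in> X (J h)" using Y(3)[OF j(1), of "J h"] J[OF hc] h by blast
    have "- f h + k = ((- f h + \<tau> x) + - (- v j + \<tau> x)) + (- v j + k)"
      by (simp add: minus_add add.assoc diff_conv_add_uminus del: add_uminus_conv_diff)
    moreover have "(- f h + \<tau> x) + - (- v j + \<tau> x) \<in> Wa"
      using XV(2)[OF x(1)] XV(2)[OF x(2)] V(4,5) Wb(3) unfolding f_def by blast
    moreover have "- v j + k \<in> Wa" using j(2) Vd(5) V(5) Wb(5) by (auto simp: P_def)
    ultimately have "- f h + k \<in> W" using Wa(3) by metis
    with hc show "\<exists>h\<in>carrier (H i). - f h + k \<in> W" by (rule bexI[rotated])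
  qed
  then show ?thesis by blast
qed

text \<open>Left Haar measure in the form of a functional on continuous functions, as delivered by a
  pointwise limit of means; nothing is asserted for other functions.\<close>

locale haar_functional =
  fixes m :: "('k::{topological_group_add, t2_space} \<Rightarrow> real) \<Rightarrow> real"
  assumes compact_UNIV: "compact (UNIV :: 'k set)"
    and add: "continuous_on UNIV \<phi> \<Longrightarrow> continuous_on UNIV \<psi> \<Longrightarrow> m (\<lambda>x. \<phi> x + \<psi> x) = m \<phi> + m \<psi>"
    and scale: "continuous_on UNIV \<phi> \<Longrightarrow> m (\<lambda>x. c * \<phi> x) = c * m \<phi>"
    and const_1: "m (\<lambda>x. 1) = 1"
    and nonneg: "continuous_on UNIV \<phi> \<Longrightarrow> (\<And>x. 0 \<le> \<phi> x) \<Longrightarrow> 0 \<le> m \<phi>"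
    and invariant: "continuous_on UNIV \<phi> \<Longrightarrow> m (\<lambda>x. \<phi> (- k + x)) = m \<phi>"

text \<open>The mean of \<open>H\<close> is pushed forward along \<open>f\<close>; the finite image
  lets it act on every function. Invariance holds up to \<open>2 * \<delta>\<close>: one
  \<open>\<delta>\<close> for replacing \<open>k\<close> by a value of \<open>f\<close>, one for the
  failure of \<open>f\<close> to be multiplicative.\<close>

lemma approximates_mean:
  fixes f :: "'b \<Rightarrow> 'k::topological_group_add"
  assumes H: "group H" "amenable H" and f: "approximates H f W"
  shows "\<exists>m :: ('k \<Rightarrow> real) \<Rightarrow> real. (\<forall>\<phi> \<psi>. m (\<lambda>x. \<phi> x + \<psi> x) = m \<phi> + m \<psi>) \<and> (\<forall>c \<phi>. m (\<lambda>x. c * \<phi> x) = c * m \<phi>) \<and>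
    m (\<lambda>x. 1) = 1 \<and> (\<forall>\<phi>. (\<forall>x. 0 \<le> \<phi> x) \<longrightarrow> 0 \<le> m \<phi>) \<and> (\<forall>\<phi> c. (\<forall>x. \<bar>\<phi> x\<bar> \<le> c) \<longrightarrow> \<bar>m \<phi>\<bar> \<le> c) \<and>
    (\<forall>\<phi> \<delta> k. (\<forall>s. \<forall>w\<in>W. \<bar>\<phi> (s + w) - \<phi> s\<bar> \<le> \<delta> \<and> \<bar>\<phi> (w + s) - \<phi> s\<bar> \<le> \<delta>) \<longrightarrow> \<bar>m (\<lambda>x. \<phi> (- k + x)) - m \<phi>\<bar> \<le> 2 * \<delta>)"
proof -
  obtain \<mu> where "mean_group H \<mu>" by (rule amenable_mean_group[OF H])
  then interpret mean_group H \<mu> .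
  have fin: "finite (f ` carrier H)" and app: "\<And>x y. x \<in> carrier H \<Longrightarrow> y \<in> carrier H \<Longrightarrow> - (f x + f y) + f (x \<otimes>\<^bsub>H\<^esub> y) \<in> W"
    and dn: "\<And>k. \<exists>h\<in>carrier H. - f h + k \<in> W" using f unfolding approximates_def by auto
  have fin': "finite ((\<lambda>x. \<phi> (f x)) ` carrier H)" for \<phi> :: "'k \<Rightarrow> real"
    using finite_imageI[OF fin, of \<phi>] by (simp add: image_image)
  define m where "m \<phi> = mint (\<lambda>x. \<phi> (f x))" for \<phi> :: "'k \<Rightarrow> real"
  have "\<bar>m (\<lambda>x. \<phi> (- k + x)) - m \<phi>\<bar> \<le> 2 * \<delta>"
    if \<phi>: "\<forall>s. \<forall>w\<in>W. \<bar>\<phi> (s + w) - \<phi> s\<bar> \<le> \<delta> \<and> \<bar>\<phi> (w + s) - \<phi> s\<bar> \<le> \<delta>" for \<phi> \<delta> k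
  proof -
    \<comment> \<open>Translation by \<open>k\<close> is compared with translation by
      \<open>h\<close> in the group, under which the mean is exactly invariant.\<close>
    obtain h where h: "h \<in> carrier H" "- f h + k \<in> W" using dn by blast
    let ?g = "\<lambda>x. inv\<^bsub>H\<^esub> h \<otimes>\<^bsub>H\<^esub> x"
    have m2: "m \<phi> = mint (\<lambda>x. \<phi> (f (?g x)))"
      unfolding m_def by (rule mint_translate[symmetric]) (use h in simp)
    have fin2: "finite ((\<lambda>x. \<phi> (f (?g x))) ` carrier H)"
      by (rule finite_subset[OF _ fin'[of \<phi>]]) (use h in auto)
    have "m (\<lambda>x. \<phi> (- k + x)) - m \<phi> = mint (\<lambda>x. \<phi> (- k + f x) - \<phi> (f (?g x)))"
      using mint_diff[OF fin'[of "\<lambda>x. \<phi> (- k + x)"] fin2] m2 by (simp add: m_def)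
    moreover have "norm \<dots> \<le> 2 * \<delta>"
    proof (rule norm_mint_le)
      show "finite ((\<lambda>x. \<phi> (- k + f x) - \<phi> (f (?g x))) ` carrier H)"
        by (rule finite_image_comp2[OF fin'[of "\<lambda>x. \<phi> (- k + x)"] fin2])
      fix x assume x: "x \<in> carrier H"
      have gx: "?g x \<in> carrier H" using x h by simp
      have hg: "h \<otimes>\<^bsub>H\<^esub> ?g x = x" using x h by (simp add: m_assoc[symmetric])
      have w: "- (f h + f (?g x)) + f x \<in> W" using app[OF h(1) gx] hg by simp
      have "f (?g x) + (- (f h + f (?g x)) + f x) = - f h + f x" by (simp add: minus_add add.assoc diff_conv_add_uminus del: add_uminus_conv_diff)
      then have 1: "\<bar>\<phi> (- f h + f x) - \<phi> (f (?g x))\<bar> \<le> \<delta>" using \<phi> w by metis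
      have "(- f h + k) + (- k + f x) = - f h + f x" by (simp add: add.assoc)
      then have 2: "\<bar>\<phi> (- f h + f x) - \<phi> (- k + f x)\<bar> \<le> \<delta>" using \<phi> h(2) by metis
      show "norm (\<phi> (- k + f x) - \<phi> (f (?g x))) \<le> 2 * \<delta>" using 1 2 by simp
    qed
    ultimately show ?thesis by simp
  qed
  moreover have "m (\<lambda>x. \<phi> x + \<psi> x) = m \<phi> + m \<psi>" for \<phi> \<psi> unfolding m_def by (rule mint_add[OF fin' fin'])
  moreover have "m (\<lambda>x. c * \<phi> x) = c * m \<phi>" for c \<phi>
    using mint_linear[of "\<lambda>x::real. c * x", OF _ fin'[of \<phi>]] by (simp add: m_def linear_times)
  moreover have "m (\<lambda>x. 1) = 1" by (simp add: m_def mint_const)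
  moreover have "0 \<le> m \<phi>" if "\<forall>x. 0 \<le> \<phi> x" for \<phi> unfolding m_def using that by (intro mint_nonneg) auto
  moreover have "\<bar>m \<phi>\<bar> \<le> c" if "\<forall>x. \<bar>\<phi> x\<bar> \<le> c" for \<phi> c
    using norm_mint_le[OF fin'[of \<phi>], of c] that by (simp add: m_def)
  ultimately show ?thesis by (intro exI[of _ m]) blast
qed

text \<open>Functionals bounded by the supremum norm lie in a product of compact intervals. By
  Tychonoff the approximate means cluster as \<open>W\<close> shrinks, and each axiom, up to any
  positive error in the case of invariance, is a closed condition on finitely many
  coordinates.\<close>

lemma haar_functional_exists:
  assumes K: "compact (UNIV :: 'k::{topological_group_add, t2_space} set)"
    and app: "\<And>W :: 'k set. open W \<Longrightarrow> 0 \<in> W \<Longrightarrow> \<exists>(H :: 'b monoid) f. group H \<and> amenable H \<and> approximates H f W"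
  shows "\<exists>m :: ('k \<Rightarrow> real) \<Rightarrow> real. haar_functional m"
proof -
  let ?I = "{W :: 'k set. open W \<and> 0 \<in> W}"
  define P where "P W m \<longleftrightarrow> (\<forall>\<phi> \<psi>. m (\<lambda>x. \<phi> x + \<psi> x) = m \<phi> + m \<psi>) \<and> (\<forall>c \<phi>. m (\<lambda>x. c * \<phi> x) = c * m \<phi>) \<and>
    m (\<lambda>x. 1) = 1 \<and> (\<forall>\<phi>. (\<forall>x. 0 \<le> \<phi> x) \<longrightarrow> 0 \<le> m \<phi>) \<and> (\<forall>\<phi> c. (\<forall>x. \<bar>\<phi> x\<bar> \<le> c) \<longrightarrow> \<bar>m \<phi>\<bar> \<le> c) \<and>
    (\<forall>\<phi> \<delta> k. (\<forall>s. \<forall>w\<in>W. \<bar>\<phi> (s + w) - \<phi> s\<bar> \<le> \<delta> \<and> \<bar>\<phi> (w + s) - \<phi> s\<bar> \<le> \<delta>) \<longrightarrow> \<bar>m (\<lambda>x. \<phi> (- k + x)) - m \<phi>\<bar> \<le> 2 * \<delta>)" for W :: "'k set" and m :: "('k \<Rightarrow> real) \<Rightarrow> real"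
  have "\<exists>m. P W m" if "W \<in> ?I" for W
  proof -
    from that have "open W" "0 \<in> W" by auto
    from app[OF this] obtain H :: "'b monoid" and f where "group H \<and> amenable H \<and> approximates H f W" by (elim exE)
    then have H: "group H" "amenable H" "approximates H f W" by simp_all
    show ?thesis using approximates_mean[OF H] by (simp only: P_def)
  qed
  then have "\<forall>W\<in>?I. \<exists>m. P W m" by blast
  from bchoice[OF this] obtain mm where "\<forall>W\<in>?I. P W (mm W)" by (rule exE)
  then have mmP: "\<And>W. W \<in> ?I \<Longrightarrow> P W (mm W)" by (rule bspec)
  note mm = mmP[unfolded P_def]
  note mm_add = mm[THEN conjunct1, THEN spec, THEN spec]
    and mm_scale = mm[THEN conjunct2, THEN conjunct1, THEN spec, THEN spec]
    and mm_1 = mm[THEN conjunct2, THEN conjunct2, THEN conjunct1]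
    and mm_nonneg = mm[THEN conjunct2, THEN conjunct2, THEN conjunct2, THEN conjunct1, THEN spec, THEN mp]
    and mm_bound = mm[THEN conjunct2, THEN conjunct2, THEN conjunct2, THEN conjunct2, THEN conjunct1, THEN spec, THEN spec, THEN mp]
    and mm_inv = mm[THEN conjunct2, THEN conjunct2, THEN conjunct2, THEN conjunct2, THEN conjunct2, THEN spec, THEN spec, THEN spec, THEN mp]
  \<comment> \<open>Off the continuous functions the means are set to 0, so that they lie in the box
    \<open>S\<close> although \<open>c\<close> bounds nothing there.\<close>
  define M where "M W \<phi> = (if continuous_on UNIV \<phi> then mm W \<phi> else 0)" for W \<phi>
  have "\<exists>c. continuous_on UNIV \<phi> \<longrightarrow> (\<forall>x. \<bar>\<phi> x\<bar> \<le> c)" for \<phi> :: "'k \<Rightarrow> real"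
  proof (cases "continuous_on UNIV \<phi>")
    case True
    then have "bounded (range \<phi>)" using K compact_continuous_image compact_imp_bounded by blast
    then show ?thesis by (auto simp: bounded_iff)
  qed blast
  then have "\<forall>\<phi> :: 'k \<Rightarrow> real. \<exists>c. continuous_on UNIV \<phi> \<longrightarrow> (\<forall>x. \<bar>\<phi> x\<bar> \<le> c)" by (rule allI)
  from choice[OF this] obtain c where c': "\<forall>\<phi> :: 'k \<Rightarrow> real. continuous_on UNIV \<phi> \<longrightarrow> (\<forall>x. \<bar>\<phi> x\<bar> \<le> c \<phi>)"
    by (rule exE)
  then have c: "\<And>\<phi> x. continuous_on UNIV \<phi> \<Longrightarrow> \<bar>\<phi> x :: real\<bar> \<le> c \<phi>" by blast
  define S where "S = Pi\<^sub>E UNIV (\<lambda>\<phi> :: 'k \<Rightarrow> real. {- \<bar>c \<phi>\<bar>..\<bar>c \<phi>\<bar>})"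
  have "compactin (product_topology (\<lambda>_. euclidean) UNIV) S"
    unfolding S_def by (subst compactin_PiE) auto
  then have S: "compact S" by (simp add: euclidean_product_topology)
  have MS: "M W \<in> S" if "W \<in> ?I" for W
  proof -
    have "\<bar>M W \<phi>\<bar> \<le> \<bar>c \<phi>\<bar>" for \<phi>
    proof (cases "continuous_on UNIV \<phi>")
      case True
      then have "\<bar>mm W \<phi>\<bar> \<le> c \<phi>" using mm_bound[OF that] c[OF True] by simp
      then show ?thesis using True by (simp add: M_def)
    qed (simp add: M_def)
    then show ?thesis unfolding S_def by (auto simp: abs_le_iff) (meson minus_le_iff)
  qed
  define F where "F W = closure (M ` {W' \<in> ?I. W' \<subseteq> W})" for W
  have "S \<inter> (\<Inter>W\<in>?I. F W) \<noteq> {}"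
  proof (rule compact_imp_fip_image[OF S])
    fix I' assume I': "finite I'" "I' \<subseteq> ?I"
    \<comment> \<open>A finite intersection of neighbourhoods is again an index, which gives the
      finite intersection property.\<close>
    have W0: "\<Inter>I' \<in> ?I" using I' by auto
    then have "M (\<Inter>I') \<in> F W" if "W \<in> I'" for W
      unfolding F_def using that by (intro subsetD[OF closure_subset]) auto
    then show "S \<inter> (\<Inter>W\<in>I'. F W) \<noteq> {}" using MS[OF W0] by blast
  qed (simp add: F_def)
  then have "\<exists>\<Phi>. \<Phi> \<in> S \<inter> (\<Inter>W\<in>?I. F W)" by (simp only: ex_in_conv not_False_eq_True)
  then obtain \<Phi> where "\<Phi> \<in> S \<inter> (\<Inter>W\<in>?I. F W)" by (rule exE)
  then have \<Phi>: "\<And>W. W \<in> ?I \<Longrightarrow> \<Phi> \<in> F W" by simp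
  have lim: "\<Phi> \<in> T" if "W \<in> ?I" "closed T" "\<And>W'. W' \<in> ?I \<Longrightarrow> W' \<subseteq> W \<Longrightarrow> M W' \<in> T" for W T
  proof -
    have "F W \<subseteq> T" unfolding F_def using that by (intro closure_minimal) auto
    then show ?thesis using \<Phi>[OF that(1)] by blast
  qed
  have U: "UNIV \<in> ?I" by simp
  have ev: "continuous_on UNIV (\<lambda>\<Phi> :: ('k \<Rightarrow> real) \<Rightarrow> real. \<Phi> \<phi>)" for \<phi> by simp
  have "haar_functional \<Phi>"
  proof
    fix \<phi> \<psi> :: "'k \<Rightarrow> real" and a :: real and k
    assume \<phi>: "continuous_on UNIV \<phi>"
    show "\<Phi> (\<lambda>x. \<phi> x + \<psi> x) = \<Phi> \<phi> + \<Phi> \<psi>" if \<psi>: "continuous_on UNIV \<psi>"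
    proof -
      have "\<Phi> \<in> {\<Phi>. \<Phi> (\<lambda>x. \<phi> x + \<psi> x) = \<Phi> \<phi> + \<Phi> \<psi>}"
      proof (rule lim[OF U])
        show "closed {\<Phi> :: ('k \<Rightarrow> real) \<Rightarrow> real. \<Phi> (\<lambda>x. \<phi> x + \<psi> x) = \<Phi> \<phi> + \<Phi> \<psi>}"
          by (intro closed_Collect_eq continuous_intros ev)
        show "M W' \<in> {\<Phi>. \<Phi> (\<lambda>x. \<phi> x + \<psi> x) = \<Phi> \<phi> + \<Phi> \<psi>}" if "W' \<in> ?I" for W'
          using mm_add[OF that] \<phi> \<psi> continuous_on_add[OF \<phi> \<psi>] by (simp add: M_def)
      qed
      then show ?thesis by simp
    qed
    have "\<Phi> \<in> {\<Phi>. \<Phi> (\<lambda>x. a * \<phi> x) = a * \<Phi> \<phi>}"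
    proof (rule lim[OF U])
      have "continuous_on UNIV (\<lambda>x. a * \<phi> x)" using \<phi> by (intro continuous_intros)
      then show "M W' \<in> {\<Phi>. \<Phi> (\<lambda>x. a * \<phi> x) = a * \<Phi> \<phi>}" if "W' \<in> ?I" for W'
        using mm_scale[OF that] \<phi> by (simp add: M_def)
      show "closed {\<Phi> :: ('k \<Rightarrow> real) \<Rightarrow> real. \<Phi> (\<lambda>x. a * \<phi> x) = a * \<Phi> \<phi>}"
        by (intro closed_Collect_eq continuous_intros ev)
    qed
    then show "\<Phi> (\<lambda>x. a * \<phi> x) = a * \<Phi> \<phi>" by simp
    show "0 \<le> \<Phi> \<phi>" if "\<And>x. 0 \<le> \<phi> x"
    proof -
      have "\<Phi> \<in> {\<Phi>. 0 \<le> \<Phi> \<phi>}"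
      proof (rule lim[OF U])
        show "closed {\<Phi> :: ('k \<Rightarrow> real) \<Rightarrow> real. 0 \<le> \<Phi> \<phi>}"
          by (intro closed_Collect_le continuous_intros ev)
        show "M W' \<in> {\<Phi>. 0 \<le> \<Phi> \<phi>}" if "W' \<in> ?I" for W'
          using mm_nonneg[OF that] \<phi> \<open>\<And>x. 0 \<le> \<phi> x\<close> by (simp add: M_def)
      qed
      then show ?thesis by simp
    qed
    show "\<Phi> (\<lambda>x. \<phi> (- k + x)) = \<Phi> \<phi>"
    proof -
      have "\<bar>\<Phi> (\<lambda>x. \<phi> (- k + x)) - \<Phi> \<phi>\<bar> \<le> 2 * \<delta>" if \<delta>: "\<delta> > 0" for \<delta>
      proof -
        obtain W where W: "open W" "0 \<in> W" "\<And>w s. w \<in> W \<Longrightarrow> \<bar>\<phi> (s + w) - \<phi> s\<bar> < \<delta>" "\<And>w s. w \<in> W \<Longrightarrow> \<bar>\<phi> (w + s) - \<phi> s\<bar> < \<delta>"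
          using uniformly_continuous_group[OF K \<phi> \<delta>] by blast
        have WI: "W \<in> ?I" using W by simp
        have ck: "continuous_on UNIV (\<lambda>x. \<phi> (- k + x))"
          by (rule continuous_on_compose2[OF \<phi>]) (auto intro!: continuous_intros)
        have "\<Phi> \<in> {\<Phi>. \<bar>\<Phi> (\<lambda>x. \<phi> (- k + x)) - \<Phi> \<phi>\<bar> \<le> 2 * \<delta>}"
        proof (rule lim[OF WI])
          show "closed {\<Phi> :: ('k \<Rightarrow> real) \<Rightarrow> real. \<bar>\<Phi> (\<lambda>x. \<phi> (- k + x)) - \<Phi> \<phi>\<bar> \<le> 2 * \<delta>}"
            by (intro closed_Collect_le continuous_intros ev)
          fix W' assume W': "W' \<in> ?I" "W' \<subseteq> W"
          have "\<forall>s. \<forall>w\<in>W'. \<bar>\<phi> (s + w) - \<phi> s\<bar> \<le> \<delta> \<and> \<bar>\<phi> (w + s) - \<phi> s\<bar> \<le> \<delta>"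
            using W(3,4) W'(2) by (meson less_imp_le subsetD)
          then show "M W' \<in> {\<Phi>. \<bar>\<Phi> (\<lambda>x. \<phi> (- k + x)) - \<Phi> \<phi>\<bar> \<le> 2 * \<delta>}"
            using mm_inv[OF W'(1)] \<phi> ck by (simp add: M_def)
        qed
        then show ?thesis by simp
      qed
      then have "\<bar>\<Phi> (\<lambda>x. \<phi> (- k + x)) - \<Phi> \<phi>\<bar> \<le> 0 + e" if "e > 0" for e
        using that[THEN half_gt_zero] by (metis add_0 field_sum_of_halves mult_2)
      then have "\<bar>\<Phi> (\<lambda>x. \<phi> (- k + x)) - \<Phi> \<phi>\<bar> \<le> 0" by (rule field_le_epsilon)
      then show ?thesis by simp
    qed
  next
    have "\<Phi> \<in> {\<Phi>. \<Phi> (\<lambda>x. 1) = 1}"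
    proof (rule lim[OF U])
      show "closed {\<Phi> :: ('k \<Rightarrow> real) \<Rightarrow> real. \<Phi> (\<lambda>x. 1) = 1}"
        by (intro closed_Collect_eq continuous_intros ev)
      show "M W' \<in> {\<Phi>. \<Phi> (\<lambda>x. 1) = 1}" if "W' \<in> ?I" for W'
        using mm_1[OF that] by (simp add: M_def)
    qed
    then show "\<Phi> (\<lambda>x. 1) = 1" by simp
  qed (rule K)
  then show ?thesis by blast
qed

section \<open>Finite-dimensional representations\<close>

lemma Urysohn_bump:
  fixes W :: "'k::{topological_group_add, t2_space} set"
  assumes K: "compact (UNIV :: 'k set)" and W: "open W" "0 \<in> W"
  shows "\<exists>b :: 'k \<Rightarrow> real. continuous_on UNIV b \<and> (\<forall>x. 0 \<le> b x) \<and> b 0 = 1 \<and> (\<forall>x. x \<notin> W \<longrightarrow> b x = 0)"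
proof -
  have "compact_space (euclidean :: 'k topology)" using K by (simp add: compact_space_def)
  moreover have "Hausdorff_space (euclidean :: 'k topology)"
    unfolding Hausdorff_space_def
  proof (intro allI impI)
    fix x y :: 'k assume "x \<in> topspace euclidean \<and> y \<in> topspace euclidean \<and> x \<noteq> y"
    then have "x \<noteq> y" by simp
    from hausdorff[OF this] obtain U V where "open U \<and> open V \<and> x \<in> U \<and> y \<in> V \<and> U \<inter> V = {}" by (elim exE)
    then show "\<exists>U V. openin euclidean U \<and> openin euclidean V \<and> x \<in> U \<and> y \<in> V \<and> disjnt U V"
      by (intro exI[of _ U] exI[of _ V]) (simp add: disjnt_def)
  qed
  ultimately have normal: "normal_space (euclidean :: 'k topology)"
    by (intro compact_Hausdorff_or_regular_imp_normal_space disjI1)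
  have sets: "closedin euclidean (- W)" "closedin euclidean {0 :: 'k}" "disjnt (- W) {0}"
    using W by (auto simp: disjnt_def)
  obtain f where f: "continuous_map euclidean (top_of_set {0..1::real}) f" "f ` (- W) \<subseteq> {0}" "f ` {0} \<subseteq> {1}"
    by (rule Urysohn_lemma[OF normal sets zero_le_one])
  have "continuous_on UNIV f" "\<And>x. f x \<in> {0..1}"
    using f(1) unfolding continuous_map_in_subtopology by auto
  then show ?thesis using f(2,3) by (intro exI[of _ f]) auto
qed

section \<open>The inner product of continuous functions\<close>

context haar_functional
begin

abbreviation cont :: "('k \<Rightarrow> real) \<Rightarrow> bool" where "cont f \<equiv> continuous_on UNIV f"

lemma cont_translate: "cont f \<Longrightarrow> cont (\<lambda>x. f (- k + x))"
  by (rule continuous_on_compose2[of UNIV f]) (auto intro!: continuous_intros)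

lemma cont_kernel: "cont f \<Longrightarrow> cont (\<lambda>y. f (- y + x))"
  by (rule continuous_on_compose2[of UNIV f]) (auto intro!: continuous_intros)

lemma cont_bounded: "cont f \<Longrightarrow> \<exists>c>0. \<forall>x. \<bar>f x\<bar> \<le> c"
proof -
  assume "cont f"
  then have "bounded (range f)" using compact_UNIV compact_continuous_image compact_imp_bounded by blast
  then obtain c where "c > 0" "\<forall>y\<in>range f. norm y \<le> c" unfolding bounded_pos by blast
  then show ?thesis by (intro exI[of _ c]) auto
qed

lemma const: "m (\<lambda>x. c) = c"
  using scale[of "\<lambda>x. 1" c] const_1 by simp

lemma diff: "cont f \<Longrightarrow> cont g \<Longrightarrow> m (\<lambda>x. f x - g x) = m f - m g"
proof -
  assume f: "cont f" and g: "cont g"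
  have "m (\<lambda>x. f x + (-1) * g x) = m f + m (\<lambda>x. (-1) * g x)"
    by (rule add[OF f]) (intro continuous_intros g)
  then show ?thesis using scale[OF g, of "-1"] by simp
qed

lemma sum: "(\<And>i. i \<in> I \<Longrightarrow> cont (F i)) \<Longrightarrow> m (\<lambda>x. \<Sum>i\<in>I. F i x) = (\<Sum>i\<in>I. m (F i))"
proof (induction I rule: infinite_finite_induct)
  case (insert i I)
  have "m (\<lambda>x. F i x + (\<Sum>i\<in>I. F i x)) = m (F i) + m (\<lambda>x. \<Sum>i\<in>I. F i x)"
    by (rule add) (use insert.prems in \<open>auto intro!: continuous_intros\<close>)
  then show ?case using insert by simp
qed (simp_all add: const)

lemma mono: "cont f \<Longrightarrow> cont g \<Longrightarrow> (\<And>x. f x \<le> g x) \<Longrightarrow> m f \<le> m g"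
  using nonneg[of "\<lambda>x. g x - f x"] diff[of g f] continuous_on_diff[of UNIV g f] by simp

lemma abs_le: "cont f \<Longrightarrow> (\<And>x. \<bar>f x\<bar> \<le> c) \<Longrightarrow> \<bar>m f\<bar> \<le> c"
  using mono[of f "\<lambda>x. c"] mono[of "\<lambda>x. - c" f] const[of c] const[of "- c"]
  by (simp add: abs_le_iff) (meson minus_le_iff)

text \<open>By compactness finitely many translates of the set where \<open>f\<close> exceeds half
  of \<open>f x0\<close> cover \<open>K\<close>. The sum of the corresponding translates of
  \<open>f\<close> dominates a positive constant, while its integral is a multiple of
  \<open>m f\<close>.\<close>

lemma pos:
  assumes f: "cont f" "\<And>x. 0 \<le> f x" and x0: "f x0 > 0"
  shows "m f > 0"
proof -
  define U where "U k = {x. f x0 / 2 < f (- k + x)}" for k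
  have "open (U k)" for k
    unfolding U_def by (intro open_Collect_less continuous_intros cont_translate f)
  moreover have "UNIV \<subseteq> (\<Union>k\<in>UNIV. U k)"
  proof
    fix x show "x \<in> (\<Union>k\<in>UNIV. U k)" using x0 by (auto simp: U_def intro!: exI[of _ "x - x0"])
  qed
  ultimately obtain C where C: "C \<subseteq> UNIV" "finite C" "UNIV \<subseteq> (\<Union>k\<in>C. U k)"
    using compactE_image[OF compact_UNIV, of UNIV U] by metis
  have ct: "cont (\<lambda>x. f (- k + x))" for k by (rule cont_translate[OF f(1)])
  have "f x0 / 2 = m (\<lambda>x. f x0 / 2)" by (simp add: const)
  also have "\<dots> \<le> m (\<lambda>x. \<Sum>k\<in>C. f (- k + x))"
  proof (rule mono)
    show "cont (\<lambda>x. \<Sum>k\<in>C. f (- k + x))" by (intro continuous_intros ct)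
    fix x
    obtain k where k: "k \<in> C" "f x0 / 2 < f (- k + x)" using C(3) by (auto simp: U_def)
    then have "f x0 / 2 \<le> f (- k + x)" by simp
    also have "\<dots> \<le> (\<Sum>k\<in>C. f (- k + x))" using k(1) C(2) f(2) by (intro member_le_sum) auto
    finally show "f x0 / 2 \<le> (\<Sum>k\<in>C. f (- k + x))" .
  qed simp
  also have "\<dots> = real (card C) * m f" using sum[of C "\<lambda>k x. f (- k + x)"] ct invariant[OF f(1)] by simp
  finally have "0 < real (card C) * m f" using x0 by simp
  then show ?thesis by (simp add: zero_less_mult_iff)
qed

definition ip :: "('k \<Rightarrow> real) \<Rightarrow> ('k \<Rightarrow> real) \<Rightarrow> real" where "ip f g = m (\<lambda>x. f x * g x)"

lemma ip_commute: "ip f g = ip g f"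
  by (simp add: ip_def mult.commute)

lemma ip_diff: "cont f \<Longrightarrow> cont g \<Longrightarrow> cont h \<Longrightarrow> ip (\<lambda>x. f x - g x) h = ip f h - ip g h"
  using diff[of "\<lambda>x. f x * h x" "\<lambda>x. g x * h x"] continuous_on_mult[of UNIV f h] continuous_on_mult[of UNIV g h]
  by (simp add: ip_def left_diff_distrib)

lemma ip_scale: "cont f \<Longrightarrow> cont h \<Longrightarrow> ip (\<lambda>x. c * f x) h = c * ip f h"
  using scale[of "\<lambda>x. f x * h x" c] continuous_on_mult[of UNIV f h] by (simp add: ip_def mult.assoc)

lemma ip_sum: "(\<And>i. i \<in> I \<Longrightarrow> cont (F i)) \<Longrightarrow> cont h \<Longrightarrow> ip (\<lambda>x. \<Sum>i\<in>I. F i x) h = (\<Sum>i\<in>I. ip (F i) h)"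
  using sum[of I "\<lambda>i x. F i x * h x"] continuous_on_mult[of UNIV _ h] by (simp add: ip_def sum_distrib_right)

lemma ip_self_nonneg: "cont f \<Longrightarrow> 0 \<le> ip f f"
  unfolding ip_def by (rule nonneg) (auto intro!: continuous_intros)

lemma ip_self_zero: "cont f \<Longrightarrow> ip f f = 0 \<Longrightarrow> f x = 0"
  using pos[of "\<lambda>x. f x * f x" x] continuous_on_mult[of UNIV f f] zero_less_mult_iff[of "f x" "f x"]
  by (fastforce simp: ip_def)

lemma ip_Cauchy_Schwarz:
  assumes f: "cont f" and g: "cont g"
  shows "(ip f g)\<^sup>2 \<le> ip f f * ip g g"
proof (cases "ip g g = 0")
  case True
  then have "g x = 0" for x using ip_self_zero[OF g] by blast
  then show ?thesis by (simp add: ip_def const)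
next
  case False
  define c where "c = ip g g"
  define b where "b = ip f g"
  define t where "t = b / c"
  have c: "c > 0" using False ip_self_nonneg[OF g] by (simp add: c_def)
  have ct: "cont (\<lambda>x. t * g x)" "cont (\<lambda>x. f x - t * g x)" by (intro continuous_intros f g)+
  have "ip (\<lambda>x. f x - t * g x) h = ip f h - t * ip g h" if "cont h" for h
    using ip_diff[OF f ct(1) that] ip_scale[OF g that] by simp
  note e = this
  have "ip (\<lambda>x. f x - t * g x) (\<lambda>x. f x - t * g x) = ip f f - t * b - t * (b - t * c)"
    using e[OF ct(2)] e[OF f] e[OF g] ip_commute by (simp add: b_def c_def)
  then have "0 \<le> ip f f - t * b - t * (b - t * c)" using ip_self_nonneg[OF ct(2)] by simp
  also have "\<dots> = ip f f - b\<^sup>2 / c" using c by (simp add: t_def power2_eq_square)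
  finally have "b\<^sup>2 \<le> ip f f * c" using c by (simp add: field_simps)
  then show ?thesis by (simp add: b_def c_def)
qed

lemma ip_translate: 
  assumes "cont f" "cont g" shows "ip (\<lambda>x. f (- k + x)) g = ip f (\<lambda>x. g (k + x))"
proof -
  have c: "cont (\<lambda>x. f x * g (k + x))"
    using cont_translate[OF assms(2), of "- k"] assms(1) by (intro continuous_intros) simp_all
  show ?thesis using invariant[OF c, of k] by (simp add: ip_def add.assoc[symmetric])
qed

lemma ip_sup_bound:
  assumes "cont f" "cont g" "\<And>x. \<bar>f x\<bar> \<le> a" "\<And>x. \<bar>g x\<bar> \<le> b"
  shows "\<bar>ip f g\<bar> \<le> a * b"
  unfolding ip_def
proof (rule abs_le)
  show "cont (\<lambda>x. f x * g x)" by (intro continuous_intros assms)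
  show "\<bar>f x * g x\<bar> \<le> a * b" for x
    unfolding abs_mult using assms(3)[of x] assms(4)[of x] by (intro mult_mono) auto
qed

text \<open>Projection onto an orthonormal family; nonnegativity in the last claim is Bessel's
  inequality.\<close>

lemma ip_orthonormal_expand:
  fixes N :: nat
  assumes e: "\<And>i. i < N \<Longrightarrow> cont (e i)" "\<And>i j. i < N \<Longrightarrow> j < N \<Longrightarrow> ip (e i) (e j) = (if i = j then 1 else 0)"
    and f: "cont f"
  defines "r \<equiv> \<lambda>x. f x - (\<Sum>i<N. ip f (e i) * e i x)"
  shows "cont r" "\<And>j. j < N \<Longrightarrow> ip r (e j) = 0" "ip r r = ip f f - (\<Sum>i<N. (ip f (e i))\<^sup>2)"
proof -
  have cs: "cont (\<lambda>x. \<Sum>i<N. ip f (e i) * e i x)" by (intro continuous_intros e(1)) auto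
  show r: "cont r" unfolding r_def by (intro continuous_on_diff f cs)
  have exp: "ip r h = ip f h - (\<Sum>i<N. ip f (e i) * ip (e i) h)" if h: "cont h" for h
  proof -
    have ci: "cont (\<lambda>x. ip f (e i) * e i x)" if "i < N" for i by (intro continuous_intros e(1) that)
    have "ip (\<lambda>x. \<Sum>i<N. ip f (e i) * e i x) h = (\<Sum>i<N. ip (\<lambda>x. ip f (e i) * e i x) h)"
      by (rule ip_sum) (use ci h in auto)
    also have "\<dots> = (\<Sum>i<N. ip f (e i) * ip (e i) h)"
      by (intro sum.cong refl ip_scale h e(1)) auto
    finally show ?thesis unfolding r_def using ip_diff[OF f cs h] by simp
  qed
  show rj: "ip r (e j) = 0" if "j < N" for j
  proof -
    have "(\<Sum>i<N. ip f (e i) * ip (e i) (e j)) = (\<Sum>i<N. if i = j then ip f (e i) else 0)"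
      by (intro sum.cong refl) (use e(2) that in auto)
    then show ?thesis using exp[OF e(1)[OF that]] that by simp
  qed
  have er: "ip (e i) r = 0" if "i < N" for i using rj[OF that] ip_commute[of "e i" r] by simp
  have "ip r r = ip f r" using exp[OF r] er by simp
  also have "\<dots> = ip r f" by (rule ip_commute)
  also have "\<dots> = ip f f - (\<Sum>i<N. ip f (e i) * ip (e i) f)" by (rule exp[OF f])
  also have "(\<Sum>i<N. ip f (e i) * ip (e i) f) = (\<Sum>i<N. (ip f (e i))\<^sup>2)"
    by (intro sum.cong refl) (subst ip_commute, simp add: power2_eq_square)
  finally show "ip r r = ip f f - (\<Sum>i<N. (ip f (e i))\<^sup>2)" .
qed

lemma partition_of_unity:
  assumes W: "open W" "0 \<in> (W :: 'k set)"
  shows "\<exists>C \<psi>. finite C \<and> (\<forall>c. cont (\<psi> c)) \<and> (\<forall>c x. 0 \<le> \<psi> c x) \<and> (\<forall>x. (\<Sum>c\<in>C. \<psi> c x) = 1) \<and>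
     (\<forall>c x. \<psi> c x \<noteq> 0 \<longrightarrow> - c + x \<in> W)"
proof -
  from Urysohn_bump[OF compact_UNIV W] obtain b :: "'k \<Rightarrow> real"
    where "cont b \<and> (\<forall>x. 0 \<le> b x) \<and> b 0 = 1 \<and> (\<forall>x. x \<notin> W \<longrightarrow> b x = 0)" by (rule exE)
  then have b: "cont b" "\<And>x. 0 \<le> b x" "b 0 = 1" "\<And>x. x \<notin> W \<Longrightarrow> b x = 0" by simp_all
  define U where "U k = {x. 0 < b (- k + x)}" for k
  have op: "open (U k)" for k
    unfolding U_def by (intro open_Collect_less continuous_intros cont_translate b)
  have "UNIV \<subseteq> (\<Union>k\<in>UNIV. U k)" using b(3) by (auto simp: U_def intro!: exI[of _ "_ :: 'k"])
  then obtain C where C: "C \<subseteq> UNIV" "finite C" "UNIV \<subseteq> (\<Union>k\<in>C. U k)"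
    by (rule compactE_image[OF compact_UNIV op])
  define s where "s x = (\<Sum>c\<in>C. b (- c + x))" for x
  have s0: "s x > 0" for x
  proof -
    obtain k where k: "k \<in> C" "0 < b (- k + x)" using C(3) by (auto simp: U_def)
    then show ?thesis unfolding s_def using C(2) b(2) by (intro sum_pos2[of C k]) auto
  qed
  have cs: "cont s" unfolding s_def by (intro continuous_intros cont_translate b(1))
  define \<psi> where "\<psi> c x = b (- c + x) / s x" for c x
  show ?thesis
  proof (intro exI[of _ C] exI[of _ \<psi>] conjI allI impI)
    show "cont (\<psi> c)" for c
    proof -
      have "s x \<noteq> 0" for x using s0[of x] by simp
      then show ?thesis unfolding \<psi>_def by (intro continuous_on_divide cont_translate b(1) cs) blast
    qed
    show "0 \<le> \<psi> c x" for c x unfolding \<psi>_def using b(2) s0[of x] by simp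
    show "(\<Sum>c\<in>C. \<psi> c x) = 1" for x
      unfolding \<psi>_def sum_divide_distrib[symmetric] s_def[symmetric] using s0[of x] by simp
    show "- c + x \<in> W" if "\<psi> c x \<noteq> 0" for c x using that b(4) by (auto simp: \<psi>_def)
  qed (rule C(2))
qed

end

section \<open>Convolution operators: smoothing, self-adjointness and compactness\<close>

locale convolution_operator = haar_functional +
  fixes \<phi> :: "'a \<Rightarrow> real" and C :: real
  assumes \<phi>: "continuous_on UNIV \<phi>" and sym: "\<phi> (- x) = \<phi> x" and C: "C > 0" "\<bar>\<phi> x\<bar> \<le> C"
begin

text \<open>Right convolution by \<open>\<phi>\<close>. The kernel \<open>\<phi> (- y + x)\<close>
  makes it commute with left translations, and evenness of \<open>\<phi>\<close> makes the kernel
  symmetric.\<close>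

definition T :: "('a \<Rightarrow> real) \<Rightarrow> 'a \<Rightarrow> real" where "T f x = m (\<lambda>y. \<phi> (- y + x) * f y)"

lemma ck: "cont (\<lambda>y. \<phi> (- y + x))" by (rule cont_kernel[OF \<phi>])

lemma T_eq_ip: "T f x = ip (\<lambda>y. \<phi> (- y + x)) f" by (simp add: T_def ip_def)

lemma sym': "\<phi> (- x + y) = \<phi> (- y + x)"
  using sym[of "- x + y"] by (simp add: minus_add)

text \<open>Cauchy-Schwarz against a difference of kernel rows: the modulus of continuity of
  \<open>T f\<close> is controlled by the square norm of \<open>f\<close> alone, which is the source
  of compactness.\<close>

lemma T_CS:
  assumes f: "cont f" and d: "\<And>y. \<bar>\<phi> (- y + x) - \<phi> (- y + x')\<bar> \<le> d"
  shows "\<bar>T f x - T f x'\<bar> \<le> d * sqrt (ip f f)"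
proof -
  have d0: "0 \<le> d" using d[of 0] by linarith
  have cd: "cont (\<lambda>y. \<phi> (- y + x) - \<phi> (- y + x'))" by (intro continuous_intros ck)
  have "T f x - T f x' = ip (\<lambda>y. \<phi> (- y + x) - \<phi> (- y + x')) f"
    unfolding T_eq_ip by (rule ip_diff[OF ck ck f, symmetric])
  then have "(T f x - T f x')\<^sup>2 \<le> ip (\<lambda>y. \<phi> (- y + x) - \<phi> (- y + x')) (\<lambda>y. \<phi> (- y + x) - \<phi> (- y + x')) * ip f f"
    using ip_Cauchy_Schwarz[OF cd f] by simp
  also have "\<dots> \<le> (d * d) * ip f f"
    using ip_sup_bound[OF cd cd d d] ip_self_nonneg[OF f] by (intro mult_right_mono) auto
  also have "\<dots> = (d * sqrt (ip f f))\<^sup>2" using ip_self_nonneg[OF f] by (simp add: power_mult_distrib power2_eq_square)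
  finally show ?thesis using d0 ip_self_nonneg[OF f] by (simp add: abs_le_square_iff[symmetric])
qed

lemma T_bound: "cont f \<Longrightarrow> \<bar>T f x\<bar> \<le> C * sqrt (ip f f)"
proof -
  assume f: "cont f"
  have "(T f x)\<^sup>2 \<le> ip (\<lambda>y. \<phi> (- y + x)) (\<lambda>y. \<phi> (- y + x)) * ip f f"
    unfolding T_eq_ip by (rule ip_Cauchy_Schwarz[OF ck f])
  also have "\<dots> \<le> (C * C) * ip f f"
    using ip_sup_bound[OF ck ck C(2) C(2), of x x] ip_self_nonneg[OF f] by (intro mult_right_mono) auto
  also have "\<dots> = (C * sqrt (ip f f))\<^sup>2" using ip_self_nonneg[OF f] by (simp add: power_mult_distrib power2_eq_square)
  finally show ?thesis using C(1) ip_self_nonneg[OF f] by (simp add: abs_le_square_iff[symmetric])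
qed

lemma sqrt_ip_le: "cont f \<Longrightarrow> (\<And>x. \<bar>f x\<bar> \<le> a) \<Longrightarrow> sqrt (ip f f) \<le> a"
proof -
  assume f: "cont f" "\<And>x. \<bar>f x\<bar> \<le> a"
  have "0 \<le> a" using f(2)[of 0] by linarith
  moreover have "ip f f \<le> a * a" using ip_sup_bound[OF f(1) f(1) f(2) f(2)] by linarith
  ultimately show ?thesis by (simp add: real_sqrt_le_iff real_le_lsqrt power2_eq_square)
qed

lemma T_sup_bound: "cont f \<Longrightarrow> (\<And>x. \<bar>f x\<bar> \<le> a) \<Longrightarrow> \<bar>T f x\<bar> \<le> C * a"
  using T_bound[of f x] sqrt_ip_le[of f a] C(1) by (meson less_imp_le mult_left_mono order_trans)

lemma equicontinuous:
  assumes "\<epsilon> > 0"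
  shows "\<exists>W. open W \<and> 0 \<in> W \<and> (\<forall>f x x'. cont f \<longrightarrow> - x' + x \<in> W \<longrightarrow> \<bar>T f x - T f x'\<bar> \<le> \<epsilon> * sqrt (ip f f)) \<and>
     (\<forall>x x' y. - x' + x \<in> W \<longrightarrow> \<bar>\<phi> (- y + x) - \<phi> (- y + x')\<bar> \<le> \<epsilon>)"
proof -
  from uniformly_continuous_group[OF compact_UNIV \<phi> assms] obtain W
    where W: "open W \<and> 0 \<in> W \<and> (\<forall>w\<in>W. \<forall>s. \<bar>\<phi> (s + w) - \<phi> s\<bar> < \<epsilon> \<and> \<bar>\<phi> (w + s) - \<phi> s\<bar> < \<epsilon>)" by (rule exE)
  have ker: "\<bar>\<phi> (- y + x) - \<phi> (- y + x')\<bar> \<le> \<epsilon>" if "- x' + x \<in> W" for x x' y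
  proof -
    have "(- y + x') + (- x' + x) = - y + x" by (simp add: add.assoc)
    then show ?thesis using W that by (metis less_imp_le)
  qed
  have "\<bar>T f x - T f x'\<bar> \<le> \<epsilon> * sqrt (ip f f)" if "cont f" "- x' + x \<in> W" for f x x'
    by (rule T_CS[OF that(1) ker[OF that(2)]])
  then show ?thesis using W ker by (intro exI[of _ W] conjI allI impI) simp_all
qed

lemma T_cont: assumes f: "cont f" shows "cont (T f)"
proof -
  have "isCont (T f) x'" for x'
    unfolding isCont_def tendsto_iff
  proof (intro allI impI)
    fix \<epsilon> :: real assume "\<epsilon> > 0"
    define q where "q = sqrt (ip f f)"
    define d where "d = \<epsilon> / (2 * (q + 1))"
    have s: "q \<ge> 0" using ip_self_nonneg[OF f] by (simp add: q_def)
    have d: "d > 0" unfolding d_def by (rule divide_pos_pos) (use \<open>\<epsilon> > 0\<close> s in auto)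
    from equicontinuous[OF d] obtain W where W': "open W \<and> 0 \<in> W \<and> (\<forall>f x x'. cont f \<longrightarrow> - x' + x \<in> W \<longrightarrow> \<bar>T f x - T f x'\<bar> \<le> d * sqrt (ip f f)) \<and>
     (\<forall>x x' y. - x' + x \<in> W \<longrightarrow> \<bar>\<phi> (- y + x) - \<phi> (- y + x')\<bar> \<le> d)" by (rule exE)
    then have W: "open W" "0 \<in> W" "\<And>x. - x' + x \<in> W \<Longrightarrow> \<bar>T f x - T f x'\<bar> \<le> d * sqrt (ip f f)"
      using f by simp_all
    have small: "d * sqrt (ip f f) < \<epsilon>"
    proof -
      have "d * q \<le> d * (q + 1)" using d by simp
      also have "\<dots> = \<epsilon> / 2"
      proof -
        have "q + 1 \<noteq> 0" using s by simp
        then show ?thesis unfolding d_def by (metis nonzero_mult_divide_mult_cancel_right times_divide_eq_left)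
      qed
      also have "\<dots> < \<epsilon>" using \<open>\<epsilon> > 0\<close> by simp
      finally show ?thesis by (simp add: q_def)
    qed
    have "open {x. - x' + x \<in> W}" "x' \<in> {x. - x' + x \<in> W}" using open_left_translate[OF W(1)] W(2) by auto
    then have "eventually (\<lambda>x. x \<in> {x. - x' + x \<in> W}) (at x')" by (rule eventually_at_in_open')
    then have "eventually (\<lambda>x. - x' + x \<in> W) (at x')" by simp
    then show "eventually (\<lambda>x. dist (T f x) (T f x') < \<epsilon>) (at x')"
      by (rule eventually_mono) (use W(3) small in \<open>force simp: dist_real_def\<close>)
  qed
  then show ?thesis by (simp add: continuous_on_eq_continuous_at)
qed

lemma T_diff: "cont f \<Longrightarrow> cont g \<Longrightarrow> T (\<lambda>x. f x - g x) x = T f x - T g x"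
  using ip_diff[of f g "\<lambda>y. \<phi> (- y + x)"] ck by (simp add: T_eq_ip ip_commute)

lemma T_scale: "cont f \<Longrightarrow> T (\<lambda>x. c * f x) x = c * T f x"
  using ip_scale[of f "\<lambda>y. \<phi> (- y + x)" c] ck by (simp add: T_eq_ip ip_commute)

lemma T_translate: "cont f \<Longrightarrow> T (\<lambda>x. f (- k + x)) x = T f (- k + x)"
proof -
  assume f: "cont f"
  have "T (\<lambda>x. f (- k + x)) x = ip (\<lambda>y. f (- k + y)) (\<lambda>y. \<phi> (- y + x))" by (simp add: T_eq_ip ip_commute)
  also have "\<dots> = ip f (\<lambda>y. \<phi> (- (k + y) + x))" by (rule ip_translate[OF f ck])
  also have "\<dots> = T f (- k + x)" by (simp add: T_eq_ip ip_commute minus_add add.assoc diff_conv_add_uminus del: add_uminus_conv_diff)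
  finally show ?thesis .
qed

text \<open>Fubini for the kernel \<open>\<phi> (- y + x)\<close>, by uniform approximation with separable kernels.\<close>

lemma T_selfadjoint:
  assumes f: "cont f" and g: "cont g" shows "ip (T f) g = ip f (T g)"
proof -
  obtain a where a: "a > 0" "\<And>x. \<bar>f x\<bar> \<le> a" using cont_bounded[OF f] by blast
  obtain b where b: "b > 0" "\<And>x. \<bar>g x\<bar> \<le> b" using cont_bounded[OF g] by blast
  have "\<bar>ip (T f) g - ip f (T g)\<bar> \<le> 0 + e" if "e > 0" for e
  proof -
    define \<epsilon> where "\<epsilon> = e / (2 * a * b)"
    have \<epsilon>: "\<epsilon> > 0" using that a b by (simp add: \<epsilon>_def)
    from equicontinuous[OF \<epsilon>] obtain W where W': "open W \<and> 0 \<in> W \<and> (\<forall>f x x'. cont f \<longrightarrow> - x' + x \<in> W \<longrightarrow> \<bar>T f x - T f x'\<bar> \<le> \<epsilon> * sqrt (ip f f)) \<and>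
     (\<forall>x x' y. - x' + x \<in> W \<longrightarrow> \<bar>\<phi> (- y + x) - \<phi> (- y + x')\<bar> \<le> \<epsilon>)" by (rule exE)
    then have W: "open W" "0 \<in> W"
      "\<And>x x' y. - x' + x \<in> W \<Longrightarrow> \<bar>\<phi> (- y + x) - \<phi> (- y + x')\<bar> \<le> \<epsilon>" by simp_all
    from partition_of_unity[OF W(1,2)] obtain D \<psi> where "finite D \<and> (\<forall>c. cont (\<psi> c)) \<and> (\<forall>c x. 0 \<le> \<psi> c x) \<and>
      (\<forall>x. (\<Sum>c\<in>D. \<psi> c x) = 1) \<and> (\<forall>c x. \<psi> c x \<noteq> 0 \<longrightarrow> - c + x \<in> W)" by (elim exE)
    then have P: "finite D" "\<And>c. cont (\<psi> c)" "\<And>c x. 0 \<le> \<psi> c x"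
      "\<And>x. (\<Sum>c\<in>D. \<psi> c x) = 1" "\<And>c x. \<psi> c x \<noteq> 0 \<Longrightarrow> - c + x \<in> W" by simp_all
    define k where "k x y = (\<Sum>c\<in>D. \<psi> c x * \<phi> (- y + c))" for x y
    have k: "\<bar>\<phi> (- y + x) - k x y\<bar> \<le> \<epsilon>" for x y
    proof -
      have "\<phi> (- y + x) - k x y = (\<Sum>c\<in>D. \<psi> c x * (\<phi> (- y + x) - \<phi> (- y + c)))"
        using P(4)[of x] by (simp add: k_def right_diff_distrib sum_subtractf sum_distrib_right[symmetric])
      also have "\<bar>\<dots>\<bar> \<le> (\<Sum>c\<in>D. \<psi> c x * \<epsilon>)"
      proof (rule order_trans[OF sum_abs sum_mono])
        fix c show "\<bar>\<psi> c x * (\<phi> (- y + x) - \<phi> (- y + c))\<bar> \<le> \<psi> c x * \<epsilon>"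
          using W(3)[of c x y] P(5)[of c x] P(3)[of c x] by (cases "\<psi> c x = 0") (auto simp: abs_mult intro: mult_left_mono)
      qed
      also have "\<dots> = \<epsilon>" using P(4)[of x] by (simp add: sum_distrib_right[symmetric])
      finally show ?thesis .
    qed
    have ckx: "cont (\<lambda>x. k x y)" "cont (\<lambda>y. k x y)" for x y
      unfolding k_def by (intro continuous_intros P(2) ck)+
    \<comment> \<open>The double integral of the separable kernel \<open>k\<close> against
      \<open>f\<close> and \<open>g\<close>, which can be taken in either order.\<close>
    define S where "S = (\<Sum>c\<in>D. T f c * ip (\<psi> c) g)"
    have 1: "\<bar>ip (T f) g - S\<bar> \<le> (\<epsilon> * a) * b"
    proof -
      define F where "F x = (\<Sum>c\<in>D. T f c * \<psi> c x)" for x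
      have cF: "cont F" unfolding F_def by (intro continuous_intros P(2))
      have FT: "\<bar>T f x - F x\<bar> \<le> \<epsilon> * a" for x
      proof -
        have cc: "cont (\<lambda>y. \<psi> c x * \<phi> (- y + c))" for c by (intro continuous_intros ck)
        have "F x = (\<Sum>c\<in>D. ip (\<lambda>y. \<psi> c x * \<phi> (- y + c)) f)"
          unfolding F_def T_eq_ip by (intro sum.cong refl) (simp add: ip_scale[OF ck f] mult.commute)
        also have "\<dots> = ip (\<lambda>y. k x y) f" unfolding k_def by (rule ip_sum[symmetric]) (use cc f in auto)
        finally have "T f x - F x = ip (\<lambda>y. \<phi> (- y + x) - k x y) f"
          unfolding T_eq_ip using ip_diff[OF ck ckx(2) f] by simp
        then show ?thesis using ip_sup_bound[OF continuous_on_diff[OF ck ckx(2)] f k a(2)] by simp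
      qed
      have "S = ip F g" unfolding S_def F_def
      proof -
        have "ip (\<lambda>x. \<Sum>c\<in>D. T f c * \<psi> c x) g = (\<Sum>c\<in>D. ip (\<lambda>x. T f c * \<psi> c x) g)"
          by (rule ip_sum) (auto intro!: continuous_intros P(2) g)
        then show "(\<Sum>c\<in>D. T f c * ip (\<psi> c) g) = ip (\<lambda>x. \<Sum>c\<in>D. T f c * \<psi> c x) g"
          by (simp add: ip_scale[OF P(2) g])
      qed
      then have "ip (T f) g - S = ip (\<lambda>x. T f x - F x) g" using ip_diff[OF T_cont[OF f] cF g] by simp
      then show ?thesis using ip_sup_bound[OF continuous_on_diff[OF T_cont[OF f] cF] g FT b(2)] by simp
    qed
    have 2: "\<bar>ip f (T g) - S\<bar> \<le> a * (\<epsilon> * b)"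
    proof -
      define G where "G y = (\<Sum>c\<in>D. ip (\<psi> c) g * \<phi> (- y + c))" for y
      have cG: "cont G" unfolding G_def by (intro continuous_intros ck)
      have GT: "\<bar>T g y - G y\<bar> \<le> \<epsilon> * b" for y
      proof -
        have cc: "cont (\<lambda>x. \<psi> c x * \<phi> (- y + c))" for c by (intro continuous_intros P(2))
        have cy: "cont (\<lambda>x. \<phi> (- y + x))" by (rule cont_translate[OF \<phi>])
        have "G y = (\<Sum>c\<in>D. ip (\<lambda>x. \<psi> c x * \<phi> (- y + c)) g)"
          unfolding G_def
        proof (intro sum.cong refl)
          fix c
          have eq: "(\<lambda>x. \<psi> c x * \<phi> (- y + c)) = (\<lambda>x. \<phi> (- y + c) * \<psi> c x)" by (simp add: mult.commute)
          have "ip (\<lambda>x. \<psi> c x * \<phi> (- y + c)) g = \<phi> (- y + c) * ip (\<psi> c) g"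
            unfolding eq by (rule ip_scale[OF P(2) g])
          then show "ip (\<psi> c) g * \<phi> (- y + c) = ip (\<lambda>x. \<psi> c x * \<phi> (- y + c)) g" by simp
        qed
        also have "\<dots> = ip (\<lambda>x. k x y) g" unfolding k_def by (rule ip_sum[symmetric]) (use cc g in auto)
        finally have "G y = ip (\<lambda>x. k x y) g" .
        moreover have "T g y = ip (\<lambda>x. \<phi> (- y + x)) g" unfolding T_eq_ip using sym' by simp
        ultimately have "T g y - G y = ip (\<lambda>x. \<phi> (- y + x) - k x y) g"
          using ip_diff[OF cy ckx(1) g] by simp
        then show ?thesis using ip_sup_bound[OF continuous_on_diff[OF cy ckx(1)] g k b(2)] by simp
      qed
      have "ip f G = ip G f" by (rule ip_commute)
      also have "\<dots> = (\<Sum>c\<in>D. ip (\<lambda>y. ip (\<psi> c) g * \<phi> (- y + c)) f)"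
        unfolding G_def by (rule ip_sum) (auto intro!: continuous_intros ck f)
      also have "\<dots> = S" unfolding S_def T_eq_ip by (simp add: ip_scale[OF ck f] mult.commute)
      finally have "ip f (T g) - S = ip (\<lambda>y. T g y - G y) f" using ip_diff[OF T_cont[OF g] cG f] by (simp add: ip_commute)
      then show ?thesis using ip_sup_bound[OF continuous_on_diff[OF T_cont[OF g] cG] f GT a(2)] by (simp add: mult.commute)
    qed
    have "\<epsilon> * a * b + a * (\<epsilon> * b) = e" using a b by (simp add: \<epsilon>_def)
    then show ?thesis using 1 2 by linarith
  qed
  then have "\<bar>ip (T f) g - ip f (T g)\<bar> \<le> 0" by (rule field_le_epsilon)
  then show ?thesis by simp
qed

text \<open>Ascoli's theorem for one sequence: Tychonoff supplies a pointwise cluster point, and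
  equicontinuity over a finite net makes the approximation uniform.\<close>

lemma T_compact:
  assumes f: "\<And>j. cont (f j)" "\<And>j::nat. ip (f j) (f j) = 1"
  shows "\<exists>h. \<forall>\<epsilon>>0. \<forall>J. \<exists>j\<ge>J. \<forall>x. \<bar>T (f j) x - h x\<bar> \<le> \<epsilon>"
proof -
  define S where "S = Pi\<^sub>E UNIV (\<lambda>x :: 'a. {- C..C})"
  have "compactin (product_topology (\<lambda>_. euclidean) UNIV) S"
    unfolding S_def by (subst compactin_PiE) auto
  then have S: "compact S" by (simp add: euclidean_product_topology)
  have FS: "T (f j) \<in> S" for j
    using T_bound[OF f(1)[of j]] f(2) by (auto simp: S_def abs_le_iff) (meson minus_le_iff)
  define A where "A J = closure ((\<lambda>j. T (f j)) ` {J..})" for J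
  have "S \<inter> (\<Inter>J\<in>UNIV. A J) \<noteq> {}"
  proof (rule compact_imp_fip_image[OF S])
    fix I' :: "nat set" assume I': "finite I'"
    define j where "j = Max (insert 0 I')"
    have "T (f j) \<in> A J" if "J \<in> I'" for J
      unfolding A_def using that I' by (intro subsetD[OF closure_subset]) (auto simp: j_def)
    then show "S \<inter> (\<Inter>J\<in>I'. A J) \<noteq> {}" using FS by blast
  qed (simp add: A_def)
  then have "\<exists>h. h \<in> S \<inter> (\<Inter>J\<in>UNIV. A J)" by (simp only: ex_in_conv not_False_eq_True)
  then obtain h where "h \<in> S \<inter> (\<Inter>J\<in>UNIV. A J)" by (rule exE)
  then have h: "h \<in> A J" for J by simp
  have near: "\<exists>j\<ge>J. \<forall>c\<in>D. \<bar>T (f j) c - h c\<bar> < \<epsilon>" if "finite D" "\<epsilon> > 0" for D \<epsilon> J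
  proof -
    let ?N = "{g :: 'a \<Rightarrow> real. \<forall>i\<in>D. g (id i) \<in> ball (h i) \<epsilon>}"
    have "open ?N"
      by (rule product_topology_basis'[OF that(1)]) simp
    moreover have "h \<in> ?N \<inter> closure ((\<lambda>j. T (f j)) ` {J..})" using that(2) h[of J] by (simp add: A_def)
    then have "?N \<inter> closure ((\<lambda>j. T (f j)) ` {J..}) \<noteq> {}" by (rule ex_in_conv[THEN iffD1, OF exI])
    ultimately have "?N \<inter> (\<lambda>j. T (f j)) ` {J..} \<noteq> {}" by (simp only: open_Int_closure_eq_empty not_False_eq_True)
    then have "\<exists>g. g \<in> ?N \<inter> (\<lambda>j. T (f j)) ` {J..}" by (simp only: ex_in_conv not_False_eq_True)
    then obtain g where g: "g \<in> ?N" "g \<in> (\<lambda>j. T (f j)) ` {J..}" by (elim exE IntE)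
    from g(2) obtain j where j: "g = T (f j)" "j \<in> {J..}" by (rule imageE)
    have "\<bar>T (f j) c - h c\<bar> < \<epsilon>" if "c \<in> D" for c
      using g(1) that by (simp add: j(1) dist_real_def abs_minus_commute)
    then show ?thesis using j(2) by (intro exI[of _ j]) simp
  qed
  have "\<exists>j\<ge>J. \<forall>x. \<bar>T (f j) x - h x\<bar> \<le> \<epsilon>" if "\<epsilon> > 0" for \<epsilon> J
  proof -
    have e4: "\<epsilon> / 4 > 0" using that by simp
    from equicontinuous[OF e4] obtain W where W': "open W \<and> 0 \<in> W \<and> (\<forall>f x x'. cont f \<longrightarrow> - x' + x \<in> W \<longrightarrow> \<bar>T f x - T f x'\<bar> \<le> (\<epsilon> / 4) * sqrt (ip f f)) \<and>
     (\<forall>x x' y. - x' + x \<in> W \<longrightarrow> \<bar>\<phi> (- y + x) - \<phi> (- y + x')\<bar> \<le> \<epsilon> / 4)" by (rule exE)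
    then have W: "open W" "0 \<in> W"
      "\<And>f x x'. cont f \<Longrightarrow> - x' + x \<in> W \<Longrightarrow> \<bar>T f x - T f x'\<bar> \<le> \<epsilon> / 4 * sqrt (ip f f)" by simp_all
    have eq: "\<bar>T (f j) x - T (f j) x'\<bar> \<le> \<epsilon> / 4" if "- x' + x \<in> W" for j x x'
      using W(3)[OF f(1) that, of j] f(2) by simp
    have eqh: "\<bar>h x - h x'\<bar> \<le> \<epsilon> / 4" if w: "- x' + x \<in> W" for x x'
    proof (rule field_le_epsilon)
      fix e :: real assume "e > 0"
      then obtain j where j: "\<forall>c\<in>{x, x'}. \<bar>T (f j) c - h c\<bar> < e / 2" using near[of "{x, x'}" "e / 2" 0] by auto
      then have "\<bar>T (f j) x - h x\<bar> < e / 2" "\<bar>T (f j) x' - h x'\<bar> < e / 2" by auto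
      then show "\<bar>h x - h x'\<bar> \<le> \<epsilon> / 4 + e" using eq[OF w, of j] by linarith
    qed
    have op: "open {x. - c + x \<in> W}" for c by (rule open_left_translate[OF W(1)])
    have "UNIV \<subseteq> (\<Union>c\<in>UNIV. {x. - c + x \<in> W})" using W(2) by (auto intro!: exI[of _ "_ :: 'a"])
    then obtain D where D: "D \<subseteq> UNIV" "finite D" "UNIV \<subseteq> (\<Union>c\<in>D. {x. - c + x \<in> W})"
      by (rule compactE_image[OF compact_UNIV op])
    obtain j where j: "j \<ge> J" "\<forall>c\<in>D. \<bar>T (f j) c - h c\<bar> < \<epsilon> / 4" using near[OF D(2) e4] by blast
    have "\<bar>T (f j) x - h x\<bar> \<le> \<epsilon>" for x
    proof -
      obtain c where c: "c \<in> D" "- c + x \<in> W" using D(3) by auto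
      have "\<bar>T (f j) c - h c\<bar> < \<epsilon> / 4" using j(2) c(1) by blast
      then show ?thesis using eq[OF c(2), of j] eqh[OF c(2)] that by linarith
    qed
    then show ?thesis using j(1) by blast
  qed
  then show ?thesis by blast
qed

end

context convolution_operator
begin

text \<open>The positive operator \<open>T\<^sup>2\<close> attains its norm on an invariant, uniformly closed subspace; no
  completeness of the inner product is needed because \<open>T\<close> maps bounded sets to totally bounded ones.\<close>

lemma T_square_eigenfunction:
  assumes E_cont: "\<And>f. f \<in> E \<Longrightarrow> cont f"
    and E_scale: "\<And>f c. f \<in> E \<Longrightarrow> (\<lambda>x. c * f x) \<in> E"
    and E_T: "\<And>f. f \<in> E \<Longrightarrow> T f \<in> E"
    and E_closed: "\<And>h. (\<And>\<epsilon>. \<epsilon> > 0 \<Longrightarrow> \<exists>f\<in>E. \<forall>x. \<bar>f x - h x\<bar> \<le> \<epsilon>) \<Longrightarrow> h \<in> E"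
    and f0: "f0 \<in> E" "T f0 x0 \<noteq> 0"
  shows "\<exists>\<kappa>>0. \<exists>h\<in>E. (\<forall>x. T (T h) x = \<kappa> * h x) \<and> ip h h \<noteq> 0"
proof -
  have normalize: "ip (\<lambda>x. c * f x) (\<lambda>x. c * f x) = c * c * ip f f" if "cont f" for f c
  proof -
    have "cont (\<lambda>x. c * f x)" by (intro continuous_intros that)
    then show ?thesis using ip_scale[of f "\<lambda>x. c * f x" c] ip_scale[of f f c] that by (simp add: ip_commute)
  qed
  have T_scale_fun: "T (\<lambda>x. c * f x) = (\<lambda>x. c * T f x)" if "cont f" for f c using T_scale[OF that] by auto
  define S where "S = {ip (T f) (T f) | f. f \<in> E \<and> ip f f = 1}"
  have ipT: "ip (T f) (T f) \<le> C * C * ip f f" if "cont f" for f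
  proof -
    have "ip (T f) (T f) \<le> (C * sqrt (ip f f)) * (C * sqrt (ip f f))"
      using ip_sup_bound[OF T_cont[OF that] T_cont[OF that] T_bound[OF that] T_bound[OF that]] by linarith
    then show ?thesis using ip_self_nonneg[OF that] by (simp add: mult_ac)
  qed
  have Sbdd: "bdd_above S" unfolding S_def bdd_above_def using ipT E_cont by (intro exI[of _ "C * C"]) fastforce
  \<comment> \<open>The squared norm of \<open>T\<close> on \<open>E\<close>, hence the candidate
    for the largest eigenvalue of its square.\<close>
  define \<kappa> where "\<kappa> = Sup S"
  have S_le: "ip (T f) (T f) \<le> \<kappa>" if "f \<in> E" "ip f f = 1" for f
    unfolding \<kappa>_def by (rule cSup_upper[OF _ Sbdd]) (use that in \<open>auto simp: S_def\<close>)
  have ip_le: "ip (T f) (T f) \<le> \<kappa> * ip f f" if f: "f \<in> E" for f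
  proof (cases "ip f f = 0")
    case True
    then have "f = (\<lambda>x. 0)" using ip_self_zero[OF E_cont[OF f]] by auto
    then have "T f = (\<lambda>x. 0)" by (auto simp: T_def const)
    then show ?thesis using True by (simp add: ip_def const)
  next
    case False
    then have p: "ip f f > 0" using ip_self_nonneg[OF E_cont[OF f]] by simp
    define c where "c = 1 / sqrt (ip f f)"
    have cc: "c * c = 1 / ip f f" using p by (simp add: c_def)
    have "ip (T (\<lambda>x. c * f x)) (T (\<lambda>x. c * f x)) \<le> \<kappa>"
      by (rule S_le[OF E_scale[OF f]]) (use normalize[OF E_cont[OF f]] cc p in simp)
    then have "(1 / ip f f) * ip (T f) (T f) \<le> \<kappa>"
      unfolding T_scale_fun[OF E_cont[OF f]] normalize[OF T_cont[OF E_cont[OF f]]] cc .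
    then show ?thesis using p by (simp add: field_simps)
  qed
  have Tf0: "ip (T f0) (T f0) > 0"
    using ip_self_nonneg[OF T_cont[OF E_cont[OF f0(1)]]] ip_self_zero[OF T_cont[OF E_cont[OF f0(1)]], of x0] f0(2)
    by fastforce
  then have f0p: "ip f0 f0 > 0"
    using ipT[OF E_cont[OF f0(1)]] C(1) ip_self_nonneg[OF E_cont[OF f0(1)]] by (cases "ip f0 f0 = 0") auto
  have \<kappa>: "\<kappa> > 0"
  proof -
    have "0 < \<kappa> * ip f0 f0" using ip_le[OF f0(1)] Tf0 by linarith
    then show ?thesis using f0p by (simp add: zero_less_mult_iff)
  qed
  have Sne: "S \<noteq> {}"
  proof -
    define c where "c = 1 / sqrt (ip f0 f0)"
    have "c * c = 1 / ip f0 f0" using f0p by (simp add: c_def)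
    then have "ip (\<lambda>x. c * f0 x) (\<lambda>x. c * f0 x) = 1" using normalize[OF E_cont[OF f0(1)]] f0p by simp
    then show ?thesis using E_scale[OF f0(1)] unfolding S_def by blast
  qed
  have "\<exists>f. f \<in> E \<and> ip f f = 1 \<and> \<kappa> - 1 / real (Suc j) < ip (T f) (T f)" for j
  proof -
    have "\<kappa> - 1 / real (Suc j) < Sup S" by (simp add: \<kappa>_def)
    then obtain s where "s \<in> S" "\<kappa> - 1 / real (Suc j) < s" using less_cSup_iff[OF Sne Sbdd] by blast
    then show ?thesis unfolding S_def by auto
  qed
  then obtain f where fE: "\<And>j. f j \<in> E" and f1: "\<And>j. ip (f j) (f j) = 1"
    and fl: "\<And>j. \<kappa> - 1 / real (Suc j) < ip (T (f j)) (T (f j))" by metis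
  have fc: "cont (f j)" for j by (rule E_cont[OF fE])
  have Tfc: "cont (T (f j))" "cont (T (T (f j)))" for j by (intro T_cont fc)+
  from T_compact[of f, OF fc f1] obtain h where h: "\<forall>\<epsilon>>0. \<forall>J. \<exists>j\<ge>J. \<forall>x. \<bar>T (f j) x - h x\<bar> \<le> \<epsilon>" by (rule exE)
  have hE: "h \<in> E"
  proof (rule E_closed)
    fix \<epsilon> :: real assume "\<epsilon> > 0"
    then obtain j where "\<forall>x. \<bar>T (f j) x - h x\<bar> \<le> \<epsilon>" using h by blast
    then show "\<exists>f\<in>E. \<forall>x. \<bar>f x - h x\<bar> \<le> \<epsilon>" using E_T[OF fE] by blast
  qed
  have hc: "cont h" by (rule E_cont[OF hE])
  \<comment> \<open>Near-maximisers are near-eigenfunctions: expanding the square with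
    self-adjointness and the norm bound on \<open>T (T (f j))\<close> leaves at most
    \<open>\<kappa>\<close> times the gap between \<open>\<kappa>\<close> and the squared norm of
    \<open>T (f j)\<close>.\<close>
  have defect: "ip (\<lambda>x. T (T (f j)) x - \<kappa> * f j x) (\<lambda>x. T (T (f j)) x - \<kappa> * f j x) \<le> \<kappa> * (1 / real (Suc j))" for j
  proof -
    let ?a = "T (T (f j))" and ?b = "\<lambda>x. \<kappa> * f j x"
    let ?t = "ip (T (f j)) (T (f j))"
    have cb: "cont ?b" by (intro continuous_intros fc)
    have cd: "cont (\<lambda>x. ?a x - ?b x)" by (intro continuous_on_diff Tfc cb)
    have af: "ip ?a (f j) = ?t" by (rule T_selfadjoint[OF Tfc(1) fc])
    have ab: "ip ?a ?b = \<kappa> * ?t" using ip_scale[OF fc Tfc(2), of \<kappa> j j] af by (simp add: ip_commute)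
    have "ip (\<lambda>x. ?a x - ?b x) (\<lambda>x. ?a x - ?b x) = ip ?a ?a - 2 * ip ?a ?b + ip ?b ?b"
      using ip_diff[OF Tfc(2) cb cd] ip_diff[OF Tfc(2) cb Tfc(2)] ip_diff[OF Tfc(2) cb cb] by (simp add: ip_commute)
    also have "\<dots> \<le> \<kappa> * ?t - 2 * (\<kappa> * ?t) + \<kappa> * \<kappa>"
      using ip_le[OF E_T[OF fE], of j] ab normalize[OF fc, of \<kappa> j] f1 by simp
    also have "\<dots> = \<kappa> * (\<kappa> - ?t)" by (simp add: algebra_simps)
    also have "\<dots> \<le> \<kappa> * (1 / real (Suc j))" using fl[of j] \<kappa> by (intro mult_left_mono) auto
    finally show ?thesis .
  qed
  have "T (T h) x = \<kappa> * h x" for x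
  proof -
    have "\<bar>T (T h) x - \<kappa> * h x\<bar> \<le> 0 + e" if "e > 0" for e
    proof -
      define D where "D = C * C + \<kappa>"
      define \<epsilon> where "\<epsilon> = e / (2 * D)"
      have D: "D > 0" using C(1) \<kappa> by (simp add: D_def add_pos_pos)
      have \<epsilon>: "\<epsilon> > 0" using that D by (simp add: \<epsilon>_def)
      have "\<epsilon> * D = e / 2" using D by (simp add: \<epsilon>_def)
      then have \<epsilon>2: "\<epsilon> * (C * C + \<kappa>) = e / 2" by (simp only: D_def)
      define \<delta> where "\<delta> = e / (2 * C)"
      have \<delta>: "\<delta> > 0" "C * \<delta> = e / 2" using that C(1) by (simp_all add: \<delta>_def)
      obtain J where J: "\<kappa> / (\<delta> * \<delta>) < real J" using reals_Archimedean2 by blast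
      obtain j where j: "j \<ge> J" "\<forall>x. \<bar>T (f j) x - h x\<bar> \<le> \<epsilon>" using h \<epsilon> by blast
      have "\<kappa> / (\<delta> * \<delta>) < real (Suc j)" using J j(1) by linarith
      then have "\<kappa> * (1 / real (Suc j)) \<le> \<delta> * \<delta>" using \<delta>(1) by (simp add: field_simps)
      define u where "u x = T (T (f j)) x - \<kappa> * f j x" for x
      have cu: "cont u" unfolding u_def by (intro continuous_intros Tfc fc)
      have "ip u u \<le> \<delta> * \<delta>" using defect[of j] \<open>\<kappa> * _ \<le> \<delta> * \<delta>\<close> unfolding u_def by linarith
      then have su: "sqrt (ip u u) \<le> \<delta>" using \<delta>(1) by (simp add: real_le_lsqrt power2_eq_square)
      have "T u x = T (T (T (f j))) x - \<kappa> * T (f j) x"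
      proof -
        have cb: "cont (\<lambda>x. \<kappa> * f j x)" by (intro continuous_intros fc)
        show ?thesis unfolding u_def using T_diff[OF Tfc(2) cb] T_scale[OF fc] by simp
      qed
      define v where "v x = h x - T (f j) x" for x
      have cv: "cont v" unfolding v_def by (intro continuous_on_diff hc Tfc)
      have vb: "\<bar>v x\<bar> \<le> \<epsilon>" for x using j(2) by (simp add: v_def abs_minus_commute)
      have Tv: "T v = (\<lambda>x. T h x - T (T (f j)) x)" unfolding v_def using T_diff[OF hc Tfc(1)] by auto
      have TTv: "T (T v) x = T (T h) x - T (T (T (f j))) x"
        unfolding Tv using T_diff[OF T_cont[OF hc] Tfc(2)] by simp
      \<comment> \<open>\<open>h\<close> approximates \<open>T (f j)\<close> and not
        \<open>f j\<close>, so the eigenvalue equation is compared after one more application of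
        \<open>T\<close>; this also turns the square-norm bound on \<open>u\<close> into a uniform
        one.\<close>
      have "T (T h) x - \<kappa> * h x = T (T v) x + T u x - \<kappa> * v x"
        unfolding TTv \<open>T u x = _\<close> by (simp add: v_def algebra_simps)
      moreover have "\<bar>T (T v) x\<bar> \<le> C * (C * \<epsilon>)"
        by (rule T_sup_bound[OF T_cont[OF cv]]) (rule T_sup_bound[OF cv vb])
      moreover have "\<bar>T u x\<bar> \<le> C * \<delta>"
        using T_bound[OF cu, of x] mult_left_mono[OF su, of C] C(1) by linarith
      moreover have "\<bar>\<kappa> * v x\<bar> \<le> \<kappa> * \<epsilon>" using vb[of x] \<kappa> by (simp add: abs_mult)
      moreover have "C * (C * \<epsilon>) + \<kappa> * \<epsilon> = e / 2" using \<epsilon>2 by (simp add: algebra_simps)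
      ultimately show ?thesis using \<delta>(2) by linarith
    qed
    then have "\<bar>T (T h) x - \<kappa> * h x\<bar> \<le> 0" by (rule field_le_epsilon)
    then show ?thesis by simp
  qed
  moreover have "ip h h \<noteq> 0"
  proof
    assume "ip h h = 0"
    \<comment> \<open>If \<open>h\<close> vanished, \<open>T (f j)\<close> would be uniformly small
      for some large \<open>j\<close>, although its squared norm is close to
      \<open>\<kappa>\<close>.\<close>
    then have h0: "h x = 0" for x using ip_self_zero[OF hc] by blast
    define \<epsilon> where "\<epsilon> = sqrt (\<kappa> / 2)"
    have \<epsilon>: "\<epsilon> > 0" "\<epsilon> * \<epsilon> = \<kappa> / 2" using \<kappa> by (simp_all add: \<epsilon>_def)
    obtain J where J: "2 / \<kappa> < real J" using reals_Archimedean2 by blast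
    obtain j where j: "j \<ge> J" "\<forall>x. \<bar>T (f j) x - h x\<bar> \<le> \<epsilon>" using h \<epsilon>(1) by blast
    have "\<bar>T (f j) x\<bar> \<le> \<epsilon>" for x using spec[OF j(2), of x] h0[of x] by simp
    then have "\<bar>ip (T (f j)) (T (f j))\<bar> \<le> \<epsilon> * \<epsilon>" by (intro ip_sup_bound Tfc)
    moreover have "2 / \<kappa> < real (Suc j)" using J j(1) by linarith
    then have "1 / real (Suc j) < \<kappa> / 2" using \<kappa> by (simp add: field_simps)
    ultimately show False using fl[of j] \<epsilon>(2) by linarith
  qed
  ultimately show ?thesis using \<kappa> hE by blast
qed

text \<open>The eigenvalue equation concerns the square of \<open>T\<close>, so the family is moved
  to the normalised \<open>T (e i)\<close>, again orthonormal. Bessel for the kernel row at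
  \<open>x\<close> against it bounds \<open>\<kappa>\<close> times the sum of the squares of
  \<open>e i x\<close> by \<open>C * C\<close>; integrating over \<open>x\<close> counts the
  family.\<close>

lemma eigenspace_orthonormal_bound:
  assumes \<kappa>: "\<kappa> > 0" and e: "\<And>i. i < N \<Longrightarrow> cont (e i)"
    and on: "\<And>i j. i < N \<Longrightarrow> j < N \<Longrightarrow> ip (e i) (e j) = (if i = j then 1 else 0)"
    and eig: "\<And>i x. i < N \<Longrightarrow> T (T (e i)) x = \<kappa> * e i x"
  shows "\<kappa> * real N \<le> C * C"
proof -
  define u where "u i x = (1 / sqrt \<kappa>) * T (e i) x" for i x
  have uc: "cont (u i)" if "i < N" for i
    unfolding u_def by (intro continuous_on_mult continuous_on_const T_cont e that)
  have Tc: "cont (T (e i))" if "i < N" for i by (intro T_cont e that)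
  have ui: "u i = (\<lambda>x. (1 / sqrt \<kappa>) * T (e i) x)" for i by (rule ext) (simp add: u_def)
  have ipu: "ip (u i) g = (1 / sqrt \<kappa>) * ip (T (e i)) g" if "i < N" "cont g" for i g
    unfolding ui by (rule ip_scale[OF Tc[OF that(1)] that(2)])
  have sq: "sqrt \<kappa> * sqrt \<kappa> = \<kappa>" "sqrt \<kappa> > 0" using \<kappa> by simp_all
  have uon: "ip (u i) (u j) = (if i = j then 1 else 0)" if "i < N" "j < N" for i j
  proof -
    have "ip (u i) (u j) = (1 / sqrt \<kappa>) * ip (T (e i)) (u j)"
      by (rule ipu[OF that(1) uc[OF that(2)]])
    also have "ip (T (e i)) (u j) = (1 / sqrt \<kappa>) * ip (T (e j)) (T (e i))"
      using ipu[OF that(2) Tc[OF that(1)]] by (simp add: ip_commute)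
    also have "ip (T (e j)) (T (e i)) = ip (e j) (T (T (e i)))"
      by (rule T_selfadjoint[OF e[OF that(2)] Tc[OF that(1)]])
    also have "T (T (e i)) = (\<lambda>x. \<kappa> * e i x)" using eig[OF that(1)] by auto
    also have "ip (e j) (\<lambda>x. \<kappa> * e i x) = \<kappa> * ip (e i) (e j)"
      using ip_scale[OF e[OF that(1)] e[OF that(2)]] by (simp add: ip_commute)
    finally have "ip (u i) (u j) = (1 / sqrt \<kappa>) * (1 / sqrt \<kappa>) * \<kappa> * ip (e i) (e j)" by simp
    also have "(1 / sqrt \<kappa>) * (1 / sqrt \<kappa>) * \<kappa> = 1" using sq \<kappa> by (simp add: field_simps)
    finally show ?thesis using on that by simp
  qed
  have pointwise: "\<kappa> * (\<Sum>i<N. e i x * e i x) \<le> C * C" for x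
  proof -
    let ?k = "\<lambda>y. \<phi> (- y + x)"
    have "0 \<le> ip ?k ?k - (\<Sum>i<N. (ip ?k (u i))\<^sup>2)"
      using ip_orthonormal_expand(3)[OF uc uon ck[of x]] ip_self_nonneg[OF ip_orthonormal_expand(1)[OF uc uon ck[of x]]]
      by simp
    moreover have "ip ?k ?k \<le> C * C" using ip_sup_bound[OF ck ck C(2) C(2), of x x] by linarith
    moreover have "(ip ?k (u i))\<^sup>2 = \<kappa> * (e i x * e i x)" if "i < N" for i
    proof -
      have "ip ?k (u i) = T (u i) x" by (simp add: T_eq_ip)
      also have "\<dots> = (1 / sqrt \<kappa>) * (\<kappa> * e i x)"
        unfolding ui T_scale[OF Tc[OF that]] eig[OF that] ..
      finally have "(ip ?k (u i))\<^sup>2 = ((1 / sqrt \<kappa>) * (1 / sqrt \<kappa>) * \<kappa>) * \<kappa> * (e i x * e i x)"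
        by (simp add: power2_eq_square)
      also have "(1 / sqrt \<kappa>) * (1 / sqrt \<kappa>) * \<kappa> = 1" using sq \<kappa> by (simp add: field_simps)
      finally show ?thesis by simp
    qed
    then have "(\<Sum>i<N. (ip ?k (u i))\<^sup>2) = (\<Sum>i<N. \<kappa> * (e i x * e i x))" by (intro sum.cong refl) auto
    ultimately show ?thesis by (simp add: sum_distrib_left)
  qed
  have cee: "cont (\<lambda>x. e i x * e i x)" if "i < N" for i by (intro continuous_on_mult e that)
  have cs: "cont (\<lambda>x. \<Sum>i<N. e i x * e i x)" by (intro continuous_on_sum cee) auto
  have "m (\<lambda>x. \<Sum>i<N. e i x * e i x) = (\<Sum>i<N. m (\<lambda>x. e i x * e i x))"
    by (rule haar_functional.sum[OF haar_functional_axioms]) (use cee in auto)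
  also have "\<dots> = (\<Sum>i<N. 1)" by (intro sum.cong refl) (use on in \<open>auto simp: ip_def\<close>)
  finally have "real N = m (\<lambda>x. \<Sum>i<N. e i x * e i x)" by simp
  then have "\<kappa> * real N = m (\<lambda>x. \<kappa> * (\<Sum>i<N. e i x * e i x))" using scale[OF cs, of \<kappa>] by simp
  also have "\<dots> \<le> m (\<lambda>x. C * C)"
    by (rule mono) (use pointwise cs in \<open>auto intro!: continuous_intros\<close>)
  also have "\<dots> = C * C" by (rule const)
  finally show ?thesis .
qed

end

section \<open>Peter-Weyl: representations on eigenspaces of convolutions\<close>

lift_definition matrix_of :: "nat \<Rightarrow> (nat \<Rightarrow> nat \<Rightarrow> real) \<Rightarrow> fmat" is
  "\<lambda>n a i j. if i < n \<and> j < n then a i j else 0"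
  subgoal for n a by (intro exI[of _ n]) auto
  done

lemma mats_matrix_of: "matrix_of n a \<in> mats n"
  by (simp add: mats_def matrix_of.rep_eq)

context haar_functional
begin

text \<open>The left regular representation on the span of \<open>e\<close>. The hypothesis
  \<open>expand\<close> is translation invariance of that span; orthogonality of the matrices comes
  from \<open>\<pi> (- k) = tr (\<pi> k)\<close>, that is, from invariance of the
  functional.\<close>

lemma translation_representation:
  fixes e :: "nat \<Rightarrow> 'k \<Rightarrow> real" and N :: nat
  assumes e: "\<And>i. i < N \<Longrightarrow> cont (e i)"
    and on: "\<And>i j. i < N \<Longrightarrow> j < N \<Longrightarrow> ip (e i) (e j) = (if i = j then 1 else 0)"
    and expand: "\<And>j k x. j < N \<Longrightarrow> e j (- k + x) = (\<Sum>i<N. ip (\<lambda>x. e j (- k + x)) (e i) * e i x)"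
  defines "\<pi> \<equiv> \<lambda>k. matrix_of N (\<lambda>i j. ip (\<lambda>x. e j (- k + x)) (e i))"
  shows "\<pi> k \<in> orth N" "\<pi> (k + l) = \<pi> k * \<pi> l"
    "\<epsilon> > 0 \<Longrightarrow> \<exists>W. open W \<and> 0 \<in> W \<and> (\<forall>k\<in>W. norm (\<pi> k - un N) < \<epsilon>)"
    "\<pi> k = un N \<Longrightarrow> j < N \<Longrightarrow> e j (- k + x) = e j x"
proof -
  have ct: "cont (\<lambda>x. e j (- k + x))" if "j < N" for j k by (rule cont_translate[OF e[OF that]])
  have ent\<pi>: "ent (\<pi> k) i j = (if i < N \<and> j < N then ip (\<lambda>x. e j (- k + x)) (e i) else 0)" for k i j
    by (simp add: \<pi>_def matrix_of.rep_eq)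
  have m\<pi>: "\<pi> k \<in> mats N" for k unfolding \<pi>_def by (rule mats_matrix_of)
  show hom: "\<pi> (k + l) = \<pi> k * \<pi> l" for k l
  proof (rule fmat_eqI)
    fix i j
    show "ent (\<pi> (k + l)) i j = ent (\<pi> k * \<pi> l) i j"
    proof (cases "i < N \<and> j < N")
      case True
      then have i: "i < N" and j: "j < N" by auto
      have "(\<lambda>x. e j (- (k + l) + x)) = (\<lambda>x. \<Sum>a<N. ip (\<lambda>x. e j (- l + x)) (e a) * e a (- k + x))"
      proof
        fix x
        have "- (k + l) + x = - l + (- k + x)" by (simp add: minus_add add.assoc diff_conv_add_uminus del: add_uminus_conv_diff)
        then have "e j (- (k + l) + x) = e j (- l + (- k + x))" by (rule arg_cong)
        also have "\<dots> = (\<Sum>a<N. ip (\<lambda>x. e j (- l + x)) (e a) * e a (- k + x))"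
          by (rule expand[OF j])
        finally show "e j (- (k + l) + x) = (\<Sum>a<N. ip (\<lambda>x. e j (- l + x)) (e a) * e a (- k + x))" .
      qed
      then have "ip (\<lambda>x. e j (- (k + l) + x)) (e i) =
          ip (\<lambda>x. \<Sum>a<N. ip (\<lambda>x. e j (- l + x)) (e a) * e a (- k + x)) (e i)"
        by (rule arg_cong)
      also have "\<dots> = (\<Sum>a<N. ip (\<lambda>x. ip (\<lambda>x. e j (- l + x)) (e a) * e a (- k + x)) (e i))"
        by (rule ip_sum) (use ct e[OF i] in \<open>auto intro!: continuous_on_mult continuous_on_const\<close>)
      also have "\<dots> = (\<Sum>a<N. ip (\<lambda>x. e j (- l + x)) (e a) * ip (\<lambda>x. e a (- k + x)) (e i))"
        by (intro sum.cong refl ip_scale ct e[OF i]) auto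
      also have "\<dots> = (\<Sum>a<N. ent (\<pi> k) i a * ent (\<pi> l) a j)"
        by (intro sum.cong refl) (use i j in \<open>simp add: ent\<pi>\<close>)
      finally show ?thesis using i j by (simp add: ent\<pi>[of "k + l"] ent_times[OF m\<pi>])
    next
      case False
      then show ?thesis using matsD[OF m\<pi>] matsD[OF mats_times[OF m\<pi> m\<pi>]] by (metis not_less)
    qed
  qed
  have zero: "\<pi> 0 = un N" by (rule fmat_eqI) (use on in \<open>auto simp: ent\<pi>\<close>)
  have neg: "\<pi> (- k) = tr (\<pi> k)" for k
  proof (rule fmat_eqI)
    fix i j
    have "ip (\<lambda>x. e j (k + x)) (e i) = ip (\<lambda>x. e i (- k + x)) (e j)" if "i < N" "j < N"
      using ip_translate[OF e[OF that(1)] e[OF that(2)], of k] ip_commute[of "\<lambda>x. e j (k + x)" "e i"] by simp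
    then show "ent (\<pi> (- k)) i j = ent (tr (\<pi> k)) i j" by (simp add: ent\<pi>)
  qed
  show orth: "\<pi> k \<in> orth N" for k
    using m\<pi> hom[of k "- k"] hom[of "- k" k] by (simp add: orth_def zero neg)
  show "e j (- k + x) = e j x" if "\<pi> k = un N" "j < N"
  proof -
    have \<delta>: "ip (\<lambda>x. e j (- k + x)) (e i) = (if i = j then 1 else 0)" if "i < N" for i
      using arg_cong[OF \<open>\<pi> k = un N\<close>, of "\<lambda>A. ent A i j"] that \<open>j < N\<close> by (simp add: ent\<pi>)
    have "e j (- k + x) = (\<Sum>i<N. ip (\<lambda>x. e j (- k + x)) (e i) * e i x)" by (rule expand[OF that(2)])
    also have "\<dots> = (\<Sum>i<N. if i = j then e i x else 0)"
      by (intro sum.cong refl) (simp add: \<delta>)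
    finally show ?thesis using that(2) by simp
  qed
  show "\<exists>W. open W \<and> 0 \<in> W \<and> (\<forall>k\<in>W. norm (\<pi> k - un N) < \<epsilon>)" if \<epsilon>: "\<epsilon> > 0"
  proof -
    have "\<exists>c>0. \<forall>x. \<bar>e i x\<bar> \<le> c" if "i < N" for i by (rule cont_bounded[OF e[OF that]])
    then obtain c where c: "\<And>i. i < N \<Longrightarrow> c i > 0 \<and> (\<forall>x. \<bar>e i x\<bar> \<le> c i)" by metis
    define B where "B = (\<Sum>i<N. c i) + 1"
    have c0: "0 \<le> c i" if "i < N" for i using c[OF that] by simp
    have B: "B > 0" unfolding B_def using c0 by (intro add_nonneg_pos sum_nonneg) auto
    have cB: "\<bar>e i x\<bar> \<le> B" if "i < N" for i x
    proof -
      have "c i \<le> (\<Sum>i<N. c i)" by (rule member_le_sum) (use that c0 in auto)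
      moreover have "\<bar>e i x\<bar> \<le> c i" using c[OF that] by blast
      ultimately show ?thesis by (simp add: B_def)
    qed
    define q where "q = real N * real N + 1"
    define d where "d = \<epsilon> / (2 * q * B)"
    have pos: "q > 0" by (simp add: q_def add_nonneg_pos)
    have d: "d > 0" unfolding d_def using \<epsilon> B pos by simp
    have "\<exists>W. open W \<and> 0 \<in> W \<and> (\<forall>w\<in>W. \<forall>s. \<bar>e j (s + w) - e j s\<bar> < d \<and> \<bar>e j (w + s) - e j s\<bar> < d)" if "j < N" for j
      by (rule uniformly_continuous_group[OF compact_UNIV e[OF that] d])
    then have "\<forall>j\<in>{..<N}. \<exists>W. open W \<and> 0 \<in> W \<and> (\<forall>w\<in>W. \<forall>s. \<bar>e j (s + w) - e j s\<bar> < d \<and> \<bar>e j (w + s) - e j s\<bar> < d)"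
      by blast
    from bchoice[OF this] obtain W where W': "\<forall>j\<in>{..<N}. open (W j) \<and> 0 \<in> W j \<and> (\<forall>w\<in>W j. \<forall>s. \<bar>e j (s + w) - e j s\<bar> < d \<and> \<bar>e j (w + s) - e j s\<bar> < d)"
      by (rule exE)
    \<comment> \<open>The translation by \<open>k\<close> involves \<open>- k\<close>, so the
      neighbourhoods are pulled back along negation.\<close>
    define V where "V = (\<Inter>j<N. uminus -` W j)"
    have "open V" unfolding V_def using W' by (intro open_INT open_vimage ballI continuous_intros) auto
    moreover have "0 \<in> V" using W' by (simp add: V_def)
    moreover have "norm (\<pi> k - un N) < \<epsilon>" if "k \<in> V" for k
    proof -
      have ent: "\<bar>ent (\<pi> k - un N) i j\<bar> \<le> d * B" if i: "i < N" and j: "j < N" for i j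
      proof -
        have k: "- k \<in> W j" using \<open>k \<in> V\<close> j by (simp add: V_def)
        have "ent (\<pi> k - un N) i j = ip (\<lambda>x. e j (- k + x)) (e i) - ip (e j) (e i)"
          using i j on by (simp add: ent\<pi>)
        also have "\<dots> = ip (\<lambda>x. e j (- k + x) - e j x) (e i)"
          by (rule ip_diff[OF ct[OF j] e[OF j] e[OF i], symmetric])
        finally show ?thesis
        proof (rule ssubst, intro ip_sup_bound)
          show "\<bar>e j (- k + x) - e j x\<bar> \<le> d" for x using W' j k less_imp_le by blast
        qed (use ct e i j cB in \<open>auto intro!: continuous_on_diff\<close>)
      qed
      have "norm (\<pi> k - un N) \<le> (\<Sum>i<N. \<Sum>j<N. \<bar>ent (\<pi> k - un N) i j\<bar>)"
        by (rule norm_le_ent) (intro mats_diff m\<pi> mats_un)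
      also have "\<dots> \<le> (\<Sum>i<N. \<Sum>j<N. d * B)" by (intro sum_mono ent) auto
      also have "\<dots> = real N * real N * (d * B)" by simp
      also have "\<dots> \<le> q * (d * B)" using d B unfolding q_def by (intro mult_right_mono) auto
      also have "\<dots> = \<epsilon> / 2" using B pos by (simp add: d_def)
      also have "\<dots> < \<epsilon>" using \<epsilon> by simp
      finally show ?thesis .
    qed
    ultimately show ?thesis by blast
  qed
qed

text \<open>The argument takes place in the space \<open>E\<close> orthogonal to all functions
  invariant under translation by \<open>Z\<close>. Stability of \<open>Z\<close> under conjugation
  makes \<open>E\<close> translation invariant; the convolution preserves it and is nonzero on it.
  If all of \<open>Z\<close> acted trivially on an eigenspace inside \<open>E\<close>, its functions
  would be invariant and thus orthogonal to themselves.\<close>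

theorem finite_dimensional_representation:
  fixes Z :: "'k set"
  assumes Z: "\<And>z k. z \<in> Z \<Longrightarrow> k + z - k \<in> Z" and z0: "z0 \<in> Z" "z0 \<noteq> 0"
  shows "\<exists>n \<pi>. (\<forall>k. \<pi> k \<in> orth n) \<and> (\<forall>k l. \<pi> (k + l) = \<pi> k * \<pi> l) \<and>
     (\<forall>\<epsilon>>0. \<exists>W. open W \<and> 0 \<in> W \<and> (\<forall>k\<in>W. norm (\<pi> k - un n) < \<epsilon>)) \<and> (\<exists>z\<in>Z. \<pi> z \<noteq> un n)"
proof -
  have "open (- {- z0})" "0 \<in> - {- z0}" using z0(2) by auto
  from nhds_sum[OF this] obtain V where "open V \<and> 0 \<in> V \<and> (\<forall>a\<in>V. \<forall>b\<in>V. a + b \<in> - {- z0}) \<and> (\<forall>a\<in>V. - a \<in> V) \<and> V \<subseteq> - {- z0}"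
    by (rule exE)
  then have V: "open V" "0 \<in> V" "\<And>a b. a \<in> V \<Longrightarrow> b \<in> V \<Longrightarrow> a + b \<noteq> - z0" by auto
  from Urysohn_bump[OF compact_UNIV V(1,2)] obtain b :: "'k \<Rightarrow> real"
    where "continuous_on UNIV b \<and> (\<forall>x. 0 \<le> b x) \<and> b 0 = 1 \<and> (\<forall>x. x \<notin> V \<longrightarrow> b x = 0)" by (rule exE)
  then have b: "cont b" "\<And>x. 0 \<le> b x" "b 0 = 1" "\<And>x. x \<notin> V \<Longrightarrow> b x = 0" by simp_all
  \<comment> \<open>Multiplying by the reflected bump makes the kernel even and keeps its support in
    \<open>V\<close>, where no two elements add up to \<open>- z0\<close>.\<close>
  define \<phi> where "\<phi> x = b x * b (- x)" for x
  have c\<phi>: "cont \<phi>" unfolding \<phi>_def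
    by (intro continuous_on_mult b(1) continuous_on_compose2[OF b(1)] continuous_on_minus continuous_on_id) auto
  have \<phi>V: "x \<in> V" if "\<phi> x \<noteq> 0" for x using that b(4) by (auto simp: \<phi>_def)
  from cont_bounded[OF c\<phi>] obtain C where C: "C > 0 \<and> (\<forall>x. \<bar>\<phi> x\<bar> \<le> C)" by (rule exE)
  interpret convolution_operator m \<phi> C
    by unfold_locales (use c\<phi> C in \<open>auto simp: \<phi>_def mult.commute\<close>)
  define Inv where "Inv = {g. cont g \<and> (\<forall>z\<in>Z. \<forall>x. g (- z + x) = g x)}"
  define E where "E = {f. cont f \<and> (\<forall>g\<in>Inv. ip f g = 0)}"
  have Inv_cont: "cont g" if "g \<in> Inv" for g using that by (simp add: Inv_def)
  have Inv_inv: "g (- z + x) = g x" if "g \<in> Inv" "z \<in> Z" for g z x using that by (simp add: Inv_def)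
  have Inv_T: "T g \<in> Inv" if g: "g \<in> Inv" for g
  proof -
    have "T g (- z + x) = T g x" if z: "z \<in> Z" for z x
    proof -
      have "(\<lambda>x. g (- z + x)) = g" using Inv_inv[OF g z] by auto
      then show ?thesis using T_translate[OF Inv_cont[OF g], of z x] by simp
    qed
    then show ?thesis using T_cont[OF Inv_cont[OF g]] by (simp add: Inv_def)
  qed
  have Inv_translate: "(\<lambda>x. g (k + x)) \<in> Inv" if g: "g \<in> Inv" for g k
  proof -
    have "g (k + (- z + x)) = g (k + x)" if z: "z \<in> Z" for z x
    proof -
      \<comment> \<open>Here stability of \<open>Z\<close> under conjugation enters.\<close>
      have "k + (- z + x) = - (k + z - k) + (k + x)"
        by (simp add: minus_add add.assoc diff_conv_add_uminus del: add_uminus_conv_diff)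
      then show ?thesis using Inv_inv[OF g Z[OF z]] by simp
    qed
    then show ?thesis using cont_translate[OF Inv_cont[OF g], of "- k"] by (simp add: Inv_def)
  qed
  have E_cont: "cont f" if "f \<in> E" for f using that by (simp add: E_def)
  have E_perp: "ip f g = 0" if "f \<in> E" "g \<in> Inv" for f g using that by (simp add: E_def)
  have EI: "f \<in> E" if "cont f" "\<And>g. g \<in> Inv \<Longrightarrow> ip f g = 0" for f using that by (simp add: E_def)
  have E_scale: "(\<lambda>x. c * f x) \<in> E" if f: "f \<in> E" for f c
  proof (rule EI)
    show "cont (\<lambda>x. c * f x)" by (intro continuous_on_mult continuous_on_const E_cont f)
    show "ip (\<lambda>x. c * f x) g = 0" if "g \<in> Inv" for g
      using ip_scale[OF E_cont[OF f] Inv_cont[OF that]] E_perp[OF f that] by simp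
  qed
  have E_diff: "(\<lambda>x. f x - g x) \<in> E" if f: "f \<in> E" and g: "g \<in> E" for f g
  proof (rule EI)
    show "cont (\<lambda>x. f x - g x)" by (intro continuous_on_diff E_cont f g)
    show "ip (\<lambda>x. f x - g x) h = 0" if "h \<in> Inv" for h
      using ip_diff[OF E_cont[OF f] E_cont[OF g] Inv_cont[OF that]] E_perp[OF f that] E_perp[OF g that] by simp
  qed
  have E_T: "T f \<in> E" if f: "f \<in> E" for f
  proof (rule EI[OF T_cont[OF E_cont[OF f]]])
    show "ip (T f) g = 0" if "g \<in> Inv" for g
      using T_selfadjoint[OF E_cont[OF f] Inv_cont[OF that]] E_perp[OF f Inv_T[OF that]] by simp
  qed
  have E_translate: "(\<lambda>x. f (- k + x)) \<in> E" if f: "f \<in> E" for f k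
  proof (rule EI[OF cont_translate[OF E_cont[OF f]]])
    show "ip (\<lambda>x. f (- k + x)) g = 0" if "g \<in> Inv" for g
      using ip_translate[OF E_cont[OF f] Inv_cont[OF that]] E_perp[OF f Inv_translate[OF that]] by simp
  qed
  have E_closed: "h \<in> E" if h: "\<And>\<epsilon>. \<epsilon> > 0 \<Longrightarrow> \<exists>f\<in>E. \<forall>x. \<bar>f x - h x\<bar> \<le> \<epsilon>" for h
  proof -
    have "\<forall>n::nat. \<exists>f. f \<in> E \<and> (\<forall>x. \<bar>f x - h x\<bar> \<le> 1 / real (Suc n))" using h by (simp add: Bex_def)
    from choice[OF this] obtain F where F: "\<forall>n::nat. F n \<in> E \<and> (\<forall>x. \<bar>F n x - h x\<bar> \<le> 1 / real (Suc n))" by (rule exE)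
    have "uniform_limit UNIV F h sequentially"
    proof (rule uniform_limitI)
      fix e :: real assume "e > 0"
      then obtain n0 where n0: "1 / real (Suc n0) < e" using nat_approx_posE by blast
      have "dist (F n x) (h x) < e" if "n \<ge> n0" for n x
      proof -
        have "\<bar>F n x - h x\<bar> \<le> 1 / real (Suc n)" using F by blast
        also have "\<dots> \<le> 1 / real (Suc n0)" using that by (simp add: frac_le)
        finally show ?thesis using n0 by (simp add: dist_real_def)
      qed
      then show "\<forall>\<^sub>F n in sequentially. \<forall>x\<in>UNIV. dist (F n x) (h x) < e"
        unfolding eventually_sequentially by blast
    qed
    then have ch: "cont h"
      by (rule uniform_limit_theorem[rotated]) (use F E_cont in auto)
    show ?thesis
    proof (rule EI[OF ch])
      fix g assume g: "g \<in> Inv"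
      from cont_bounded[OF Inv_cont[OF g]] obtain a where a: "a > 0 \<and> (\<forall>x. \<bar>g x\<bar> \<le> a)" by (rule exE)
      have "\<bar>ip h g\<bar> \<le> 0 + e" if "e > 0" for e
      proof -
        have "e / a > 0" using a that by simp
        from h[OF this] obtain f where f: "f \<in> E" "\<forall>x. \<bar>f x - h x\<bar> \<le> e / a" by (rule bexE)
        have "ip (\<lambda>x. f x - h x) g = - ip h g"
          using ip_diff[OF E_cont[OF f(1)] ch Inv_cont[OF g]] E_perp[OF f(1) g] by simp
        then have "\<bar>ip h g\<bar> \<le> (e / a) * a"
          using ip_sup_bound[OF continuous_on_diff[OF E_cont[OF f(1)] ch] Inv_cont[OF g], of "e / a" a] f(2) a by simp
        then show ?thesis using a by simp
      qed
      then have "\<bar>ip h g\<bar> \<le> 0" by (rule field_le_epsilon)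
      then show "ip h g = 0" by simp
    qed
  qed
  \<comment> \<open>A function minus its translate by an element of \<open>Z\<close> is orthogonal
    to all invariant functions. At 0, \<open>T f0\<close> is the positive number
    \<open>T \<phi> 0\<close> minus a term that vanishes by the choice of \<open>V\<close>.\<close>
  define f0 where "f0 x = \<phi> x - \<phi> (- z0 + x)" for x
  have ct: "cont (\<lambda>x. \<phi> (- z0 + x))" by (rule cont_translate[OF c\<phi>])
  have f0E: "f0 \<in> E"
  proof (rule EI)
    show "cont f0" unfolding f0_def by (intro continuous_on_diff c\<phi> ct)
    show "ip f0 g = 0" if g: "g \<in> Inv" for g
    proof -
      have "g (z0 + x) = g x" for x using Inv_inv[OF g z0(1), of "z0 + x"] by (simp add: add.assoc[symmetric])
      then have "(\<lambda>x. g (z0 + x)) = g" by auto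
      then show ?thesis
        unfolding f0_def using ip_diff[OF c\<phi> ct Inv_cont[OF g]] ip_translate[OF c\<phi> Inv_cont[OF g], of z0] by simp
    qed
  qed
  have Tf0: "T f0 0 \<noteq> 0"
  proof -
    have "T f0 0 = T \<phi> 0 - T \<phi> (- z0)"
      unfolding f0_def using T_diff[OF c\<phi> ct] T_translate[OF c\<phi>, of z0 0] by simp
    moreover have "T \<phi> (- z0) = 0"
    proof -
      have "\<phi> (- y + - z0) * \<phi> y = 0" for y
      proof (rule ccontr)
        assume "\<phi> (- y + - z0) * \<phi> y \<noteq> 0"
        then have "y + (- y + - z0) \<noteq> - z0" using \<phi>V by (intro V(3)) auto
        then show False by (simp add: diff_conv_add_uminus del: add_uminus_conv_diff)
      qed
      then have "(\<lambda>y. \<phi> (- y + - z0) * \<phi> y) = (\<lambda>y. 0)" by (intro ext)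
      then show ?thesis unfolding T_def by (simp only: const)
    qed
    moreover have "T \<phi> 0 > 0"
    proof -
      have "m (\<lambda>y. \<phi> y * \<phi> y) > 0"
      proof (rule pos[OF continuous_on_mult[OF c\<phi> c\<phi>]])
        have "\<phi> 0 = 1" by (simp add: \<phi>_def b(3))
        then show "0 < \<phi> 0 * \<phi> 0" by simp
      qed simp
      then show ?thesis using sym by (simp add: T_def)
    qed
    ultimately show ?thesis by simp
  qed
  from T_square_eigenfunction[of E, OF E_cont E_scale E_T E_closed f0E Tf0]
  obtain \<kappa> where \<kappa>: "\<kappa> > 0 \<and> (\<exists>h\<in>E. (\<forall>x. T (T h) x = \<kappa> * h x) \<and> ip h h \<noteq> 0)" by (rule exE)
  then obtain h where h: "h \<in> E" "\<And>x. T (T h) x = \<kappa> * h x" "ip h h \<noteq> 0" by blast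
  define S where "S = {f \<in> E. \<forall>x. T (T f) x = \<kappa> * f x}"
  have SE: "f \<in> E" and S_eig: "T (T f) x = \<kappa> * f x" if "f \<in> S" for f x using that by (simp_all add: S_def)
  have S_cont: "cont f" if "f \<in> S" for f using E_cont[OF SE[OF that]] .
  have T_fun: "T (\<lambda>x. f x - g x) = (\<lambda>x. T f x - T g x)" if "cont f" "cont g" for f g using T_diff[OF that] by auto
  have Ts_fun: "T (\<lambda>x. c * f x) = (\<lambda>x. c * T f x)" if "cont f" for c f using T_scale[OF that] by auto
  have S_scale: "(\<lambda>x. c * f x) \<in> S" if f: "f \<in> S" for f c
  proof -
    have "T (T (\<lambda>x. c * f x)) x = \<kappa> * (c * f x)" for x
      unfolding Ts_fun[OF S_cont[OF f]] Ts_fun[OF T_cont[OF S_cont[OF f]]] S_eig[OF f] by simp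
    then show ?thesis using E_scale[OF SE[OF f]] by (simp add: S_def)
  qed
  have S_diff: "(\<lambda>x. f x - g x) \<in> S" if f: "f \<in> S" and g: "g \<in> S" for f g
  proof -
    have "T (T (\<lambda>x. f x - g x)) x = \<kappa> * (f x - g x)" for x
      unfolding T_fun[OF S_cont[OF f] S_cont[OF g]] T_fun[OF T_cont[OF S_cont[OF f]] T_cont[OF S_cont[OF g]]]
        S_eig[OF f] S_eig[OF g] by (simp add: right_diff_distrib)
    then show ?thesis using E_diff[OF SE[OF f] SE[OF g]] by (simp add: S_def)
  qed
  have S_translate: "(\<lambda>x. f (- k + x)) \<in> S" if f: "f \<in> S" for f k
  proof -
    have "T (\<lambda>x. f (- k + x)) = (\<lambda>x. T f (- k + x))" using T_translate[OF S_cont[OF f]] by auto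
    then have "T (T (\<lambda>x. f (- k + x))) x = \<kappa> * f (- k + x)" for x
      using T_translate[OF T_cont[OF S_cont[OF f]], of k x] S_eig[OF f, of "- k + x"] by simp
    then show ?thesis using E_translate[OF SE[OF f]] by (simp add: S_def)
  qed
  have normalized: "\<exists>c. ip (\<lambda>x. c * f x) (\<lambda>x. c * f x) = 1" if "cont f" "ip f f \<noteq> 0" for f
  proof -
    define c where "c = 1 / sqrt (ip f f)"
    have p: "ip f f > 0" using ip_self_nonneg[OF that(1)] that(2) by simp
    have "cont (\<lambda>x. c * f x)" by (intro continuous_on_mult continuous_on_const that(1))
    then have "ip (\<lambda>x. c * f x) (\<lambda>x. c * f x) = c * (c * ip f f)"
      using ip_scale[OF that(1), of "\<lambda>x. c * f x" c] ip_scale[OF that(1) that(1), of c] by (simp add: ip_commute)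
    also have "\<dots> = 1" using p by (simp add: c_def)
    finally show ?thesis by blast
  qed
  define P where "P N e \<longleftrightarrow> (\<forall>i<N. e i \<in> S) \<and> (\<forall>i<N. \<forall>j<N. ip (e i) (e j) = (if i = j then 1 else 0))"
    for N :: nat and e :: "nat \<Rightarrow> 'k \<Rightarrow> real"
  have P_bound: "N \<le> nat \<lceil>C * C / \<kappa>\<rceil>" if P: "P N e" for N e
  proof -
    have "\<kappa> * real N \<le> C * C"
      by (rule eigenspace_orthonormal_bound[of \<kappa> N e]) (use P \<kappa> S_cont S_eig in \<open>auto simp: P_def\<close>)
    then have "real N \<le> C * C / \<kappa>" using \<kappa> by (simp add: field_simps)
    then show ?thesis by linarith
  qed
  obtain c1 where "ip (\<lambda>x. c1 * h x) (\<lambda>x. c1 * h x) = 1" using normalized[OF E_cont[OF h(1)] h(3)] by blast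
  moreover have "h \<in> S" using h by (simp add: S_def)
  ultimately have P1: "P 1 (\<lambda>_ x. c1 * h x)" using S_scale by (simp add: P_def)
  \<comment> \<open>A largest orthonormal family in the eigenspace, which exists by
    \<open>P_bound\<close>; a nonzero remainder of an expansion would enlarge it.\<close>
  define N where "N = (GREATEST N. \<exists>e. P N e)"
  have bnd: "\<And>N. \<exists>e. P N e \<Longrightarrow> N \<le> nat \<lceil>C * C / \<kappa>\<rceil>" using P_bound by blast
  have ex1: "\<exists>e. P 1 e" using P1 by blast
  have "\<exists>e. P N e" unfolding N_def by (rule GreatestI_nat[of "\<lambda>N. \<exists>e. P N e", OF ex1 bnd])
  then obtain e where e: "P N e" by blast
  have N1: "N \<ge> 1" unfolding N_def by (rule Greatest_le_nat[of "\<lambda>N. \<exists>e. P N e", OF ex1 bnd])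
  have max: "\<not> P (Suc N) e'" for e'
  proof
    assume "P (Suc N) e'"
    then have "\<exists>e. P (Suc N) e" by blast
    then have "Suc N \<le> N" unfolding N_def by (rule Greatest_le_nat[of "\<lambda>N. \<exists>e. P N e", OF _ bnd])
    then show False by simp
  qed
  have eS: "e i \<in> S" if "i < N" for i using e that by (simp add: P_def)
  have on: "ip (e i) (e j) = (if i = j then 1 else 0)" if "i < N" "j < N" for i j using e that by (simp add: P_def)
  have expand: "f x = (\<Sum>i<N. ip f (e i) * e i x)" if f: "f \<in> S" for f x
  proof -
    define r where "r x = f x - (\<Sum>i<N. ip f (e i) * e i x)" for x
    have partial: "(\<lambda>x. f x - (\<Sum>i<M. ip f (e i) * e i x)) \<in> S" if "M \<le> N" for M
      using that
    proof (induction M)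
      case 0
      then show ?case using f by simp
    next
      case (Suc M)
      have "(\<lambda>x. (f x - (\<Sum>i<M. ip f (e i) * e i x)) - ip f (e M) * e M x) \<in> S"
        by (rule S_diff[OF Suc.IH[OF Suc_leD[OF Suc.prems]] S_scale[OF eS]]) (use Suc.prems in simp)
      then show ?case by (simp add: diff_diff_eq)
    qed
    have rS: "r \<in> S" unfolding r_def using partial[of N] by simp
    have rj: "ip r (e j) = 0" if "j < N" for j
      unfolding r_def by (rule ip_orthonormal_expand(2)[OF S_cont[OF eS] on S_cont[OF f] that])
    have "ip r r = 0"
    proof (rule ccontr)
      assume "ip r r \<noteq> 0"
      then obtain c where c: "ip (\<lambda>x. c * r x) (\<lambda>x. c * r x) = 1" using normalized[OF S_cont[OF rS]] by blast
      define e' where "e' i = (if i = N then (\<lambda>x. c * r x) else e i)" for i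
      have orth: "ip (\<lambda>x. c * r x) (e j) = 0" if "j < N" for j
        using ip_scale[OF S_cont[OF rS] S_cont[OF eS[OF that]]] rj[OF that] by simp
      have "P (Suc N) e'"
        unfolding P_def
      proof (intro conjI allI impI)
        fix i assume i: "i < Suc N"
        show "e' i \<in> S" using i eS[of i] S_scale[OF rS] by (cases "i = N") (simp_all add: e'_def)
        fix j assume j: "j < Suc N"
        show "ip (e' i) (e' j) = (if i = j then 1 else 0)"
        proof (cases "i = N"; cases "j = N")
          assume "i = N" "j = N" then show ?thesis using c by (simp add: e'_def)
        next
          assume "i = N" "j \<noteq> N" then show ?thesis using orth[of j] j by (simp add: e'_def)
        next
          assume "i \<noteq> N" "j = N" then show ?thesis
            using orth[of i] i ip_commute[of "e i" "\<lambda>x. c * r x"] by (simp add: e'_def)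
        next
          assume "i \<noteq> N" "j \<noteq> N" then show ?thesis using on[of i j] i j by (simp add: e'_def)
        qed
      qed
      then show False using max by blast
    qed
    then have "r x = 0" by (rule ip_self_zero[OF S_cont[OF rS]])
    then show ?thesis by (simp add: r_def)
  qed
  have rep_expand: "e j (- k + x) = (\<Sum>i<N. ip (\<lambda>x. e j (- k + x)) (e i) * e i x)" if "j < N" for j k x
    by (rule expand[OF S_translate[OF eS[OF that]]])
  note rep = translation_representation[OF S_cont[OF eS] on rep_expand]
  define \<pi> where "\<pi> k = matrix_of N (\<lambda>i j. ip (\<lambda>x. e j (- k + x)) (e i))" for k
  have "\<exists>z\<in>Z. \<pi> z \<noteq> un N"
  proof (rule ccontr)
    assume "\<not> (\<exists>z\<in>Z. \<pi> z \<noteq> un N)"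
    then have "e 0 (- z + x) = e 0 x" if "z \<in> Z" for z x
      using rep(4)[of z 0 x] that N1 unfolding \<pi>_def by auto
    then have "e 0 \<in> Inv" using S_cont[OF eS[of 0]] N1 by (simp add: Inv_def)
    then have "ip (e 0) (e 0) = 0" using E_perp[OF SE[OF eS[of 0]]] N1 by simp
    then show False using on[of 0 0] N1 by simp
  qed
  moreover have "\<pi> k \<in> orth N" for k unfolding \<pi>_def by (rule rep(1))
  moreover have "\<pi> (k + l) = \<pi> k * \<pi> l" for k l unfolding \<pi>_def by (rule rep(2))
  moreover have "\<exists>W. open W \<and> 0 \<in> W \<and> (\<forall>k\<in>W. norm (\<pi> k - un N) < \<epsilon>)" if "\<epsilon> > 0" for \<epsilon>
    unfolding \<pi>_def by (rule rep(3)) (use that in auto)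
  ultimately show ?thesis by (intro exI[of _ N] exI[of _ \<pi>]) blast
qed

end

section \<open>Commutators of the identity component\<close>

text \<open>A subgroup containing the neighbourhood \<open>W\<close> is open, and so is its
  complement, which contains a translate of \<open>W\<close> around each of its points; a connected
  set through 0 cannot leave it.\<close>

lemma open_subgroup_contains_component:
  fixes S W :: "'k::topological_group_add set"
  assumes W: "open W" "0 \<in> W" "W \<subseteq> S" and add: "\<And>a b. a \<in> S \<Longrightarrow> b \<in> S \<Longrightarrow> a + b \<in> S"
    and minus: "\<And>a. a \<in> S \<Longrightarrow> - a \<in> S"
  shows "connected_component_set UNIV 0 \<subseteq> S"
proof
  fix x :: 'k assume "x \<in> connected_component_set UNIV 0"
  then obtain T where T: "connected T" "0 \<in> T" "x \<in> T" by (auto simp: connected_component_def)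
  have nbhd: "open {k. - s + k \<in> W}" "s \<in> {k. - s + k \<in> W}" for s
    using open_left_translate[OF W(1)] W(2) by auto
  have "open S"
  proof (subst open_subopen, intro ballI exI conjI)
    fix s assume "s \<in> S"
    show "{k. - s + k \<in> W} \<subseteq> S"
    proof
      fix k assume "k \<in> {k. - s + k \<in> W}"
      then have "s + (- s + k) \<in> S" by (intro add[OF \<open>s \<in> S\<close> subsetD[OF W(3)]]) simp
      then show "k \<in> S" by (simp add: add.assoc[symmetric])
    qed
  qed (use nbhd in auto)
  moreover have "open (- S)"
  proof (subst open_subopen, intro ballI exI conjI)
    fix s assume "s \<in> - S"
    show "{k. - s + k \<in> W} \<subseteq> - S"
    proof
      fix k assume k: "k \<in> {k. - s + k \<in> W}"
      show "k \<in> - S"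
      proof
        assume "k \<in> S"
        then have "k + - (- s + k) \<in> S" using k by (intro add minus[OF subsetD[OF W(3)]]) simp_all
        then show False using \<open>s \<in> - S\<close>
          by (simp add: minus_add diff_conv_add_uminus del: add_uminus_conv_diff)
      qed
    qed
  qed (use nbhd in auto)
  ultimately have "S \<inter> T = {} \<or> - S \<inter> T = {}" using connectedD[OF T(1), of S "- S"] by blast
  then show "x \<in> S" using T(2,3) W(2,3) by blast
qed

lemma component_conj:
  fixes a k :: "'k::topological_group_add"
  assumes "a \<in> connected_component_set UNIV 0"
  shows "k + a - k \<in> connected_component_set UNIV 0"
proof -
  obtain T where T: "connected T" "0 \<in> T" "a \<in> T" using assms by (auto simp: connected_component_def)
  have "continuous_on T (\<lambda>x. k + x - k)" by (intro continuous_intros)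
  then have "connected ((\<lambda>x. k + x - k) ` T)" using T(1) by (rule connected_continuous_image)
  moreover have "0 \<in> (\<lambda>x. k + x - k) ` T" using T(2) by (intro image_eqI[of _ _ 0]) auto
  ultimately show ?thesis using T(3) by (auto simp: connected_component_def)
qed

text \<open>Composing \<open>\<pi>\<close> with an approximation of \<open>K\<close> and correcting
  places elements of a torsion group within \<open>2 * \<eta>\<close> of \<open>\<pi> x\<close> and
  \<open>\<pi> y\<close>. With \<open>\<eta>\<close> at most 1/16 the radius 1/8 grows to at most
  1/4, the radius of exact commutation. It stays fixed while \<open>\<eta>\<close> tends to 0, so
  the remaining error \<open>8 * \<eta> * sqrt n\<close> disappears.\<close>

lemma near_identity_commute:
  fixes \<pi> :: "'k::topological_group_add \<Rightarrow> fmat"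
  assumes app: "\<And>W :: 'k set. open W \<Longrightarrow> 0 \<in> W \<Longrightarrow>
      \<exists>(H :: 'b monoid) f. group H \<and> amenable H \<and> torsion_group H \<and> approximates H f W"
    and \<pi>: "\<And>k. \<pi> k \<in> orth n" "\<And>k l. \<pi> (k + l) = \<pi> k * \<pi> l"
      "\<And>\<epsilon>. \<epsilon> > 0 \<Longrightarrow> \<exists>W. open W \<and> 0 \<in> W \<and> (\<forall>k\<in>W. norm (\<pi> k - un n) < \<epsilon>)"
    and x: "norm (\<pi> x - un n) < 1/8" and y: "norm (\<pi> y - un n) < 1/8"
  shows "\<pi> x * \<pi> y = \<pi> y * \<pi> x"
proof -
  have bound: "norm (\<pi> x * \<pi> y - \<pi> y * \<pi> x) \<le> 8 * \<eta> * sqrt n" if \<eta>: "0 < \<eta>" "\<eta> \<le> 1/16" for \<eta>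
  proof -
    obtain \<epsilon> where \<epsilon>: "\<epsilon> > 0" and stab: "\<And>(H :: 'b monoid) A. group H \<Longrightarrow> amenable H \<Longrightarrow> finite (A ` carrier H) \<Longrightarrow>
      A ` carrier H \<subseteq> orth n \<Longrightarrow>
      (\<And>x y. x \<in> carrier H \<Longrightarrow> y \<in> carrier H \<Longrightarrow> norm (A (x \<otimes>\<^bsub>H\<^esub> y) - A x * A y) \<le> \<epsilon>) \<Longrightarrow>
      \<exists>\<rho>. (\<forall>x\<in>carrier H. \<rho> x \<in> orth n \<and> norm (\<rho> x - A x) \<le> \<eta>) \<and> \<rho> \<one>\<^bsub>H\<^esub> = un n \<and>
        (\<forall>x\<in>carrier H. \<forall>y\<in>carrier H. \<rho> (x \<otimes>\<^bsub>H\<^esub> y) = \<rho> x * \<rho> y)"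
      by (rule amenable_stability[OF \<eta>(1), where n = n]) blast
    have "min \<epsilon> \<eta> > 0" using \<epsilon> \<eta>(1) by simp
    from \<pi>(3)[OF this] obtain W where "open W \<and> 0 \<in> W \<and> (\<forall>k\<in>W. norm (\<pi> k - un n) < min \<epsilon> \<eta>)" by (rule exE)
    then have W: "open W" "0 \<in> W" "\<And>k. k \<in> W \<Longrightarrow> norm (\<pi> k - un n) < min \<epsilon> \<eta>" by simp_all
    from app[OF W(1,2)] obtain H :: "'b monoid" and f
      where "group H \<and> amenable H \<and> torsion_group H \<and> approximates H f W" by (elim exE)
    then have H: "group H" "amenable H" "torsion_group H" and fin: "finite (f ` carrier H)"
      and fh: "\<And>a b. a \<in> carrier H \<Longrightarrow> b \<in> carrier H \<Longrightarrow> - (f a + f b) + f (a \<otimes>\<^bsub>H\<^esub> b) \<in> W"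
      and fd: "\<And>k. \<exists>h\<in>carrier H. - f h + k \<in> W" by (simp_all add: approximates_def)
    interpret group H by (rule H(1))
    note \<pi>m = orthD(1)[OF \<pi>(1)]
    have close: "norm (\<pi> b - \<pi> a) < min \<epsilon> \<eta>" if "- a + b \<in> W" for a b
    proof -
      have "\<pi> b = \<pi> a * \<pi> (- a + b)" using \<pi>(2)[of a "- a + b"] by (simp add: add.assoc[symmetric])
      then have "\<pi> b - \<pi> a = \<pi> a * (\<pi> (- a + b) - un n)" using \<pi>m by (simp add: right_diff_distrib)
      then have "norm (\<pi> b - \<pi> a) = norm (\<pi> (- a + b) - un n)"
        using norm_orth_times(1)[OF \<pi>(1), of "\<pi> (- a + b) - un n" a] \<pi>m by (simp add: mats_diff)
      then show ?thesis using W(3)[OF that] by simp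
    qed
    define A where "A h = \<pi> (f h)" for h
    have "\<exists>\<rho>. (\<forall>x\<in>carrier H. \<rho> x \<in> orth n \<and> norm (\<rho> x - A x) \<le> \<eta>) \<and> \<rho> \<one>\<^bsub>H\<^esub> = un n \<and>
        (\<forall>x\<in>carrier H. \<forall>y\<in>carrier H. \<rho> (x \<otimes>\<^bsub>H\<^esub> y) = \<rho> x * \<rho> y)"
    proof (rule stab[OF H(1,2)])
      show "finite (A ` carrier H)" using finite_imageI[OF fin, of \<pi>] by (simp add: A_def image_image)
      show "A ` carrier H \<subseteq> orth n" using \<pi>(1) by (auto simp: A_def)
      show "norm (A (a \<otimes>\<^bsub>H\<^esub> b) - A a * A b) \<le> \<epsilon>" if "a \<in> carrier H" "b \<in> carrier H" for a b
        using close[OF fh[OF that]] by (simp add: A_def \<pi>(2))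
    qed
    then obtain \<rho> where "(\<forall>x\<in>carrier H. \<rho> x \<in> orth n \<and> norm (\<rho> x - A x) \<le> \<eta>) \<and> \<rho> \<one>\<^bsub>H\<^esub> = un n \<and>
        (\<forall>x\<in>carrier H. \<forall>y\<in>carrier H. \<rho> (x \<otimes>\<^bsub>H\<^esub> y) = \<rho> x * \<rho> y)" by (rule exE)
    then have \<rho>: "\<And>h. h \<in> carrier H \<Longrightarrow> \<rho> h \<in> orth n" "\<And>h. h \<in> carrier H \<Longrightarrow> norm (\<rho> h - A h) \<le> \<eta>" "\<rho> \<one>\<^bsub>H\<^esub> = un n"
      "\<And>a b. a \<in> carrier H \<Longrightarrow> b \<in> carrier H \<Longrightarrow> \<rho> (a \<otimes>\<^bsub>H\<^esub> b) = \<rho> a * \<rho> b" by simp_all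
    have \<rho>inv: "tr (\<rho> h) = \<rho> (inv\<^bsub>H\<^esub> h)" if h: "h \<in> carrier H" for h
    proof -
      have e: "\<rho> h * \<rho> (inv\<^bsub>H\<^esub> h) = un n" using \<rho>(4)[of h "inv\<^bsub>H\<^esub> h"] h by (simp add: \<rho>(3))
      have "tr (\<rho> h) = tr (\<rho> h) * (\<rho> h * \<rho> (inv\<^bsub>H\<^esub> h))"
        unfolding e using orthD(1)[OF \<rho>(1)[OF h]] by simp
      also have "\<dots> = \<rho> (inv\<^bsub>H\<^esub> h)"
        using orthD(3)[OF \<rho>(1)[OF h]] orthD(1)[OF \<rho>(1)[of "inv\<^bsub>H\<^esub> h"]] h by (simp add: mult.assoc[symmetric])
      finally show ?thesis .
    qed
    obtain h where h: "h \<in> carrier H" "- f h + x \<in> W" using fd by blast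
    obtain l where l: "l \<in> carrier H" "- f l + y \<in> W" using fd by blast
    have near: "norm (\<pi> k - \<rho> a) \<le> 2 * \<eta>" if "a \<in> carrier H" "- f a + k \<in> W" for a k
      using norm_triangle_ineq[of "\<pi> k - A a" "A a - \<rho> a"] close[OF that(2)] \<rho>(2)[OF that(1)]
      by (simp add: A_def norm_minus_commute)
    have near1: "norm (\<rho> a - un n) \<le> 1/4" if "a \<in> carrier H" "- f a + k \<in> W" "norm (\<pi> k - un n) < 1/8" for a k
      using norm_triangle_ineq[of "\<rho> a - \<pi> k" "\<pi> k - un n"] near[OF that(1,2)] that(3) \<eta>(2)
      by (simp add: norm_minus_commute)
    have comm: "\<rho> h * \<rho> l = \<rho> l * \<rho> h"
    proof (rule torsion_orth_near_identity_commute[OF \<rho>(1)[OF h(1)] near1[OF h x] \<rho>(1)[OF l(1)]])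
      show "norm (\<rho> l - un n) < 1" using near1[OF l y] by simp
      fix g assume "g \<in> gen n {\<rho> h, \<rho> l, tr (\<rho> h), tr (\<rho> l)}"
      \<comment> \<open>Every word is again a value of \<open>\<rho>\<close>, so torsion passes from
        \<open>H\<close> to the generated group.\<close>
      then have "\<exists>a\<in>carrier H. g = \<rho> a"
      proof induction
        case gen_un
        show ?case using \<rho>(3) by (intro bexI[of _ "\<one>\<^bsub>H\<^esub>"]) auto
      next
        case (gen_step g s)
        then obtain a where a: "a \<in> carrier H" "g = \<rho> a" by blast
        have "\<exists>b\<in>carrier H. s = \<rho> b" using gen_step.hyps h(1) l(1) \<rho>inv by auto
        then obtain b where b: "b \<in> carrier H" "s = \<rho> b" by blast
        have "g * s = \<rho> (a \<otimes>\<^bsub>H\<^esub> b)" using a b \<rho>(4) by simp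
        then show ?case using a(1) b(1) by blast
      qed
      then obtain a where a: "a \<in> carrier H" "g = \<rho> a" by blast
      obtain m :: nat where m: "m > 0" "a [^]\<^bsub>H\<^esub> m = \<one>\<^bsub>H\<^esub>" using H(3) a(1) by (auto simp: torsion_group_def)
      have "mpow n (\<rho> a) j = \<rho> (a [^]\<^bsub>H\<^esub> j)" for j :: nat
      proof (induction j)
        case (Suc j)
        then show ?case using \<rho>(4)[of a "a [^]\<^bsub>H\<^esub> j"] a(1) nat_pow_Suc2[OF a(1), of j] by simp
      qed (simp add: \<rho>(3))
      then show "\<exists>m>0. mpow n g m = un n" using m a(2) \<rho>(3) by auto
    qed
    have step: "norm (\<pi> u * \<pi> v - \<rho> a * \<rho> b) \<le> 4 * \<eta> * sqrt n"
      if "norm (\<pi> u - \<rho> a) \<le> 2 * \<eta>" "norm (\<pi> v - \<rho> b) \<le> 2 * \<eta>" "a \<in> carrier H" for u v a b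
    proof -
      have "\<pi> u * \<pi> v - \<rho> a * \<rho> b = (\<pi> u - \<rho> a) * \<pi> v + \<rho> a * (\<pi> v - \<rho> b)" by (simp add: algebra_simps)
      also have "norm \<dots> \<le> norm (\<pi> u - \<rho> a) * norm (\<pi> v) + norm (\<rho> a) * norm (\<pi> v - \<rho> b)"
        by (intro order_trans[OF norm_triangle_ineq] add_mono norm_mult_ineq)
      also have "\<dots> \<le> 2 * \<eta> * sqrt n + sqrt n * (2 * \<eta>)"
        unfolding norm_orth[OF \<pi>(1)] norm_orth[OF \<rho>(1)[OF that(3)]]
        by (intro add_mono mult_right_mono mult_left_mono that) auto
      finally show ?thesis by simp
    qed
    have "norm (\<pi> x * \<pi> y - \<pi> y * \<pi> x) \<le> norm (\<pi> x * \<pi> y - \<rho> h * \<rho> l) + norm (\<pi> y * \<pi> x - \<rho> l * \<rho> h)"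
      using norm_triangle_ineq4[of "\<pi> x * \<pi> y - \<rho> h * \<rho> l" "\<pi> y * \<pi> x - \<rho> l * \<rho> h"] comm by simp
    also have "\<dots> \<le> 4 * \<eta> * sqrt n + 4 * \<eta> * sqrt n"
      by (intro add_mono step near h l)
    finally show ?thesis by simp
  qed
  have "norm (\<pi> x * \<pi> y - \<pi> y * \<pi> x) \<le> 0 + e" if e: "e > 0" for e
  proof -
    \<comment> \<open>The added 1 keeps the divisor positive when \<open>n = 0\<close>.\<close>
    define q where "q = 8 * sqrt n + 1"
    have q: "q > 0" by (simp add: q_def add_nonneg_pos)
    define \<eta> where "\<eta> = min (1/16) (e / q)"
    have "0 < \<eta>" using e q by (simp add: \<eta>_def)
    moreover have "\<eta> \<le> 1/16" "\<eta> \<le> e / q" unfolding \<eta>_def by (rule min.cobounded1, rule min.cobounded2)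
    ultimately have \<eta>: "0 < \<eta>" "\<eta> \<le> 1/16" "\<eta> \<le> e / q" by blast+
    have "8 * \<eta> * sqrt n \<le> \<eta> * q" using \<eta>(1) by (simp add: q_def algebra_simps)
    also have "\<dots> \<le> e" using \<eta>(3) q by (simp add: field_simps)
    finally show ?thesis using bound[OF \<eta>(1,2)] by simp
  qed
  then have "norm (\<pi> x * \<pi> y - \<pi> y * \<pi> x) \<le> 0" by (rule field_le_epsilon)
  then show ?thesis by simp
qed

text \<open>Double centraliser, formed through \<open>\<pi>\<close>: the centraliser of
  \<open>W\<close> is a subgroup containing \<open>W\<close>, so it contains the identity component,
  and the same holds for the centraliser of that centraliser. One of the two elements is placed in
  each.\<close>

lemma component_commutators_trivial:
  fixes \<pi> :: "'k::topological_group_add \<Rightarrow> fmat"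
  assumes \<pi>: "\<And>k. \<pi> k \<in> orth n" "\<And>k l. \<pi> (k + l) = \<pi> k * \<pi> l"
    and W: "open W" "0 \<in> W" "\<And>x y. x \<in> W \<Longrightarrow> y \<in> W \<Longrightarrow> \<pi> x * \<pi> y = \<pi> y * \<pi> x"
    and x: "x \<in> connected_component_set UNIV 0" and y: "y \<in> connected_component_set UNIV 0"
  shows "\<pi> (x + y - x - y) = un n"
proof -
  note m = orthD(1)[OF \<pi>(1)]
  have \<pi>0: "\<pi> 0 = un n"
  proof -
    have "\<pi> 0 = tr (\<pi> 0) * (\<pi> 0 * \<pi> 0)" using orthD(3)[OF \<pi>(1), of 0] m[of 0] by (simp add: mult.assoc[symmetric])
    also have "\<pi> 0 * \<pi> 0 = \<pi> 0" using \<pi>(2)[of 0 0] by simp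
    finally show ?thesis using orthD(3)[OF \<pi>(1), of 0] by simp
  qed
  have inv: "\<pi> (- k) * \<pi> k = un n" "\<pi> k * \<pi> (- k) = un n" for k
    using \<pi>(2)[of "- k" k] \<pi>(2)[of k "- k"] \<pi>0 by simp_all
  define cen where "cen S = {c. \<forall>s\<in>S. \<pi> c * \<pi> s = \<pi> s * \<pi> c}" for S
  have cen_add: "a + b \<in> cen S" if "a \<in> cen S" "b \<in> cen S" for a b S
  proof -
    have "\<pi> (a + b) * \<pi> s = \<pi> s * \<pi> (a + b)" if "s \<in> S" for s
    proof -
      have "\<pi> (a + b) * \<pi> s = \<pi> a * (\<pi> b * \<pi> s)" by (simp add: \<pi>(2) mult.assoc)
      also have "\<pi> b * \<pi> s = \<pi> s * \<pi> b" using \<open>b \<in> cen S\<close> that by (simp add: cen_def)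
      also have "\<pi> a * (\<pi> s * \<pi> b) = \<pi> a * \<pi> s * \<pi> b" by (simp add: mult.assoc)
      also have "\<pi> a * \<pi> s = \<pi> s * \<pi> a" using \<open>a \<in> cen S\<close> that by (simp add: cen_def)
      finally show ?thesis by (simp add: \<pi>(2) mult.assoc)
    qed
    then show ?thesis by (simp add: cen_def)
  qed
  have cen_minus: "- a \<in> cen S" if "a \<in> cen S" for a S
  proof -
    have "\<pi> (- a) * \<pi> s = \<pi> s * \<pi> (- a)" if "s \<in> S" for s
    proof -
      have "\<pi> (- a) * \<pi> s = \<pi> (- a) * (\<pi> s * \<pi> a) * \<pi> (- a)"
        using inv(2)[of a] m by (simp add: mult.assoc)
      also have "\<pi> s * \<pi> a = \<pi> a * \<pi> s" using \<open>a \<in> cen S\<close> that by (simp add: cen_def)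
      also have "\<pi> (- a) * (\<pi> a * \<pi> s) * \<pi> (- a) = (\<pi> (- a) * \<pi> a) * \<pi> s * \<pi> (- a)" by (simp add: mult.assoc)
      finally show ?thesis using inv(1)[of a] m by simp
    qed
    then show ?thesis by (simp add: cen_def)
  qed
  have "W \<subseteq> cen W" using W(3) by (auto simp: cen_def)
  then have 1: "connected_component_set UNIV 0 \<subseteq> cen W"
    by (rule open_subgroup_contains_component[OF W(1,2) _ cen_add cen_minus])
  have "W \<subseteq> cen (cen W)" by (auto simp: cen_def)
  then have 2: "connected_component_set UNIV 0 \<subseteq> cen (cen W)"
    by (rule open_subgroup_contains_component[OF W(1,2) _ cen_add cen_minus])
  have "x \<in> cen (cen W)" "y \<in> cen W" using x y 1 2 by blast+
  then have comm: "\<pi> x * \<pi> y = \<pi> y * \<pi> x" unfolding cen_def by blast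
  have "x + y - x - y = (x + y) + (- x + - y)" by (simp add: diff_conv_add_uminus add.assoc del: add_uminus_conv_diff)
  then have "\<pi> (x + y - x - y) = \<pi> x * \<pi> y * (\<pi> (- x) * \<pi> (- y))" by (simp only: \<pi>(2))
  also have "\<dots> = \<pi> y * (\<pi> x * \<pi> (- x)) * \<pi> (- y)" unfolding comm by (simp add: mult.assoc)
  finally show "\<pi> (x + y - x - y) = un n" using inv(2)[of x] inv(2)[of y] m by simp
qed

theorem theorem2p9:
  fixes L :: "('f, 'r) language" and m :: 'f
    and M :: "('f, 'r, 'a) fo_structure" and G :: "'a monoid"
    and U :: "'i filter"
    and N :: "'i \<Rightarrow> ('f, 'r, 'b) fo_structure" and H :: "'i \<Rightarrow> 'b monoid"
    and \<tau> :: "'a \<Rightarrow> 'k::{topological_group_add, t2_space}"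
  assumes "expands_group L m M G"
    and "is_ultrafilter U"
    and "\<And>i. expands_group L m (N i) (H i)"
    and "\<And>i. amenable (H i)"
    and "\<And>i. torsion_group (H i)"
    and "elementarily_equivalent L M (ultraproduct U N)"
    and "definable_compactification L M G \<tau>"
  shows "\<forall>x \<in> connected_component_set UNIV (0::'k). \<forall>y \<in> connected_component_set UNIV (0::'k).
           x + y = y + x"
proof (intro ballI, rule ccontr)
  fix x y :: 'k
  assume x: "x \<in> connected_component_set UNIV 0" and y: "y \<in> connected_component_set UNIV 0" and ne: "x + y \<noteq> y + x"
  have K: "compact (UNIV :: 'k set)"
    using assms(7) by (simp add: definable_compactification_def compactification_def)
  have grp: "group (H i)" for i using assms(3)[of i] by (simp add: expands_group_def)
  have app: "\<exists>(H :: 'b monoid) f. group H \<and> amenable H \<and> torsion_group H \<and> approximates H f W"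
    if W: "open W" "0 \<in> W" for W :: "'k set"
  proof -
    from definable_compactification_approximates[OF assms(1,2,3,6,7) W] obtain i f where "approximates (H i) f W"
      by (elim exE)
    then show ?thesis using grp assms(4,5) by (intro exI[of _ "H i"] exI[of _ f]) simp
  qed
  have "\<exists>m :: ('k \<Rightarrow> real) \<Rightarrow> real. haar_functional m"
  proof (rule haar_functional_exists[OF K])
    fix W :: "'k set" assume "open W" "0 \<in> W"
    from app[OF this] show "\<exists>(H :: 'b monoid) f. group H \<and> amenable H \<and> approximates H f W" by blast
  qed
  then obtain \<mu> :: "('k \<Rightarrow> real) \<Rightarrow> real" where "haar_functional \<mu>" by (rule exE)
  then interpret haar_functional \<mu> .
  let ?K0 = "connected_component_set UNIV (0 :: 'k)"
  \<comment> \<open>The bare set of commutators suffices: it is stable under conjugation because the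
    component is normal.\<close>
  define Z where "Z = {a + b - a - b | a b. a \<in> ?K0 \<and> b \<in> ?K0}"
  have Zconj: "k + z - k \<in> Z" if "z \<in> Z" for z k
  proof -
    from that obtain a b where ab: "z = a + b - a - b" "a \<in> ?K0" "b \<in> ?K0" unfolding Z_def by blast
    have "k + z - k = (k + a - k) + (k + b - k) - (k + a - k) - (k + b - k)"
      unfolding ab(1) by (simp add: minus_add add.assoc diff_conv_add_uminus del: add_uminus_conv_diff)
    then show ?thesis using component_conj[OF ab(2), of k] component_conj[OF ab(3), of k] unfolding Z_def by blast
  qed
  have z0: "x + y - x - y \<in> Z" using x y by (auto simp: Z_def)
  have z_ne: "x + y - x - y \<noteq> 0"
  proof
    assume "x + y - x - y = 0"
    then have "x + y - x = y" by simp
    then have "x + y = y + x" by (simp add: diff_eq_eq)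
    then show False using ne by simp
  qed
  have "\<exists>n \<pi>. (\<forall>k. \<pi> k \<in> orth n) \<and> (\<forall>k l. \<pi> (k + l) = \<pi> k * \<pi> l) \<and>
     (\<forall>\<epsilon>>0. \<exists>W. open W \<and> 0 \<in> W \<and> (\<forall>k\<in>W. norm (\<pi> k - un n) < \<epsilon>)) \<and> (\<exists>z\<in>Z. \<pi> z \<noteq> un n)"
  proof (rule finite_dimensional_representation[OF _ z0 z_ne])
    show "k + z - k \<in> Z" if "z \<in> Z" for z k by (rule Zconj[OF that])
  qed
  then obtain n \<pi> where "(\<forall>k. \<pi> k \<in> orth n) \<and> (\<forall>k l. \<pi> (k + l) = \<pi> k * \<pi> l) \<and>
     (\<forall>\<epsilon>>0. \<exists>W. open W \<and> 0 \<in> W \<and> (\<forall>k\<in>W. norm (\<pi> k - un n) < \<epsilon>)) \<and> (\<exists>z\<in>Z. \<pi> z \<noteq> un n)" by (elim exE)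
  then have \<pi>: "\<And>k. \<pi> k \<in> orth n" "\<And>k l. \<pi> (k + l) = \<pi> k * \<pi> l"
      "\<And>\<epsilon>. \<epsilon> > 0 \<Longrightarrow> \<exists>W. open W \<and> 0 \<in> W \<and> (\<forall>k\<in>W. norm (\<pi> k - un n) < \<epsilon>)"
    and nontriv: "\<exists>z\<in>Z. \<pi> z \<noteq> un n" by simp_all
  from \<pi>(3)[of "1/8"] obtain W where W: "open W \<and> 0 \<in> W \<and> (\<forall>k\<in>W. norm (\<pi> k - un n) < 1/8)" by auto
  have "\<pi> z = un n" if "z \<in> Z" for z
  proof -
    from that obtain a b where ab: "z = a + b - a - b" "a \<in> ?K0" "b \<in> ?K0" unfolding Z_def by blast
    show ?thesis unfolding ab(1)
    proof (rule component_commutators_trivial[OF \<pi>(1,2) _ _ _ ab(2,3)])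
      show "open W" "0 \<in> W" using W by auto
      show "\<pi> u * \<pi> v = \<pi> v * \<pi> u" if "u \<in> W" "v \<in> W" for u v
        by (rule near_identity_commute[OF app \<pi>]) (use W that in auto)
    qed
  qed
  then show False using nontriv by blast
qed

end
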